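(* Let $d\in\mathbb N$, $1<p_1,p_2,\ldots,p_d<\infty$ and $\bar p=(p_1,p_2,\ldots,p_d)$. Then the $d$-parameter tensor product Haar system $(h_{\bar I})_{\bar I\in\mathcal R_d}$, with an appropriate linear order (enumerating it as a sequence indexed by $\mathbb N$), is strategically reproducible in $L^{\bar p}_0$.
   Context: All Banach spaces are real. $\mathcal D$ is the set of dyadic intervals $[\frac{i-1}{2^j},\frac{i}{2^j})$, $j\ge0$, $1\le i\le2^j$; for $I\in\mathcal D$ with left half $I^+$ and right half $I^-$, $h_I=\chi_{I^+}-\chi_{I^-}$. $\mathcal R_d=\{I_1\times\cdots\times I_d: I_1,\dots,I_d\in\mathcal D\}$ and $h_{\bar I}(t_1,\dots,t_d)=h_{I_1}(t_1)\cdots h_{I_d}(t_d)$ for $\bar I=I_1\times\cdots\times I_d$. $L^{\bar p}=L^{p_1}(L^{p_2}(\cdots(L^{p_d})\cdots))$ is the mixed norm Lebesgue space on $[0,1]^d$ and $L^{\bar p}_0=\{f\in L^{\bar p}:\int_0^1f(t_1,\dots,t_d)\,dt_j=0\text{ for all }1\le j\le d\}$ (as functions of the remaining variables, a.e.). For $1<p_1,\dots,p_d<\infty$ the space $L^{\bar p}_0$ is reflexive and $(h_{\bar I})_{\bar I\in\mathcal R_d}$ is an unconditional (and shrinking) basis of it. Impartial equivalence: sequences $(x_i)$, $(y_i)$ in Banach spaces are impartially $C$-equivalent if $\frac1{\sqrt C}\|\sum a_iy_i\|\le\|\sum a_ix_i\|\le\sqrt C\|\sum a_iy_i\|$ for all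 finitely supported real sequences $(a_i)$. Strategical reproducibility (for unconditional shrinking bases): let $X$ be a Banach space with an unconditional and shrinking basis $(e_n)_{n\in\mathbb N}$ and coordinate functionals $(e_n^* )\subset X^*$. For $C\ge1$ consider the infinite game in which in turn $k=1,2,\dots$ player (I) chooses $n_k\in\mathbb N$ and then player (II) chooses $b_k\in\mathrm{span}(e_n:n\ge n_k)$ and $b_k^*\in\mathrm{span}(e_n^*:n\ge n_k)$. Player (II) wins if $(b_k)$ is impartially $C$-equivalent to $(e_k)$, $(b_k^* )$ is impartially $C$-equivalent to $(e_k^* )$, and $b_k^*(b_l)=\delta_{k,l}$ for all $k,l\in\mathbb N$. The basis $(e_n)$ is strategically reproducible if for some $C\ge1$ player (II) has a winning strategy in this game. *)

theory Defs
  imports "HOL-Analysis.Analysis" "HOL-Library.Function_Algebras"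
begin

instantiation "fun" :: (type, real_vector) real_vector
begin

definition scaleR_fun_def: "c *\<^sub>R f = (\<lambda>x. c *\<^sub>R f x)"

instance
  by standard (auto simp: scaleR_fun_def plus_fun_def scaleR_add_right scaleR_add_left)

end

lemma scaleR_fun_apply [simp]: "(c *\<^sub>R f) x = c *\<^sub>R f x"
  by (simp add: scaleR_fun_def)


section \<open>Banach spaces given by a carrier and a norm\<close>

text \<open>
  The spaces \<open>L\<^sup>p\<^sub>0\<close> depend on the real parameters \<open>p\<close>, so a Banach space is given by a
  linear subspace \<open>V\<close> of an ambient real vector space and a function \<open>N\<close> on it. As usual for
  function spaces, \<open>N\<close> is only required to be a seminorm: the Banach space in question is \<open>V\<close>
  with \<open>x\<close> and \<open>y\<close> identified whenever \<open>N (x - y) = 0\<close>, and none of the notions below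
  distinguishes between identified vectors.
\<close>

definition banach_on :: "'a::real_vector set \<Rightarrow> ('a \<Rightarrow> real) \<Rightarrow> bool" where
  "banach_on V N \<longleftrightarrow>
     subspace V \<and>
     (\<forall>x\<in>V. 0 \<le> N x) \<and>
     (\<forall>x\<in>V. \<forall>y\<in>V. N (x + y) \<le> N x + N y) \<and>
     (\<forall>c. \<forall>x\<in>V. N (c *\<^sub>R x) = \<bar>c\<bar> * N x) \<and>
     (\<forall>X::nat \<Rightarrow> 'a. (\<forall>n. X n \<in> V) \<and>
        (\<forall>\<epsilon>>0. \<exists>M. \<forall>m\<ge>M. \<forall>n\<ge>M. N (X m - X n) < \<epsilon>) \<longrightarrow>
        (\<exists>x\<in>V. (\<lambda>n. N (X n - x)) \<longlonglongrightarrow> 0))"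

definition sums_in :: "('a::real_vector \<Rightarrow> real) \<Rightarrow> (nat \<Rightarrow> 'a) \<Rightarrow> 'a \<Rightarrow> bool" where
  "sums_in N f x \<longleftrightarrow> (\<lambda>m. N ((\<Sum>n<m. f n) - x)) \<longlonglongrightarrow> 0"

text \<open>
  Functionals on \<open>V\<close> are functions on the ambient space that vanish outside \<open>V\<close>, so that a
  functional is determined by its values on \<open>V\<close>.
\<close>

definition dual_space :: "'a::real_vector set \<Rightarrow> ('a \<Rightarrow> real) \<Rightarrow> ('a \<Rightarrow> real) set" where
  "dual_space V N = {\<phi>.
     (\<forall>x\<in>V. \<forall>y\<in>V. \<phi> (x + y) = \<phi> x + \<phi> y) \<and>
     (\<forall>c. \<forall>x\<in>V. \<phi> (c *\<^sub>R x) = c * \<phi> x) \<and>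
     (\<exists>K. \<forall>x\<in>V. \<bar>\<phi> x\<bar> \<le> K * N x) \<and>
     (\<forall>x. x \<notin> V \<longrightarrow> \<phi> x = 0)}"

definition dual_norm :: "'a::real_vector set \<Rightarrow> ('a \<Rightarrow> real) \<Rightarrow> ('a \<Rightarrow> real) \<Rightarrow> real" where
  "dual_norm V N \<phi> = (SUP x\<in>{x\<in>V. N x \<le> 1}. \<bar>\<phi> x\<bar>)"


section \<open>Bases\<close>

definition schauder_basis :: "'a::real_vector set \<Rightarrow> ('a \<Rightarrow> real) \<Rightarrow> (nat \<Rightarrow> 'a) \<Rightarrow> bool" where
  "schauder_basis V N e \<longleftrightarrow>
     (\<forall>n. e n \<in> V) \<and> (\<forall>x\<in>V. \<exists>!a::nat \<Rightarrow> real. sums_in N (\<lambda>n. a n *\<^sub>R e n) x)"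

definition coord :: "'a::real_vector set \<Rightarrow> ('a \<Rightarrow> real) \<Rightarrow> (nat \<Rightarrow> 'a) \<Rightarrow> nat \<Rightarrow> 'a \<Rightarrow> real" where
  "coord V N e n = (\<lambda>x. if x \<in> V then (THE a. sums_in N (\<lambda>k. a k *\<^sub>R e k) x) n else 0)"

definition unconditional_basis :: "'a::real_vector set \<Rightarrow> ('a \<Rightarrow> real) \<Rightarrow> (nat \<Rightarrow> 'a) \<Rightarrow> bool" where
  "unconditional_basis V N e \<longleftrightarrow>
     schauder_basis V N e \<and>
     (\<forall>x\<in>V. \<forall>\<pi>::nat \<Rightarrow> nat. bij \<pi> \<longrightarrow>
        sums_in N (\<lambda>n. coord V N e (\<pi> n) x *\<^sub>R e (\<pi> n)) x)"

definition shrinking_basis :: "'a::real_vector set \<Rightarrow> ('a \<Rightarrow> real) \<Rightarrow> (nat \<Rightarrow> 'a) \<Rightarrow> bool" where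
  "shrinking_basis V N e \<longleftrightarrow>
     schauder_basis V N e \<and>
     schauder_basis (dual_space V N) (dual_norm V N) (coord V N e)"


section \<open>Strategical reproducibility\<close>

definition impartially_equivalent ::
  "real \<Rightarrow> ('a::real_vector \<Rightarrow> real) \<Rightarrow> (nat \<Rightarrow> 'a) \<Rightarrow> ('b::real_vector \<Rightarrow> real) \<Rightarrow> (nat \<Rightarrow> 'b) \<Rightarrow> bool"
  where
  "impartially_equivalent C N x M y \<longleftrightarrow>
     (\<forall>a::nat \<Rightarrow> real. finite {i. a i \<noteq> 0} \<longrightarrow>
        1 / sqrt C * M (\<Sum>i | a i \<noteq> 0. a i *\<^sub>R y i) \<le> N (\<Sum>i | a i \<noteq> 0. a i *\<^sub>R x i) \<and>
        N (\<Sum>i | a i \<noteq> 0. a i *\<^sub>R x i) \<le> sqrt C * M (\<Sum>i | a i \<noteq> 0. a i *\<^sub>R y i))"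

text \<open>
  A strategy of player (II) answers the moves \<open>[n 0, \<dots>, n k]\<close> made so far by player (I) with
  a pair \<open>(b k, b\<^sup>* k)\<close>.
\<close>

definition winning_strategy ::
  "'a::real_vector set \<Rightarrow> ('a \<Rightarrow> real) \<Rightarrow> (nat \<Rightarrow> 'a) \<Rightarrow> real \<Rightarrow> (nat list \<Rightarrow> 'a \<times> ('a \<Rightarrow> real)) \<Rightarrow> bool"
  where
  "winning_strategy V N e C S \<longleftrightarrow>
     (\<forall>n::nat \<Rightarrow> nat.
        let b = (\<lambda>k. fst (S (map n [0..<Suc k])));
            b' = (\<lambda>k. snd (S (map n [0..<Suc k])))
        in (\<forall>k. b k \<in> span (e ` {n k..}) \<and> b' k \<in> span (coord V N e ` {n k..})) \<and>
           impartially_equivalent C N b N e \<and>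
           impartially_equivalent C (dual_norm V N) b' (dual_norm V N) (coord V N e) \<and>
           (\<forall>k l. b' k (b l) = (if k = l then 1 else 0)))"

definition strategically_reproducible ::
  "'a::real_vector set \<Rightarrow> ('a \<Rightarrow> real) \<Rightarrow> (nat \<Rightarrow> 'a) \<Rightarrow> bool" where
  "strategically_reproducible V N e \<longleftrightarrow>
     banach_on V N \<and> unconditional_basis V N e \<and> shrinking_basis V N e \<and>
     (\<exists>C\<ge>1. \<exists>S. winning_strategy V N e C S)"


section \<open>The tensor product Haar system\<close>

definition dyadic_intervals :: "real set set" where
  "dyadic_intervals = {{(real i - 1) / 2 ^ j ..< real i / 2 ^ j} | i j :: nat. 1 \<le> i \<and> i \<le> 2 ^ j}"

definition left_half :: "real set \<Rightarrow> real set" where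
  "left_half I = {t\<in>I. t < (Inf I + Sup I) / 2}"

definition right_half :: "real set \<Rightarrow> real set" where
  "right_half I = {t\<in>I. (Inf I + Sup I) / 2 \<le> t}"

definition haar :: "real set \<Rightarrow> real \<Rightarrow> real" where
  "haar I t = indicator (left_half I) t - indicator (right_half I) t"

text \<open>
  A dyadic rectangle is represented by the tuple \<open>(I\<^sub>1, \<dots>, I\<^sub>d)\<close> of its sides, and points of
  \<open>[0,1]\<^sup>d\<close> are functions on \<open>{1..d}\<close>.
\<close>

definition dyadic_rectangles :: "nat \<Rightarrow> (nat \<Rightarrow> real set) set" where
  "dyadic_rectangles d = {1..d} \<rightarrow>\<^sub>E dyadic_intervals"

definition haar_tensor :: "nat \<Rightarrow> (nat \<Rightarrow> real set) \<Rightarrow> (nat \<Rightarrow> real) \<Rightarrow> real" where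
  "haar_tensor d I t = (\<Prod>j\<in>{1..d}. haar (I j) (t j))"


section \<open>Mixed norm Lebesgue spaces\<close>

definition unit_measure :: "real measure" where
  "unit_measure = restrict_space lborel {0..1}"

definition cube_measure :: "nat set \<Rightarrow> (nat \<Rightarrow> real) measure" where
  "cube_measure J = Pi\<^sub>M J (\<lambda>_. unit_measure)"

definition ennreal_powr :: "ennreal \<Rightarrow> real \<Rightarrow> ennreal" where
  "ennreal_powr x r = (if x = \<infinity> then \<infinity> else ennreal (enn2real x powr r))"

text \<open>
  For a list \<open>[j\<^sub>1, \<dots>, j\<^sub>m]\<close> of coordinates this is the norm in
  \<open>L\<^bsup>p(j\<^sub>1)\<^esup>(\<cdots>(L\<^bsup>p(j\<^sub>m)\<^esup>)\<cdots>)\<close> of \<open>f\<close> as a function of these coordinates,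
  the others being fixed as in \<open>t\<close>; the coordinate \<open>j\<^sub>1\<close> is integrated last.
\<close>

primrec iterated_norm ::
  "(nat \<Rightarrow> real) \<Rightarrow> nat list \<Rightarrow> ((nat \<Rightarrow> real) \<Rightarrow> real) \<Rightarrow> (nat \<Rightarrow> real) \<Rightarrow> ennreal" where
  "iterated_norm p [] f t = ennreal \<bar>f t\<bar>"
| "iterated_norm p (j # js) f t =
     ennreal_powr
       (\<integral>\<^sup>+ s. ennreal_powr (iterated_norm p js f (t(j := s))) (p j) \<partial>unit_measure) (1 / p j)"

definition mixed_norm_ennreal :: "nat \<Rightarrow> (nat \<Rightarrow> real) \<Rightarrow> ((nat \<Rightarrow> real) \<Rightarrow> real) \<Rightarrow> ennreal" where
  "mixed_norm_ennreal d p f = iterated_norm p [1..<Suc d] f (\<lambda>_. undefined)"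

definition mixed_norm :: "nat \<Rightarrow> (nat \<Rightarrow> real) \<Rightarrow> ((nat \<Rightarrow> real) \<Rightarrow> real) \<Rightarrow> real" where
  "mixed_norm d p f = enn2real (mixed_norm_ennreal d p f)"

definition mixed_Lp :: "nat \<Rightarrow> (nat \<Rightarrow> real) \<Rightarrow> ((nat \<Rightarrow> real) \<Rightarrow> real) set" where
  "mixed_Lp d p = {f \<in> borel_measurable (cube_measure {1..d}). mixed_norm_ennreal d p f < \<infinity>}"

definition mixed_Lp0 :: "nat \<Rightarrow> (nat \<Rightarrow> real) \<Rightarrow> ((nat \<Rightarrow> real) \<Rightarrow> real) set" where
  "mixed_Lp0 d p = {f \<in> mixed_Lp d p. \<forall>j\<in>{1..d}.
     AE t in cube_measure ({1..d} - {j}). (\<integral>s. f (t(j := s)) \<partial>unit_measure) = 0}"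

end

theory Submission
  imports Defs
begin

text \<open>
  A strategy for player (II) exists because the norm of \<open>L\<^sup>p\<^sub>0\<close> sees a Haar polynomial, up to constants,
  only through its square function \<open>(\<Sum>R. (a R h\<^sub>R)\<^sup>2)\<^sup>1\<^sup>/\<^sup>2\<close>, and because the square function of a Haar
  function \<open>h\<^sub>R\<close> can be reproduced on arbitrarily fine scales: if \<open>desc R m\<close> is the set of the
  rectangles inside \<open>R\<close> whose sides all have length \<open>2\<^sup>-\<^sup>m\<close>, then \<open>\<Sum>K\<in>desc R m. h\<^sub>K\<^sup>2 = h\<^sub>R\<^sup>2\<close>.
  In round \<open>k\<close> player (II) takes a level \<open>m\<close> that is new and finer than every rectangle with
  index below the move of player (I), and answers for \<open>R\<close> the \<open>k\<close>-th rectangle with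
  \<open>b k = \<Sum>K\<in>desc R m. h\<^sub>K\<close> and with the average of the coordinate functionals of these \<open>K\<close>, weighted by
  \<open>\<bar>K\<bar> / \<bar>R\<bar>\<close>. Distinct levels make the blocks disjoint, so \<open>\<Sum>k. c k b k\<close> and \<open>\<Sum>k. c k h\<^sub>k\<close> have the same
  square function; this is the equivalence of \<open>(b k)\<close> with the basis (\<open>blocks_equivalent\<close>). By duality
  the operator that replaces the coefficients on a block by their weighted average is bounded
  (\<open>block_averages_bounded\<close>), which gives the equivalence of the functionals (\<open>block_system\<close>).

  The square function estimates are proved on the discrete cube, where points are tuples of
  binary words of a fixed length and nothing has to be measurable or integrable. In one variable the
  operators that change the signs of Haar coefficients are bounded uniformly in the length. This
  is shown for functions with values in the iterated spaces by induction on the number of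
  variables: when the exponents of the integration and of the innermost remaining space agree the
  two integrations commute (\<open>sign_bound_exists\<close>), a bound passes to smaller exponents by a martingale
  argument with Doob's inequality (\<open>extrapolation\<close>), and to larger ones by \<open>duality\<close>. Hence independent
  sign changes in all variables are bounded (\<open>change_signs\<close>). Averaging over all signs and
  Khinchine's inequality for products of signs (\<open>chaos_L1\<close>) bound the square function by the
  polynomial (\<open>square_function_upper\<close>); the converse follows by duality (\<open>square_function_lower\<close>).

  The passage to \<open>[0,1]\<^sup>d\<close> is exact: a function that depends only on the first \<open>N\<close> binary digits of
  each coordinate has the same norm as its discrete counterpart (\<open>nrm_step\<close>). Density of Haar
  polynomials in \<open>L\<^sup>p\<^sub>0\<close> is \<open>haar_polynomials_dense\<close> and completeness \<open>banach_mixed_Lp0\<close>. That the Haar system is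
  an unconditional basis follows from density and from domination of norms by domination of
  coefficients. It is shrinking because disjointly supported combinations of norm at most \<open>1\<close>
  satisfy an upper \<open>r\<close>-estimate for some \<open>r > 1\<close> (\<open>disjoint_sum_bound\<close>), so that a functional cannot be large on
  infinitely many successive blocks.
\<close>

section \<open>Martingales over the dyadic tree\<close>

text \<open>Points of the dyadic tree are binary words whose head is the latest digit, so the ancestors
  of a word are its suffixes and \<open>cexp n \<phi> u\<close> is the conditional expectation of \<open>\<phi>\<close>, a function of words of
  length \<open>length u + n\<close>, given the initial digits \<open>u\<close>.\<close>

primrec cexp :: "nat \<Rightarrow> (bool list \<Rightarrow> 'b::real_vector) \<Rightarrow> bool list \<Rightarrow> 'b" where
  "cexp 0 \<phi> u = \<phi> u"
| "cexp (Suc n) \<phi> u = (1/2) *\<^sub>R (cexp n \<phi> (True # u) + cexp n \<phi> (False # u))"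

abbreviation avg :: "nat \<Rightarrow> (bool list \<Rightarrow> 'b::real_vector) \<Rightarrow> 'b" where
  "avg N \<phi> \<equiv> cexp N \<phi> []"

lemma cexp_Suc_inner:
  "cexp (Suc n) \<phi> u = cexp n (\<lambda>v. (1/2) *\<^sub>R (\<phi> (True # v) + \<phi> (False # v))) u"
  by (induction n arbitrary: u) auto

lemma cexp_cong:
  "(\<And>w. length w = length u + n \<Longrightarrow> \<phi> w = \<psi> w) \<Longrightarrow> cexp n \<phi> u = cexp n \<psi> u"
  by (induction n arbitrary: u) auto

lemma avg_cong: "(\<And>w. length w = N \<Longrightarrow> \<phi> w = \<psi> w) \<Longrightarrow> avg N \<phi> = avg N \<psi>"
  by (rule cexp_cong) simp

lemma cexp_add: "cexp n (\<lambda>w. \<phi> w + \<psi> w) u = cexp n \<phi> u + cexp n \<psi> u"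
  by (induction n arbitrary: u) (auto simp: algebra_simps)

lemma cexp_scaleR: "cexp n (\<lambda>w. c *\<^sub>R \<phi> w) u = c *\<^sub>R cexp n \<phi> u"
  by (induction n arbitrary: u) (auto simp: algebra_simps)

lemma cexp_minus: "cexp n (\<lambda>w. - \<phi> w) u = - cexp n \<phi> u"
  using cexp_scaleR[of n "-1" \<phi> u] by simp

lemma cexp_diff: "cexp n (\<lambda>w. \<phi> w - \<psi> w) u = cexp n \<phi> u - cexp n \<psi> u"
  using cexp_add[of n \<phi> "\<lambda>w. - \<psi> w" u] by (simp add: cexp_minus)

lemma cexp_mult_left: "cexp n (\<lambda>w. c * \<phi> w) u = c * cexp n \<phi> u" for c :: real
  using cexp_scaleR[of n c \<phi> u] by simp

lemma cexp_mult_right: "cexp n (\<lambda>w. \<phi> w * c) u = cexp n \<phi> u * c" for c :: real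
  using cexp_mult_left[of n c \<phi> u] by (simp add: mult.commute)

lemma cexp_const [simp]: "cexp n (\<lambda>w. c) u = c"
proof (induction n arbitrary: u)
  case (Suc n)
  have "(1/2) *\<^sub>R (c + c) = c"
    by (metis scaleR_half_double scaleR_right_distrib)
  then show ?case using Suc by simp
qed simp

lemma cexp_sum: "cexp n (\<lambda>w. \<Sum>i\<in>A. \<phi> i w) u = (\<Sum>i\<in>A. cexp n (\<phi> i) u)"
  by (induction A rule: infinite_finite_induct) (auto simp: cexp_add)

lemma cexp_mono:
  fixes \<phi> :: "bool list \<Rightarrow> real"
  shows "(\<And>w. length w = length u + n \<Longrightarrow> \<phi> w \<le> \<psi> w) \<Longrightarrow> cexp n \<phi> u \<le> cexp n \<psi> u"
proof (induction n arbitrary: u)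
  case (Suc n)
  show ?case using Suc.IH[of "True # u"] Suc.IH[of "False # u"] Suc.prems by simp
qed simp

lemma avg_mono:
  fixes \<phi> :: "bool list \<Rightarrow> real"
  shows "(\<And>w. length w = N \<Longrightarrow> \<phi> w \<le> \<psi> w) \<Longrightarrow> avg N \<phi> \<le> avg N \<psi>"
  by (rule cexp_mono) simp

lemma cexp_nonneg:
  fixes \<phi> :: "bool list \<Rightarrow> real"
  shows "(\<And>w. length w = length u + n \<Longrightarrow> 0 \<le> \<phi> w) \<Longrightarrow> 0 \<le> cexp n \<phi> u"
  using cexp_mono[of u n "\<lambda>_. 0" \<phi>] by simp

lemma avg_nonneg:
  fixes \<phi> :: "bool list \<Rightarrow> real"
  shows "(\<And>w. length w = N \<Longrightarrow> 0 \<le> \<phi> w) \<Longrightarrow> 0 \<le> avg N \<phi>"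
  by (rule cexp_nonneg) simp

lemma cexp_fun: "cexp n \<phi> u t = cexp n (\<lambda>w. \<phi> w t) u"
  for \<phi> :: "bool list \<Rightarrow> 'x \<Rightarrow> 'c::real_vector"
  by (induction n arbitrary: u) auto

lemma cexp_swap: "cexp n (\<lambda>s. cexp m (\<lambda>t. f s t) v) u = cexp m (\<lambda>t. cexp n (\<lambda>s. f s t) u) v"
  by (induction n arbitrary: u) (auto simp: cexp_scaleR cexp_add)

lemma cexp_eq_0D:
  fixes \<phi> :: "bool list \<Rightarrow> real"
  assumes "\<And>w. 0 \<le> \<phi> w" "cexp n \<phi> u = 0" "length v = n"
  shows "\<phi> (v @ u) = 0"
  using assms(2,3)
proof (induction n arbitrary: u v)
  case (Suc n)
  have "0 \<le> cexp n \<phi> (b # u)" for b using assms(1) by (intro cexp_nonneg)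
  from this[of True] this[of False] Suc.prems(1)
  have "cexp n \<phi> (b # u) = 0" for b by (cases b) auto
  moreover obtain w b where "v = w @ [b]" "length w = n"
    using Suc.prems(2) by (metis length_append_singleton nat.inject rev_exhaust length_Suc_conv list.distinct(1) append_is_Nil_conv length_0_conv old.nat.distinct(2))
  ultimately show ?case using Suc.IH[of "b # u" w] by simp
qed simp

lemma powr_convex_comb:
  fixes x y s t :: real
  assumes "0 \<le> x" "0 \<le> y" "1 \<le> s" "0 \<le> t" "t \<le> 1"
  shows "((1 - t) * x + t * y) powr s \<le> (1 - t) * x powr s + t * y powr s"
proof -
  have le: "c powr s \<le> c" if "0 \<le> c" "c \<le> 1" for c :: real
    using powr_mono'[of 1 s c] that assms by (cases "c = 0") auto
  show ?thesis
  proof (cases "x = 0 \<or> y = 0")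
    case True
    then show ?thesis
      using assms mult_right_mono[OF le[of t], of "y powr s"] mult_right_mono[OF le[of "1 - t"], of "x powr s"]
      by (auto simp: powr_mult)
  next
    case False
    then show ?thesis
      using convex_onD[OF powr_convex[of s], of t x y] assms by simp
  qed
qed

text \<open>Young's inequality gives Hoelder's inequality for averages.\<close>

lemma avg_Holder:
  fixes \<phi> \<psi> :: "bool list \<Rightarrow> real"
  assumes r: "1 < r" "1 < s" "1 / r + 1 / s = 1"
    and nn: "\<And>w. 0 \<le> \<phi> w" "\<And>w. 0 \<le> \<psi> w"
  shows "avg N (\<lambda>w. \<phi> w * \<psi> w) \<le> avg N (\<lambda>w. \<phi> w powr r) powr (1/r) * avg N (\<lambda>w. \<psi> w powr s) powr (1/s)"
proof -
  define A where "A = avg N (\<lambda>w. \<phi> w powr r)"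
  define B where "B = avg N (\<lambda>w. \<psi> w powr s)"
  have AB: "0 \<le> A" "0 \<le> B" unfolding A_def B_def by (auto intro!: avg_nonneg)
  have z: "\<phi> w = 0" if "A = 0" "length w = N" for w
    using cexp_eq_0D[of "\<lambda>w. \<phi> w powr r" N "[]" w] that by (simp add: A_def)
  have z': "\<psi> w = 0" if "B = 0" "length w = N" for w
    using cexp_eq_0D[of "\<lambda>w. \<psi> w powr s" N "[]" w] that by (simp add: B_def)
  show ?thesis
  proof (cases "A = 0 \<or> B = 0")
    case True
    then have "avg N (\<lambda>w. \<phi> w * \<psi> w) = avg N (\<lambda>w. 0)"
      by (intro avg_cong) (use z z' in auto)
    then show ?thesis by (simp)
  next
    case False
    then have pos: "0 < A" "0 < B" using AB by auto
    define a where "a = A powr (1/r)"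
    define b where "b = B powr (1/s)"
    have ab: "0 < a" "0 < b" "a powr r = A" "b powr s = B"
      using pos r by (auto simp: a_def b_def powr_powr)
    have "avg N (\<lambda>w. (\<phi> w / a) * (\<psi> w / b)) \<le> avg N (\<lambda>w. (\<phi> w / a) powr r / r + (\<psi> w / b) powr s / s)"
      using nn ab r by (intro avg_mono Youngs_inequality) auto
    also have "\<dots> = avg N (\<lambda>w. (1 / (r * A)) * \<phi> w powr r + (1 / (s * B)) * \<psi> w powr s)"
      using nn ab by (intro avg_cong) (auto simp: powr_divide mult.commute)
    also have "\<dots> = (1 / (r * A)) * A + (1 / (s * B)) * B"
      by (simp only: cexp_add cexp_mult_left A_def B_def)
    also have "\<dots> = 1" using pos r by simp
    finally have "avg N (\<lambda>w. (1 / (a * b)) * (\<phi> w * \<psi> w)) \<le> 1"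
      by (simp add: field_simps)
    then have "avg N (\<lambda>w. \<phi> w * \<psi> w) \<le> a * b"
      using ab by (simp only: cexp_mult_left) (simp add: field_simps)
    then show ?thesis by (simp add: a_def b_def A_def B_def)
  qed
qed

subsection \<open>Doob's maximal inequality\<close>

primrec rmax :: "(bool list \<Rightarrow> real) \<Rightarrow> bool list \<Rightarrow> real" where
  "rmax a [] = a []"
| "rmax a (b # u) = max (rmax a u) (a (b # u))"

lemma le_rmax: "a u \<le> rmax a u"
  by (cases u) auto

lemma rmax_nonneg: "(\<And>u. 0 \<le> a u) \<Longrightarrow> 0 \<le> rmax a u"
  using le_rmax order_trans by blast

lemma Doob_step:
  fixes m a p :: real
  assumes "0 \<le> m" "0 \<le> a" "1 < p"
  shows "max m a powr p - p / (p - 1) * a * max m a powr (p - 1) \<le> m powr p - p / (p - 1) * a * m powr (p - 1)"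
proof (cases "a \<le> m")
  case False
  define s where "s = p / (p - 1)"
  have s: "1 < s" "1 / s + 1 / p = 1" "(p - 1) * s = p" using assms by (auto simp: s_def field_simps)
  have "m powr (p - 1) * a \<le> (m powr (p - 1)) powr s / s + a powr p / p"
    using assms s by (intro Youngs_inequality) auto
  then have "m powr (p - 1) * a \<le> m powr p / s + a powr p / p"
    using s by (simp add: powr_powr)
  then have "s * (m powr (p - 1) * a) \<le> s * (m powr p / s + a powr p / p)"
    using s by (intro mult_left_mono) auto
  also have "\<dots> = m powr p + (s - 1) * a powr p"
    using s assms by (auto simp: s_def field_simps)
  finally have *: "s * (m powr (p - 1) * a) \<le> m powr p + (s - 1) * a powr p" .
  have "a * a powr (p - 1) = a powr p"
    using assms False by (cases "a = 0") (auto simp: powr_diff)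
  then have e: "s * a * a powr (p - 1) = s * a powr p" by (simp add: mult.assoc)
  have m: "max m a = a" using False by simp
  show ?thesis unfolding s_def[symmetric] m e using * by (simp add: algebra_simps)
qed (simp add: max_def)

text \<open>Along a nonnegative martingale \<open>a\<close> with running maximum \<open>m\<close> the expectation of
  \<open>m\<^sup>p - q a m\<^bsup>p-1\<^esup>\<close> decreases; it is negative at the root, and Hoelder's inequality concludes.\<close>

lemma Doob_Lp:
  fixes \<phi> :: "bool list \<Rightarrow> real" and N :: nat
  assumes p: "1 < p" and nn: "\<And>w. 0 \<le> \<phi> w"
  defines "a \<equiv> \<lambda>u. cexp (N - length u) \<phi> u"
  shows "avg N (\<lambda>u. rmax a u powr p) \<le> (p / (p - 1)) powr p * avg N (\<lambda>u. \<phi> u powr p)"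
proof -
  define q where "q = p / (p - 1)"
  have q: "1 < q" "1 / p + 1 / q = 1" "(p - 1) * q = p" using p by (auto simp: q_def field_simps)
  have a0: "0 \<le> a u" for u unfolding a_def using nn by (intro cexp_nonneg)
  have am: "a u = (a (True # u) + a (False # u)) / 2" if "length u < N" for u
  proof -
    have "N - length u = Suc (N - Suc (length u))" using that by simp
    then show ?thesis by (simp add: a_def)
  qed
  define B where "B = (\<lambda>u. rmax a u powr p - q * a u * rmax a u powr (p - 1))"
  have "k \<le> N \<Longrightarrow> avg k B \<le> 0" for k
  proof (induction k)
    case 0
    have "a [] * a [] powr (p - 1) = a [] powr p"
      using a0[of "[]"] by (cases "a [] = 0") (auto simp: powr_diff)
    then have "B [] = (1 - q) * a [] powr p" by (simp add: B_def algebra_simps)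
    then show ?case using q by (auto intro: mult_nonpos_nonneg)
  next
    case (Suc k)
    have "avg (Suc k) B = avg k (\<lambda>v. (1/2) *\<^sub>R (B (True # v) + B (False # v)))"
      by (rule cexp_Suc_inner)
    also have "\<dots> \<le> avg k B"
    proof (rule avg_mono)
      fix w :: "bool list" assume "length w = k"
      then have aw: "a w = (a (True # w) + a (False # w)) / 2" using am Suc.prems by simp
      have "B (b # w) \<le> rmax a w powr p - q * a (b # w) * rmax a w powr (p - 1)" for b
        using Doob_step[of "rmax a w" "a (b # w)" p] rmax_nonneg[of a w] a0 p by (simp add: B_def q_def)
      from this[of True] this[of False]
      have "B (True # w) + B (False # w) \<le> 2 * rmax a w powr p - q * (a (True # w) + a (False # w)) * rmax a w powr (p - 1)"
        by (simp add: algebra_simps)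
      moreover have Bw: "B w = rmax a w powr p - q * a w * rmax a w powr (p - 1)" by (simp add: B_def)
      ultimately show "(1/2) *\<^sub>R (B (True # w) + B (False # w)) \<le> B w"
        unfolding Bw aw by (simp add: field_simps)
    qed
    finally show ?case using Suc by simp
  qed
  then have "avg N B \<le> 0" by simp
  moreover have "avg N B = avg N (\<lambda>u. rmax a u powr p) - q * avg N (\<lambda>u. \<phi> u * rmax a u powr (p - 1))"
  proof -
    have "avg N B = avg N (\<lambda>u. rmax a u powr p - q * (\<phi> u * rmax a u powr (p - 1)))"
      by (rule avg_cong) (simp add: B_def a_def)
    then show ?thesis by (simp only: cexp_diff cexp_mult_left)
  qed
  moreover have "avg N (\<lambda>u. \<phi> u * rmax a u powr (p - 1)) \<le>
      avg N (\<lambda>u. \<phi> u powr p) powr (1/p) * avg N (\<lambda>u. (rmax a u powr (p - 1)) powr q) powr (1/q)"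
    by (rule avg_Holder) (use p q nn in auto)
  moreover have "avg N (\<lambda>u. (rmax a u powr (p - 1)) powr q) = avg N (\<lambda>u. rmax a u powr p)"
    using q by (simp add: powr_powr)
  ultimately have main: "avg N (\<lambda>u. rmax a u powr p) \<le>
      q * (avg N (\<lambda>u. \<phi> u powr p) powr (1/p) * avg N (\<lambda>u. rmax a u powr p) powr (1/q))"
    using mult_left_mono[of _ _ q] q by (smt (verit))
  define X where "X = avg N (\<lambda>u. rmax a u powr p)"
  define Y where "Y = avg N (\<lambda>u. \<phi> u powr p)"
  have X0: "0 \<le> X" and Y0: "0 \<le> Y" by (auto simp: X_def Y_def intro!: avg_nonneg)
  show ?thesis
  proof (cases "X = 0")
    case True
    then show ?thesis using Y0 q by (simp add: X_def Y_def)
  next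
    case False
    then have "X = X powr (1/p) * X powr (1/q)"
      using X0 q by (simp add: powr_add[symmetric])
    with main have "X powr (1/p) * X powr (1/q) \<le> q * Y powr (1/p) * X powr (1/q)"
      by (simp add: X_def Y_def mult.assoc)
    then have "X powr (1/p) \<le> q * Y powr (1/p)" using False X0 by simp
    then have "(X powr (1/p)) powr p \<le> (q * Y powr (1/p)) powr p"
      using p by (intro powr_mono2) auto
    then have "X \<le> q powr p * Y" using X0 Y0 p q by (simp add: powr_powr powr_mult)
    then show ?thesis by (simp only: X_def Y_def q_def)
  qed
qed


section \<open>Sign transforms of vector-valued Haar polynomials\<close>

definition haar_sign :: "bool \<Rightarrow> real" where
  "haar_sign b = (if b then -1 else 1)"

text \<open>The Haar polynomial with coefficients \<open>y\<close> as a martingale: passing from \<open>u\<close> to a child adds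
  \<open>y u\<close> or \<open>- y u\<close>.\<close>

primrec fpoly :: "(bool list \<Rightarrow> 'b::real_vector) \<Rightarrow> bool list \<Rightarrow> 'b" where
  "fpoly y [] = 0"
| "fpoly y (b # u) = fpoly y u + haar_sign b *\<^sub>R y u"

lemma cexp_fpoly: "cexp n (fpoly y) u = fpoly y u"
proof (induction n arbitrary: u)
  case (Suc n)
  have "fpoly y (True # u) + fpoly y (False # u) = 2 *\<^sub>R fpoly y u"
    by (simp add: haar_sign_def scaleR_2)
  then show ?case using Suc by (simp del: fpoly.simps)
qed simp

lemma martingale_fpoly:
  assumes "\<And>u. length u < N \<Longrightarrow> a u = (1/2) *\<^sub>R (a (True # u) + a (False # u))"
  shows "length u \<le> N \<Longrightarrow> a u = a [] + fpoly (\<lambda>v. (1/2) *\<^sub>R (a (False # v) - a (True # v))) u"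
proof (induction u)
  case (Cons b u)
  have "a (b # u) = (1/2) *\<^sub>R (a (True # u) + a (False # u))
      + haar_sign b *\<^sub>R (1/2) *\<^sub>R (a (False # u) - a (True # u))"
  proof (cases b)
    case True
    have "(1/2) *\<^sub>R (a (True # u) + a (False # u)) + haar_sign b *\<^sub>R (1/2) *\<^sub>R (a (False # u) - a (True # u))
      = (1/2) *\<^sub>R (a (True # u) + a (True # u))"
      using True by (simp add: haar_sign_def algebra_simps)
    then show ?thesis using True by simp
  next
    case False
    have "(1/2) *\<^sub>R (a (True # u) + a (False # u)) + haar_sign b *\<^sub>R (1/2) *\<^sub>R (a (False # u) - a (True # u))
      = (1/2) *\<^sub>R (a (False # u) + a (False # u))"
      using False by (simp add: haar_sign_def algebra_simps)
    then show ?thesis using False by simp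
  qed
  also have "(1/2) *\<^sub>R (a (True # u) + a (False # u)) = a u"
    using assms[of u] Cons.prems by simp
  finally show ?case using Cons by simp
qed simp

lemma haar_expansion:
  obtains z where "\<And>u. length u = N \<Longrightarrow> G u = avg N G + fpoly z u"
proof -
  define a where "a = (\<lambda>u. cexp (N - length u) G u)"
  have "a u = (1/2) *\<^sub>R (a (True # u) + a (False # u))" if "length u < N" for u
  proof -
    have "N - length u = Suc (N - Suc (length u))" using that by simp
    then show ?thesis by (simp add: a_def)
  qed
  from martingale_fpoly[where a = a, OF this]
  have "length u \<le> N \<Longrightarrow> a u = a [] + fpoly (\<lambda>v. (1/2) *\<^sub>R (a (False # v) - a (True # v))) u" for u by blast
  then have "\<And>u. length u = N \<Longrightarrow> G u = avg N G + fpoly (\<lambda>v. (1/2) *\<^sub>R (a (False # v) - a (True # v))) u"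
    by (force simp: a_def)
  then show ?thesis by (rule that)
qed

definition seminorm :: "('b::real_vector \<Rightarrow> real) \<Rightarrow> bool" where
  "seminorm n \<longleftrightarrow> (\<forall>x y. n (x + y) \<le> n x + n y) \<and> (\<forall>c x. n (c *\<^sub>R x) = \<bar>c\<bar> * n x)"

lemma seminorm_zero: "seminorm n \<Longrightarrow> n 0 = 0"
  unfolding seminorm_def by (metis abs_zero mult_zero_left scaleR_zero_left)

lemma seminorm_minus: "seminorm n \<Longrightarrow> n (- x) = n x"
  unfolding seminorm_def by (metis abs_1 abs_minus_cancel mult_1 scaleR_minus1_left)

lemma seminorm_add: "seminorm n \<Longrightarrow> n (x + y) \<le> n x + n y"
  unfolding seminorm_def by blast

lemma seminorm_scaleR: "seminorm n \<Longrightarrow> n (c *\<^sub>R x) = \<bar>c\<bar> * n x"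
  unfolding seminorm_def by blast

lemma seminorm_diff: "seminorm n \<Longrightarrow> n (x - y) \<le> n x + n y"
  using seminorm_add[of n x "- y"] seminorm_minus[of n y] by simp

lemma seminorm_nonneg: "seminorm n \<Longrightarrow> 0 \<le> n x"
  using seminorm_diff[of n x x] seminorm_zero[of n] by simp

lemma seminorm_cexp: "seminorm n \<Longrightarrow> n (cexp k \<phi> u) \<le> cexp k (\<lambda>w. n (\<phi> w)) u"
proof (induction k arbitrary: u)
  case (Suc k)
  have "n (cexp (Suc k) \<phi> u) = (1/2) * n (cexp k \<phi> (True # u) + cexp k \<phi> (False # u))"
    using Suc.prems by (simp add: seminorm_scaleR)
  also have "\<dots> \<le> (1/2) * (cexp k (\<lambda>w. n (\<phi> w)) (True # u) + cexp k (\<lambda>w. n (\<phi> w)) (False # u))"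
    using seminorm_add[OF Suc.prems, of "cexp k \<phi> (True # u)" "cexp k \<phi> (False # u)"]
      Suc.IH[OF Suc.prems, of "True # u"] Suc.IH[OF Suc.prems, of "False # u"] by simp
  finally show ?case by simp
qed simp

lemma seminorm_sum: "seminorm n \<Longrightarrow> n (\<Sum>i\<in>A. x i) \<le> (\<Sum>i\<in>A. n (x i))"
proof (induction A rule: infinite_finite_induct)
  case (insert a A)
  then show ?case using seminorm_add[of n "x a" "sum x A"] by simp
qed (auto simp: seminorm_zero)

text \<open>Summation by parts in the extrapolation argument produces increments of negative powers of
  the running maximum; because the maximum at most doubles in one step, they are controlled by
  increments of positive powers, which telescope.\<close>

lemma powr_increment_bound:
  fixes x y \<alpha> :: real
  assumes x: "0 < x" "x \<le> y" "y \<le> 2 * x" and a: "0 < \<alpha>" "\<alpha> < 1"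
  shows "(x powr (- \<alpha>) - y powr (- \<alpha>)) * y \<le> 2 / (1 - \<alpha>) * (y powr (1 - \<alpha>) - x powr (1 - \<alpha>))"
proof -
  define \<beta> where "\<beta> = 1 - \<alpha>"
  define l where "l = y / x"
  have l: "1 \<le> l" "l \<le> 2" "y = l * x" using x by (auto simp: l_def field_simps)
  have b: "0 < \<beta>" "\<beta> < 1" using a by (auto simp: \<beta>_def)
  have "(1 / l) powr \<beta> * 1 powr (1 - \<beta>) \<le> \<beta> * (1 / l) + (1 - \<beta>) * 1"
    using l b by (intro Youngs_inequality_0) auto
  then have "l powr \<beta> * (1 / l) powr \<beta> \<le> l powr \<beta> * (\<beta> * (1 / l) + (1 - \<beta>))"
    by (intro mult_left_mono) auto
  then have "1 \<le> l powr \<beta> * (\<beta> * (1 / l) + (1 - \<beta>))"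
    using l by (simp add: powr_mult[symmetric])
  then have 1: "l powr \<beta> * (\<beta> * (1 - 1 / l)) \<le> l powr \<beta> - 1"
    by (simp add: algebra_simps)
  have "(l - 1) / 2 \<le> (l - 1) / l" using l by (intro divide_left_mono) auto
  also have "\<dots> = 1 - 1 / l" using l by (simp add: field_simps)
  finally have "(l - 1) / 2 \<le> 1 - 1 / l" .
  then have "\<beta> * ((l - 1) / 2) \<le> \<beta> * (1 - 1 / l)" using b by (intro mult_left_mono) auto
  also have "\<dots> \<le> l powr \<beta> * (\<beta> * (1 - 1 / l))"
    using l b mult_right_mono[of 1 "l powr \<beta>" "\<beta> * (1 - 1 / l)"] by (simp add: ge_one_powr_ge_zero)
  finally have "\<beta> * ((l - 1) / 2) \<le> l powr \<beta> - 1" using 1 by linarith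
  then have 2: "l - 1 \<le> 2 / \<beta> * (l powr \<beta> - 1)" using b by (simp add: field_simps)
  have 3: "1 \<le> l powr \<beta>" using l b by (simp add: ge_one_powr_ge_zero)
  have "l - l powr \<beta> \<le> 2 / \<beta> * (l powr \<beta> - 1)" using 2 3 by simp
  then have "x powr \<beta> * (l - l powr \<beta>) \<le> x powr \<beta> * (2 / \<beta> * (l powr \<beta> - 1))"
    by (intro mult_left_mono) auto
  moreover have "x powr \<beta> * l = x powr (- \<alpha>) * y"
    using x by (simp add: l(3) \<beta>_def powr_diff powr_minus field_simps)
  moreover have "x powr \<beta> * l powr \<beta> = y powr \<beta>"
    using x l by (simp add: powr_mult)
  moreover have "y powr (- \<alpha>) * y = y powr \<beta>"
    using x by (simp add: \<beta>_def powr_diff powr_minus field_simps)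
  ultimately show ?thesis by (simp add: \<beta>_def[symmetric] algebra_simps diff_divide_distrib)
qed

definition extrapolation_const :: "real \<Rightarrow> real \<Rightarrow> real \<Rightarrow> real" where
  "extrapolation_const K p q = 2 powr p *
     ((q / (q - 1)) powr q * (K * (2 / (p / q) + 1) powr q)) powr (p / q) * (p / (p - 1)) powr p"

text \<open>A bound in \<open>L\<^sup>q\<close> passes to smaller exponents. Dividing the coefficient at \<open>v\<close> by a power of the
  running maximum of \<open>E(n f | v)\<close>, which is known at \<open>v\<close>, gives a martingale whose values are bounded by
  the power \<open>p / q\<close> of that maximum; the hypothesis applies to it in \<open>L\<^sup>q\<close>. The division is undone by
  summation by parts and Hoelder's inequality, and Doob's inequality in \<open>L\<^sup>p\<close> returns from the
  maximum to the polynomial.\<close>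

lemma extrapolation:
  fixes n :: "'b::real_vector \<Rightarrow> real"
  assumes n: "seminorm n" and p: "1 < p" "p < q" and K: "0 \<le> K"
    and hyp: "\<And>y \<epsilon>. (\<forall>u. \<bar>\<epsilon> u\<bar> = 1) \<Longrightarrow>
      avg N (\<lambda>u. n (fpoly (\<lambda>v. \<epsilon> v *\<^sub>R y v) u) powr q) \<le> K * avg N (\<lambda>u. n (fpoly y u) powr q)"
    and eps: "\<forall>u. \<bar>\<epsilon> u\<bar> = (1::real)"
  shows "avg N (\<lambda>u. n (fpoly (\<lambda>v. \<epsilon> v *\<^sub>R y v) u) powr p)
    \<le> extrapolation_const K p q * avg N (\<lambda>u. n (fpoly y u) powr p)"
proof -
  define \<phi> where "\<phi> = (\<lambda>u. n (fpoly y u))"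
  define a where "a = (\<lambda>u. cexp (N - length u) \<phi> u)"
  define m where "m = rmax a"
  have \<phi>0: "0 \<le> \<phi> u" for u unfolding \<phi>_def by (rule seminorm_nonneg[OF n])
  have a0: "0 \<le> a u" for u unfolding a_def using \<phi>0 by (intro cexp_nonneg)
  have am: "a u = (a (True # u) + a (False # u)) / 2" if "length u < N" for u
  proof -
    have "N - length u = Suc (N - Suc (length u))" using that by simp
    then show ?thesis by (simp add: a_def)
  qed
  have na: "n (fpoly y u) \<le> a u" for u
    using seminorm_cexp[OF n, of "N - length u" "fpoly y" u]
    by (simp only: cexp_fpoly a_def \<phi>_def)
  have dbl: "a (b # u) \<le> 2 * a u" if "length u < N" for b u
    using am[OF that] a0[of "True # u"] a0[of "False # u"] by (cases b) auto
  define f' where "f' = fpoly (\<lambda>v. \<epsilon> v *\<^sub>R y v)"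
  have C0: "0 \<le> extrapolation_const K p q"
    using K unfolding extrapolation_const_def by simp
  show ?thesis
  proof (cases "a [] = 0")
    case True
    have az: "length u \<le> N \<Longrightarrow> a u = 0" for u
    proof (induction u)
      case (Cons b u)
      then have "a u = 0" by simp
      with dbl[of u b] a0[of "b # u"] Cons.prems show ?case by simp
    qed (use True in simp)
    have nz: "n (fpoly y u) = 0" if "length u \<le> N" for u
      using na[of u] az[OF that] seminorm_nonneg[OF n, of "fpoly y u"] by simp
    have yz: "n (y u) = 0" if "length u < N" for u
    proof -
      have "y u = fpoly y (False # u) - fpoly y u" by (simp add: haar_sign_def)
      then have "n (y u) \<le> 0"
        using seminorm_diff[OF n, of "fpoly y (False # u)" "fpoly y u"] nz[of "False # u"] nz[of u] that by simp
      then show ?thesis using seminorm_nonneg[OF n, of "y u"] by simp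
    qed
    have "length u \<le> N \<Longrightarrow> n (f' u) = 0" for u
    proof (induction u)
      case Nil
      then show ?case by (simp add: f'_def seminorm_zero[OF n])
    next
      case (Cons b u)
      have "n (f' (b # u)) \<le> n (f' u) + n (haar_sign b *\<^sub>R \<epsilon> u *\<^sub>R y u)"
        unfolding f'_def fpoly.simps by (rule seminorm_add[OF n])
      also have "\<dots> = 0" using Cons yz[of u] by (simp add: seminorm_scaleR[OF n])
      finally show ?case using seminorm_nonneg[OF n, of "f' (b # u)"] by simp
    qed
    then have "avg N (\<lambda>u. n (f' u) powr p) = avg N (\<lambda>u. 0)"
      by (intro avg_cong) simp
    moreover have "0 \<le> avg N (\<lambda>u. n (fpoly y u) powr p)" by (rule avg_nonneg) simp
    ultimately show ?thesis using C0 by (simp add: f'_def)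
  next
    case False
    have mpos: "0 < m u" for u
    proof (induction u)
      case Nil
      then show ?case using False a0[of "[]"] by (simp add: m_def)
    qed (simp add: m_def)
    have am_le: "a u \<le> m u" for u by (simp add: m_def le_rmax)
    have m_step: "m u \<le> m (b # u)" for u b by (simp add: m_def)
    have m_dbl: "m (b # u) \<le> 2 * m u" if "length u < N" for u b
      using dbl[OF that, of b] am_le[of u] mpos[of u] by (simp add: m_def)
    define \<alpha> where "\<alpha> = 1 - p / q"
    have al: "0 < \<alpha>" "\<alpha> < 1" "1 - \<alpha> = p / q" using p by (auto simp: \<alpha>_def)
    define C where "C = 2 / (p / q)"
    have C: "0 \<le> C" using p by (simp add: C_def)
    define yg where "yg = (\<lambda>v. m v powr (- \<alpha>) *\<^sub>R y v)"
    define g where "g = fpoly yg"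
    have gb: "length u \<le> N \<Longrightarrow> n (g u - m u powr (- \<alpha>) *\<^sub>R fpoly y u) \<le> C * m u powr (1 - \<alpha>)" for u
    proof (induction u)
      case Nil
      then show ?case using C by (simp add: g_def seminorm_zero[OF n])
    next
      case (Cons b u)
      let ?x = "m u" and ?z = "m (b # u)"
      have eq: "g (b # u) - ?z powr (- \<alpha>) *\<^sub>R fpoly y (b # u) =
        (g u - ?x powr (- \<alpha>) *\<^sub>R fpoly y u) + (?x powr (- \<alpha>) - ?z powr (- \<alpha>)) *\<^sub>R fpoly y (b # u)"
        by (simp add: g_def yg_def algebra_simps)
      have nn: "?z powr (- \<alpha>) \<le> ?x powr (- \<alpha>)"
        using mpos[of u] m_step[of u b] al by (intro powr_mono2') auto
      have "n (g (b # u) - ?z powr (- \<alpha>) *\<^sub>R fpoly y (b # u)) \<le>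
        n (g u - ?x powr (- \<alpha>) *\<^sub>R fpoly y u) + (?x powr (- \<alpha>) - ?z powr (- \<alpha>)) * n (fpoly y (b # u))"
        unfolding eq
        using seminorm_add[OF n, of "g u - ?x powr (- \<alpha>) *\<^sub>R fpoly y u" "(?x powr (- \<alpha>) - ?z powr (- \<alpha>)) *\<^sub>R fpoly y (b # u)"]
          seminorm_scaleR[OF n, of "?x powr (- \<alpha>) - ?z powr (- \<alpha>)" "fpoly y (b # u)"] nn by (simp del: fpoly.simps)
      also have "\<dots> \<le> C * ?x powr (1 - \<alpha>) + (?x powr (- \<alpha>) - ?z powr (- \<alpha>)) * ?z"
        using Cons na[of "b # u"] am_le[of "b # u"] nn
        by (intro add_mono mult_left_mono) auto
      also have "\<dots> \<le> C * ?x powr (1 - \<alpha>) + C * (?z powr (1 - \<alpha>) - ?x powr (1 - \<alpha>))"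
        using powr_increment_bound[of ?x ?z \<alpha>] mpos m_step m_dbl[of u b] al Cons.prems
        unfolding C_def by simp
      also have "\<dots> = C * ?z powr (1 - \<alpha>)" by (simp add: algebra_simps)
      finally show ?case .
    qed
    have ng: "n (g u) \<le> (C + 1) * m u powr (1 - \<alpha>)" if "length u \<le> N" for u
    proof -
      have "n (g u) \<le> n (g u - m u powr (- \<alpha>) *\<^sub>R fpoly y u) + m u powr (- \<alpha>) * n (fpoly y u)"
        using seminorm_add[OF n, of "g u - m u powr (- \<alpha>) *\<^sub>R fpoly y u" "m u powr (- \<alpha>) *\<^sub>R fpoly y u"]
        by (simp add: seminorm_scaleR[OF n])
      also have "\<dots> \<le> C * m u powr (1 - \<alpha>) + m u powr (- \<alpha>) * m u"
        using gb[OF that] na[of u] am_le[of u] by (intro add_mono mult_left_mono) auto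
      also have "m u powr (- \<alpha>) * m u = m u powr (1 - \<alpha>)"
        using mpos[of u] by (simp add: powr_diff powr_minus field_simps)
      finally show ?thesis by (simp add: algebra_simps)
    qed
    define G where "G = fpoly (\<lambda>v. \<epsilon> v *\<^sub>R yg v)"
    define aG where "aG = (\<lambda>u. cexp (N - length u) (\<lambda>w. n (G w)) u)"
    define M where "M = rmax aG"
    have nG: "n (G u) \<le> aG u" for u
      using seminorm_cexp[OF n, of "N - length u" G u]
      by (simp only: cexp_fpoly aG_def G_def)
    have M0: "0 \<le> M u" for u
      unfolding M_def aG_def by (intro rmax_nonneg cexp_nonneg seminorm_nonneg[OF n])
    have GM: "n (G u) \<le> M u" for u
      using nG[of u] le_rmax[of aG u] by (simp add: M_def)
    have fb: "n (f' u - m u powr \<alpha> *\<^sub>R G u) \<le> m u powr \<alpha> * M u" for u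
    proof (induction u)
      case Nil
      then show ?case using M0[of "[]"] by (simp add: f'_def G_def seminorm_zero[OF n])
    next
      case (Cons b u)
      let ?x = "m u" and ?z = "m (b # u)"
      have "?x powr \<alpha> *\<^sub>R (?x powr (- \<alpha>) *\<^sub>R y u) = y u"
        using mpos[of u] by (simp add: powr_minus)
      then have e1: "\<epsilon> u *\<^sub>R y u = ?x powr \<alpha> *\<^sub>R (\<epsilon> u *\<^sub>R yg u)"
        unfolding yg_def by (metis scaleR_left_commute)
      have eq: "f' (b # u) - ?z powr \<alpha> *\<^sub>R G (b # u) =
        (f' u - ?x powr \<alpha> *\<^sub>R G u) - (?z powr \<alpha> - ?x powr \<alpha>) *\<^sub>R G (b # u)"
        unfolding f'_def G_def fpoly.simps e1 by (simp add: algebra_simps)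
      have nn: "?x powr \<alpha> \<le> ?z powr \<alpha>"
        by (rule powr_mono2) (use mpos[of u] m_step[of u b] al in auto)
      have "n (f' (b # u) - ?z powr \<alpha> *\<^sub>R G (b # u)) \<le>
        n (f' u - ?x powr \<alpha> *\<^sub>R G u) + (?z powr \<alpha> - ?x powr \<alpha>) * n (G (b # u))"
        unfolding eq
        using seminorm_diff[OF n, of "f' u - ?x powr \<alpha> *\<^sub>R G u" "(?z powr \<alpha> - ?x powr \<alpha>) *\<^sub>R G (b # u)"]
          seminorm_scaleR[OF n, of "?z powr \<alpha> - ?x powr \<alpha>" "G (b # u)"] nn by simp
      also have "\<dots> \<le> ?x powr \<alpha> * M u + (?z powr \<alpha> - ?x powr \<alpha>) * M (b # u)"
        using Cons GM[of "b # u"] nn by (intro add_mono mult_left_mono) auto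
      also have "\<dots> \<le> ?x powr \<alpha> * M (b # u) + (?z powr \<alpha> - ?x powr \<alpha>) * M (b # u)"
        using nn by (intro add_mono mult_left_mono) (auto simp: M_def)
      also have "\<dots> = ?z powr \<alpha> * M (b # u)" by (simp add: algebra_simps)
      finally show ?case .
    qed
    have nf': "n (f' u) \<le> 2 * (m u powr \<alpha> * M u)" for u
    proof -
      have "n (f' u) \<le> n (f' u - m u powr \<alpha> *\<^sub>R G u) + m u powr \<alpha> * n (G u)"
        using seminorm_add[OF n, of "f' u - m u powr \<alpha> *\<^sub>R G u" "m u powr \<alpha> *\<^sub>R G u"]
        by (simp add: seminorm_scaleR[OF n])
      also have "\<dots> \<le> m u powr \<alpha> * M u + m u powr \<alpha> * M u"
        using fb GM by (intro add_mono mult_left_mono) auto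
      finally show ?thesis by (simp add: mult.commute)
    qed
    define X where "X = avg N (\<lambda>u. m u powr p)"
    have X0: "0 \<le> X" unfolding X_def by (intro avg_nonneg) simp
    have dual: "1 < 1 / \<alpha>" "1 < q / p" "1 / (1 / \<alpha>) + 1 / (q / p) = 1"
      using al p by (auto simp: \<alpha>_def field_simps)
    have MX: "avg N (\<lambda>u. M u powr q) \<le> (q / (q - 1)) powr q * (K * ((C + 1) powr q * X))"
    proof -
      have "avg N (\<lambda>u. M u powr q) \<le> (q / (q - 1)) powr q * avg N (\<lambda>u. n (G u) powr q)"
        unfolding M_def aG_def by (rule Doob_Lp) (use p seminorm_nonneg[OF n] in auto)
      also have "avg N (\<lambda>u. n (G u) powr q) \<le> K * avg N (\<lambda>u. n (g u) powr q)"
        unfolding G_def g_def by (rule hyp[OF eps])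
      also have "avg N (\<lambda>u. n (g u) powr q) \<le> avg N (\<lambda>u. (C + 1) powr q * m u powr p)"
      proof (rule avg_mono)
        fix w :: "bool list" assume "length w = N"
        then have "n (g w) powr q \<le> ((C + 1) * m w powr (1 - \<alpha>)) powr q"
          using ng[of w] seminorm_nonneg[OF n] p by (intro powr_mono2) auto
        also have "\<dots> = (C + 1) powr q * m w powr p"
          using C p al by (simp add: powr_mult powr_powr)
        finally show "n (g w) powr q \<le> (C + 1) powr q * m w powr p" .
      qed
      also have "\<dots> = (C + 1) powr q * X" by (simp only: cexp_mult_left X_def)
      finally show ?thesis using K by (simp add: mult_left_mono)
    qed
    have "avg N (\<lambda>u. n (f' u) powr p) \<le> avg N (\<lambda>u. 2 powr p * (m u powr (\<alpha> * p) * M u powr p))"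
    proof (rule avg_mono)
      fix w
      have "n (f' w) powr p \<le> (2 * (m w powr \<alpha> * M w)) powr p"
        using nf'[of w] seminorm_nonneg[OF n] p by (intro powr_mono2) auto
      then show "n (f' w) powr p \<le> 2 powr p * (m w powr (\<alpha> * p) * M w powr p)"
        using M0[of w] by (simp add: powr_mult powr_powr)
    qed
    also have "\<dots> = 2 powr p * avg N (\<lambda>u. m u powr (\<alpha> * p) * M u powr p)" by (rule cexp_mult_left)
    also have "avg N (\<lambda>u. m u powr (\<alpha> * p) * M u powr p) \<le>
        avg N (\<lambda>u. (m u powr (\<alpha> * p)) powr (1 / \<alpha>)) powr (1 / (1 / \<alpha>)) *
        avg N (\<lambda>u. (M u powr p) powr (q / p)) powr (1 / (q / p))"
      using dual by (intro avg_Holder) auto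
    also have "\<dots> = X powr \<alpha> * avg N (\<lambda>u. M u powr q) powr (p / q)"
      using al p by (simp add: powr_powr X_def)
    also have "\<dots> \<le> X powr \<alpha> * ((q / (q - 1)) powr q * (K * ((C + 1) powr q * X))) powr (p / q)"
      using MX p M0 by (intro mult_left_mono powr_mono2) (auto intro!: avg_nonneg)
    also have "((q / (q - 1)) powr q * (K * ((C + 1) powr q * X))) powr (p / q)
      = ((q / (q - 1)) powr q * (K * (C + 1) powr q)) powr (p / q) * X powr (p / q)"
      using K X0 by (simp add: powr_mult[symmetric] mult.assoc)
    also have "X powr \<alpha> * (((q / (q - 1)) powr q * (K * (C + 1) powr q)) powr (p / q) * X powr (p / q))
      = ((q / (q - 1)) powr q * (K * (C + 1) powr q)) powr (p / q) * X"
    proof -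
      have "X powr \<alpha> * X powr (p / q) = X"
        using X0 by (simp add: powr_add[symmetric] \<alpha>_def)
      then show ?thesis by (metis mult.left_commute)
    qed
    also have "X \<le> (p / (p - 1)) powr p * avg N (\<lambda>u. n (fpoly y u) powr p)"
      unfolding X_def m_def a_def \<phi>_def by (rule Doob_Lp) (use p seminorm_nonneg[OF n] in auto)
    finally show ?thesis
      by (simp add: f'_def extrapolation_const_def C_def mult_left_mono mult.assoc)
  qed
qed


lemma sign_transform_orthogonal:
  fixes \<beta> :: "'b::real_vector \<Rightarrow> 'c::real_vector \<Rightarrow> real"
  assumes bl: "\<And>x x' z. \<beta> (x + x') z = \<beta> x z + \<beta> x' z" "\<And>c x z. \<beta> (c *\<^sub>R x) z = c * \<beta> x z"
     "\<And>x z z'. \<beta> x (z + z') = \<beta> x z + \<beta> x z'" "\<And>c x z. \<beta> x (c *\<^sub>R z) = c * \<beta> x z"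
  shows "avg N (\<lambda>u. \<beta> (fpoly y u) (fpoly z u)) = (\<Sum>k<N. avg k (\<lambda>u. \<beta> (y u) (z u)))"
proof (induction N)
  case 0
  show ?case using bl(2)[of 0 0 0] by simp
next
  case (Suc N)
  have m: "\<beta> (x - x') z = \<beta> x z - \<beta> x' z" "\<beta> x (w - w') = \<beta> x w - \<beta> x w'" for x x' z w w'
    using bl(1)[of "x - x'" x' z] bl(3)[of x "w - w'" w'] by auto
  have "avg (Suc N) (\<lambda>u. \<beta> (fpoly y u) (fpoly z u)) = avg N (\<lambda>u. \<beta> (fpoly y u) (fpoly z u) + \<beta> (y u) (z u))"
    unfolding cexp_Suc_inner
    by (intro avg_cong) (simp add: haar_sign_def bl m algebra_simps)
  then show ?case using Suc by (simp add: cexp_add del: cexp.simps)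
qed

text \<open>Changing signs is symmetric for any bilinear pairing since only products of coefficients at
  the same node survive averaging; the constant \<open>c\<close> is annihilated.\<close>

lemma sign_transform_selfadjoint:
  fixes \<beta> :: "'b::real_vector \<Rightarrow> 'c::real_vector \<Rightarrow> real"
  assumes bl: "\<And>x x' z. \<beta> (x + x') z = \<beta> x z + \<beta> x' z" "\<And>c x z. \<beta> (c *\<^sub>R x) z = c * \<beta> x z"
     "\<And>x z z'. \<beta> x (z + z') = \<beta> x z + \<beta> x z'" "\<And>c x z. \<beta> x (c *\<^sub>R z) = c * \<beta> x z"
  shows "avg N (\<lambda>u. \<beta> (fpoly (\<lambda>v. \<epsilon> v *\<^sub>R y v) u) (c + fpoly z u))
       = avg N (\<lambda>u. \<beta> (fpoly y u) (fpoly (\<lambda>v. \<epsilon> v *\<^sub>R z v) u))"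
proof -
  have mean0: "avg N (\<lambda>u. \<beta> (fpoly w u) c) = 0" for w
  proof (induction N)
    case 0
    show ?case using bl(2)[of 0 0 c] by simp
  next
    case (Suc N)
    have m: "\<beta> (x - x') z = \<beta> x z - \<beta> x' z" for x x' z
      using bl(1)[of "x - x'" x' z] by auto
    have "avg (Suc N) (\<lambda>u. \<beta> (fpoly w u) c) = avg N (\<lambda>u. \<beta> (fpoly w u) c)"
      unfolding cexp_Suc_inner
      by (intro avg_cong) (simp add: haar_sign_def bl m algebra_simps)
    then show ?case using Suc by simp
  qed
  show ?thesis
    by (simp add: bl(3) cexp_add mean0 sign_transform_orthogonal[where \<beta> = \<beta>, OF bl] bl(2,4))
qed

definition duality_const :: "real \<Rightarrow> real \<Rightarrow> real" where
  "duality_const K r = (K * 2 powr (r / (r - 1))) powr (r - 1)"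

lemma duality:
  fixes n :: "'b::real_vector \<Rightarrow> real" and n' :: "'c::real_vector \<Rightarrow> real"
  assumes bl: "\<And>x x' z. \<beta> (x + x') z = \<beta> x z + \<beta> x' z" "\<And>c x z. \<beta> (c *\<^sub>R x) z = c * \<beta> x z"
     "\<And>x z z'. \<beta> x (z + z') = \<beta> x z + \<beta> x z'" "\<And>c x z. \<beta> x (c *\<^sub>R z) = c * \<beta> x z"
    and n: "seminorm n" "seminorm n'"
    and Hoelder: "\<And>x z. \<beta> x z \<le> n x * n' z"
    and norming: "\<And>x. \<exists>z. \<beta> x z = n x \<and> n' z \<le> 1"
    and r: "1 < r" and s: "s = r / (r - 1)" and K: "0 \<le> K"
    and hyp: "\<And>z. avg N (\<lambda>u. n' (fpoly (\<lambda>v. \<epsilon> v *\<^sub>R z v) u) powr s) \<le> K * avg N (\<lambda>u. n' (fpoly z u) powr s)"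
  shows "avg N (\<lambda>u. n (fpoly (\<lambda>v. \<epsilon> v *\<^sub>R y v) u) powr r)
    \<le> duality_const K r * avg N (\<lambda>u. n (fpoly y u) powr r)"
proof -
  have rs: "1 < s" "1 / r + 1 / s = 1" "(r - 1) * s = r" "r / s = r - 1"
    unfolding s using r by (auto simp: field_simps)
  define f where "f = fpoly (\<lambda>v. \<epsilon> v *\<^sub>R y v)"
  obtain d where d: "\<And>x. \<beta> x (d x) = n x" "\<And>x. n' (d x) \<le> 1" using norming by metis
  define G where "G = (\<lambda>u. n (f u) powr (r - 1) *\<^sub>R d (f u))"
  obtain z where z: "\<And>u. length u = N \<Longrightarrow> G u = avg N G + fpoly z u"
    using haar_expansion[of N G] by metis
  define A where "A = avg N (\<lambda>u. n (f u) powr r)"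
  define B where "B = avg N (\<lambda>u. n (fpoly y u) powr r)"
  have A0: "0 \<le> A" and B0: "0 \<le> B" by (auto simp: A_def B_def intro!: avg_nonneg)
  have nn: "0 \<le> n x" "0 \<le> n' w" for x w using n seminorm_nonneg by auto
  have G': "n' (G u) \<le> n (f u) powr (r - 1)" for u
    using d(2)[of "f u"] mult_left_mono[OF d(2)[of "f u"], of "n (f u) powr (r - 1)"]
    by (simp add: G_def seminorm_scaleR[OF n(2)])
  have GA: "avg N (\<lambda>u. n' (G u) powr s) \<le> A"
    unfolding A_def
  proof (rule avg_mono)
    fix w
    have "n' (G w) powr s \<le> (n (f w) powr (r - 1)) powr s"
      using G' nn rs by (intro powr_mono2) auto
    then show "n' (G w) powr s \<le> n (f w) powr r" using rs by (simp add: powr_powr)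
  qed
  have mean: "n' (avg N G) powr s \<le> A"
  proof -
    have "n' (avg N G) \<le> avg N (\<lambda>u. n' (G u) * 1)" using seminorm_cexp[OF n(2), of N G "[]"] by simp
    also have "\<dots> \<le> avg N (\<lambda>u. n' (G u) powr s) powr (1/s) * avg N (\<lambda>u. 1 powr r) powr (1/r)"
      using r rs nn by (intro avg_Holder) auto
    finally have "n' (avg N G) powr s \<le> (avg N (\<lambda>u. n' (G u) powr s) powr (1/s)) powr s"
      using nn rs by (intro powr_mono2) auto
    also have "\<dots> = avg N (\<lambda>u. n' (G u) powr s)"
      using rs avg_nonneg[of N "\<lambda>u. n' (G u) powr s"] by (simp add: powr_powr)
    finally show ?thesis using GA by simp
  qed
  have zA: "avg N (\<lambda>u. n' (fpoly z u) powr s) \<le> 2 powr s * A"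
  proof -
    have "avg N (\<lambda>u. n' (fpoly z u) powr s) \<le> avg N (\<lambda>u. 2 powr s * (1/2 * n' (G u) powr s + 1/2 * n' (avg N G) powr s))"
    proof (rule avg_mono)
      fix w :: "bool list" assume w: "length w = N"
      have "fpoly z w = G w - avg N G" using z[OF w] by simp
      then have "n' (fpoly z w) \<le> n' (G w) + n' (avg N G)" using seminorm_diff[OF n(2)] by metis
      then have "n' (fpoly z w) powr s \<le> (2 * (1/2 * n' (G w) + 1/2 * n' (avg N G))) powr s"
        using nn rs by (intro powr_mono2) auto
      also have "\<dots> = 2 powr s * (1/2 * n' (G w) + 1/2 * n' (avg N G)) powr s"
        by (rule powr_mult)
      also have "\<dots> \<le> 2 powr s * (1/2 * n' (G w) powr s + 1/2 * n' (avg N G) powr s)"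
        using powr_convex_comb[of "n' (G w)" "n' (avg N G)" s "1/2"] rs nn
        by (intro mult_left_mono) auto
      finally show "n' (fpoly z w) powr s \<le> 2 powr s * (1/2 * n' (G w) powr s + 1/2 * n' (avg N G) powr s)" .
    qed
    also have "\<dots> = 2 powr s * (1/2 * avg N (\<lambda>u. n' (G u) powr s) + 1/2 * n' (avg N G) powr s)"
      by (simp only: cexp_mult_left cexp_add cexp_const)
    also have "\<dots> \<le> 2 powr s * A" using GA mean by (intro mult_left_mono) auto
    finally show ?thesis .
  qed
  have "A = avg N (\<lambda>u. \<beta> (f u) (G u))"
    unfolding A_def
  proof (rule avg_cong)
    fix w
    have "n (f w) powr r = n (f w) powr (r - 1) * n (f w)"
      using nn(1)[of "f w"] by (cases "n (f w) = 0") (auto simp: powr_diff)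
    then show "n (f w) powr r = \<beta> (f w) (G w)" by (simp add: G_def bl d)
  qed
  also have "\<dots> = avg N (\<lambda>u. \<beta> (f u) (avg N G + fpoly z u))" by (rule avg_cong) (simp add: z[symmetric])
  also have "\<dots> = avg N (\<lambda>u. \<beta> (fpoly y u) (fpoly (\<lambda>v. \<epsilon> v *\<^sub>R z v) u))"
    unfolding f_def by (rule sign_transform_selfadjoint[OF bl])
  also have "\<dots> \<le> avg N (\<lambda>u. n (fpoly y u) * n' (fpoly (\<lambda>v. \<epsilon> v *\<^sub>R z v) u))"
    by (intro avg_mono Hoelder)
  also have "\<dots> \<le> B powr (1/r) * avg N (\<lambda>u. n' (fpoly (\<lambda>v. \<epsilon> v *\<^sub>R z v) u) powr s) powr (1/s)"
    unfolding B_def using r rs nn by (intro avg_Holder) auto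
  also have "\<dots> \<le> B powr (1/r) * (K * (2 powr s * A)) powr (1/s)"
  proof (intro mult_left_mono powr_mono2)
    show "avg N (\<lambda>u. n' (fpoly (\<lambda>v. \<epsilon> v *\<^sub>R z v) u) powr s) \<le> K * (2 powr s * A)"
      using hyp[of z] mult_left_mono[OF zA K] by linarith
  qed (use rs in \<open>auto intro!: avg_nonneg\<close>)
  finally have main: "A \<le> B powr (1/r) * (K * (2 powr s * A)) powr (1/s)" .
  show ?thesis
  proof (cases "A = 0")
    case True
    then show ?thesis using B0 by (simp add: A_def[symmetric] B_def[symmetric] f_def[symmetric] duality_const_def)
  next
    case False
    have "A = A powr (1/r) * A powr (1/s)"
      using A0 rs by (simp add: powr_add[symmetric])
    moreover have "(K * (2 powr s * A)) powr (1/s) = (K * 2 powr s) powr (1/s) * A powr (1/s)"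
      using K A0 by (simp add: powr_mult[symmetric] mult.assoc)
    ultimately have "A powr (1/r) * A powr (1/s) \<le> (B powr (1/r) * (K * 2 powr s) powr (1/s)) * A powr (1/s)"
      using main by (simp add: mult.assoc)
    then have "A powr (1/r) \<le> B powr (1/r) * (K * 2 powr s) powr (1/s)" using False A0 by simp
    then have "(A powr (1/r)) powr r \<le> (B powr (1/r) * (K * 2 powr s) powr (1/s)) powr r"
      using r by (intro powr_mono2) auto
    moreover have "(B powr (1/r) * (K * 2 powr s) powr (1/s)) powr r = (B powr (1/r)) powr r * ((K * 2 powr s) powr (1/s)) powr r"
      by (rule powr_mult)
    moreover have "((K * 2 powr s) powr (1/s)) powr r = (K * 2 powr s) powr (r - 1)"
      using rs(4) by (simp only: powr_powr) simp
    moreover have "(A powr (1/r)) powr r = A" "(B powr (1/r)) powr r = B"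
      using A0 B0 r by (simp_all add: powr_powr)
    ultimately have "A \<le> B * (K * 2 powr s) powr (r - 1)" by simp
    then show ?thesis by (simp add: A_def B_def f_def duality_const_def s mult.commute)
  qed
qed

section \<open>Mixed norms on the discrete cube\<close>

primrec mavg :: "nat \<Rightarrow> nat list \<Rightarrow> ((nat \<Rightarrow> bool list) \<Rightarrow> real) \<Rightarrow> (nat \<Rightarrow> bool list) \<Rightarrow> real" where
  "mavg N [] F t = F t"
| "mavg N (j # js) F t = avg N (\<lambda>s. mavg N js F (t(j := s)))"

text \<open>The iterated norm on the discrete cube, with averages over words of length \<open>N\<close> in place of
  integrals.\<close>

primrec dnorm ::
  "nat \<Rightarrow> (nat \<Rightarrow> real) \<Rightarrow> nat list \<Rightarrow> ((nat \<Rightarrow> bool list) \<Rightarrow> real) \<Rightarrow> (nat \<Rightarrow> bool list) \<Rightarrow> real" where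
  "dnorm N p [] F t = \<bar>F t\<bar>"
| "dnorm N p (j # js) F t = avg N (\<lambda>s. dnorm N p js F (t(j := s)) powr p j) powr (1 / p j)"

text \<open>The points that the mixed norm at \<open>t\<close> evaluates: the coordinates in \<open>js\<close> vary over words of
  length \<open>N\<close>, the others are fixed.\<close>

definition pts :: "nat \<Rightarrow> nat list \<Rightarrow> (nat \<Rightarrow> bool list) \<Rightarrow> (nat \<Rightarrow> bool list) set" where
  "pts N js t = {t'. (\<forall>i. i \<notin> set js \<longrightarrow> t' i = t i) \<and> (\<forall>i\<in>set js. length (t' i) = N)}"

lemma pts_Cons: "length s = N \<Longrightarrow> t' \<in> pts N js (t(j := s)) \<Longrightarrow> t' \<in> pts N (j # js) t"
  unfolding pts_def by (auto split: if_splits)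

lemma pts_Nil [simp]: "pts N [] t = {t}"
  by (auto simp: pts_def)

lemma mavg_cong: "(\<And>t'. t' \<in> pts N js t \<Longrightarrow> F t' = G t') \<Longrightarrow> mavg N js F t = mavg N js G t"
proof (induction js arbitrary: t)
  case (Cons j js)
  show ?case by (simp, intro avg_cong Cons.IH Cons.prems pts_Cons)
qed simp

lemma mavg_mono: "(\<And>t'. t' \<in> pts N js t \<Longrightarrow> F t' \<le> G t') \<Longrightarrow> mavg N js F t \<le> mavg N js G t"
proof (induction js arbitrary: t)
  case (Cons j js)
  show ?case by (simp, intro avg_mono Cons.IH Cons.prems pts_Cons)
qed simp

lemma mavg_add: "mavg N js (\<lambda>t. F t + G t) t = mavg N js F t + mavg N js G t"
  by (induction js arbitrary: t) (auto simp: cexp_add)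

lemma mavg_cmult: "mavg N js (\<lambda>t. c * F t) t = c * mavg N js F t"
  by (induction js arbitrary: t) (auto simp: cexp_mult_left)

lemma mavg_diff: "mavg N js (\<lambda>t. F t - G t) t = mavg N js F t - mavg N js G t"
  using mavg_add[of N js F "\<lambda>t. - G t" t] mavg_cmult[of N js "-1" G t] by simp

lemma mavg_const [simp]: "mavg N js (\<lambda>t. c) t = c"
  by (induction js arbitrary: t) auto

lemma mavg_sum: "mavg N js (\<lambda>t. \<Sum>i\<in>A. F i t) t = (\<Sum>i\<in>A. mavg N js (F i) t)"
  by (induction js arbitrary: t) (auto simp: cexp_sum)

lemma mavg_pull: "(\<And>t'. t' \<in> pts N js t \<Longrightarrow> c t' = c t) \<Longrightarrow> mavg N js (\<lambda>t. c t * F t) t = c t * mavg N js F t"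
  using mavg_cong[of N js t "\<lambda>t. c t * F t" "\<lambda>t'. c t * F t'"] by (simp add: mavg_cmult)

lemma dnorm_nonneg: "0 \<le> dnorm N p js F t"
  by (cases js) auto

lemma dnorm_mono:
  assumes "\<And>j. j \<in> set js \<Longrightarrow> 0 < p j"
  shows "(\<And>t'. t' \<in> pts N js t \<Longrightarrow> \<bar>F t'\<bar> \<le> \<bar>G t'\<bar>) \<Longrightarrow> dnorm N p js F t \<le> dnorm N p js G t"
  using assms
proof (induction js arbitrary: t)
  case (Cons j js)
  have p: "0 \<le> p j" "0 \<le> 1 / p j" using Cons.prems(2)[of j] by auto
  have *: "dnorm N p js F (t(j := s)) powr p j \<le> dnorm N p js G (t(j := s)) powr p j" if "length s = N" for s
    by (intro powr_mono2 Cons.IH dnorm_nonneg p Cons.prems(1) pts_Cons[OF that] Cons.prems(2); (assumption | simp))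
  show ?case unfolding dnorm.simps
    using p by (intro powr_mono2 avg_mono *) (auto intro!: avg_nonneg)
qed simp

lemma dnorm_cong:
  "(\<And>t'. t' \<in> pts N js t \<Longrightarrow> \<bar>F t'\<bar> = \<bar>G t'\<bar>) \<Longrightarrow> dnorm N p js F t = dnorm N p js G t"
proof (induction js arbitrary: t)
  case (Cons j js)
  have "avg N (\<lambda>s. dnorm N p js F (t(j := s)) powr p j) = avg N (\<lambda>s. dnorm N p js G (t(j := s)) powr p j)"
    by (intro avg_cong arg_cong2[where f = "(powr)"] Cons.IH Cons.prems pts_Cons refl)
  then show ?case by simp
qed simp

lemma dnorm_scale:
  assumes "\<And>j. j \<in> set js \<Longrightarrow> 0 < p j"
  shows "dnorm N p js (\<lambda>t. c * F t) t = \<bar>c\<bar> * dnorm N p js F t"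
  using assms
proof (induction js arbitrary: t)
  case (Cons j js)
  have "0 < p j" using Cons.prems[of j] by simp
  then have p: "0 < p j" "p j \<noteq> 0" by auto
  have "avg N (\<lambda>s. (\<bar>c\<bar> * dnorm N p js F (t(j := s))) powr p j) = \<bar>c\<bar> powr p j * avg N (\<lambda>s. dnorm N p js F (t(j := s)) powr p j)"
    by (simp add: powr_mult cexp_mult_left)
  then show ?case using Cons p(2) by (simp add: powr_mult powr_powr)
qed (simp add: abs_mult)

lemma dnorm_pull:
  assumes "\<And>j. j \<in> set js \<Longrightarrow> 0 < p j" "\<And>t'. t' \<in> pts N js t \<Longrightarrow> c t' = c t"
  shows "dnorm N p js (\<lambda>t. c t * F t) t = \<bar>c t\<bar> * dnorm N p js F t"
  using dnorm_cong[of N js t "\<lambda>t. c t * F t" "\<lambda>t'. c t * F t'" p] assms by (simp add: dnorm_scale)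

lemma dnorm_indep:
  "(\<And>i. i \<notin> set js \<Longrightarrow> t' i = t i) \<Longrightarrow> dnorm N p js F t' = dnorm N p js F t"
proof (induction js arbitrary: t t')
  case Nil
  then have "t' = t" by auto
  then show ?case by simp
next
  case (Cons j js)
  have "dnorm N p js F (t'(j := s)) = dnorm N p js F (t(j := s))" for s
    by (rule Cons.IH) (use Cons.prems in auto)
  then show ?case by simp
qed

lemma avg_Minkowski:
  fixes \<phi> \<psi> :: "bool list \<Rightarrow> real"
  assumes p: "1 \<le> p" and nn: "\<And>w. 0 \<le> \<phi> w" "\<And>w. 0 \<le> \<psi> w"
  shows "avg N (\<lambda>w. (\<phi> w + \<psi> w) powr p) powr (1/p)
    \<le> avg N (\<lambda>w. \<phi> w powr p) powr (1/p) + avg N (\<lambda>w. \<psi> w powr p) powr (1/p)"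
proof -
  define A where "A = avg N (\<lambda>w. \<phi> w powr p)"
  define B where "B = avg N (\<lambda>w. \<psi> w powr p)"
  have AB: "0 \<le> A" "0 \<le> B" unfolding A_def B_def by (auto intro!: avg_nonneg)
  have z: "\<phi> w = 0" if "A = 0" "length w = N" for w
    using cexp_eq_0D[of "\<lambda>w. \<phi> w powr p" N "[]" w] that by (simp add: A_def)
  have z': "\<psi> w = 0" if "B = 0" "length w = N" for w
    using cexp_eq_0D[of "\<lambda>w. \<psi> w powr p" N "[]" w] that by (simp add: B_def)
  consider "A = 0" | "B = 0" | "0 < A" "0 < B" using AB by fastforce
  then show ?thesis
  proof cases
    case 1
    have "avg N (\<lambda>w. (\<phi> w + \<psi> w) powr p) = B"
      unfolding B_def by (rule avg_cong) (use z[OF 1] in simp)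
    then show ?thesis by (simp add: B_def)
  next
    case 2
    have "avg N (\<lambda>w. (\<phi> w + \<psi> w) powr p) = A"
      unfolding A_def by (rule avg_cong) (use z'[OF 2] in simp)
    then show ?thesis by (simp add: A_def)
  next
    case 3
    define a where "a = A powr (1/p)"
    define b where "b = B powr (1/p)"
    have ab: "0 < a" "0 < b" "a powr p = A" "b powr p = B"
      using 3 p by (auto simp: a_def b_def powr_powr)
    define t where "t = b / (a + b)"
    have t: "0 \<le> t" "t \<le> 1" "1 - t = a / (a + b)" using ab by (auto simp: t_def field_simps)
    have "avg N (\<lambda>w. (1 / (a + b) powr p) * (\<phi> w + \<psi> w) powr p)
      \<le> avg N (\<lambda>w. ((1 - t) / A) * \<phi> w powr p + (t / B) * \<psi> w powr p)"
    proof (rule avg_mono)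
      fix w
      have "(\<phi> w + \<psi> w) / (a + b) = (1 - t) * (\<phi> w / a) + t * (\<psi> w / b)"
        unfolding t(3) unfolding t_def using ab by (simp add: add_divide_distrib)
      then have "((\<phi> w + \<psi> w) / (a + b)) powr p \<le> (1 - t) * (\<phi> w / a) powr p + t * (\<psi> w / b) powr p"
        using powr_convex_comb[of "\<phi> w / a" "\<psi> w / b" p t] ab nn p t by simp
      then show "(1 / (a + b) powr p) * (\<phi> w + \<psi> w) powr p \<le> ((1 - t) / A) * \<phi> w powr p + (t / B) * \<psi> w powr p"
        using ab nn by (simp add: powr_divide)
    qed
    also have "\<dots> = ((1 - t) / A) * A + (t / B) * B"
      by (simp only: cexp_add cexp_mult_left A_def B_def)
    also have "\<dots> = 1" using 3 by simp
    finally have "avg N (\<lambda>w. (\<phi> w + \<psi> w) powr p) \<le> (a + b) powr p"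
      using ab by (simp only: cexp_mult_left) (simp add: field_simps)
    then have "avg N (\<lambda>w. (\<phi> w + \<psi> w) powr p) powr (1/p) \<le> ((a + b) powr p) powr (1/p)"
      using p by (intro powr_mono2) (auto intro!: avg_nonneg)
    then show ?thesis using ab p by (simp add: powr_powr a_def[symmetric] b_def[symmetric] A_def[symmetric] B_def[symmetric])
  qed
qed

lemma dnorm_triangle:
  assumes "\<And>j. j \<in> set js \<Longrightarrow> 1 \<le> p j"
  shows "dnorm N p js (\<lambda>t. F t + G t) t \<le> dnorm N p js F t + dnorm N p js G t"
  using assms
proof (induction js arbitrary: t)
  case (Cons j js)
  have p: "1 \<le> p j" using Cons.prems[of j] by simp
  then have p': "0 \<le> p j" "0 \<le> 1 / p j" by auto
  have *: "dnorm N p js (\<lambda>t. F t + G t) t' \<le> dnorm N p js F t' + dnorm N p js G t'" for t'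
    using Cons by simp
  have "dnorm N p (j # js) (\<lambda>t. F t + G t) t
    \<le> avg N (\<lambda>s. (dnorm N p js F (t(j := s)) + dnorm N p js G (t(j := s))) powr p j) powr (1 / p j)"
    unfolding dnorm.simps
    by (intro powr_mono2 avg_mono * p' dnorm_nonneg avg_nonneg powr_ge_zero)
  also have "\<dots> \<le> dnorm N p (j # js) F t + dnorm N p (j # js) G t"
    unfolding dnorm.simps by (rule avg_Minkowski[OF p dnorm_nonneg dnorm_nonneg])
  finally show ?case .
qed simp

lemma seminorm_dnorm:
  assumes "\<And>j. j \<in> set js \<Longrightarrow> 1 \<le> p j"
  shows "seminorm (\<lambda>F. dnorm N p js F t)"
  unfolding seminorm_def
proof (intro conjI allI)
  fix F G
  show "dnorm N p js (F + G) t \<le> dnorm N p js F t + dnorm N p js G t"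
    using dnorm_triangle[of js p N F G t] assms by (simp add: plus_fun_def)
next
  fix c :: real and F
  have "\<And>j. j \<in> set js \<Longrightarrow> 0 < p j" using assms by force
  from dnorm_scale[OF this, where c = c and F = F and N = N and t = t] show "dnorm N p js (c *\<^sub>R F) t = \<bar>c\<bar> * dnorm N p js F t"
    by (simp add: scaleR_fun_def)
qed

lemma dnorm_sum:
  assumes "\<And>j. j \<in> set js \<Longrightarrow> 1 \<le> p j"
  shows "dnorm N p js (\<lambda>t. \<Sum>i\<in>A. F i t) t \<le> (\<Sum>i\<in>A. dnorm N p js (F i) t)"
proof -
  have "(\<lambda>t. \<Sum>i\<in>A. F i t) = (\<Sum>i\<in>A. F i)" by (induction A rule: infinite_finite_induct) (auto simp: fun_eq_iff)
  then show ?thesis using seminorm_sum[OF seminorm_dnorm[where js = js and p = p and N = N and t = t], of F A] assms by simp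
qed

lemma dnorm_outer_mono:
  assumes "\<And>j. j \<in> set os \<Longrightarrow> 0 < p j" "0 \<le> C"
  shows "(\<And>t'. t' \<in> pts N os t \<Longrightarrow> dnorm N p js F t' \<le> C * dnorm N p js G t') \<Longrightarrow>
    dnorm N p (os @ js) F t \<le> C * dnorm N p (os @ js) G t"
  using assms(1)
proof (induction os arbitrary: t)
  case (Cons j os)
  have p: "0 < p j" "0 \<le> p j" "0 \<le> 1 / p j" using Cons.prems(2)[of j] by auto
  have *: "dnorm N p (os @ js) F (t(j := s)) powr p j \<le> (C * dnorm N p (os @ js) G (t(j := s))) powr p j"
    if "length s = N" for s
    by (intro powr_mono2 Cons.IH dnorm_nonneg p Cons.prems(1) pts_Cons[OF that] Cons.prems(2); (assumption | simp))
  have "dnorm N p ((j # os) @ js) F t \<le> avg N (\<lambda>s. (C * dnorm N p (os @ js) G (t(j := s))) powr p j) powr (1 / p j)"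
    unfolding append_Cons dnorm.simps
    using p by (intro powr_mono2 avg_mono *) (auto intro!: avg_nonneg)
  also have "\<dots> = C * dnorm N p ((j # os) @ js) G t"
    using p assms(2) by (simp add: powr_mult cexp_mult_left powr_powr)
  finally show ?case .
qed simp

definition conj_exp :: "(nat \<Rightarrow> real) \<Rightarrow> nat \<Rightarrow> real" where
  "conj_exp p j = p j / (p j - 1)"

lemma conj_exp: "1 < p j \<Longrightarrow> 1 < conj_exp p j" "1 < p j \<Longrightarrow> 1 / p j + 1 / conj_exp p j = 1"
  by (auto simp: conj_exp_def field_simps)

lemma conj_exp_mult: "1 < p j \<Longrightarrow> (p j - 1) * conj_exp p j = p j"
  by (simp add: conj_exp_def)

lemma dnorm_Holder:
  assumes "\<And>j. j \<in> set js \<Longrightarrow> 1 < p j"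
  shows "mavg N js (\<lambda>t. F t * G t) t \<le> dnorm N p js F t * dnorm N (conj_exp p) js G t"
  using assms
proof (induction js arbitrary: t)
  case Nil
  show ?case using abs_ge_self[of "F t * G t"] by (simp add: abs_mult)
next
  case (Cons j js)
  then have p: "1 < p j" by simp
  have "mavg N (j # js) (\<lambda>t. F t * G t) t \<le> avg N (\<lambda>s. dnorm N p js F (t(j := s)) * dnorm N (conj_exp p) js G (t(j := s)))"
    unfolding mavg.simps using Cons by (intro avg_mono) auto
  also have "\<dots> \<le> dnorm N p (j # js) F t * dnorm N (conj_exp p) (j # js) G t"
    unfolding dnorm.simps by (intro avg_Holder p conj_exp dnorm_nonneg)
  finally show ?case .
qed

text \<open>The extremal function in Hoelder's inequality for the mixed norm, built from the innermost variable outwards.\<close>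

primrec dualf ::
  "nat \<Rightarrow> (nat \<Rightarrow> real) \<Rightarrow> nat list \<Rightarrow> ((nat \<Rightarrow> bool list) \<Rightarrow> real) \<Rightarrow> (nat \<Rightarrow> bool list) \<Rightarrow> real" where
  "dualf N p [] F t = sgn (F t)"
| "dualf N p (j # js) F t =
    dnorm N p js F t powr (p j - 1) / dnorm N p (j # js) F t powr (p j - 1) * dualf N p js F t"

lemma dualf_norming:
  assumes "\<And>j. j \<in> set js \<Longrightarrow> 1 < p j"
  shows "mavg N js (\<lambda>t. F t * dualf N p js F t) t = dnorm N p js F t \<and>
    dnorm N (conj_exp p) js (dualf N p js F) t \<le> 1"
  using assms
proof (induction js arbitrary: t)
  case Nil
  show ?case by (auto simp: abs_sgn sgn_if)
next
  case (Cons j js)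
  then have p: "1 < p j" by simp
  define D where "D = dnorm N p (j # js) F t"
  define u where "u = (\<lambda>s. dnorm N p js F (t(j := s)))"
  have D0: "0 \<le> D" unfolding D_def by (rule dnorm_nonneg)
  have u0: "0 \<le> u s" for s unfolding u_def by (rule dnorm_nonneg)
  have Dp: "D powr p j = avg N (\<lambda>s. u s powr p j)"
    using p avg_nonneg[of N "\<lambda>s. u s powr p j"] by (simp add: D_def u_def powr_powr)
  define c where "c = (\<lambda>t'. dnorm N p js F t' powr (p j - 1) / dnorm N p (j # js) F t' powr (p j - 1))"
  have c: "c t' = u s powr (p j - 1) / D powr (p j - 1)" if "t' \<in> pts N js (t(j := s))" for t' s
  proof -
    have "dnorm N p js F t' = u s"
      unfolding u_def by (rule dnorm_indep) (use that in \<open>auto simp: pts_def\<close>)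
    moreover have "dnorm N p (j # js) F t' = D"
      unfolding D_def by (rule dnorm_indep) (use that in \<open>auto simp: pts_def\<close>)
    ultimately show ?thesis by (simp add: c_def)
  qed
  have c': "c (t(j := s)) = u s powr (p j - 1) / D powr (p j - 1)" for s
  proof -
    have "dnorm N p (j # js) F (t(j := s)) = D"
      unfolding D_def by (rule dnorm_indep) auto
    then show ?thesis by (simp add: c_def u_def)
  qed
  have cc: "c t' = c (t(j := s))" if "t' \<in> pts N js (t(j := s))" for t' s
    using c[OF that] c' by simp
  have p0: "\<And>i. i \<in> set js \<Longrightarrow> 0 < conj_exp p i"
    using Cons.prems conj_exp(1) by (meson list.set_intros(2) less_trans zero_less_one)
  have IH: "mavg N js (\<lambda>t. F t * dualf N p js F t) t' = dnorm N p js F t'"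
    "dnorm N (conj_exp p) js (dualf N p js F) t' \<le> 1" for t'
    using Cons by auto
  have "mavg N (j # js) (\<lambda>t. F t * dualf N p (j # js) F t) t
    = avg N (\<lambda>s. mavg N js (\<lambda>t. c t * (F t * dualf N p js F t)) (t(j := s)))"
    by (simp add: c_def mult_ac)
  also have "\<dots> = avg N (\<lambda>s. c (t(j := s)) * mavg N js (\<lambda>t. F t * dualf N p js F t) (t(j := s)))"
    by (simp only: mavg_pull[where c = c, OF cc])
  also have "\<dots> = avg N (\<lambda>s. (1 / D powr (p j - 1)) * u s powr p j)"
  proof (rule avg_cong)
    fix w
    have "u w powr (p j - 1) * u w = u w powr p j"
      using u0[of w] by (cases "u w = 0") (auto simp: powr_diff)
    moreover have uw: "dnorm N p js F (t(j := w)) = u w" by (simp add: u_def)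
    ultimately show "c (t(j := w)) * mavg N js (\<lambda>t. F t * dualf N p js F t) (t(j := w)) = (1 / D powr (p j - 1)) * u w powr p j"
      using uw by (simp add: c' IH(1))
  qed
  also have "\<dots> = (1 / D powr (p j - 1)) * D powr p j"
    by (simp only: cexp_mult_left Dp)
  also have "\<dots> = D" using D0 p by (cases "D = 0") (auto simp: powr_diff)
  finally have 1: "mavg N (j # js) (\<lambda>t. F t * dualf N p (j # js) F t) t = D" .
  have q: "1 < conj_exp p j" "(p j - 1) * conj_exp p j = p j"
    using conj_exp(1)[of p j] conj_exp_mult[of p j] p by auto
  have "dnorm N (conj_exp p) js (dualf N p (j # js) F) (t(j := s)) powr conj_exp p j
    \<le> (1 / D powr p j) * u s powr p j" for s
  proof -
    have "dnorm N (conj_exp p) js (dualf N p (j # js) F) (t(j := s))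
      = dnorm N (conj_exp p) js (\<lambda>t. c t * dualf N p js F t) (t(j := s))"
    proof -
      have "dualf N p (j # js) F = (\<lambda>t. c t * dualf N p js F t)" by (rule ext) (simp add: c_def)
      then show ?thesis by (simp only:)
    qed
    also have "\<dots> = \<bar>c (t(j := s))\<bar> * dnorm N (conj_exp p) js (dualf N p js F) (t(j := s))"
      by (rule dnorm_pull) (use p0 cc in blast)+
    also have "\<dots> \<le> \<bar>c (t(j := s))\<bar> * 1" by (intro mult_left_mono IH) auto
    finally have "dnorm N (conj_exp p) js (dualf N p (j # js) F) (t(j := s)) powr conj_exp p j
      \<le> (u s powr (p j - 1) / D powr (p j - 1)) powr conj_exp p j"
      using q by (intro powr_mono2 dnorm_nonneg) (auto simp: c')
    then show ?thesis using q by (simp add: powr_divide powr_powr)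
  qed
  then have "avg N (\<lambda>s. dnorm N (conj_exp p) js (dualf N p (j # js) F) (t(j := s)) powr conj_exp p j)
    \<le> avg N (\<lambda>s. (1 / D powr p j) * u s powr p j)" by (intro avg_mono)
  also have "\<dots> = (1 / D powr p j) * D powr p j" by (simp only: cexp_mult_left Dp)
  also have "\<dots> \<le> 1" by simp
  finally have "dnorm N (conj_exp p) (j # js) (dualf N p (j # js) F) t \<le> 1 powr (1 / conj_exp p j)"
    unfolding dnorm.simps using q by (intro powr_mono2) (auto intro!: avg_nonneg)
  then have 2: "dnorm N (conj_exp p) (j # js) (dualf N p (j # js) F) t \<le> 1" by simp
  show ?case using 1 2 unfolding D_def by blast
qed

lemma dnorm_powr:
  assumes "\<And>j. j \<in> set js \<Longrightarrow> 0 < p j" "0 < r"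
  shows "dnorm N p js (\<lambda>t. \<bar>F t\<bar> powr (1 / r)) t = dnorm N (\<lambda>j. p j / r) js F t powr (1 / r)"
  using assms(1)
proof (induction js arbitrary: t)
  case (Cons j js)
  then have "0 < p j" by simp
  with Cons assms(2) show ?case by (simp add: powr_powr)
qed simp

lemma dnorm_power_sum:
  assumes p: "\<And>j. j \<in> set js \<Longrightarrow> r \<le> p j" and r: "1 \<le> r"
  shows "dnorm N p js (\<lambda>t. (\<Sum>i\<in>A. \<bar>F i t\<bar> powr r) powr (1 / r)) t \<le> (\<Sum>i\<in>A. dnorm N p js (F i) t powr r) powr (1 / r)"
proof -
  let ?q = "\<lambda>j. p j / r"
  have p0: "\<And>j. j \<in> set js \<Longrightarrow> 0 < p j" using p r by force
  have q1: "\<And>j. j \<in> set js \<Longrightarrow> 1 \<le> ?q j" using p r by (simp add: field_simps)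
  have s: "0 \<le> (\<Sum>i\<in>A. \<bar>F i t\<bar> powr r)" for t by (intro sum_nonneg) auto
  have F: "dnorm N ?q js (\<lambda>t. \<bar>F i t\<bar> powr r) t = dnorm N p js (F i) t powr r" for i
  proof -
    have "dnorm N p js (F i) t = dnorm N p js (\<lambda>t. \<bar>\<bar>F i t\<bar> powr r\<bar> powr (1 / r)) t"
      using r by (intro dnorm_cong) (simp add: powr_powr)
    also have "\<dots> = dnorm N ?q js (\<lambda>t. \<bar>F i t\<bar> powr r) t powr (1 / r)"
      by (rule dnorm_powr) (use p0 r in auto)
    finally show ?thesis using r dnorm_nonneg by (simp add: powr_powr)
  qed
  have "dnorm N p js (\<lambda>t. (\<Sum>i\<in>A. \<bar>F i t\<bar> powr r) powr (1 / r)) t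
    = dnorm N p js (\<lambda>t. \<bar>\<Sum>i\<in>A. \<bar>F i t\<bar> powr r\<bar> powr (1 / r)) t"
    using s by (intro dnorm_cong) (simp add: abs_of_nonneg)
  also have "\<dots> = dnorm N ?q js (\<lambda>t. \<Sum>i\<in>A. \<bar>F i t\<bar> powr r) t powr (1 / r)"
    by (rule dnorm_powr) (use p0 r in auto)
  also have "\<dots> \<le> (\<Sum>i\<in>A. dnorm N ?q js (\<lambda>t. \<bar>F i t\<bar> powr r) t) powr (1 / r)"
    using r by (intro powr_mono2 dnorm_sum q1 dnorm_nonneg) auto
  finally show ?thesis by (simp add: F)
qed

section \<open>Uniform bounds for sign transforms in one variable\<close>

definition sign_bound :: "(nat \<Rightarrow> real) \<Rightarrow> nat list \<Rightarrow> real \<Rightarrow> real \<Rightarrow> bool" where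
  "sign_bound p js r K \<longleftrightarrow> 0 \<le> K \<and> (\<forall>N t y \<epsilon>. (\<forall>u. \<bar>\<epsilon> u\<bar> = (1::real)) \<longrightarrow>
     avg N (\<lambda>s. dnorm N p js (fpoly (\<lambda>v. \<epsilon> v *\<^sub>R y v) s) t powr r)
       \<le> K * avg N (\<lambda>s. dnorm N p js (fpoly y s) t powr r))"

lemma sign_boundD:
  "sign_bound p js r K \<Longrightarrow> (\<forall>u. \<bar>\<epsilon> u\<bar> = (1::real)) \<Longrightarrow>
     avg N (\<lambda>s. dnorm N p js (fpoly (\<lambda>v. \<epsilon> v *\<^sub>R y v) s) t powr r)
       \<le> K * avg N (\<lambda>s. dnorm N p js (fpoly y s) t powr r)"
  unfolding sign_bound_def by blast

lemma sign_bound_extrapolate: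
  assumes p: "\<And>j. j \<in> set js \<Longrightarrow> 1 < p j" and b: "sign_bound p js q K" and r: "1 < r" "r < q"
  shows "sign_bound p js r (extrapolation_const K r q)"
proof -
  have K: "0 \<le> K" using b by (simp add: sign_bound_def)
  show ?thesis unfolding sign_bound_def
  proof (intro conjI allI impI)
    show "0 \<le> extrapolation_const K r q" using K unfolding extrapolation_const_def by simp
  next
    fix N t y and \<epsilon> :: "bool list \<Rightarrow> real"
    assume eps: "\<forall>u. \<bar>\<epsilon> u\<bar> = 1"
    have "seminorm (\<lambda>F. dnorm N p js F t)" using p by (intro seminorm_dnorm) (simp add: less_imp_le)
    then show "avg N (\<lambda>s. dnorm N p js (fpoly (\<lambda>v. \<epsilon> v *\<^sub>R y v) s) t powr r)
       \<le> extrapolation_const K r q * avg N (\<lambda>s. dnorm N p js (fpoly y s) t powr r)"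
      by (rule extrapolation[OF _ r K _ eps]) (rule sign_boundD[OF b])
  qed
qed

lemma sign_bound_dual:
  assumes p: "\<And>j. j \<in> set js \<Longrightarrow> 1 < p j" and r: "1 < r"
    and b: "sign_bound (conj_exp p) js (r / (r - 1)) K"
  shows "sign_bound p js r (duality_const K r)"
proof -
  have K: "0 \<le> K" using b by (simp add: sign_bound_def)
  show ?thesis unfolding sign_bound_def
  proof (intro conjI allI impI)
    show "0 \<le> duality_const K r" unfolding duality_const_def by simp
  next
    fix N t y and \<epsilon> :: "bool list \<Rightarrow> real"
    assume eps: "\<forall>u. \<bar>\<epsilon> u\<bar> = 1"
    have n: "seminorm (\<lambda>F. dnorm N p js F t)" using p by (intro seminorm_dnorm) (simp add: less_imp_le)
    have n': "seminorm (\<lambda>F. dnorm N (conj_exp p) js F t)"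
      using p conj_exp(1)[of p] by (intro seminorm_dnorm) (simp add: less_imp_le)
    show "avg N (\<lambda>s. dnorm N p js (fpoly (\<lambda>v. \<epsilon> v *\<^sub>R y v) s) t powr r)
       \<le> duality_const K r * avg N (\<lambda>s. dnorm N p js (fpoly y s) t powr r)"
    proof (rule duality[where \<beta> = "\<lambda>x z. mavg N js (\<lambda>t. x t * z t) t", OF _ _ _ _ n n' _ _ r refl K sign_boundD[OF b eps]])
      fix x z
      show "mavg N js (\<lambda>t. x t * z t) t \<le> dnorm N p js x t * dnorm N (conj_exp p) js z t"
        by (rule dnorm_Holder[OF p])
      show "\<exists>z. mavg N js (\<lambda>t. x t * z t) t = dnorm N p js x t \<and> dnorm N (conj_exp p) js z t \<le> 1"
        using dualf_norming[of js p N x t, OF p] by blast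
    qed (auto simp: algebra_simps mavg_add mavg_cmult scaleR_fun_def mavg_cmult[where F = "\<lambda>t. _ t * _ t", simplified mult.assoc])
  qed
qed

lemma sign_bound_all:
  assumes p: "\<And>j. j \<in> set js \<Longrightarrow> 1 < p j" and q: "1 < q"
    and b: "sign_bound p js q K" "sign_bound (conj_exp p) js (q / (q - 1)) K'" and r: "1 < r"
  shows "\<exists>K. sign_bound p js r K"
proof -
  consider "r < q" | "r = q" | "q < r" by linarith
  then show ?thesis
  proof cases
    case 1
    then show ?thesis using sign_bound_extrapolate[OF p b(1) r] by blast
  next
    case 2
    then show ?thesis using b by blast
  next
    case 3
    have "1 < r / (r - 1)" "r / (r - 1) < q / (q - 1)" using 3 q by (auto simp: field_simps)
    from sign_bound_extrapolate[OF _ b(2) this] conj_exp(1)[of p] p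
    have "sign_bound (conj_exp p) js (r / (r - 1)) (extrapolation_const K' (r / (r - 1)) (q / (q - 1)))" by blast
    from sign_bound_dual[OF p r this] show ?thesis by blast
  qed
qed

lemma sign_bound_base: "sign_bound p [] 2 1"
proof -
  have "avg N (\<lambda>s. dnorm N p [] (fpoly (\<lambda>v. \<epsilon> v *\<^sub>R y v) s) t powr 2) = avg N (\<lambda>s. dnorm N p [] (fpoly y s) t powr 2)"
    if "\<forall>u. \<bar>\<epsilon> u\<bar> = (1::real)" for N t y \<epsilon>
  proof -
    have sq: "\<bar>F\<bar> powr 2 = F * F" for F :: real
      by (cases "F = 0") (auto simp: powr_numeral power2_eq_square abs_mult_self_eq)
    have e: "\<epsilon> u * \<epsilon> u = 1" for u using that[rule_format, of u] by (metis abs_mult_self_eq mult_1)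
    have bl: "avg N (\<lambda>u. fpoly y u t * fpoly z u t) = (\<Sum>k<N. avg k (\<lambda>u. y u t * z u t))"
      for y z :: "bool list \<Rightarrow> (nat \<Rightarrow> bool list) \<Rightarrow> real"
      by (rule sign_transform_orthogonal[where \<beta> = "\<lambda>x z. x t * z t"]) (auto simp: algebra_simps)
    have ea: "(\<epsilon> u * a) * (\<epsilon> u * a) = a * a" for u a
    proof -
      have "(\<epsilon> u * a) * (\<epsilon> u * a) = (\<epsilon> u * \<epsilon> u) * (a * a)" by (simp only: mult_ac)
      then show ?thesis by (simp only: e mult_1)
    qed
    show ?thesis by (simp only: dnorm.simps sq bl scaleR_fun_apply real_scaleR_def ea)
  qed
  then show ?thesis unfolding sign_bound_def by auto
qed

text \<open>For \<open>r = p j\<close> the outer two integrations commute, so a bound for the values in the space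
  with one variable less suffices; all other \<open>r\<close> follow by extrapolation and duality.\<close>

lemma sign_bound_step:
  assumes p: "1 < p j" and b: "sign_bound p js (p j) K"
  shows "sign_bound p (j # js) (p j) K"
  unfolding sign_bound_def
proof (intro conjI allI impI)
  show "0 \<le> K" using b by (simp add: sign_bound_def)
next
  fix N t y and \<epsilon> :: "bool list \<Rightarrow> real"
  assume eps: "\<forall>u. \<bar>\<epsilon> u\<bar> = 1"
  have pw: "dnorm N p (j # js) F t powr p j = avg N (\<lambda>s. dnorm N p js F (t(j := s)) powr p j)" for F
    using p avg_nonneg[of N "\<lambda>s. dnorm N p js F (t(j := s)) powr p j"] by (simp add: powr_powr)
  have sw: "avg N (\<lambda>s. dnorm N p (j # js) (fpoly y s) t powr p j)
    = avg N (\<lambda>s'. avg N (\<lambda>s. dnorm N p js (fpoly y s) (t(j := s')) powr p j))" for y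
    unfolding pw by (rule cexp_swap)
  show "avg N (\<lambda>s. dnorm N p (j # js) (fpoly (\<lambda>v. \<epsilon> v *\<^sub>R y v) s) t powr p j)
    \<le> K * avg N (\<lambda>s. dnorm N p (j # js) (fpoly y s) t powr p j)"
    unfolding sw cexp_mult_left[symmetric] by (rule avg_mono) (use sign_boundD[OF b eps] in \<open>simp add: cexp_mult_left\<close>)
qed

text \<open>Induction on the list of variables. For the exponent \<open>p j\<close> of the outermost variable of the space
  of values the bound is inherited from the shorter list; every other exponent is reached
  from there by extrapolation downwards or by duality.\<close>

lemma sign_bound_exists:
  assumes "\<And>j. j \<in> set js \<Longrightarrow> 1 < p j" "1 < r"
  shows "\<exists>K. sign_bound p js r K"
  using assms
proof (induction js arbitrary: p r)
  case Nil
  have "2 / (2 - 1) = (2::real)" by simp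
  then show ?case using sign_bound_all[of "[]" p 2 1 1 r] sign_bound_base Nil by simp
next
  case (Cons j js)
  then have p: "1 < p j" by simp
  have q: "1 < conj_exp p i" if "i \<in> set (j # js)" for i using Cons.prems(1)[OF that] by (rule conj_exp)
  obtain K where K: "sign_bound p js (p j) K" using Cons.IH[of p "p j"] Cons.prems by auto
  obtain K' where K': "sign_bound (conj_exp p) js (conj_exp p j) K'"
    using Cons.IH[of "conj_exp p" "conj_exp p j"] q by auto
  have "sign_bound (conj_exp p) (j # js) (p j / (p j - 1)) K'"
    using sign_bound_step[of "conj_exp p" j js K'] q K' by (simp add: conj_exp_def[symmetric])
  then show ?case
    using sign_bound_all[OF Cons.prems(1) p sign_bound_step[where p = p, OF p K] _ Cons.prems(2)] by blast
qed

section \<open>The tensor Haar system on the discrete cube\<close>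

text \<open>The Haar function of the dyadic interval with digits \<open>u\<close> at a point with digits \<open>w\<close>: it is nonzero
  when \<open>u\<close> is a proper suffix of \<open>w\<close>, and the digit following \<open>u\<close> decides the sign.\<close>

primrec hw :: "bool list \<Rightarrow> bool list \<Rightarrow> real" where
  "hw u [] = 0"
| "hw u (b # w) = (if w = u then haar_sign b else hw u w)"

lemma hw_short: "length w \<le> length u \<Longrightarrow> hw u w = 0"
  by (induction w) auto

lemma hw_eq_fpoly: "hw u w = fpoly (\<lambda>v. of_bool (v = u)) w"
  by (induction w) (auto simp: hw_short)

lemma finite_short_lists: "finite {u::bool list. length u < N}"
  using finite_lists_length_le[of "UNIV :: bool set" N]
  by (rule finite_subset[rotated]) auto

lemma finite_length_lists: "finite {u::bool list. length u = N}"
  using finite_lists_length_eq[of "UNIV :: bool set" N] by simp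

lemma fpoly_eq_sum:
  "length w \<le> N \<Longrightarrow> fpoly y w = (\<Sum>u | length u < N. hw u w *\<^sub>R y u)"
proof (induction w)
  case (Cons b w)
  have "(\<Sum>u | length u < N. hw u (b # w) *\<^sub>R y u)
    = (\<Sum>u | length u < N. hw u w *\<^sub>R y u + (if u = w then haar_sign b *\<^sub>R y w else 0))"
    by (intro sum.cong) (auto simp: hw_short)
  also have "\<dots> = fpoly y w + haar_sign b *\<^sub>R y w"
    using Cons by (simp add: sum.distrib finite_short_lists)
  finally show ?case by simp
qed simp

lemma avg_hw_mult:
  "avg N (\<lambda>w. hw u w * hw v w) = (\<Sum>k<N. avg k (\<lambda>w. of_bool (w = u) * of_bool (w = v)))"
  unfolding hw_eq_fpoly
  by (rule sign_transform_orthogonal[where \<beta> = "(*)"]) (auto simp: algebra_simps)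

lemma avg_hw_orthogonal: "u \<noteq> v \<Longrightarrow> avg N (\<lambda>w. hw u w * hw v w) = 0"
proof -
  assume "u \<noteq> v"
  then have "(\<lambda>w. of_bool (w = u) * of_bool (w = v)) = (\<lambda>w. 0::real)" by auto
  then show ?thesis by (simp add: avg_hw_mult)
qed

lemma cexp_point:
  "length w = length u + n \<Longrightarrow> cexp n (\<lambda>v. of_bool (v = w)) u = (if drop n w = u then (1/2)^n else (0::real))"
proof (induction n arbitrary: u)
  case (Suc n)
  have n: "n < length w" using Suc.prems by simp
  have d: "drop n w = (w ! n) # drop (Suc n) w" using n by (simp add: Cons_nth_drop_Suc)
  show ?case using Suc.IH[of "True # u"] Suc.IH[of "False # u"] Suc.prems
    by (cases "w ! n") (auto simp: d)
qed simp

lemma avg_point: "avg k (\<lambda>w. of_bool (w = u)) = (if k = length u then (1/2)^k else (0::real))"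
proof (cases "k = length u")
  case True
  then show ?thesis using cexp_point[of u "[]" k] by simp
next
  case False
  then have "avg k (\<lambda>w. of_bool (w = u)) = avg k (\<lambda>w. 0::real)" by (intro avg_cong) auto
  then show ?thesis using False by simp
qed

lemma avg_hw_sq: "length u < N \<Longrightarrow> avg N (\<lambda>w. (hw u w)\<^sup>2) = (1/2)^length u"
proof -
  assume u: "length u < N"
  have "(\<lambda>w. of_bool (w = u) * of_bool (w = u)) = (\<lambda>w. of_bool (w = u) :: real)" by auto
  then have "avg N (\<lambda>w. (hw u w)\<^sup>2) = (\<Sum>k<N. if k = length u then (1/2)^k else 0)"
    by (simp add: power2_eq_square avg_hw_mult avg_point)
  also have "\<dots> = (1/2)^length u" using u by simp
  finally show ?thesis .
qed

lemma hw_sq: "(hw u w)\<^sup>2 = of_bool (\<exists>v. v \<noteq> [] \<and> w = v @ u)"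
proof (induction w)
  case (Cons b w)
  show ?case
  proof (cases "w = u")
    case True
    then have "\<exists>v. v \<noteq> [] \<and> b # w = v @ u" by (intro exI[of _ "[b]"]) simp
    then show ?thesis using True by (simp add: haar_sign_def)
  next
    case False
    have "(\<exists>v. v \<noteq> [] \<and> b # w = v @ u) \<longleftrightarrow> (\<exists>v. v \<noteq> [] \<and> w = v @ u)"
      using False by (metis append_Cons append_Nil append_eq_Cons_conv list.distinct(1))
    then show ?thesis using False Cons by simp
  qed
qed simp

text \<open>Rectangles are tuples of words shorter than \<open>N\<close>, the ones whose Haar functions depend on \<open>N\<close>
  digits only.\<close>

definition rects :: "nat list \<Rightarrow> nat \<Rightarrow> (nat \<Rightarrow> bool list) set" where
  "rects js N = (\<Pi>\<^sub>E j\<in>set js. {u. length u < N})"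

definition ht :: "nat list \<Rightarrow> (nat \<Rightarrow> bool list) \<Rightarrow> (nat \<Rightarrow> bool list) \<Rightarrow> real" where
  "ht js R t = (\<Prod>j\<in>set js. hw (R j) (t j))"

definition hpoly :: "nat list \<Rightarrow> nat \<Rightarrow> ((nat \<Rightarrow> bool list) \<Rightarrow> real) \<Rightarrow> (nat \<Rightarrow> bool list) \<Rightarrow> real" where
  "hpoly js N a t = (\<Sum>R\<in>rects js N. a R * ht js R t)"

definition sqf :: "nat list \<Rightarrow> nat \<Rightarrow> ((nat \<Rightarrow> bool list) \<Rightarrow> real) \<Rightarrow> (nat \<Rightarrow> bool list) \<Rightarrow> real" where
  "sqf js N a t = sqrt (\<Sum>R\<in>rects js N. (a R * ht js R t)\<^sup>2)"

lemma finite_rects: "finite (rects js N)"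
  unfolding rects_def by (intro finite_PiE finite_set finite_short_lists)

lemma sqf_nonneg: "0 \<le> sqf js N a t"
  unfolding sqf_def by (intro real_sqrt_ge_zero sum_nonneg) auto

lemma sum_fun_apply: "(\<Sum>i\<in>A. f i) t = (\<Sum>i\<in>A. f i t)"
  by (induction A rule: infinite_finite_induct) auto

section \<open>Changing signs in all variables\<close>

lemma dnorm_shift:
  "i \<notin> set js \<Longrightarrow> dnorm N p js (\<lambda>\<tau>. F (\<tau>(i := s))) t = dnorm N p js F (t(i := s))"
proof (induction js arbitrary: t)
  case (Cons j js)
  then have "(t(i := s))(j := x) = (t(j := x))(i := s)" for x by (auto simp: fun_upd_twist)
  then show ?case using Cons by (simp del: fun_upd_apply)
qed simp

lemma mavg_shift:
  "i \<notin> set js \<Longrightarrow> mavg N js (\<lambda>\<tau>. F (\<tau>(i := s))) t = mavg N js F (t(i := s))"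
proof (induction js arbitrary: t)
  case (Cons j js)
  then have "(t(i := s))(j := x) = (t(j := x))(i := s)" for x by (auto simp: fun_upd_twist)
  then show ?case using Cons by (simp del: fun_upd_apply)
qed simp

lemma hpoly_slice:
  assumes "i \<in> set js" "length s \<le> N"
  shows "hpoly js N a (\<tau>(i := s)) = fpoly (\<lambda>u \<tau>. \<Sum>R | R \<in> rects js N \<and> R i = u. a R * (\<Prod>j\<in>set js - {i}. hw (R j) (\<tau> j))) s \<tau>"
    (is "_ = fpoly ?y s \<tau>")
proof -
  have sub: "(\<lambda>R. R i) ` rects js N \<subseteq> {u. length u < N}"
    using assms(1) by (auto simp: rects_def PiE_def)
  have "fpoly ?y s \<tau> = (\<Sum>u | length u < N. hw u s * ?y u \<tau>)"
    using fpoly_eq_sum[OF assms(2), of ?y] by (simp add: sum_fun_apply)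
  also have "\<dots> = (\<Sum>u | length u < N. \<Sum>R | R \<in> rects js N \<and> R i = u. a R * ht js R (\<tau>(i := s)))"
  proof (intro sum.cong refl)
    fix u
    have "(\<Prod>j\<in>set js. hw (R j) ((\<tau>(i := s)) j)) = hw (R i) s * (\<Prod>j\<in>set js - {i}. hw (R j) (\<tau> j))" for R
      using assms(1) by (simp add: prod.remove[of "set js" i])
    then show "hw u s * ?y u \<tau> = (\<Sum>R | R \<in> rects js N \<and> R i = u. a R * ht js R (\<tau>(i := s)))"
      unfolding ht_def sum_distrib_left by (intro sum.cong) (auto simp: mult_ac)
  qed
  also have "\<dots> = hpoly js N a (\<tau>(i := s))"
    unfolding hpoly_def by (rule sum.group[OF finite_rects finite_short_lists sub])
  finally show ?thesis by simp
qed

lemma change_signs_one: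
  assumes js: "distinct js" "i \<in> set js" and p: "\<And>j. j \<in> set js \<Longrightarrow> 1 < p j"
  shows "\<exists>C\<ge>0. \<forall>N a t \<epsilon>. (\<forall>u. \<bar>\<epsilon> u\<bar> = (1::real)) \<longrightarrow>
    dnorm N p js (hpoly js N (\<lambda>R. \<epsilon> (R i) * a R)) t \<le> C * dnorm N p js (hpoly js N a) t"
proof -
  obtain os ns where split: "js = os @ i # ns" "i \<notin> set os" "i \<notin> set ns"
    using js split_list[of i js] by auto
  have pi: "1 < p i" using p js by auto
  obtain K where K: "sign_bound p ns (p i) K"
    using sign_bound_exists[of ns p "p i"] p split pi by auto
  then have K0: "0 \<le> K" by (simp add: sign_bound_def)
  have "dnorm N p js (hpoly js N (\<lambda>R. \<epsilon> (R i) * a R)) t \<le> K powr (1 / p i) * dnorm N p js (hpoly js N a) t"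
    if eps: "\<forall>u. \<bar>\<epsilon> u\<bar> = (1::real)" for N a t \<epsilon>
  proof -
    define y where "y = (\<lambda>u \<tau>. \<Sum>R | R \<in> rects js N \<and> R i = u. a R * (\<Prod>j\<in>set js - {i}. hw (R j) (\<tau> j)))"
    have slice: "dnorm N p ns (hpoly js N a) (t'(i := s)) = dnorm N p ns (fpoly y s) t'" if "length s = N" for t' s
      unfolding dnorm_shift[OF split(3), symmetric] y_def
      using that js by (intro dnorm_cong) (simp add: hpoly_slice del: fun_upd_apply)
    have y': "(\<lambda>u \<tau>. \<Sum>R | R \<in> rects js N \<and> R i = u. \<epsilon> (R i) * a R * (\<Prod>j\<in>set js - {i}. hw (R j) (\<tau> j)))
      = (\<lambda>u. \<epsilon> u *\<^sub>R y u)"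
      by (intro ext) (auto simp: y_def sum_distrib_left mult.assoc intro!: sum.cong)
    have slice': "dnorm N p ns (hpoly js N (\<lambda>R. \<epsilon> (R i) * a R)) (t'(i := s)) = dnorm N p ns (fpoly (\<lambda>u. \<epsilon> u *\<^sub>R y u) s) t'"
      if "length s = N" for t' s
      unfolding dnorm_shift[OF split(3), symmetric] y'[symmetric]
      using that js by (intro dnorm_cong) (simp add: hpoly_slice del: fun_upd_apply)
    have "dnorm N p (i # ns) (hpoly js N (\<lambda>R. \<epsilon> (R i) * a R)) t' \<le> K powr (1 / p i) * dnorm N p (i # ns) (hpoly js N a) t'" for t'
    proof -
      have "avg N (\<lambda>s. dnorm N p ns (hpoly js N (\<lambda>R. \<epsilon> (R i) * a R)) (t'(i := s)) powr p i)
        = avg N (\<lambda>s. dnorm N p ns (fpoly (\<lambda>u. \<epsilon> u *\<^sub>R y u) s) t' powr p i)"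
        by (intro avg_cong) (simp only: slice')
      also have "\<dots> \<le> K * avg N (\<lambda>s. dnorm N p ns (fpoly y s) t' powr p i)"
        by (rule sign_boundD[OF K eps])
      also have "avg N (\<lambda>s. dnorm N p ns (fpoly y s) t' powr p i) = avg N (\<lambda>s. dnorm N p ns (hpoly js N a) (t'(i := s)) powr p i)"
        by (intro avg_cong) (simp only: slice)
      finally have "dnorm N p (i # ns) (hpoly js N (\<lambda>R. \<epsilon> (R i) * a R)) t' \<le>
        (K * avg N (\<lambda>s. dnorm N p ns (hpoly js N a) (t'(i := s)) powr p i)) powr (1 / p i)"
        unfolding dnorm.simps using pi by (intro powr_mono2) (auto intro!: avg_nonneg simp del: fun_upd_apply)
      then show ?thesis by (simp add: powr_mult del: fun_upd_apply)
    qed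
    then show ?thesis unfolding split(1)
      by (intro dnorm_outer_mono) (use p split(1) in \<open>force+\<close>)
  qed
  then show ?thesis by (intro exI[of _ "K powr (1 / p i)"]) auto
qed

text \<open>One variable at a time: for fixed values of the other variables the polynomial is a Haar
  polynomial in one variable with vector-valued coefficients.\<close>

lemma change_signs:
  assumes js: "distinct js" and p: "\<And>j. j \<in> set js \<Longrightarrow> 1 < p j"
  shows "\<exists>C\<ge>0. \<forall>N a t \<epsilon>. (\<forall>i u. \<bar>\<epsilon> i u\<bar> = (1::real)) \<longrightarrow>
    dnorm N p js (hpoly js N (\<lambda>R. (\<Prod>i\<in>set js. \<epsilon> i (R i)) * a R)) t \<le> C * dnorm N p js (hpoly js N a) t"
proof -
  have "\<exists>C\<ge>0. \<forall>N a t \<epsilon>. (\<forall>i u. \<bar>\<epsilon> i u\<bar> = (1::real)) \<longrightarrow>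
    dnorm N p js (hpoly js N (\<lambda>R. (\<Prod>i\<in>I. \<epsilon> i (R i)) * a R)) t \<le> C * dnorm N p js (hpoly js N a) t"
    if "finite I" "I \<subseteq> set js" for I
    using that
  proof (induction I)
    case empty
    show ?case by (intro exI[of _ 1]) simp
  next
    case (insert i I)
    then obtain C where C: "0 \<le> C" "\<And>N a t \<epsilon>. (\<forall>i u. \<bar>\<epsilon> i u\<bar> = (1::real)) \<Longrightarrow>
      dnorm N p js (hpoly js N (\<lambda>R. (\<Prod>i\<in>I. \<epsilon> i (R i)) * a R)) t \<le> C * dnorm N p js (hpoly js N a) t"
      by blast
    obtain D where D: "0 \<le> D" "\<And>N a t \<epsilon>. (\<forall>u. \<bar>\<epsilon> u\<bar> = (1::real)) \<Longrightarrow>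
      dnorm N p js (hpoly js N (\<lambda>R. \<epsilon> (R i) * a R)) t \<le> D * dnorm N p js (hpoly js N a) t"
      using change_signs_one[OF js, of i p] p insert.prems by auto
    have "dnorm N p js (hpoly js N (\<lambda>R. (\<Prod>i\<in>insert i I. \<epsilon> i (R i)) * a R)) t \<le> (D * C) * dnorm N p js (hpoly js N a) t"
      if e: "\<forall>i u. \<bar>\<epsilon> i u\<bar> = (1::real)" for N a t \<epsilon>
    proof -
      have "dnorm N p js (hpoly js N (\<lambda>R. (\<Prod>i\<in>insert i I. \<epsilon> i (R i)) * a R)) t
        = dnorm N p js (hpoly js N (\<lambda>R. \<epsilon> i (R i) * ((\<Prod>i\<in>I. \<epsilon> i (R i)) * a R))) t"
        using insert.hyps by (simp add: mult.assoc)
      also have "\<dots> \<le> D * dnorm N p js (hpoly js N (\<lambda>R. (\<Prod>i\<in>I. \<epsilon> i (R i)) * a R)) t"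
        using e by (intro D) auto
      also have "\<dots> \<le> D * (C * dnorm N p js (hpoly js N a) t)"
        using e D(1) by (intro mult_left_mono C) auto
      finally show ?thesis by simp
    qed
    then show ?case using C D by (intro exI[of _ "D * C"]) auto
  qed
  from this[of "set js"] show ?thesis by simp
qed

section \<open>Khinchine's inequality for Rademacher chaos\<close>

definition sgnv :: "'i set \<Rightarrow> 'i \<Rightarrow> real" where
  "sgnv X i = (if i \<in> X then -1 else 1)"

text \<open>A polynomial in independent signs, one for each element of \<open>V\<close>; the sample point is the set of
  the elements whose sign is negative.\<close>

definition chaos :: "'i set \<Rightarrow> ('i set \<Rightarrow> real) \<Rightarrow> 'i set \<Rightarrow> real" where
  "chaos V c X = (\<Sum>S\<in>Pow V. c S * (\<Prod>i\<in>S. sgnv X i))"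

definition expect :: "'i set \<Rightarrow> ('i set \<Rightarrow> real) \<Rightarrow> real" where
  "expect V \<phi> = (\<Sum>X\<in>Pow V. \<phi> X) / 2 ^ card V"

lemma expect_mono: "(\<And>X. X \<subseteq> V \<Longrightarrow> \<phi> X \<le> \<psi> X) \<Longrightarrow> expect V \<phi> \<le> expect V \<psi>"
  unfolding expect_def by (intro divide_right_mono sum_mono) auto

lemma expect_cong: "(\<And>X. X \<subseteq> V \<Longrightarrow> \<phi> X = \<psi> X) \<Longrightarrow> expect V \<phi> = expect V \<psi>"
  unfolding expect_def by (intro arg_cong2[where f = "(/)"] sum.cong) auto

lemma expect_add: "expect V (\<lambda>X. \<phi> X + \<psi> X) = expect V \<phi> + expect V \<psi>"
  by (simp add: expect_def sum.distrib add_divide_distrib)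

lemma expect_cmult: "expect V (\<lambda>X. c * \<phi> X) = c * expect V \<phi>"
  by (simp add: expect_def sum_distrib_left)

lemma expect_nonneg: "(\<And>X. 0 \<le> \<phi> X) \<Longrightarrow> 0 \<le> expect V \<phi>"
  unfolding expect_def by (intro divide_nonneg_nonneg sum_nonneg) auto

lemma sum_Pow_insert:
  assumes "finite V" "v \<notin> V"
  shows "(\<Sum>X\<in>Pow (insert v V). f X) = (\<Sum>X\<in>Pow V. f X + f (insert v X))"
proof -
  have "(\<Sum>X\<in>Pow (insert v V). f X) = (\<Sum>X\<in>Pow V. f X) + (\<Sum>X\<in>insert v ` Pow V. f X)"
    unfolding Pow_insert using assms by (intro sum.union_disjoint) auto
  also have "(\<Sum>X\<in>insert v ` Pow V. f X) = (\<Sum>X\<in>Pow V. f (insert v X))"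
    using assms by (intro sum.reindex_cong[of "insert v"]) (auto intro!: inj_onI)
  finally show ?thesis by (simp add: sum.distrib)
qed

lemma expect_insert:
  assumes "finite V" "v \<notin> V"
  shows "expect (insert v V) \<phi> = expect V (\<lambda>X. (\<phi> X + \<phi> (insert v X)) / 2)"
  using assms by (simp add: expect_def sum_Pow_insert sum_divide_distrib[symmetric] field_simps)

lemma chaos_insert:
  assumes "finite V" "v \<notin> V" "X \<subseteq> V"
  shows "chaos (insert v V) c X = chaos V c X + chaos V (\<lambda>S. c (insert v S)) X"
    "chaos (insert v V) c (insert v X) = chaos V c X - chaos V (\<lambda>S. c (insert v S)) X"
proof -
  have 1: "(\<Prod>i\<in>insert v S. sgnv Y i) = sgnv Y v * (\<Prod>i\<in>S. sgnv Y i)" if "S \<in> Pow V" for S Y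
    using that assms by (subst prod.insert) (auto intro: finite_subset)
  have 2: "(\<Prod>i\<in>S. sgnv (insert v X) i) = (\<Prod>i\<in>S. sgnv X i)" if "S \<in> Pow V" for S
    using that assms by (intro prod.cong) (auto simp: sgnv_def)
  have 3: "sgnv X v = 1" "sgnv (insert v X) v = -1" using assms by (auto simp: sgnv_def)
  show "chaos (insert v V) c X = chaos V c X + chaos V (\<lambda>S. c (insert v S)) X"
    unfolding chaos_def sum_Pow_insert[OF assms(1,2)] sum.distrib[symmetric]
    by (intro sum.cong refl) (simp only: 1 3 mult_1)
  show "chaos (insert v V) c (insert v X) = chaos V c X - chaos V (\<lambda>S. c (insert v S)) X"
    unfolding chaos_def sum_Pow_insert[OF assms(1,2)] sum_subtractf[symmetric]
  proof (intro sum.cong refl)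
    fix S assume S: "S \<in> Pow V"
    show "c S * prod (sgnv (insert v X)) S + c (insert v S) * prod (sgnv (insert v X)) (insert v S)
      = c S * prod (sgnv X) S - c (insert v S) * prod (sgnv X) S"
      unfolding 1[OF S] 2[OF S] 3 by simp
  qed
qed

lemma expect_Cauchy_Schwarz: "(expect V (\<lambda>X. \<phi> X * \<psi> X))\<^sup>2 \<le> expect V (\<lambda>X. (\<phi> X)\<^sup>2) * expect V (\<lambda>X. (\<psi> X)\<^sup>2)"
  unfolding expect_def using Cauchy_Schwarz_ineq_sum[of \<phi> \<psi> "Pow V"]
  by (simp add: power_divide divide_right_mono power2_eq_square)

lemma chaos_L2: "finite V \<Longrightarrow> expect V (\<lambda>X. (chaos V c X)\<^sup>2) = (\<Sum>S\<in>Pow V. (c S)\<^sup>2)"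
proof (induction V arbitrary: c rule: finite_induct)
  case (insert v V)
  have "expect (insert v V) (\<lambda>X. (chaos (insert v V) c X)\<^sup>2)
    = expect V (\<lambda>X. (chaos V c X)\<^sup>2 + (chaos V (\<lambda>S. c (insert v S)) X)\<^sup>2)"
    by (subst expect_insert[OF insert.hyps], rule expect_cong)
       (simp add: chaos_insert[OF insert.hyps] power2_eq_square field_simps)
  then show ?case using insert by (simp add: expect_add sum_Pow_insert sum.distrib)
qed (simp add: expect_def chaos_def)

text \<open>Bonami's hypercontractive estimate, by induction on the number of variables.\<close>

lemma chaos_L4:
  assumes "finite V" "\<And>S. S \<subseteq> V \<Longrightarrow> c S \<noteq> 0 \<Longrightarrow> card S \<le> k"
  shows "expect V (\<lambda>X. (chaos V c X)^4) \<le> 9 ^ k * (expect V (\<lambda>X. (chaos V c X)\<^sup>2))\<^sup>2"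
  using assms
proof (induction V arbitrary: c k rule: finite_induct)
  case empty
  have "1 * ((c {})\<^sup>2)\<^sup>2 \<le> 9 ^ k * ((c {})\<^sup>2)\<^sup>2" by (intro mult_right_mono) auto
  then show ?case by (simp add: expect_def chaos_def flip: power_mult)
next
  case (insert v V)
  define G where "G = chaos V c"
  define H where "H = chaos V (\<lambda>S. c (insert v S))"
  define EG where "EG = expect V (\<lambda>X. (G X)\<^sup>2)"
  define EH where "EH = expect V (\<lambda>X. (H X)\<^sup>2)"
  have EGH: "0 \<le> EG" "0 \<le> EH" unfolding EG_def EH_def by (auto intro!: expect_nonneg)
  have e2: "expect (insert v V) (\<lambda>X. (chaos (insert v V) c X)\<^sup>2) = EG + EH"
  proof -
    have "expect (insert v V) (\<lambda>X. (chaos (insert v V) c X)\<^sup>2) = expect V (\<lambda>X. (G X)\<^sup>2 + (H X)\<^sup>2)"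
      unfolding G_def H_def
      by (subst expect_insert[OF insert.hyps], rule expect_cong)
         (simp add: chaos_insert[OF insert.hyps] power2_eq_square field_simps)
    then show ?thesis by (simp add: expect_add EG_def EH_def)
  qed
  have e4: "expect (insert v V) (\<lambda>X. (chaos (insert v V) c X)^4)
    = expect V (\<lambda>X. (G X)^4) + 6 * expect V (\<lambda>X. (G X)\<^sup>2 * (H X)\<^sup>2) + expect V (\<lambda>X. (H X)^4)"
  proof -
    have *: "((g + h)^4 + (g - h)^4) / 2 = g^4 + 6 * (g\<^sup>2 * h\<^sup>2) + h^4" for g h :: real
      by (simp add: power4_eq_xxxx power2_eq_square field_simps)
    have "expect (insert v V) (\<lambda>X. (chaos (insert v V) c X)^4)
      = expect V (\<lambda>X. (G X)^4 + 6 * ((G X)\<^sup>2 * (H X)\<^sup>2) + (H X)^4)"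
      unfolding G_def H_def
      unfolding expect_insert[OF insert.hyps]
    proof (rule expect_cong)
      fix X assume X: "X \<subseteq> V"
      show "(chaos (insert v V) c X ^ 4 + chaos (insert v V) c (insert v X) ^ 4) / 2 =
        chaos V c X ^ 4 + 6 * ((chaos V c X)\<^sup>2 * (chaos V (\<lambda>S. c (insert v S)) X)\<^sup>2) + chaos V (\<lambda>S. c (insert v S)) X ^ 4"
        unfolding chaos_insert[OF insert.hyps X] by (rule *)
    qed
    then show ?thesis by (simp only: expect_add expect_cmult)
  qed
  have G4: "expect V (\<lambda>X. (G X)^4) \<le> 9 ^ k * EG\<^sup>2"
    unfolding G_def EG_def by (rule insert.IH, rule insert.prems) auto
  show ?case
  proof (cases k)
    case 0
    have "c (insert v S) = 0" if "S \<subseteq> V" for S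
    proof (rule ccontr)
      assume "c (insert v S) \<noteq> 0"
      then have "card (insert v S) \<le> k" by (rule insert.prems[rotated]) (use that in blast)
      then have "card (insert v S) = 0" using 0 by simp
      then show False using finite_subset[OF that insert.hyps(1)] by simp
    qed
    then have H0: "H = (\<lambda>X. 0)" unfolding H_def chaos_def by (intro ext sum.neutral) auto
    have z: "expect V (\<lambda>X. 0) = 0" by (simp add: expect_def)
    have "EH = 0" "expect V (\<lambda>X. (G X)\<^sup>2 * (H X)\<^sup>2) = 0" "expect V (\<lambda>X. (H X)^4) = 0"
      by (simp_all add: EH_def H0 z)
    then show ?thesis unfolding e2 e4 using G4 by simp
  next
    case (Suc l)
    have H4: "expect V (\<lambda>X. (H X)^4) \<le> 9 ^ l * EH\<^sup>2"
      unfolding H_def EH_def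
    proof (rule insert.IH)
      fix S assume S: "S \<subseteq> V" "c (insert v S) \<noteq> 0"
      then have "card (insert v S) \<le> k" by (intro insert.prems) auto
      moreover have "card (insert v S) = Suc (card S)"
      proof (rule card_insert_disjoint)
        show "finite S" by (rule finite_subset[OF S(1) insert.hyps(1)])
        show "v \<notin> S" using S(1) insert.hyps(2) by blast
      qed
      ultimately show "card S \<le> l" using Suc by simp
    qed
    have "(expect V (\<lambda>X. (G X)\<^sup>2 * (H X)\<^sup>2))\<^sup>2 \<le> expect V (\<lambda>X. ((G X)\<^sup>2)\<^sup>2) * expect V (\<lambda>X. ((H X)\<^sup>2)\<^sup>2)"
      by (rule expect_Cauchy_Schwarz)
    also have "\<dots> = expect V (\<lambda>X. (G X)^4) * expect V (\<lambda>X. (H X)^4)"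
    proof -
      have "(x\<^sup>2)\<^sup>2 = x^4" for x :: real by (simp add: power2_eq_square power4_eq_xxxx)
      then show ?thesis by (simp only:)
    qed
    also have "\<dots> \<le> (9 ^ k * EG\<^sup>2) * (9 ^ l * EH\<^sup>2)"
      using G4 H4 by (intro mult_mono) (auto intro!: expect_nonneg)
    also have "\<dots> = (3 * 9 ^ l * (EG * EH))\<^sup>2"
    proof -
      have "(9 * x * EG\<^sup>2) * (x * EH\<^sup>2) = (3 * x * (EG * EH))\<^sup>2" for x by algebra
      then show ?thesis unfolding Suc power_Suc .
    qed
    finally have "expect V (\<lambda>X. (G X)\<^sup>2 * (H X)\<^sup>2) \<le> 3 * 9 ^ l * (EG * EH)"
      by (rule power2_le_imp_le) (use EGH in auto)
    then have "expect (insert v V) (\<lambda>X. (chaos (insert v V) c X)^4) \<le> 9 ^ k * EG\<^sup>2 + 6 * (3 * 9 ^ l * (EG * EH)) + 9 ^ l * EH\<^sup>2"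
      unfolding e4 using G4 H4 by linarith
    also have "\<dots> \<le> 9 ^ k * EG\<^sup>2 + 6 * (3 * 9 ^ l * (EG * EH)) + 9 ^ k * EH\<^sup>2"
      using Suc EGH by (intro add_mono mult_right_mono) auto
    also have "\<dots> = 9 ^ k * (EG + EH)\<^sup>2"
    proof -
      have "9 * x * EG\<^sup>2 + 6 * (3 * x * (EG * EH)) + 9 * x * EH\<^sup>2 = 9 * x * (EG + EH)\<^sup>2" for x by algebra
      then show ?thesis unfolding Suc power_Suc .
    qed
    finally show ?thesis unfolding e2 .
  qed
qed

text \<open>The elementary bound \<open>(3 x\<^sup>2 - x\<^sup>4) / 2 \<le> \<bar>x\<bar>\<close> turns the fourth moment into a lower bound for the first.\<close>

lemma chaos_L1:
  assumes V: "finite V" and c: "\<And>S. S \<subseteq> V \<Longrightarrow> c S \<noteq> 0 \<Longrightarrow> card S \<le> k"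
  shows "sqrt (\<Sum>S\<in>Pow V. (c S)\<^sup>2) \<le> 3 ^ k * expect V (\<lambda>X. \<bar>chaos V c X\<bar>)"
proof -
  define E where "E = (\<Sum>S\<in>Pow V. (c S)\<^sup>2)"
  define \<tau> where "\<tau> = 3 ^ k * sqrt E"
  have E0: "0 \<le> E" unfolding E_def by (intro sum_nonneg) auto
  show ?thesis
  proof (cases "E = 0")
    case True
    then show ?thesis by (auto simp: E_def[symmetric] intro!: mult_nonneg_nonneg expect_nonneg)
  next
    case False
    then have E: "0 < E" using E0 by simp
    then have t: "0 < \<tau>" by (simp add: \<tau>_def)
    have t2: "\<tau>\<^sup>2 = 9 ^ k * E"
    proof -
      have "(3 ^ k)\<^sup>2 = (9::real) ^ k" by (simp add: power2_eq_square flip: power_mult_distrib)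
      then show ?thesis using E by (simp add: \<tau>_def power_mult_distrib)
    qed
    have pw: "\<bar>x\<bar> \<ge> 3 / 2 * (1 / \<tau>) * x\<^sup>2 - 1 / 2 * (1 / \<tau>^3) * x^4" for x
    proof -
      define z where "z = \<bar>x\<bar> / \<tau>"
      have z0: "0 \<le> z" using t by (simp add: z_def)
      have "0 \<le> (z - 1)\<^sup>2 * (z + 2)" using z0 by simp
      then have "0 \<le> z * ((z - 1)\<^sup>2 * (z + 2))" using z0 by (rule mult_nonneg_nonneg[rotated])
      then have "3 * z\<^sup>2 - z^4 \<le> 2 * z"
        by (simp add: power2_eq_square power4_eq_xxxx algebra_simps)
      then have "\<tau> * (3 * z\<^sup>2 - z^4) \<le> \<tau> * (2 * z)" using t by simp
      moreover have "\<tau> * z = \<bar>x\<bar>" using t by (simp add: z_def)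
      moreover have "\<tau> * z\<^sup>2 = 1 / \<tau> * x\<^sup>2" using t by (simp add: z_def power2_eq_square)
      moreover have "\<tau> * z^4 = 1 / \<tau>^3 * x^4" using t by (simp add: z_def power4_eq_xxxx power3_eq_cube power_divide)
      ultimately show ?thesis by (simp add: algebra_simps)
    qed
    have "3 / 2 * (1 / \<tau>) * E - 1 / 2 * (1 / \<tau>^3) * (9 ^ k * E\<^sup>2) \<le>
      3 / 2 * (1 / \<tau>) * expect V (\<lambda>X. (chaos V c X)\<^sup>2) + (- (1 / 2 * (1 / \<tau>^3))) * expect V (\<lambda>X. (chaos V c X)^4)"
    proof -
      have e2: "expect V (\<lambda>X. (chaos V c X)\<^sup>2) = E"
        unfolding E_def by (rule chaos_L2[OF V])
      have "expect V (\<lambda>X. (chaos V c X)^4) \<le> 9 ^ k * E\<^sup>2"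
        unfolding e2[symmetric] using V c by (rule chaos_L4)
      then have "1 / 2 * (1 / \<tau>^3) * expect V (\<lambda>X. (chaos V c X)^4) \<le> 1 / 2 * (1 / \<tau>^3) * (9 ^ k * E\<^sup>2)"
        by (rule mult_left_mono) (use t in simp)
      then show ?thesis unfolding e2 by linarith
    qed
    also have "\<dots> = expect V (\<lambda>X. 3 / 2 * (1 / \<tau>) * (chaos V c X)\<^sup>2 + (- (1 / 2 * (1 / \<tau>^3))) * (chaos V c X)^4)"
      by (simp only: expect_add expect_cmult)
    also have "\<dots> \<le> expect V (\<lambda>X. \<bar>chaos V c X\<bar>)"
      using pw by (intro expect_mono) simp
    also have "3 / 2 * (1 / \<tau>) * E - 1 / 2 * (1 / \<tau>^3) * (9 ^ k * E\<^sup>2) = E / \<tau>"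
    proof -
      have "9 ^ k * E\<^sup>2 = \<tau>\<^sup>2 * E" unfolding t2 by (simp add: power2_eq_square)
      moreover have "1 / \<tau>^3 * (\<tau>\<^sup>2 * E) = E / \<tau>" using t by (simp add: power2_eq_square power3_eq_cube)
      ultimately have "1 / \<tau>^3 * (9 ^ k * E\<^sup>2) = E / \<tau>" by (simp only:)
      then show ?thesis by simp
    qed
    finally have "E / \<tau> \<le> expect V (\<lambda>X. \<bar>chaos V c X\<bar>)" .
    moreover have "E / \<tau> = sqrt E / 3 ^ k" using E by (simp add: \<tau>_def real_div_sqrt field_simps)
    ultimately show ?thesis by (simp add: E_def[symmetric] field_simps)
  qed
qed

section \<open>The square function\<close>

lemma rects_inj:
  assumes "R \<in> rects js N" "R' \<in> rects js N" "(\<lambda>j. (j, R j)) ` set js = (\<lambda>j. (j, R' j)) ` set js"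
  shows "R = R'"
proof (rule PiE_ext)
  show "R \<in> Pi\<^sub>E (set js) (\<lambda>_. {u. length u < N})" "R' \<in> Pi\<^sub>E (set js) (\<lambda>_. {u. length u < N})"
    using assms by (auto simp: rects_def)
  fix j assume "j \<in> set js"
  then have "(j, R j) \<in> (\<lambda>j. (j, R' j)) ` set js" using assms(3) by blast
  then show "R j = R' j" by auto
qed

definition chaos_signs :: "(nat \<times> bool list) set \<Rightarrow> nat \<Rightarrow> bool list \<Rightarrow> real" where
  "chaos_signs X j u = sgnv X (j, u)"

lemma sqf_le_expect:
  fixes N js
  defines "V \<equiv> set js \<times> {u. length u < N}"
  shows "sqf js N a t \<le> 3 ^ card (set js) *
    expect V (\<lambda>X. \<bar>hpoly js N (\<lambda>R. (\<Prod>j\<in>set js. chaos_signs X j (R j)) * a R) t\<bar>)"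
proof -
  define gr where "gr = (\<lambda>R. (\<lambda>j. (j, R j)) ` set js :: (nat \<times> bool list) set)"
  have V: "finite V" unfolding V_def by (intro finite_cartesian_product finite_set finite_short_lists)
  have inj: "inj_on gr (rects js N)" by (rule inj_onI) (auto simp: gr_def intro: rects_inj)
  have sub: "gr ` rects js N \<subseteq> Pow V" by (auto simp: gr_def V_def rects_def PiE_def)
  define c where "c = (\<lambda>S. if S \<in> gr ` rects js N then (let R = the_inv_into (rects js N) gr S in a R * ht js R t) else 0)"
  have c_gr: "c (gr R) = a R * ht js R t" if "R \<in> rects js N" for R
    using that by (simp add: c_def the_inv_into_f_f[OF inj])
  have c0: "c S = 0" if "S \<in> Pow V - gr ` rects js N" for S using that by (simp add: c_def)
  have prod: "(\<Prod>i\<in>gr R. sgnv X i) = (\<Prod>j\<in>set js. chaos_signs X j (R j))" for X R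
    unfolding gr_def by (subst prod.reindex) (auto intro!: inj_onI simp: chaos_signs_def)
  have card: "card S \<le> card (set js)" if "c S \<noteq> 0" for S
  proof -
    have "S \<in> gr ` rects js N" using that by (auto simp: c_def split: if_splits)
    then show ?thesis by (auto simp: gr_def intro: card_image_le)
  qed
  have "(\<Sum>S\<in>Pow V. (c S)\<^sup>2) = (\<Sum>S\<in>gr ` rects js N. (c S)\<^sup>2)"
    by (rule sum.mono_neutral_right) (use V sub c0 in auto)
  also have "\<dots> = (\<Sum>R\<in>rects js N. (a R * ht js R t)\<^sup>2)"
    by (subst sum.reindex[OF inj]) (simp add: c_gr)
  finally have sq: "sqf js N a t = sqrt (\<Sum>S\<in>Pow V. (c S)\<^sup>2)" by (simp add: sqf_def)
  have ch: "chaos V c X = hpoly js N (\<lambda>R. (\<Prod>j\<in>set js. chaos_signs X j (R j)) * a R) t" for X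
  proof -
    have "chaos V c X = (\<Sum>S\<in>gr ` rects js N. c S * (\<Prod>i\<in>S. sgnv X i))"
      unfolding chaos_def by (rule sum.mono_neutral_right) (use V sub c0 in auto)
    also have "\<dots> = (\<Sum>R\<in>rects js N. a R * ht js R t * (\<Prod>j\<in>set js. chaos_signs X j (R j)))"
      by (subst sum.reindex[OF inj]) (simp add: c_gr prod)
    finally show ?thesis by (simp add: hpoly_def mult_ac)
  qed
  show ?thesis
    unfolding sq ch[symmetric] by (rule chaos_L1[OF V card])
qed

text \<open>For independent signs \<open>\<epsilon>\<close> attached to the pairs (variable, interval) the products of the signs of the
  sides of a rectangle form an orthonormal system of polynomials of degree \<open>length js\<close>. By Khinchine's
  inequality for such polynomials the square function is at most a constant times the mean of
  the moduli of the transformed polynomials; the triangle inequality takes the mean out of the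
  norm, where each transform is bounded.\<close>

lemma square_function_upper:
  assumes js: "distinct js" and p: "\<And>j. j \<in> set js \<Longrightarrow> 1 < p j"
  shows "\<exists>C\<ge>0. \<forall>N a t. dnorm N p js (sqf js N a) t \<le> C * dnorm N p js (hpoly js N a) t"
proof -
  have "\<exists>C\<ge>0. \<forall>N a t \<epsilon>. (\<forall>i u. \<bar>\<epsilon> i u\<bar> = (1::real)) \<longrightarrow>
    dnorm N p js (hpoly js N (\<lambda>R. (\<Prod>i\<in>set js. \<epsilon> i (R i)) * a R)) t \<le> C * dnorm N p js (hpoly js N a) t"
    using js p by (rule change_signs)
  then obtain C where C: "0 \<le> C" "\<forall>N a t \<epsilon>. (\<forall>i u. \<bar>\<epsilon> i u\<bar> = (1::real)) \<longrightarrow>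
    dnorm N p js (hpoly js N (\<lambda>R. (\<Prod>i\<in>set js. \<epsilon> i (R i)) * a R)) t \<le> C * dnorm N p js (hpoly js N a) t"
    by (elim exE conjE) (rule that)
  have p0: "0 < p j" and p1: "1 \<le> p j" if "j \<in> set js" for j using p[OF that] by auto
  define D where "D = 3 ^ card (set js) * C"
  have "dnorm N p js (sqf js N a) t \<le> D * dnorm N p js (hpoly js N a) t" for N a t
  proof -
    define V where "V = set js \<times> {u::bool list. length u < N}"
    have finV: "finite V" unfolding V_def by (intro finite_cartesian_product finite_set finite_short_lists)
    define F where "F = (\<lambda>X t. \<bar>hpoly js N (\<lambda>R. (\<Prod>j\<in>set js. chaos_signs X j (R j)) * a R) t\<bar>)"
    have sg: "\<forall>i u. \<bar>chaos_signs X i u\<bar> = 1" for X by (simp add: chaos_signs_def sgnv_def)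
    have "dnorm N p js (sqf js N a) t \<le> dnorm N p js (\<lambda>t. (3 ^ card (set js) / 2 ^ card V) * (\<Sum>X\<in>Pow V. F X t)) t"
    proof (rule dnorm_mono)
      fix t'
      have "sqf js N a t' \<le> 3 ^ card (set js) * expect V (\<lambda>X. F X t')"
        unfolding V_def F_def by (rule sqf_le_expect)
      moreover have "0 \<le> (\<Sum>X\<in>Pow V. F X t')" unfolding F_def by (intro sum_nonneg abs_ge_zero)
      ultimately show "\<bar>sqf js N a t'\<bar> \<le> \<bar>(3 ^ card (set js) / 2 ^ card V) * (\<Sum>X\<in>Pow V. F X t')\<bar>"
        using sqf_nonneg[of js N a t'] by (simp add: expect_def)
    qed (rule p0)
    also have "\<dots> = (3 ^ card (set js) / 2 ^ card V) * dnorm N p js (\<lambda>t. \<Sum>X\<in>Pow V. F X t) t"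
      by (subst dnorm_scale[OF p0]) auto
    also have "\<dots> \<le> (3 ^ card (set js) / 2 ^ card V) * (\<Sum>X\<in>Pow V. dnorm N p js (F X) t)"
      by (intro mult_left_mono dnorm_sum p1) auto
    also have "\<dots> \<le> (3 ^ card (set js) / 2 ^ card V) * (\<Sum>X\<in>Pow V. C * dnorm N p js (hpoly js N a) t)"
    proof (intro mult_left_mono sum_mono)
      fix X
      have "dnorm N p js (F X) t = dnorm N p js (hpoly js N (\<lambda>R. (\<Prod>j\<in>set js. chaos_signs X j (R j)) * a R)) t"
        unfolding F_def by (intro dnorm_cong abs_idempotent)
      also have "\<dots> \<le> C * dnorm N p js (hpoly js N a) t" by (rule C(2)[rule_format, OF sg[rule_format]])
      finally show "dnorm N p js (F X) t \<le> C * dnorm N p js (hpoly js N a) t" .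
    qed auto
    also have "\<dots> = D * dnorm N p js (hpoly js N a) t"
      using finV by (simp add: D_def card_Pow)
    finally show ?thesis .
  qed
  then show ?thesis using C(1) by (intro exI[of _ D]) (auto simp: D_def)
qed

section \<open>Projection onto the span of the tensor Haar system\<close>

lemma mavg_avg: "mavg N js (\<lambda>\<tau>. avg M (\<lambda>s. G s \<tau>)) t = avg M (\<lambda>s. mavg N js (G s) t)"
proof (induction js arbitrary: t)
  case (Cons j js)
  show ?case unfolding mavg.simps Cons.IH by (rule cexp_swap)
qed simp

lemma avg_slice_mavg:
  "distinct js \<Longrightarrow> j \<in> set js \<Longrightarrow> mavg N js (\<lambda>\<tau>. avg N (\<lambda>s. K (\<tau>(j := s)))) t = mavg N js K t"
proof (induction js arbitrary: t)
  case (Cons i js)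
  show ?case
  proof (cases "i = j")
    case True
    then have j: "j \<notin> set js" using Cons.prems by auto
    have "mavg N (i # js) (\<lambda>\<tau>. avg N (\<lambda>s. K (\<tau>(j := s)))) t = avg N (\<lambda>s. avg N (\<lambda>s'. mavg N js K ((t(j := s'))(j := s))))"
      unfolding mavg.simps mavg_avg mavg_shift[OF j] True ..
    also have "\<dots> = avg N (\<lambda>s. mavg N js K (t(j := s)))" by (simp del: fun_upd_apply)
    finally show ?thesis unfolding True mavg.simps(2)[of N j js K t] .
  next
    case False
    then show ?thesis using Cons by (simp del: fun_upd_apply)
  qed
qed simp

lemma dnorm_avg_slice:
  assumes js: "distinct js" "j \<in> set js" and p: "\<And>j. j \<in> set js \<Longrightarrow> 1 < p j"
  shows "dnorm N p js (\<lambda>\<tau>. avg N (\<lambda>s. G (\<tau>(j := s)))) t \<le> dnorm N p js G t"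
proof -
  obtain os ns where split: "js = os @ j # ns" "j \<notin> set os" "j \<notin> set ns"
    using js split_list[of j js] by auto
  have pj: "1 < p j" using p[of j] js by simp
  have pn: "1 \<le> p i" if "i \<in> set ns" for i using p[of i] that split(1) by simp
  have po: "0 < p i" if "i \<in> set os" for i using p[of i] that split(1) by simp
  define AG where "AG = (\<lambda>\<tau>. avg N (\<lambda>s. G (\<tau>(j := s))))"
  have "dnorm N p (j # ns) AG t' \<le> 1 * dnorm N p (j # ns) G t'" for t'
  proof -
    define u where "u = (\<lambda>s. dnorm N p ns G (t'(j := s)))"
    have u0: "0 \<le> u s" for s unfolding u_def by (rule dnorm_nonneg)
    have b: "dnorm N p ns AG (t'(j := s')) \<le> avg N u" for s'
    proof -
      have "dnorm N p ns AG (t'(j := s')) = dnorm N p ns (\<lambda>\<tau>. AG (\<tau>(j := s'))) t'"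
        by (rule dnorm_shift[OF split(3), symmetric])
      also have "\<dots> = dnorm N p ns (avg N (\<lambda>s \<tau>. G (\<tau>(j := s)))) t'"
        by (rule dnorm_cong) (simp add: AG_def cexp_fun del: fun_upd_apply)
      also have "\<dots> \<le> avg N (\<lambda>s. dnorm N p ns (\<lambda>\<tau>. G (\<tau>(j := s))) t')"
        by (rule seminorm_cexp[OF seminorm_dnorm[OF pn]])
      also have "\<dots> = avg N u" unfolding u_def dnorm_shift[OF split(3)] ..
      finally show ?thesis .
    qed
    have "avg N (\<lambda>s. dnorm N p ns AG (t'(j := s)) powr p j) \<le> avg N (\<lambda>s. avg N u powr p j)"
      using pj by (intro avg_mono powr_mono2 b dnorm_nonneg) auto
    then have "dnorm N p (j # ns) AG t' \<le> (avg N u powr p j) powr (1 / p j)"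
      unfolding dnorm.simps using pj by (intro powr_mono2) (auto intro!: avg_nonneg)
    also have "\<dots> = avg N (\<lambda>s. u s * 1)" using pj u0 by (simp add: powr_powr avg_nonneg)
    also have "\<dots> \<le> avg N (\<lambda>s. u s powr p j) powr (1 / p j) * avg N (\<lambda>s. 1 powr conj_exp p j) powr (1 / conj_exp p j)"
      by (intro avg_Holder pj conj_exp u0) auto
    also have "\<dots> = 1 * dnorm N p (j # ns) G t'" by (simp add: u_def)
    finally show ?thesis .
  qed
  then have "dnorm N p (os @ j # ns) AG t \<le> 1 * dnorm N p (os @ j # ns) G t"
    by (intro dnorm_outer_mono po) auto
  then show ?thesis by (simp add: split(1) AG_def)
qed

lemma haar_coefficients: "\<exists>Z. \<forall>(\<phi> :: bool list \<Rightarrow> 'b::real_vector) u. length u = N \<longrightarrow> \<phi> u = avg N \<phi> + fpoly (Z \<phi>) u"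
proof -
  have "\<exists>z. \<forall>u. length u = N \<longrightarrow> \<phi> u = avg N \<phi> + fpoly z u" for \<phi> :: "bool list \<Rightarrow> 'b"
    using haar_expansion[of N \<phi>] by metis
  then show ?thesis by metis
qed

lemma avg_slice_hpoly:
  assumes "j \<in> set js" shows "avg N (\<lambda>s. hpoly js N a (t(j := s))) = 0"
proof -
  have "avg N (\<lambda>s. hpoly js N a (t(j := s))) =
    avg N (\<lambda>s. fpoly (\<lambda>u. \<Sum>R | R \<in> rects js N \<and> R j = u. a R * (\<Prod>i\<in>set js - {j}. hw (R i) (t i))) s)"
  proof (rule avg_cong)
    fix s :: "bool list" assume s: "length s = N"
    have ff: "fpoly y s t = fpoly (\<lambda>u. y u t) s" for y :: "bool list \<Rightarrow> (nat \<Rightarrow> bool list) \<Rightarrow> real"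
      by (induction s) auto
    show "hpoly js N a (t(j := s)) =
      fpoly (\<lambda>u. \<Sum>R | R \<in> rects js N \<and> R j = u. a R * (\<Prod>i\<in>set js - {j}. hw (R i) (t i))) s"
      unfolding hpoly_slice[OF assms eq_imp_le[OF s]] ff ..
  qed
  then show ?thesis by (simp add: cexp_fpoly del: fun_upd_apply)
qed

text \<open>Subtracting the averages over the variables one at a time produces a combination of Haar
  products; against functions without averages this changes nothing.\<close>

lemma projection_exists:
  assumes js: "distinct js" and p: "\<And>j. j \<in> set js \<Longrightarrow> 1 < p j"
  shows "\<exists>b. dnorm N p js (hpoly js N b) t \<le> 2 ^ length js * dnorm N p js G t \<and>
    (\<forall>a. mavg N js (\<lambda>\<tau>. hpoly js N a \<tau> * hpoly js N b \<tau>) t = mavg N js (\<lambda>\<tau>. hpoly js N a \<tau> * G \<tau>) t) \<and>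
    ((\<forall>j\<in>set js. \<forall>\<tau>\<in>pts N js t. avg N (\<lambda>s. G (\<tau>(j := s))) = 0) \<longrightarrow>
      (\<forall>\<tau>\<in>pts N js t. hpoly js N b \<tau> = G \<tau>))"
proof -
  obtain Z :: "(bool list \<Rightarrow> real) \<Rightarrow> bool list \<Rightarrow> real"
    where Z: "\<And>\<phi> u. length u = N \<Longrightarrow> \<phi> u = avg N \<phi> + fpoly (Z \<phi>) u"
    using haar_coefficients[of N] by metis
  have p1: "1 \<le> p j" if "j \<in> set js" for j using p[OF that] by simp
  have "\<exists>G' c. dnorm N p js G' t \<le> 2 ^ card I * dnorm N p js G t \<and>
      (\<forall>a. mavg N js (\<lambda>\<tau>. hpoly js N a \<tau> * G' \<tau>) t = mavg N js (\<lambda>\<tau>. hpoly js N a \<tau> * G \<tau>) t) \<and>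
      ((\<forall>j\<in>set js. \<forall>\<tau>\<in>pts N js t. avg N (\<lambda>s. G (\<tau>(j := s))) = 0) \<longrightarrow> (\<forall>\<tau>\<in>pts N js t. G' \<tau> = G \<tau>)) \<and>
      (\<forall>\<tau>. (\<forall>j\<in>I. length (\<tau> j) = N) \<longrightarrow>
         G' \<tau> = (\<Sum>R\<in>(\<Pi>\<^sub>E j\<in>I. {u. length u < N}). c R \<tau> * (\<Prod>j\<in>I. hw (R j) (\<tau> j)))) \<and>
      (\<forall>R \<tau> \<tau>'. (\<forall>i. i \<notin> I \<longrightarrow> \<tau> i = \<tau>' i) \<longrightarrow> c R \<tau> = c R \<tau>')"
    if "finite I" "I \<subseteq> set js" for I
    using that
  proof (induction I)
    case empty
    show ?case
      by (intro exI[of _ G] exI[of _ "\<lambda>R. G"]) (auto simp: PiE_empty_domain intro!: arg_cong[where f = G])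
  next
    case (insert j I)
    then obtain G' c where
      nG: "dnorm N p js G' t \<le> 2 ^ card I * dnorm N p js G t" and
      mG: "\<And>a. mavg N js (\<lambda>\<tau>. hpoly js N a \<tau> * G' \<tau>) t = mavg N js (\<lambda>\<tau>. hpoly js N a \<tau> * G \<tau>) t" and
      zG: "(\<forall>j\<in>set js. \<forall>\<tau>\<in>pts N js t. avg N (\<lambda>s. G (\<tau>(j := s))) = 0) \<longrightarrow> (\<forall>\<tau>\<in>pts N js t. G' \<tau> = G \<tau>)" and
      rG: "\<And>\<tau>. (\<forall>j\<in>I. length (\<tau> j) = N) \<Longrightarrow>
         G' \<tau> = (\<Sum>R\<in>(\<Pi>\<^sub>E j\<in>I. {u. length u < N}). c R \<tau> * (\<Prod>j\<in>I. hw (R j) (\<tau> j)))" and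
      cG: "\<And>R \<tau> \<tau>'. (\<forall>i. i \<notin> I \<longrightarrow> \<tau> i = \<tau>' i) \<Longrightarrow> c R \<tau> = c R \<tau>'" by blast
    have j: "j \<in> set js" using insert.prems by simp
    define A where "A = (\<lambda>\<tau>. avg N (\<lambda>s. G' (\<tau>(j := s))))"
    define G2 where "G2 = (\<lambda>\<tau>. G' \<tau> - A \<tau>)"
    define c2 where "c2 = (\<lambda>R \<tau>. Z (\<lambda>s. c (R(j := undefined)) (\<tau>(j := s))) (R j))"
    have "dnorm N p js G2 t \<le> dnorm N p js G' t + dnorm N p js A t"
    proof -
      have "seminorm (\<lambda>F. dnorm N p js F t)" by (intro seminorm_dnorm p1)
      from seminorm_diff[OF this, of G' A] show ?thesis by (simp add: G2_def fun_diff_def)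
    qed
    also have "dnorm N p js A t \<le> dnorm N p js G' t"
      unfolding A_def by (rule dnorm_avg_slice[OF js j p])
    finally have n2: "dnorm N p js G2 t \<le> 2 ^ card (insert j I) * dnorm N p js G t"
      using nG insert.hyps by simp
    have m2: "mavg N js (\<lambda>\<tau>. hpoly js N a \<tau> * G2 \<tau>) t = mavg N js (\<lambda>\<tau>. hpoly js N a \<tau> * G \<tau>) t" for a
    proof -
      have "mavg N js (\<lambda>\<tau>. hpoly js N a \<tau> * A \<tau>) t = mavg N js (\<lambda>\<tau>. avg N (\<lambda>s. hpoly js N a (\<tau>(j := s)) * A (\<tau>(j := s)))) t"
        by (rule avg_slice_mavg[OF js j, symmetric])
      also have "\<dots> = mavg N js (\<lambda>\<tau>. avg N (\<lambda>s. hpoly js N a (\<tau>(j := s)) * A \<tau>)) t"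
        by (simp add: A_def del: fun_upd_apply)
      also have "\<dots> = 0" by (simp only: cexp_mult_right avg_slice_hpoly[OF j] mult_zero_left mavg_const)
      finally show ?thesis unfolding G2_def right_diff_distrib mavg_diff by (simp add: mG)
    qed
    have r2: "G2 \<tau> = (\<Sum>R\<in>(\<Pi>\<^sub>E j\<in>insert j I. {u. length u < N}). c2 R \<tau> * (\<Prod>i\<in>insert j I. hw (R i) (\<tau> i)))"
      if len: "\<forall>i\<in>insert j I. length (\<tau> i) = N" for \<tau>
    proof -
      let ?P = "\<Pi>\<^sub>E j\<in>I. {u::bool list. length u < N}"
      let ?h = "\<lambda>R. \<Prod>i\<in>I. hw (R i) (\<tau> i)"
      have pr: "(\<Prod>i\<in>I. hw (R i) ((\<tau>(j := s)) i)) = ?h R" for R s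
        using insert.hyps by (intro prod.cong) auto
      have sl: "G' (\<tau>(j := s)) = (\<Sum>R\<in>?P. c R (\<tau>(j := s)) * ?h R)" for s
        using len insert.hyps by (subst rG) (auto simp: pr[simplified] intro!: sum.cong)
      have "G' \<tau> = (\<Sum>R\<in>?P. c R \<tau> * ?h R)" using len by (intro rG) auto
      then have "G2 \<tau> = (\<Sum>R\<in>?P. c R \<tau> * ?h R) - (\<Sum>R\<in>?P. avg N (\<lambda>s. c R (\<tau>(j := s))) * ?h R)"
        unfolding G2_def A_def by (simp only: sl cexp_sum cexp_mult_right)
      also have "\<dots> = (\<Sum>R\<in>?P. (c R \<tau> - avg N (\<lambda>s. c R (\<tau>(j := s)))) * ?h R)"
        by (simp only: sum_subtractf left_diff_distrib)
      also have "\<dots> = (\<Sum>R\<in>?P. \<Sum>u | length u < N. (hw u (\<tau> j) * Z (\<lambda>s. c R (\<tau>(j := s))) u) * ?h R)"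
      proof (rule sum.cong[OF refl])
        fix R
        have "c R \<tau> = (\<lambda>s. c R (\<tau>(j := s))) (\<tau> j)" by simp
        also have "\<dots> = avg N (\<lambda>s. c R (\<tau>(j := s))) + fpoly (Z (\<lambda>s. c R (\<tau>(j := s)))) (\<tau> j)"
          by (rule Z) (use len in simp)
        finally have "c R \<tau> - avg N (\<lambda>s. c R (\<tau>(j := s))) = fpoly (Z (\<lambda>s. c R (\<tau>(j := s)))) (\<tau> j)" by simp
        also have "\<dots> = (\<Sum>u | length u < N. hw u (\<tau> j) * Z (\<lambda>s. c R (\<tau>(j := s))) u)"
          using fpoly_eq_sum[of "\<tau> j" N "Z (\<lambda>s. c R (\<tau>(j := s)))"] len by simp
        finally show "(c R \<tau> - avg N (\<lambda>s. c R (\<tau>(j := s)))) * ?h R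
          = (\<Sum>u | length u < N. (hw u (\<tau> j) * Z (\<lambda>s. c R (\<tau>(j := s))) u) * ?h R)"
          by (simp only: sum_distrib_right)
      qed
      also have "\<dots> = (\<Sum>u | length u < N. \<Sum>R\<in>?P. (hw u (\<tau> j) * Z (\<lambda>s. c R (\<tau>(j := s))) u) * ?h R)"
        by (rule sum.swap)
      also have "\<dots> = (\<Sum>(u, R)\<in>{u. length u < N} \<times> ?P. (hw u (\<tau> j) * Z (\<lambda>s. c R (\<tau>(j := s))) u) * ?h R)"
        by (rule sum.cartesian_product)
      also have "\<dots> = (\<Sum>R\<in>(\<lambda>(u, R). R(j := u)) ` ({u. length u < N} \<times> ?P). c2 R \<tau> * (\<Prod>i\<in>insert j I. hw (R i) (\<tau> i)))"
      proof (rule sum.reindex_cong[symmetric, OF _ refl])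
        show "inj_on (\<lambda>(u, R). R(j := u)) ({u. length u < N} \<times> ?P)"
        proof (rule inj_onI, clarify)
          fix u R u' R' assume R: "R \<in> ?P" "R' \<in> ?P" and e: "R(j := u) = R'(j := u')"
          have "R i = R' i" for i
          proof (cases "i = j")
            case True
            then show ?thesis using R insert.hyps by (simp add: PiE_def extensional_def)
          qed (use fun_cong[OF e, of i] in simp)
          then show "u = u' \<and> R = R'" using fun_cong[OF e, of j] by auto
        qed
      next
        fix x :: "bool list \<times> (nat \<Rightarrow> bool list)"
        assume x: "x \<in> {u. length u < N} \<times> ?P"
        obtain u R where xx: "x = (u, R)" by (cases x)
        have "R j = undefined" using x xx insert.hyps by (auto simp: PiE_def extensional_def)
        then have Rj: "(R(j := u))(j := undefined) = R" by auto
        have "(\<Prod>i\<in>insert j I. hw ((R(j := u)) i) (\<tau> i)) = hw u (\<tau> j) * ?h R"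
          using insert.hyps by (simp, intro disjI2 prod.cong) auto
        then show "c2 (case x of (u, R) \<Rightarrow> R(j := u)) \<tau> * (\<Prod>i\<in>insert j I. hw ((case x of (u, R) \<Rightarrow> R(j := u)) i) (\<tau> i))
          = (case x of (u, R) \<Rightarrow> (hw u (\<tau> j) * Z (\<lambda>s. c R (\<tau>(j := s))) u) * ?h R)"
          unfolding xx prod.case c2_def Rj by (simp only: fun_upd_same mult_ac)
      qed
      also have "(\<lambda>(u, R). R(j := u)) ` ({u. length u < N} \<times> ?P) = (\<Pi>\<^sub>E j\<in>insert j I. {u. length u < N})"
        by (simp add: PiE_insert_eq)
      finally show ?thesis .
    qed
    have i2: "c2 R \<tau> = c2 R \<tau>'" if "\<forall>i. i \<notin> insert j I \<longrightarrow> \<tau> i = \<tau>' i" for R \<tau> \<tau>'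
    proof -
      have "c S (\<tau>(j := s)) = c S (\<tau>'(j := s))" for S s
        by (rule cG) (use that in auto)
      then show ?thesis by (simp only: c2_def)
    qed
    have z2: "(\<forall>j\<in>set js. \<forall>\<tau>\<in>pts N js t. avg N (\<lambda>s. G (\<tau>(j := s))) = 0) \<longrightarrow> (\<forall>\<tau>\<in>pts N js t. G2 \<tau> = G \<tau>)"
    proof (intro impI ballI)
      fix \<tau> assume z: "\<forall>j\<in>set js. \<forall>\<tau>\<in>pts N js t. avg N (\<lambda>s. G (\<tau>(j := s))) = 0" and \<tau>: "\<tau> \<in> pts N js t"
      have G': "\<forall>\<tau>\<in>pts N js t. G' \<tau> = G \<tau>" using zG z by (rule mp)
      have "avg N (\<lambda>s. G' (\<tau>(j := s))) = avg N (\<lambda>s. G (\<tau>(j := s)))"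
      proof (rule avg_cong)
        fix s :: "bool list" assume "length s = N"
        then have "\<tau>(j := s) \<in> pts N js t" using \<tau> j by (auto simp: pts_def)
        then show "G' (\<tau>(j := s)) = G (\<tau>(j := s))" using G' by blast
      qed
      also have "\<dots> = 0" using z j \<tau> by blast
      finally show "G2 \<tau> = G \<tau>" using G' \<tau> by (simp add: G2_def A_def)
    qed
    show ?case using n2 m2 r2 i2 z2 by blast
  qed
  from this[OF finite_set order_refl] obtain G' c where
      nG: "dnorm N p js G' t \<le> 2 ^ card (set js) * dnorm N p js G t" and
      mG: "\<And>a. mavg N js (\<lambda>\<tau>. hpoly js N a \<tau> * G' \<tau>) t = mavg N js (\<lambda>\<tau>. hpoly js N a \<tau> * G \<tau>) t" and
      zG: "(\<forall>j\<in>set js. \<forall>\<tau>\<in>pts N js t. avg N (\<lambda>s. G (\<tau>(j := s))) = 0) \<longrightarrow> (\<forall>\<tau>\<in>pts N js t. G' \<tau> = G \<tau>)" and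
      rG: "\<And>\<tau>. (\<forall>j\<in>set js. length (\<tau> j) = N) \<Longrightarrow>
         G' \<tau> = (\<Sum>R\<in>(\<Pi>\<^sub>E j\<in>set js. {u. length u < N}). c R \<tau> * (\<Prod>j\<in>set js. hw (R j) (\<tau> j)))" and
      cG: "\<And>R \<tau> \<tau>'. (\<forall>i. i \<notin> set js \<longrightarrow> \<tau> i = \<tau>' i) \<Longrightarrow> c R \<tau> = c R \<tau>'" by blast
  define b where "b = (\<lambda>R. c R t)"
  have eq: "G' \<tau> = hpoly js N b \<tau>" if "\<tau> \<in> pts N js t" for \<tau>
  proof -
    have "c R \<tau> = b R" for R unfolding b_def by (rule cG) (use that in \<open>auto simp: pts_def\<close>)
    then show ?thesis using rG[of \<tau>] that by (simp add: pts_def hpoly_def rects_def ht_def)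
  qed
  have "dnorm N p js (hpoly js N b) t = dnorm N p js G' t" by (rule dnorm_cong) (simp add: eq)
  moreover have "mavg N js (\<lambda>\<tau>. hpoly js N a \<tau> * hpoly js N b \<tau>) t = mavg N js (\<lambda>\<tau>. hpoly js N a \<tau> * G' \<tau>) t" for a
    by (rule mavg_cong) (simp add: eq)
  moreover have "(\<forall>j\<in>set js. \<forall>\<tau>\<in>pts N js t. avg N (\<lambda>s. G (\<tau>(j := s))) = 0) \<longrightarrow> (\<forall>\<tau>\<in>pts N js t. hpoly js N b \<tau> = G \<tau>)"
    using zG eq by metis
  ultimately show ?thesis using nG mG by (intro exI[of _ b]) (simp add: distinct_card[OF js])
qed

section \<open>Square function estimates and their consequences\<close>

lemma mavg_prod:
  "distinct js \<Longrightarrow> mavg N js (\<lambda>\<tau>. \<Prod>j\<in>set js. f j (\<tau> j)) t = (\<Prod>j\<in>set js. avg N (f j))"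
proof (induction js arbitrary: t)
  case (Cons j js)
  have j: "j \<notin> set js" "distinct js" using Cons.prems by auto
  have "mavg N (j # js) (\<lambda>\<tau>. \<Prod>j\<in>set (j # js). f j (\<tau> j)) t
    = avg N (\<lambda>s. mavg N js (\<lambda>\<tau>. f j (\<tau> j) * (\<Prod>j\<in>set js. f j (\<tau> j))) (t(j := s)))"
    using j by (simp del: fun_upd_apply)
  also have "\<dots> = avg N (\<lambda>s. f j s * (\<Prod>j\<in>set js. avg N (f j)))"
  proof (rule avg_cong)
    fix s
    have "mavg N js (\<lambda>\<tau>. f j (\<tau> j) * (\<Prod>j\<in>set js. f j (\<tau> j))) (t(j := s))
      = mavg N js (\<lambda>\<tau>. f j s * (\<Prod>j\<in>set js. f j (\<tau> j))) (t(j := s))"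
      by (rule mavg_cong) (use j in \<open>auto simp: pts_def\<close>)
    then show "mavg N js (\<lambda>\<tau>. f j (\<tau> j) * (\<Prod>j\<in>set js. f j (\<tau> j))) (t(j := s)) = f j s * (\<Prod>j\<in>set js. avg N (f j))"
      by (simp only: mavg_cmult Cons.IH[OF j(2)])
  qed
  also have "\<dots> = (\<Prod>j\<in>set (j # js). avg N (f j))" using j by (simp add: cexp_mult_right)
  finally show ?case .
qed simp

definition rmeas :: "nat list \<Rightarrow> (nat \<Rightarrow> bool list) \<Rightarrow> real" where
  "rmeas js R = (\<Prod>j\<in>set js. (1/2) ^ length (R j))"

lemma rmeas_pos: "0 < rmeas js R"
  unfolding rmeas_def by (intro prod_pos) auto

lemma mavg_ht_orthogonal:
  assumes "distinct js" "R \<in> rects js N" "R' \<in> rects js N"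
  shows "mavg N js (\<lambda>\<tau>. ht js R \<tau> * ht js R' \<tau>) t = (if R = R' then rmeas js R else 0)"
proof -
  have *: "mavg N js (\<lambda>\<tau>. ht js R \<tau> * ht js R' \<tau>) t = (\<Prod>j\<in>set js. avg N (\<lambda>w. hw (R j) w * hw (R' j) w))"
    unfolding ht_def prod.distrib[symmetric] by (rule mavg_prod[OF assms(1)])
  show ?thesis
  proof (cases "R = R'")
    case True
    have "avg N (\<lambda>w. hw (R j) w * hw (R j) w) = (1/2) ^ length (R j)" if "j \<in> set js" for j
      using avg_hw_sq[of "R j" N] assms(2) that by (auto simp: rects_def power2_eq_square)
    then show ?thesis unfolding * using True by (simp add: rmeas_def)
  next
    case False
    then obtain j where "j \<in> set js" "R j \<noteq> R' j"
      using assms(2,3) unfolding rects_def by (metis PiE_ext)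
    then have "avg N (\<lambda>w. hw (R j) w * hw (R' j) w) = 0" by (intro avg_hw_orthogonal)
    then show ?thesis unfolding * using False \<open>j \<in> set js\<close> by (auto intro: prod_zero)
  qed
qed

lemma pairing_diagonal:
  assumes "distinct js"
  shows "mavg N js (\<lambda>\<tau>. hpoly js N a \<tau> * hpoly js N b \<tau>) t = mavg N js (\<lambda>\<tau>. \<Sum>R\<in>rects js N. a R * b R * (ht js R \<tau>)\<^sup>2) t"
    and "mavg N js (\<lambda>\<tau>. hpoly js N a \<tau> * hpoly js N b \<tau>) t = (\<Sum>R\<in>rects js N. a R * b R * rmeas js R)"
proof -
  have "hpoly js N a \<tau> * hpoly js N b \<tau> = (\<Sum>R\<in>rects js N. \<Sum>R'\<in>rects js N. (a R * b R') * (ht js R \<tau> * ht js R' \<tau>))" for \<tau>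
    unfolding hpoly_def sum_product by (intro sum.cong refl) (simp add: mult_ac)
  then have "mavg N js (\<lambda>\<tau>. hpoly js N a \<tau> * hpoly js N b \<tau>) t
    = (\<Sum>R\<in>rects js N. \<Sum>R'\<in>rects js N. (a R * b R') * (if R = R' then rmeas js R else 0))"
    by (simp only: mavg_sum mavg_cmult) (intro sum.cong refl, simp add: mavg_ht_orthogonal[OF assms])
  also have "\<dots> = (\<Sum>R\<in>rects js N. a R * b R * rmeas js R)"
    by (simp add: if_distrib sum.delta finite_rects cong: if_cong)
  finally show 1: "mavg N js (\<lambda>\<tau>. hpoly js N a \<tau> * hpoly js N b \<tau>) t = (\<Sum>R\<in>rects js N. a R * b R * rmeas js R)" .
  have "mavg N js (\<lambda>\<tau>. \<Sum>R\<in>rects js N. a R * b R * (ht js R \<tau>)\<^sup>2) t = (\<Sum>R\<in>rects js N. a R * b R * rmeas js R)"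
    by (simp only: mavg_sum mavg_cmult power2_eq_square) (intro sum.cong refl, simp add: mavg_ht_orthogonal[OF assms])
  with 1 show "mavg N js (\<lambda>\<tau>. hpoly js N a \<tau> * hpoly js N b \<tau>) t = mavg N js (\<lambda>\<tau>. \<Sum>R\<in>rects js N. a R * b R * (ht js R \<tau>)\<^sup>2) t" by simp
qed

text \<open>The extremal function for the norm may be replaced by its projection onto Haar polynomials,
  since it is only paired with a Haar polynomial.\<close>

lemma norming_polynomial:
  assumes js: "distinct js" and p: "\<And>j. j \<in> set js \<Longrightarrow> 1 < p j"
  shows "\<exists>b. dnorm N (conj_exp p) js (hpoly js N b) t \<le> 2 ^ length js \<and>
    dnorm N p js (hpoly js N a) t = mavg N js (\<lambda>\<tau>. hpoly js N a \<tau> * hpoly js N b \<tau>) t"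
proof -
  let ?G = "dualf N p js (hpoly js N a)"
  have G: "mavg N js (\<lambda>\<tau>. hpoly js N a \<tau> * ?G \<tau>) t = dnorm N p js (hpoly js N a) t"
    "dnorm N (conj_exp p) js ?G t \<le> 1"
    using dualf_norming[of js p N "hpoly js N a" t] p by auto
  have q: "1 < conj_exp p j" if "j \<in> set js" for j using p[OF that] by (rule conj_exp)
  obtain b where b: "dnorm N (conj_exp p) js (hpoly js N b) t \<le> 2 ^ length js * dnorm N (conj_exp p) js ?G t"
    "\<And>a. mavg N js (\<lambda>\<tau>. hpoly js N a \<tau> * hpoly js N b \<tau>) t = mavg N js (\<lambda>\<tau>. hpoly js N a \<tau> * ?G \<tau>) t"
    using projection_exists[of js "conj_exp p" N t ?G] js q by auto
  have "dnorm N (conj_exp p) js (hpoly js N b) t \<le> 2 ^ length js * 1"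
    by (rule order_trans[OF b(1) mult_left_mono[OF G(2)]]) simp
  then show ?thesis using b(2) G(1) by (intro exI[of _ b]) simp
qed

text \<open>Paired with a norming polynomial \<open>b\<close>, the polynomial \<open>a\<close> contributes only diagonal terms, and these
  are bounded pointwise by the product of the two square functions. The upper estimate for the
  conjugate exponents bounds the square function of \<open>b\<close>.\<close>

lemma square_function_lower:
  assumes js: "distinct js" and p: "\<And>j. j \<in> set js \<Longrightarrow> 1 < p j"
  shows "\<exists>C\<ge>0. \<forall>N a t. dnorm N p js (hpoly js N a) t \<le> C * dnorm N p js (sqf js N a) t"
proof -
  have q: "1 < conj_exp p j" if "j \<in> set js" for j using p[OF that] by (rule conj_exp)
  have "\<exists>C\<ge>0. \<forall>N a t. dnorm N (conj_exp p) js (sqf js N a) t \<le> C * dnorm N (conj_exp p) js (hpoly js N a) t"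
    using js q by (rule square_function_upper)
  then obtain C where C: "0 \<le> C" "\<And>N a t. dnorm N (conj_exp p) js (sqf js N a) t \<le> C * dnorm N (conj_exp p) js (hpoly js N a) t"
    by blast
  have "dnorm N p js (hpoly js N a) t \<le> (C * 2 ^ length js) * dnorm N p js (sqf js N a) t" for N a t
  proof -
    obtain b where b: "dnorm N (conj_exp p) js (hpoly js N b) t \<le> 2 ^ length js"
      "dnorm N p js (hpoly js N a) t = mavg N js (\<lambda>\<tau>. hpoly js N a \<tau> * hpoly js N b \<tau>) t"
      using norming_polynomial[of js p N t a] js p by auto
    have "mavg N js (\<lambda>\<tau>. hpoly js N a \<tau> * hpoly js N b \<tau>) t \<le> mavg N js (\<lambda>\<tau>. sqf js N a \<tau> * sqf js N b \<tau>) t"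
      unfolding pairing_diagonal(1)[OF js]
    proof (rule mavg_mono)
      fix \<tau>
      have "(\<Sum>R\<in>rects js N. a R * b R * (ht js R \<tau>)\<^sup>2) = (\<Sum>R\<in>rects js N. (a R * ht js R \<tau>) * (b R * ht js R \<tau>))"
        by (intro sum.cong refl) (simp add: power2_eq_square mult_ac)
      also have "\<dots> \<le> sqrt ((\<Sum>R\<in>rects js N. (a R * ht js R \<tau>)\<^sup>2) * (\<Sum>R\<in>rects js N. (b R * ht js R \<tau>)\<^sup>2))"
        by (rule real_le_rsqrt[OF Cauchy_Schwarz_ineq_sum])
      finally show "(\<Sum>R\<in>rects js N. a R * b R * (ht js R \<tau>)\<^sup>2) \<le> sqf js N a \<tau> * sqf js N b \<tau>"
        by (simp add: sqf_def real_sqrt_mult)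
    qed
    also have "\<dots> \<le> dnorm N p js (sqf js N a) t * dnorm N (conj_exp p) js (sqf js N b) t"
      by (rule dnorm_Holder) (rule p)
    also have "\<dots> \<le> dnorm N p js (sqf js N a) t * (C * 2 ^ length js)"
      using C(2)[of N b t] mult_left_mono[OF b(1) C(1)] by (intro mult_left_mono dnorm_nonneg) simp
    finally show ?thesis unfolding b(2) by (simp add: mult.commute)
  qed
  then show ?thesis using C(1) by (intro exI[of _ "C * 2 ^ length js"]) auto
qed

lemma hpoly_dominated:
  assumes js: "distinct js" and p: "\<And>j. j \<in> set js \<Longrightarrow> 1 < p j"
  shows "\<exists>C\<ge>1. \<forall>N a b t. (\<forall>\<tau>\<in>pts N js t. sqf js N b \<tau> \<le> sqf js N a \<tau>) \<longrightarrow>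
    dnorm N p js (hpoly js N b) t \<le> C * dnorm N p js (hpoly js N a) t"
proof -
  have "\<exists>C\<ge>0. \<forall>N a t. dnorm N p js (sqf js N a) t \<le> C * dnorm N p js (hpoly js N a) t"
    using js p by (rule square_function_upper)
  then obtain C where C: "0 \<le> C" "\<And>N a t. dnorm N p js (sqf js N a) t \<le> C * dnorm N p js (hpoly js N a) t"
    by blast
  have "\<exists>C\<ge>0. \<forall>N a t. dnorm N p js (hpoly js N a) t \<le> C * dnorm N p js (sqf js N a) t"
    using js p by (rule square_function_lower)
  then obtain D where D: "0 \<le> D" "\<And>N a t. dnorm N p js (hpoly js N a) t \<le> D * dnorm N p js (sqf js N a) t"
    by blast
  have "dnorm N p js (hpoly js N b) t \<le> (max 1 (D * C)) * dnorm N p js (hpoly js N a) t"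
    if "\<forall>\<tau>\<in>pts N js t. sqf js N b \<tau> \<le> sqf js N a \<tau>" for N a b t
  proof -
    have p0: "0 < p j" if "j \<in> set js" for j using p[OF that] by simp
    have "dnorm N p js (sqf js N b) t \<le> dnorm N p js (sqf js N a) t"
      by (rule dnorm_mono[OF p0]) (use that sqf_nonneg in auto)
    then have "D * dnorm N p js (sqf js N b) t \<le> D * (C * dnorm N p js (hpoly js N a) t)"
      using C(2)[of N a t] D(1) by (intro mult_left_mono) auto
    then have "dnorm N p js (hpoly js N b) t \<le> (D * C) * dnorm N p js (hpoly js N a) t"
      using D(2)[of N b t] by simp
    also have "\<dots> \<le> max 1 (D * C) * dnorm N p js (hpoly js N a) t"
      by (intro mult_right_mono dnorm_nonneg) auto
    finally show ?thesis .
  qed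
  then show ?thesis by (intro exI[of _ "max 1 (D * C)"]) auto
qed

text \<open>Coefficients of \<open>\<Sum>k\<in>F. c k * (\<Sum>K\<in>S k. h\<^sub>K)\<close> for disjoint \<open>S k\<close>.\<close>

definition fam :: "'k set \<Rightarrow> ('k \<Rightarrow> 'r set) \<Rightarrow> ('k \<Rightarrow> real) \<Rightarrow> 'r \<Rightarrow> real" where
  "fam F S c K = (\<Sum>k\<in>F. if K \<in> S k then c k else 0)"

lemma sum_fam:
  assumes "finite F" "finite U" "\<And>k. k \<in> F \<Longrightarrow> S k \<subseteq> U"
  shows "(\<Sum>K\<in>U. fam F S c K * x K) = (\<Sum>k\<in>F. c k * (\<Sum>K\<in>S k. x K))"
proof -
  have "(\<Sum>K\<in>U. fam F S c K * x K) = (\<Sum>K\<in>U. \<Sum>k\<in>F. if K \<in> S k then c k * x K else 0)"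
    by (auto simp: fam_def sum_distrib_right intro!: sum.cong)
  also have "\<dots> = (\<Sum>k\<in>F. \<Sum>K\<in>U. if K \<in> S k then c k * x K else 0)" by (rule sum.swap)
  also have "\<dots> = (\<Sum>k\<in>F. c k * (\<Sum>K\<in>S k. x K))"
  proof (rule sum.cong[OF refl])
    fix k assume "k \<in> F"
    then have "U \<inter> S k = S k" using assms(3) by blast
    then show "(\<Sum>K\<in>U. if K \<in> S k then c k * x K else 0) = c k * (\<Sum>K\<in>S k. x K)"
      using assms(2) by (simp add: sum.inter_restrict[symmetric] sum_distrib_left)
  qed
  finally show ?thesis .
qed

lemma fam_power2:
  assumes "finite F" "\<And>k l. k \<in> F \<Longrightarrow> l \<in> F \<Longrightarrow> k \<noteq> l \<Longrightarrow> S k \<inter> S l = {}"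
  shows "(fam F S c K)\<^sup>2 = fam F S (\<lambda>k. (c k)\<^sup>2) K"
proof (cases "\<exists>k\<in>F. K \<in> S k")
  case True
  then obtain k where k: "k \<in> F" "K \<in> S k" by blast
  have "fam F S d K = d k" for d
  proof -
    have "fam F S d K = (\<Sum>l\<in>F. if l = k then d l else 0)"
      unfolding fam_def using assms(2) k by (intro sum.cong) auto
    then show ?thesis using assms(1) k by simp
  qed
  then show ?thesis by simp
next
  case False
  then have "fam F S d K = 0" for d unfolding fam_def by (intro sum.neutral) auto
  then show ?thesis by simp
qed

lemma hpoly_fam:
  assumes "finite F" "\<And>k. k \<in> F \<Longrightarrow> S k \<subseteq> rects js N"
  shows "hpoly js N (fam F S c) \<tau> = (\<Sum>k\<in>F. c k * (\<Sum>K\<in>S k. ht js K \<tau>))"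
  unfolding hpoly_def by (rule sum_fam[OF assms(1) finite_rects assms(2)])

lemma sqf_fam:
  assumes "finite F" "\<And>k. k \<in> F \<Longrightarrow> S k \<subseteq> rects js N"
    "\<And>k l. k \<in> F \<Longrightarrow> l \<in> F \<Longrightarrow> k \<noteq> l \<Longrightarrow> S k \<inter> S l = {}"
  shows "sqf js N (fam F S c) \<tau> = sqrt (\<Sum>k\<in>F. (c k)\<^sup>2 * (\<Sum>K\<in>S k. (ht js K \<tau>)\<^sup>2))"
proof -
  have "(fam F S c K)\<^sup>2 = fam F S (\<lambda>k. (c k)\<^sup>2) K" for K
    by (rule fam_power2[OF assms(1)]) (rule assms(3))
  then show ?thesis
    by (simp add: sqf_def power_mult_distrib sum_fam[OF assms(1) finite_rects assms(2)])
qed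

text \<open>The rectangles inside \<open>R\<close> all of whose sides have length \<open>2\<^sup>-\<^sup>m\<close>: a word describes a subinterval of
  the interval of each of its suffixes.\<close>

definition desc :: "nat list \<Rightarrow> (nat \<Rightarrow> bool list) \<Rightarrow> nat \<Rightarrow> (nat \<Rightarrow> bool list) set" where
  "desc js R m = (\<Pi>\<^sub>E j\<in>set js. {u. length u = m \<and> (\<exists>v. u = v @ R j)})"

lemma sum_hw_sq_desc:
  assumes "length r \<le> m" "m < length w"
  shows "(\<Sum>u | length u = m \<and> (\<exists>v. u = v @ r). (hw u w)\<^sup>2) = (hw r w)\<^sup>2"
proof -
  let ?E = "{u. length u = m \<and> (\<exists>v. u = v @ r)}"
  define u0 where "u0 = drop (length w - m) w"
  have fin: "finite ?E" by (rule finite_subset[OF _ finite_length_lists[of m]]) auto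
  have w: "w = take (length w - m) w @ u0" by (simp add: u0_def)
  have l0: "length u0 = m" using assms by (simp add: u0_def)
  have eq: "(hw u w)\<^sup>2 = of_bool (u = u0)" if "u \<in> ?E" for u
  proof -
    have "(\<exists>v. v \<noteq> [] \<and> w = v @ u) \<longleftrightarrow> u = u0"
    proof
      assume "\<exists>v. v \<noteq> [] \<and> w = v @ u"
      then show "u = u0" using that by (auto simp: u0_def)
    next
      assume "u = u0"
      then show "\<exists>v. v \<noteq> [] \<and> w = v @ u" using w assms by (intro exI[of _ "take (length w - m) w"]) auto
    qed
    then show ?thesis by (simp add: hw_sq)
  qed
  have "(\<Sum>u\<in>?E. (hw u w)\<^sup>2) = (\<Sum>u\<in>?E. if u = u0 then 1 else 0)"
    by (rule sum.cong[OF refl]) (simp add: eq)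
  also have "\<dots> = of_bool (u0 \<in> ?E)" using fin by simp
  also have "u0 \<in> ?E \<longleftrightarrow> (\<exists>v. v \<noteq> [] \<and> w = v @ r)"
  proof
    assume "u0 \<in> ?E"
    then obtain v where "u0 = v @ r" by blast
    then have "w = (take (length w - m) w @ v) @ r" using w by simp
    moreover have "take (length w - m) w \<noteq> []" using assms by auto
    ultimately show "\<exists>v. v \<noteq> [] \<and> w = v @ r" by blast
  next
    assume "\<exists>v. v \<noteq> [] \<and> w = v @ r"
    then obtain v where v: "w = v @ r" by blast
    then have "u0 = drop (length w - m) v @ r" using assms by (simp add: u0_def)
    then show "u0 \<in> ?E" using l0 by blast
  qed
  finally show ?thesis by (simp add: hw_sq)
qed

lemma finite_desc: "finite (desc js R m)"
  unfolding desc_def by (intro finite_PiE finite_set) (auto intro: finite_subset[OF _ finite_length_lists[of m]])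

lemma desc_subset_rects: "m < N \<Longrightarrow> desc js R m \<subseteq> rects js N"
  by (auto simp: desc_def rects_def PiE_def Pi_def)

lemma desc_disjoint: "js \<noteq> [] \<Longrightarrow> m \<noteq> m' \<Longrightarrow> desc js R m \<inter> desc js R' m' = {}"
  by (cases js) (auto simp: desc_def PiE_def Pi_def)

lemma sum_ht_sq_desc:
  assumes "\<And>j. j \<in> set js \<Longrightarrow> length (R j) \<le> m" "\<And>j. j \<in> set js \<Longrightarrow> m < length (\<tau> j)"
  shows "(\<Sum>K\<in>desc js R m. (ht js K \<tau>)\<^sup>2) = (ht js R \<tau>)\<^sup>2"
proof -
  have "(\<Sum>K\<in>desc js R m. (ht js K \<tau>)\<^sup>2) = (\<Sum>K\<in>desc js R m. \<Prod>j\<in>set js. (hw (K j) (\<tau> j))\<^sup>2)"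
    by (simp add: ht_def prod_power_distrib)
  also have "\<dots> = (\<Prod>j\<in>set js. \<Sum>u | length u = m \<and> (\<exists>v. u = v @ R j). (hw u (\<tau> j))\<^sup>2)"
    unfolding desc_def
    by (rule prod_sum_PiE[symmetric]) (auto intro: finite_subset[OF _ finite_length_lists[of m]])
  also have "\<dots> = (ht js R \<tau>)\<^sup>2"
    using assms by (simp add: ht_def prod_power_distrib sum_hw_sq_desc)
  finally show ?thesis .
qed

lemma sum_rmeas_desc:
  assumes js: "distinct js" and R: "\<And>j. j \<in> set js \<Longrightarrow> length (R j) \<le> m" and RP: "R \<in> extensional (set js)"
  shows "(\<Sum>K\<in>desc js R m. rmeas js K) = rmeas js R"
proof -
  define N where "N = Suc m"
  have sub: "desc js R m \<subseteq> rects js N" by (rule desc_subset_rects) (simp add: N_def)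
  have "R \<in> rects js N" using R RP by (fastforce simp: rects_def PiE_def N_def)
  then have "rmeas js R = mavg N js (\<lambda>\<tau>. (ht js R \<tau>)\<^sup>2) undefined"
    using mavg_ht_orthogonal[OF js, of R N R] by (simp add: power2_eq_square)
  also have "\<dots> = mavg N js (\<lambda>\<tau>. \<Sum>K\<in>desc js R m. (ht js K \<tau>)\<^sup>2) undefined"
    by (rule mavg_cong, rule sum_ht_sq_desc[symmetric]) (use R in \<open>auto simp: pts_def N_def\<close>)
  also have "\<dots> = (\<Sum>K\<in>desc js R m. rmeas js K)"
    unfolding mavg_sum
  proof (rule sum.cong[OF refl])
    fix K assume "K \<in> desc js R m"
    then have "K \<in> rects js N" using sub by blast
    then show "mavg N js (\<lambda>\<tau>. (ht js K \<tau>)\<^sup>2) undefined = rmeas js K"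
      using mavg_ht_orthogonal[OF js, of K N K] by (simp add: power2_eq_square)
  qed
  finally show ?thesis by simp
qed

text \<open>The blocks \<open>\<Sum>K\<in>desc R m. h\<^sub>K\<close> have the modulus of \<open>h\<^sub>R\<close>, so the square functions of
  corresponding combinations coincide.\<close>

lemma blocks_equivalent:
  assumes js: "distinct js" "js \<noteq> []" and p: "\<And>j. j \<in> set js \<Longrightarrow> 1 < p j"
  shows "\<exists>C\<ge>1. \<forall>N (F :: nat set) \<rho> m c t.
    finite F \<and> inj_on \<rho> F \<and> inj_on m F \<and> (\<forall>k\<in>F. m k < N \<and> \<rho> k \<in> rects js (Suc (m k))) \<longrightarrow>
    dnorm N p js (\<lambda>\<tau>. \<Sum>k\<in>F. c k * (\<Sum>K\<in>desc js (\<rho> k) (m k). ht js K \<tau>)) t \<le>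
      C * dnorm N p js (\<lambda>\<tau>. \<Sum>k\<in>F. c k * ht js (\<rho> k) \<tau>) t \<and>
    dnorm N p js (\<lambda>\<tau>. \<Sum>k\<in>F. c k * ht js (\<rho> k) \<tau>) t \<le>
      C * dnorm N p js (\<lambda>\<tau>. \<Sum>k\<in>F. c k * (\<Sum>K\<in>desc js (\<rho> k) (m k). ht js K \<tau>)) t"
proof -
  have "\<exists>C\<ge>1. \<forall>N a b t. (\<forall>\<tau>\<in>pts N js t. sqf js N b \<tau> \<le> sqf js N a \<tau>) \<longrightarrow>
    dnorm N p js (hpoly js N b) t \<le> C * dnorm N p js (hpoly js N a) t"
    using js(1) p by (rule hpoly_dominated)
  then obtain C where C: "1 \<le> C" "\<And>N a b t. (\<forall>\<tau>\<in>pts N js t. sqf js N b \<tau> \<le> sqf js N a \<tau>) \<Longrightarrow>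
    dnorm N p js (hpoly js N b) t \<le> C * dnorm N p js (hpoly js N a) t" by blast
  show ?thesis
  proof (rule exI[of _ C], intro conjI C allI impI)
    fix N and F :: "nat set" and \<rho> m c t
    assume A: "finite F \<and> inj_on \<rho> F \<and> inj_on m F \<and> (\<forall>k\<in>F. m k < N \<and> \<rho> k \<in> rects js (Suc (m k)))"
    let ?S = "\<lambda>k. desc js (\<rho> k) (m k)"
    have S: "finite F" "\<And>k. k \<in> F \<Longrightarrow> ?S k \<subseteq> rects js N" "\<And>k l. k \<in> F \<Longrightarrow> l \<in> F \<Longrightarrow> k \<noteq> l \<Longrightarrow> ?S k \<inter> ?S l = {}"
      using A js(2) by (auto intro!: desc_disjoint desc_subset_rects simp: inj_on_eq_iff)
    have "\<And>k. k \<in> F \<Longrightarrow> \<rho> k \<in> rects js N" using A by (fastforce simp: rects_def PiE_def Pi_def)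
    moreover have len: "length (\<rho> k j) \<le> m k" if "k \<in> F" "j \<in> set js" for k j
    proof -
      have "\<rho> k j \<in> {u. length u < Suc (m k)}" using A that unfolding rects_def by (blast intro: PiE_mem)
      then show ?thesis by simp
    qed
    ultimately have T: "\<And>k. k \<in> F \<Longrightarrow> {\<rho> k} \<subseteq> rects js N" "\<And>k l. k \<in> F \<Longrightarrow> l \<in> F \<Longrightarrow> k \<noteq> l \<Longrightarrow> {\<rho> k} \<inter> {\<rho> l} = {}"
      using A by (auto simp: inj_on_eq_iff)
    have hp: "hpoly js N (fam F ?S c) = (\<lambda>\<tau>. \<Sum>k\<in>F. c k * (\<Sum>K\<in>?S k. ht js K \<tau>))"
      "hpoly js N (fam F (\<lambda>k. {\<rho> k}) c) = (\<lambda>\<tau>. \<Sum>k\<in>F. c k * ht js (\<rho> k) \<tau>)"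
      by (intro ext, subst hpoly_fam, use S T in auto)+
    have sq: "sqf js N (fam F ?S c) \<tau> = sqf js N (fam F (\<lambda>k. {\<rho> k}) c) \<tau>" if "\<tau> \<in> pts N js t" for \<tau>
    proof -
      have "(\<Sum>K\<in>?S k. (ht js K \<tau>)\<^sup>2) = (ht js (\<rho> k) \<tau>)\<^sup>2" if "k \<in> F" for k
        by (rule sum_ht_sq_desc) (use A \<open>\<tau> \<in> pts N js t\<close> that len in \<open>auto simp: pts_def\<close>)
      then show ?thesis
        by (simp add: sqf_fam[OF S] sqf_fam[OF S(1) T] cong: sum.cong)
    qed
    show "dnorm N p js (\<lambda>\<tau>. \<Sum>k\<in>F. c k * (\<Sum>K\<in>?S k. ht js K \<tau>)) t \<le> C * dnorm N p js (\<lambda>\<tau>. \<Sum>k\<in>F. c k * ht js (\<rho> k) \<tau>) t"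
      unfolding hp[symmetric] by (rule C(2)) (simp add: sq)
    show "dnorm N p js (\<lambda>\<tau>. \<Sum>k\<in>F. c k * ht js (\<rho> k) \<tau>) t \<le> C * dnorm N p js (\<lambda>\<tau>. \<Sum>k\<in>F. c k * (\<Sum>K\<in>?S k. ht js K \<tau>)) t"
      unfolding hp[symmetric] by (rule C(2)) (simp add: sq)
  qed
qed

text \<open>The weighted averages are the adjoint of forming blocks: testing the left-hand side against a
  Haar polynomial with coefficients \<open>c\<close> gives the same number as testing the right-hand side against
  \<open>\<Sum>k. c k b k\<close>, whose norm for the conjugate exponents is comparable to that of \<open>\<Sum>k. c k h\<^sub>k\<close>.\<close>

lemma block_averages_bounded:
  assumes js: "distinct js" "js \<noteq> []" and p: "\<And>j. j \<in> set js \<Longrightarrow> 1 < p j"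
  shows "\<exists>C\<ge>1. \<forall>N (F :: nat set) \<rho> m x t.
    finite F \<and> inj_on \<rho> F \<and> inj_on m F \<and> (\<forall>k\<in>F. m k < N \<and> \<rho> k \<in> rects js (Suc (m k))) \<longrightarrow>
    dnorm N p js (\<lambda>\<tau>. \<Sum>k\<in>F. (\<Sum>K\<in>desc js (\<rho> k) (m k). rmeas js K / rmeas js (\<rho> k) * x K) * ht js (\<rho> k) \<tau>) t \<le>
      C * dnorm N p js (\<lambda>\<tau>. \<Sum>k\<in>F. \<Sum>K\<in>desc js (\<rho> k) (m k). x K * ht js K \<tau>) t"
proof -
  have q: "1 < conj_exp p j" if "j \<in> set js" for j using p[OF that] by (rule conj_exp)
  have "\<exists>C\<ge>1. \<forall>N a b t. (\<forall>\<tau>\<in>pts N js t. sqf js N b \<tau> \<le> sqf js N a \<tau>) \<longrightarrow>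
    dnorm N (conj_exp p) js (hpoly js N b) t \<le> C * dnorm N (conj_exp p) js (hpoly js N a) t"
    using js(1) q by (rule hpoly_dominated)
  then obtain C where C: "1 \<le> C" "\<And>N a b t. (\<forall>\<tau>\<in>pts N js t. sqf js N b \<tau> \<le> sqf js N a \<tau>) \<Longrightarrow>
    dnorm N (conj_exp p) js (hpoly js N b) t \<le> C * dnorm N (conj_exp p) js (hpoly js N a) t" by blast
  show ?thesis
  proof (rule exI[of _ "C * 2 ^ length js"], intro conjI allI impI)
    have "1 * 1 \<le> C * 2 ^ length js" using C(1) by (intro mult_mono) auto
    then show "1 \<le> C * 2 ^ length js" by simp
  next
    fix N and F :: "nat set" and \<rho> m t and x :: "(nat \<Rightarrow> bool list) \<Rightarrow> real"
    assume A: "finite F \<and> inj_on \<rho> F \<and> inj_on m F \<and> (\<forall>k\<in>F. m k < N \<and> \<rho> k \<in> rects js (Suc (m k)))"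
    let ?S = "\<lambda>k. desc js (\<rho> k) (m k)"
    have S: "finite F" "\<And>k. k \<in> F \<Longrightarrow> ?S k \<subseteq> rects js N" "\<And>k l. k \<in> F \<Longrightarrow> l \<in> F \<Longrightarrow> k \<noteq> l \<Longrightarrow> ?S k \<inter> ?S l = {}"
      using A js(2) by (auto intro!: desc_disjoint desc_subset_rects simp: inj_on_eq_iff)
    have "\<And>k. k \<in> F \<Longrightarrow> \<rho> k \<in> rects js N" using A by (fastforce simp: rects_def PiE_def Pi_def)
    moreover have len: "length (\<rho> k j) \<le> m k" if "k \<in> F" "j \<in> set js" for k j
    proof -
      have "\<rho> k j \<in> {u. length u < Suc (m k)}" using A that unfolding rects_def by (blast intro: PiE_mem)
      then show ?thesis by simp
    qed
    ultimately have T: "\<And>k. k \<in> F \<Longrightarrow> {\<rho> k} \<subseteq> rects js N" "\<And>k l. k \<in> F \<Longrightarrow> l \<in> F \<Longrightarrow> k \<noteq> l \<Longrightarrow> {\<rho> k} \<inter> {\<rho> l} = {}"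
      using A by (auto simp: inj_on_eq_iff)
    define c where "c = (\<lambda>k. \<Sum>K\<in>?S k. rmeas js K / rmeas js (\<rho> k) * x K)"
    define a where "a = fam F (\<lambda>k. {\<rho> k}) c"
    have ha: "hpoly js N a = (\<lambda>\<tau>. \<Sum>k\<in>F. c k * ht js (\<rho> k) \<tau>)"
      unfolding a_def by (intro ext, subst hpoly_fam, use S T in auto)
    define xx where "xx = (\<lambda>K. fam F ?S (\<lambda>k. 1) K * x K)"
    have hx: "hpoly js N xx = (\<lambda>\<tau>. \<Sum>k\<in>F. \<Sum>K\<in>?S k. x K * ht js K \<tau>)"
      unfolding hpoly_def xx_def mult.assoc by (intro ext, subst sum_fam[OF S(1) finite_rects S(2)]) auto
    obtain b where b: "dnorm N (conj_exp p) js (hpoly js N b) t \<le> 2 ^ length js"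
      "dnorm N p js (hpoly js N a) t = mavg N js (\<lambda>\<tau>. hpoly js N a \<tau> * hpoly js N b \<tau>) t"
      using norming_polynomial[of js p N t a] js(1) p by auto
    define e where "e = fam F ?S (\<lambda>k. b (\<rho> k))"
    have "mavg N js (\<lambda>\<tau>. hpoly js N a \<tau> * hpoly js N b \<tau>) t = (\<Sum>k\<in>F. c k * (b (\<rho> k) * rmeas js (\<rho> k)))"
      unfolding pairing_diagonal(2)[OF js(1)] a_def mult.assoc
      by (subst sum_fam[OF S(1) finite_rects T(1)]) auto
    also have "\<dots> = (\<Sum>k\<in>F. b (\<rho> k) * (\<Sum>K\<in>?S k. x K * rmeas js K))"
    proof (rule sum.cong[OF refl])
      fix k
      have "c k * rmeas js (\<rho> k) = (\<Sum>K\<in>?S k. x K * rmeas js K)"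
        unfolding c_def sum_distrib_right using rmeas_pos[of js "\<rho> k"] by (intro sum.cong) auto
      then show "c k * (b (\<rho> k) * rmeas js (\<rho> k)) = b (\<rho> k) * (\<Sum>K\<in>?S k. x K * rmeas js K)"
        by (metis mult.left_commute)
    qed
    also have "\<dots> = (\<Sum>K\<in>rects js N. e K * (x K * rmeas js K))"
      unfolding e_def by (rule sum_fam[OF S(1) finite_rects S(2), symmetric])
    also have "\<dots> = (\<Sum>K\<in>rects js N. xx K * e K * rmeas js K)"
    proof (rule sum.cong[OF refl])
      fix K
      have "fam F ?S (\<lambda>k. 1) K * e K = e K"
      proof (cases "\<exists>k\<in>F. K \<in> ?S k")
        case True
        then obtain k where k: "k \<in> F" "K \<in> ?S k" by blast
        have "fam F ?S (\<lambda>k. 1) K = (\<Sum>l\<in>F. if l = k then 1 else 0)"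
          unfolding fam_def using S(3) k by (intro sum.cong) auto
        then show ?thesis using S(1) k by simp
      next
        case False
        then have "e K = 0" unfolding e_def fam_def by (intro sum.neutral) auto
        then show ?thesis by simp
      qed
      then show "e K * (x K * rmeas js K) = xx K * e K * rmeas js K"
        unfolding xx_def by (metis mult.assoc mult.commute)
    qed
    also have "\<dots> = mavg N js (\<lambda>\<tau>. hpoly js N xx \<tau> * hpoly js N e \<tau>) t"
      by (rule pairing_diagonal(2)[OF js(1), symmetric])
    also have "\<dots> \<le> dnorm N p js (hpoly js N xx) t * dnorm N (conj_exp p) js (hpoly js N e) t"
      by (rule dnorm_Holder) (rule p)
    also have "\<dots> \<le> dnorm N p js (hpoly js N xx) t * (C * 2 ^ length js)"
    proof (intro mult_left_mono dnorm_nonneg)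
      have "dnorm N (conj_exp p) js (hpoly js N e) t \<le> C * dnorm N (conj_exp p) js (hpoly js N b) t"
      proof (rule C(2), intro ballI)
        fix \<tau> assume "\<tau> \<in> pts N js t"
        then have "(\<Sum>K\<in>?S k. (ht js K \<tau>)\<^sup>2) = (ht js (\<rho> k) \<tau>)\<^sup>2" if "k \<in> F" for k
          by (intro sum_ht_sq_desc) (use A that len in \<open>auto simp: pts_def\<close>)
        then have "(\<Sum>k\<in>F. (b (\<rho> k))\<^sup>2 * (\<Sum>K\<in>?S k. (ht js K \<tau>)\<^sup>2)) = (\<Sum>k\<in>F. (b (\<rho> k) * ht js (\<rho> k) \<tau>)\<^sup>2)"
          by (intro sum.cong) (auto simp: power_mult_distrib)
        also have "\<dots> = (\<Sum>R\<in>\<rho> ` F. (b R * ht js R \<tau>)\<^sup>2)" using A by (simp add: sum.reindex)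
        also have "\<dots> \<le> (\<Sum>R\<in>rects js N. (b R * ht js R \<tau>)\<^sup>2)"
          using T(1) by (intro sum_mono2 finite_rects) auto
        also have "(\<Sum>k\<in>F. (b (\<rho> k))\<^sup>2 * (\<Sum>K\<in>?S k. (ht js K \<tau>)\<^sup>2)) = (sqf js N e \<tau>)\<^sup>2"
        proof -
          have "sqf js N e \<tau> = sqrt (\<Sum>k\<in>F. (b (\<rho> k))\<^sup>2 * (\<Sum>K\<in>?S k. (ht js K \<tau>)\<^sup>2))"
            unfolding e_def by (rule sqf_fam[OF S])
          then show ?thesis by (simp add: sum_nonneg)
        qed
        finally have "(sqf js N e \<tau>)\<^sup>2 \<le> (sqf js N b \<tau>)\<^sup>2"
          unfolding sqf_def[of js N b] by (simp add: sum_nonneg)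
        then show "sqf js N e \<tau> \<le> sqf js N b \<tau>" using sqf_nonneg by (rule power2_le_imp_le)
      qed
      also have "\<dots> \<le> C * 2 ^ length js" using b(1) C(1) by (intro mult_left_mono) auto
      finally show "dnorm N (conj_exp p) js (hpoly js N e) t \<le> C * 2 ^ length js" .
    qed
    finally have "dnorm N p js (hpoly js N a) t \<le> C * 2 ^ length js * dnorm N p js (hpoly js N xx) t"
      unfolding b(2) by (simp add: mult.commute)
    then show "dnorm N p js (\<lambda>\<tau>. \<Sum>k\<in>F. (\<Sum>K\<in>?S k. rmeas js K / rmeas js (\<rho> k) * x K) * ht js (\<rho> k) \<tau>) t \<le>
      C * 2 ^ length js * dnorm N p js (\<lambda>\<tau>. \<Sum>k\<in>F. \<Sum>K\<in>?S k. x K * ht js K \<tau>) t"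
      unfolding ha hx c_def .
  qed
qed

lemma l2_le_lr:
  fixes x :: "'i \<Rightarrow> real"
  assumes "finite I" "1 \<le> r" "r \<le> 2" "\<And>i. i \<in> I \<Longrightarrow> 0 \<le> x i"
  shows "sqrt (\<Sum>i\<in>I. (x i)\<^sup>2) \<le> (\<Sum>i\<in>I. x i powr r) powr (1 / r)"
proof -
  define S where "S = (\<Sum>i\<in>I. x i powr r) powr (1 / r)"
  have s0: "0 \<le> (\<Sum>i\<in>I. x i powr r)" by (intro sum_nonneg) auto
  have Sr: "S powr r = (\<Sum>i\<in>I. x i powr r)" using assms s0 by (simp add: S_def powr_powr)
  have S0: "0 \<le> S" by (simp add: S_def)
  have le: "x i \<le> S" if "i \<in> I" for i
  proof -
    have "x i powr r \<le> (\<Sum>i\<in>I. x i powr r)" using assms that by (intro member_le_sum) auto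
    then have "(x i powr r) powr (1 / r) \<le> S" unfolding S_def using assms by (intro powr_mono2) auto
    then show ?thesis using assms(2) assms(4)[OF that] by (simp add: powr_powr)
  qed
  have "(x i)\<^sup>2 \<le> x i powr r * S powr (2 - r)" if "i \<in> I" for i
  proof (cases "x i = 0")
    case False
    then have pos: "0 < x i" using assms(4)[OF that] by simp
    have "(x i)\<^sup>2 = x i powr r * x i powr (2 - r)"
      using pos by (simp add: powr_add[symmetric] powr_numeral)
    also have "\<dots> \<le> x i powr r * S powr (2 - r)"
      using pos le[OF that] assms by (intro mult_left_mono powr_mono2) auto
    finally show ?thesis .
  qed simp
  then have "(\<Sum>i\<in>I. (x i)\<^sup>2) \<le> (\<Sum>i\<in>I. x i powr r * S powr (2 - r))" by (rule sum_mono)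
  also have "\<dots> = S powr r * S powr (2 - r)" by (simp only: sum_distrib_right[symmetric] Sr)
  also have "\<dots> = S\<^sup>2" using S0 by (cases "S = 0") (auto simp: powr_add[symmetric] powr_numeral)
  finally show ?thesis unfolding S_def[symmetric] using S0 by (intro real_le_lsqrt) auto
qed

text \<open>The square function of a sum of polynomials with disjoint sets of rectangles is the \<open>\<ell>\<^sup>2\<close>-sum of
  their square functions, hence at most the \<open>\<ell>\<^sup>r\<close>-sum when \<open>r \<le> 2\<close>, and a mixed norm with all exponents at
  least \<open>r\<close> satisfies the triangle inequality for \<open>r\<close>-th powers.\<close>

lemma disjoint_sum_bound:
  assumes js: "distinct js" and p: "\<And>j. j \<in> set js \<Longrightarrow> 1 < p j"
    and r: "1 \<le> r" "r \<le> 2" "\<And>j. j \<in> set js \<Longrightarrow> r \<le> p j"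
  shows "\<exists>C\<ge>0. \<forall>N (I :: nat set) S x t. finite I \<and> (\<forall>i\<in>I. S i \<subseteq> rects js N) \<and>
      (\<forall>i\<in>I. \<forall>k\<in>I. i \<noteq> k \<longrightarrow> S i \<inter> S k = {}) \<and>
      (\<forall>i\<in>I. dnorm N p js (\<lambda>\<tau>. \<Sum>R\<in>S i. x R * ht js R \<tau>) t \<le> 1) \<longrightarrow>
    dnorm N p js (\<lambda>\<tau>. \<Sum>i\<in>I. \<Sum>R\<in>S i. x R * ht js R \<tau>) t \<le> C * real (card I) powr (1 / r)"
proof -
  have "\<exists>C\<ge>0. \<forall>N a t. dnorm N p js (sqf js N a) t \<le> C * dnorm N p js (hpoly js N a) t"
    using js p by (rule square_function_upper)
  then obtain C where C: "0 \<le> C" "\<And>N a t. dnorm N p js (sqf js N a) t \<le> C * dnorm N p js (hpoly js N a) t"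
    by blast
  have "\<exists>C\<ge>0. \<forall>N a t. dnorm N p js (hpoly js N a) t \<le> C * dnorm N p js (sqf js N a) t"
    using js p by (rule square_function_lower)
  then obtain D where D: "0 \<le> D" "\<And>N a t. dnorm N p js (hpoly js N a) t \<le> D * dnorm N p js (sqf js N a) t"
    by blast
  have p0: "0 < p j" if "j \<in> set js" for j using p[OF that] by simp
  show ?thesis
  proof (rule exI[of _ "D * C"], intro conjI allI impI)
    show "0 \<le> D * C" using C D by simp
  next
    fix N and I :: "nat set" and S and x :: "(nat \<Rightarrow> bool list) \<Rightarrow> real" and t
    assume A: "finite I \<and> (\<forall>i\<in>I. S i \<subseteq> rects js N) \<and> (\<forall>i\<in>I. \<forall>k\<in>I. i \<noteq> k \<longrightarrow> S i \<inter> S k = {}) \<and>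
      (\<forall>i\<in>I. dnorm N p js (\<lambda>\<tau>. \<Sum>R\<in>S i. x R * ht js R \<tau>) t \<le> 1)"
    define a where "a = (\<lambda>i R. if R \<in> S i then x R else 0)"
    define b where "b = (\<lambda>R. fam I S (\<lambda>i. 1) R * x R)"
    have ha: "hpoly js N (a i) = (\<lambda>\<tau>. \<Sum>R\<in>S i. x R * ht js R \<tau>)" if "i \<in> I" for i
    proof
      fix \<tau>
      have "rects js N \<inter> S i = S i" using A that by blast
      then show "hpoly js N (a i) \<tau> = (\<Sum>R\<in>S i. x R * ht js R \<tau>)"
        unfolding hpoly_def a_def using finite_rects[of js N]
        by (simp add: if_distrib[of "\<lambda>y. y * _"] sum.inter_restrict[symmetric] cong: if_cong)
    qed
    have SI: "finite I" "\<And>i. i \<in> I \<Longrightarrow> S i \<subseteq> rects js N" "\<And>k l. k \<in> I \<Longrightarrow> l \<in> I \<Longrightarrow> k \<noteq> l \<Longrightarrow> S k \<inter> S l = {}" using A by auto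
    have hb: "hpoly js N b = (\<lambda>\<tau>. \<Sum>i\<in>I. \<Sum>R\<in>S i. x R * ht js R \<tau>)"
      unfolding hpoly_def b_def mult.assoc by (intro ext, subst sum_fam[OF SI(1) finite_rects SI(2)]) auto
    have sqa: "(sqf js N (a i) \<tau>)\<^sup>2 = (\<Sum>R\<in>S i. (x R * ht js R \<tau>)\<^sup>2)" if "i \<in> I" for i \<tau>
    proof -
      have "rects js N \<inter> S i = S i" using A that by blast
      moreover have "(a i R * ht js R \<tau>)\<^sup>2 = (if R \<in> S i then (x R * ht js R \<tau>)\<^sup>2 else 0)" for R
        by (simp add: a_def)
      ultimately show ?thesis
        unfolding sqf_def using finite_rects[of js N]
        by (simp add: sum.inter_restrict[symmetric] sum_nonneg)
    qed
    have sqb: "sqf js N b \<tau> = sqrt (\<Sum>i\<in>I. (sqf js N (a i) \<tau>)\<^sup>2)" for \<tau>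
    proof -
      have "(b R * ht js R \<tau>)\<^sup>2 = fam I S (\<lambda>i. 1) R * (x R * ht js R \<tau>)\<^sup>2" for R
        using fam_power2[OF SI(1,3), where c = "\<lambda>i. 1" and K = R] by (simp add: b_def power_mult_distrib)
      then show ?thesis
        unfolding sqf_def[of js N b] by (simp add: sum_fam[OF SI(1) finite_rects SI(2)] sqa)
    qed
    have "dnorm N p js (sqf js N b) t \<le> dnorm N p js (\<lambda>\<tau>. (\<Sum>i\<in>I. \<bar>sqf js N (a i) \<tau>\<bar> powr r) powr (1 / r)) t"
    proof (rule dnorm_mono[OF p0])
      fix \<tau>
      show "\<bar>sqf js N b \<tau>\<bar> \<le> \<bar>(\<Sum>i\<in>I. \<bar>sqf js N (a i) \<tau>\<bar> powr r) powr (1 / r)\<bar>"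
        using l2_le_lr[OF SI(1) r(1,2), of "\<lambda>i. sqf js N (a i) \<tau>"] sqf_nonneg
        by (simp add: sqb sum_nonneg)
    qed
    also have "\<dots> \<le> (\<Sum>i\<in>I. dnorm N p js (sqf js N (a i)) t powr r) powr (1 / r)"
      by (rule dnorm_power_sum[OF r(3) r(1)])
    also have "\<dots> \<le> (\<Sum>i\<in>I. C powr r) powr (1 / r)"
    proof (intro powr_mono2 sum_mono)
      fix i assume i: "i \<in> I"
      have "dnorm N p js (sqf js N (a i)) t \<le> C * dnorm N p js (hpoly js N (a i)) t" by (rule C(2))
      also have "\<dots> \<le> C * 1" using A i C(1) unfolding ha[OF i] by (intro mult_left_mono) auto
      finally show "dnorm N p js (sqf js N (a i)) t \<le> C" by simp
    qed (use r in \<open>auto intro: sum_nonneg dnorm_nonneg\<close>)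
    also have "\<dots> = C * real (card I) powr (1 / r)"
      using C(1) r by (simp add: powr_mult powr_powr)
    finally have "dnorm N p js (sqf js N b) t \<le> C * real (card I) powr (1 / r)" .
    then have "D * dnorm N p js (sqf js N b) t \<le> D * (C * real (card I) powr (1 / r))"
      using D(1) by (rule mult_left_mono)
    then show "dnorm N p js (\<lambda>\<tau>. \<Sum>i\<in>I. \<Sum>R\<in>S i. x R * ht js R \<tau>) t \<le> D * C * real (card I) powr (1 / r)"
      using D(2)[of N b t] unfolding hb by simp
  qed
qed

section \<open>Powers in the extended half-line\<close>

lemma epow_ennreal: "0 \<le> x \<Longrightarrow> ennreal_powr (ennreal x) r = ennreal (x powr r)"
  by (simp add: ennreal_powr_def)

lemma epow_top [simp]: "ennreal_powr top r = top"
  by (simp add: ennreal_powr_def)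

lemma epow_0 [simp]: "ennreal_powr 0 r = 0"
  by (simp add: ennreal_powr_def)

lemma epow_mono: "0 \<le> r \<Longrightarrow> x \<le> y \<Longrightarrow> ennreal_powr x r \<le> ennreal_powr y r"
  by (cases x; cases y) (auto simp: epow_ennreal top_unique intro!: ennreal_leI powr_mono2)

lemma epow_epow: "ennreal_powr (ennreal_powr x r) s = ennreal_powr x (r * s)"
  by (cases x) (auto simp: epow_ennreal powr_powr)

lemma epow_1 [simp]: "ennreal_powr x 1 = x"
  by (cases x) (auto simp: epow_ennreal)

lemma epow_one [simp]: "ennreal_powr 1 r = 1"
  using epow_ennreal[of 1 r] by simp

lemma epow_eq_0 [simp]: "ennreal_powr x r = 0 \<longleftrightarrow> x = 0"
  by (cases x) (auto simp: epow_ennreal)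

lemma epow_eq_top [simp]: "ennreal_powr x r = top \<longleftrightarrow> x = top"
  by (cases x) (auto simp: epow_ennreal)

lemma epow_less_top [simp]: "ennreal_powr x r < top \<longleftrightarrow> x < top"
  by (metis epow_eq_top less_top)

lemma epow_mult: "ennreal_powr (x * y) r = ennreal_powr x r * ennreal_powr y r"
proof (cases x; cases y)
  fix a b :: real assume "0 \<le> a" "x = ennreal a" "0 \<le> b" "y = ennreal b"
  then show ?thesis by (simp add: epow_ennreal powr_mult flip: ennreal_mult)
next
  fix a :: real assume a: "0 \<le> a" "x = ennreal a" "y = top"
  then show ?thesis by (cases "a = 0") (auto simp: ennreal_mult_top epow_ennreal)
next
  fix a :: real assume a: "x = top" "0 \<le> a" "y = ennreal a"
  then show ?thesis by (cases "a = 0") (auto simp: ennreal_top_mult epow_ennreal)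
qed (auto simp: ennreal_mult_top)

lemma epow_le_iff: "0 < r \<Longrightarrow> ennreal_powr x r \<le> y \<longleftrightarrow> x \<le> ennreal_powr y (1 / r)"
  using epow_mono[of "1 / r" "ennreal_powr x r" y] epow_mono[of r x "ennreal_powr y (1 / r)"]
  by (auto simp: epow_epow)

lemma le_epow_iff: "0 < r \<Longrightarrow> y \<le> ennreal_powr x r \<longleftrightarrow> ennreal_powr y (1 / r) \<le> x"
  using epow_mono[of "1 / r" y "ennreal_powr x r"] epow_mono[of r "ennreal_powr y (1 / r)" x]
  by (auto simp: epow_epow)

lemma epow_SUP: "0 < r \<Longrightarrow> ennreal_powr (SUP n. f n) r = (SUP n. ennreal_powr (f n) r)"
proof (rule antisym)
  assume r: "0 < r"
  have "f n \<le> ennreal_powr (SUP n. ennreal_powr (f n) r) (1 / r)" for n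
    unfolding epow_le_iff[OF r, symmetric] by (rule SUP_upper) simp
  then show "ennreal_powr (SUP n. f n) r \<le> (SUP n. ennreal_powr (f n) r)"
    unfolding epow_le_iff[OF r] by (intro SUP_least)
  show "(SUP n. ennreal_powr (f n) r) \<le> ennreal_powr (SUP n. f n) r"
    using r by (intro SUP_least epow_mono SUP_upper) auto
qed

lemma epow_INF: "0 < r \<Longrightarrow> ennreal_powr (INF n. f n) r = (INF n. ennreal_powr (f n) r)"
proof (rule antisym)
  assume r: "0 < r"
  show "ennreal_powr (INF n. f n) r \<le> (INF n. ennreal_powr (f n) r)"
    using r by (intro INF_greatest epow_mono INF_lower) auto
  have "ennreal_powr (INF n. ennreal_powr (f n) r) (1 / r) \<le> f n" for n
    unfolding le_epow_iff[OF r, symmetric] by (rule INF_lower) simp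
  then show "(INF n. ennreal_powr (f n) r) \<le> ennreal_powr (INF n. f n) r"
    unfolding le_epow_iff[OF r] by (intro INF_greatest)
qed

lemma measurable_epow [measurable]:
  assumes [measurable]: "f \<in> borel_measurable M"
  shows "(\<lambda>x. ennreal_powr (f x) r) \<in> borel_measurable M"
  unfolding ennreal_powr_def by measurable

lemma ennreal_lin_comb:
  "0 \<le> c0 \<Longrightarrow> 0 \<le> c1 \<Longrightarrow> 0 \<le> c2 \<Longrightarrow> 0 \<le> u \<Longrightarrow> 0 \<le> v \<Longrightarrow>
    ennreal (c0 * (c1 * u + c2 * v)) = ennreal c0 * (ennreal c1 * ennreal u + ennreal c2 * ennreal v)"
  by (simp add: ennreal_mult)

lemma epow_Young:
  assumes p: "1 < p" "1 < q" "1 / p + 1 / q = 1" and ab: "0 < a" "0 < b"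
  shows "x * y \<le> ennreal (a * b) * (ennreal (1 / (p * a powr p)) * ennreal_powr x p + ennreal (1 / (q * b powr q)) * ennreal_powr y q)"
proof -
  have pos: "0 < 1 / (p * a powr p)" "0 < 1 / (q * b powr q)" "0 < a * b" using p ab by auto
  have top: "z \<le> ennreal c0 * (ennreal c1 * ennreal_powr x p + ennreal c2 * ennreal_powr y q)"
    if "x = top \<or> y = top" "0 < c0" "0 < c1" "0 < c2" for c0 c1 c2 z
    using that by (auto simp: ennreal_mult_top ennreal_eq_0_iff)
  consider "x = top \<or> y = top" | "x \<noteq> top" "y \<noteq> top" by blast
  then show ?thesis
  proof cases
    case 1
    then show ?thesis using pos by (intro top)
  next
    case 2
    note 3 = 2
    obtain u where u: "0 \<le> u" "x = ennreal u" using 3 by (cases x) auto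
    obtain v where v: "0 \<le> v" "y = ennreal v" using 3 by (cases y) auto
    have "(u / a) * (v / b) \<le> (u / a) powr p / p + (v / b) powr q / q"
      using p ab u v by (intro Youngs_inequality) auto
    then have "(a * b) * ((u / a) * (v / b)) \<le> (a * b) * ((u / a) powr p / p + (v / b) powr q / q)"
      using ab by (intro mult_left_mono) auto
    then have "u * v \<le> (a * b) * (1 / (p * a powr p) * u powr p + 1 / (q * b powr q) * v powr q)"
      using ab u v by (simp add: powr_divide mult.commute)
    then have "ennreal (u * v) \<le> ennreal ((a * b) * (1 / (p * a powr p) * u powr p + 1 / (q * b powr q) * v powr q))"
      by (rule ennreal_leI)
    also have "\<dots> = ennreal (a * b) * (ennreal (1 / (p * a powr p)) * ennreal (u powr p) + ennreal (1 / (q * b powr q)) * ennreal (v powr q))"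
      using pos by (intro ennreal_lin_comb) auto
    finally show ?thesis using u v by (simp add: epow_ennreal ennreal_mult)
  qed
qed

lemma nn_Holder:
  assumes p: "1 < p" "1 < q" "1 / p + 1 / q = 1"
    and [measurable]: "u \<in> borel_measurable M" "v \<in> borel_measurable M"
  shows "(\<integral>\<^sup>+ x. u x * v x \<partial>M) \<le> ennreal_powr (\<integral>\<^sup>+ x. ennreal_powr (u x) p \<partial>M) (1 / p) * ennreal_powr (\<integral>\<^sup>+ x. ennreal_powr (v x) q \<partial>M) (1 / q)"
proof -
  define A where "A = (\<integral>\<^sup>+ x. ennreal_powr (u x) p \<partial>M)"
  define B where "B = (\<integral>\<^sup>+ x. ennreal_powr (v x) q \<partial>M)"
  consider "A = 0 \<or> B = 0" | "A \<noteq> 0" "B \<noteq> 0" "A = top \<or> B = top" | "A \<noteq> 0" "B \<noteq> 0" "A \<noteq> top" "B \<noteq> top" by blast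
  then show ?thesis
  proof cases
    case 1
    then have "(AE x in M. u x = 0) \<or> (AE x in M. v x = 0)"
      unfolding A_def B_def by (simp add: nn_integral_0_iff_AE)
    then have "AE x in M. u x * v x = 0" by auto
    then have "(\<integral>\<^sup>+ x. u x * v x \<partial>M) = (\<integral>\<^sup>+ x. 0 \<partial>M)" by (rule nn_integral_cong_AE)
    then show ?thesis by simp
  next
    case 2
    then have "ennreal_powr A (1 / p) * ennreal_powr B (1 / q) = top" by (auto simp: ennreal_mult_eq_top_iff)
    then show ?thesis by (simp add: A_def B_def)
  next
    case 3
    obtain A' where A': "0 < A'" "A = ennreal A'" using 3 by (cases A) (auto simp: zero_less_iff_neq_zero less_le)
    obtain B' where B': "0 < B'" "B = ennreal B'" using 3 by (cases B) (auto simp: zero_less_iff_neq_zero less_le)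
    define a where "a = A' powr (1 / p)"
    define b where "b = B' powr (1 / q)"
    have ab: "0 < a" "0 < b" "a powr p = A'" "b powr q = B'" using A' B' p by (auto simp: a_def b_def powr_powr)
    have "(\<integral>\<^sup>+ x. u x * v x \<partial>M) \<le> (\<integral>\<^sup>+ x. ennreal (a * b) * (ennreal (1 / (p * a powr p)) * ennreal_powr (u x) p + ennreal (1 / (q * b powr q)) * ennreal_powr (v x) q) \<partial>M)"
      by (intro nn_integral_mono epow_Young p ab)
    also have "\<dots> = ennreal (a * b) * (ennreal (1 / (p * a powr p)) * A + ennreal (1 / (q * b powr q)) * B)"
      by (simp add: nn_integral_cmult nn_integral_add A_def B_def)
    also have "\<dots> = ennreal ((a * b) * (1 / (p * A') * A' + 1 / (q * B') * B'))"
      using A' B' ab p by (simp add: ennreal_mult[symmetric] ennreal_plus[symmetric] del: ennreal_plus)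
    also have "(a * b) * (1 / (p * A') * A' + 1 / (q * B') * B') = a * b" using A' B' p by simp
    also have "ennreal (a * b) = ennreal_powr A (1 / p) * ennreal_powr B (1 / q)"
      using A' B' by (simp add: epow_ennreal a_def b_def ennreal_mult)
    finally show ?thesis by (simp add: A_def B_def)
  qed
qed

lemma epow_convex:
  assumes p: "1 \<le> p" and ab: "0 < a" "0 < b"
  shows "ennreal_powr (x + y) p \<le> ennreal ((a + b) powr (p - 1)) * (ennreal (a powr (1 - p)) * ennreal_powr x p + ennreal (b powr (1 - p)) * ennreal_powr y p)"
proof -
  have pos: "0 < a powr (1 - p)" "0 < b powr (1 - p)" "0 < (a + b) powr (p - 1)" using ab by auto
  consider "x = top" | "y = top" | "x \<noteq> top" "y \<noteq> top" by blast
  then show ?thesis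
  proof cases
    case 1
    then show ?thesis using pos by (simp add: ennreal_mult_top)
  next
    case 2
    then show ?thesis using pos by (simp add: ennreal_mult_top)
  next
    case 3
    obtain u where u: "0 \<le> u" "x = ennreal u" using 3 by (cases x) auto
    obtain v where v: "0 \<le> v" "y = ennreal v" using 3 by (cases y) auto
    define t where "t = b / (a + b)"
    have t: "0 \<le> t" "t \<le> 1" "1 - t = a / (a + b)" using ab by (auto simp: t_def field_simps)
    have "(u + v) / (a + b) = (1 - t) * (u / a) + t * (v / b)"
      unfolding t(3) unfolding t_def using ab by (simp add: add_divide_distrib)
    then have "((u + v) / (a + b)) powr p \<le> (1 - t) * (u / a) powr p + t * (v / b) powr p"
      using powr_convex_comb[of "u / a" "v / b" p t] ab u v p t by simp
    then have "(a + b) powr p * ((u + v) / (a + b)) powr p \<le> (a + b) powr p * ((1 - t) * (u / a) powr p + t * (v / b) powr p)"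
      by (intro mult_left_mono) auto
    moreover have "(a + b) powr p * ((u + v) / (a + b)) powr p = (u + v) powr p"
      using ab u v by (simp add: powr_divide)
    moreover have "(a + b) powr p * ((1 - t) * (u / a) powr p + t * (v / b) powr p)
      = (a + b) powr (p - 1) * (a powr (1 - p) * u powr p + b powr (1 - p) * v powr p)"
    proof -
      have "(a + b) powr (p - 1) = (a + b) powr p / (a + b)" "a powr (1 - p) = a / a powr p" "b powr (1 - p) = b / b powr p"
        using ab by (auto simp: powr_diff)
      moreover have "(u / a) powr p = u powr p / a powr p" "(v / b) powr p = v powr p / b powr p"
        using ab u v by (auto simp: powr_divide)
      ultimately show ?thesis unfolding t(3) by (simp add: t_def distrib_left mult_ac)
    qed
    ultimately have "ennreal ((u + v) powr p) \<le> ennreal ((a + b) powr (p - 1) * (a powr (1 - p) * u powr p + b powr (1 - p) * v powr p))"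
      by (intro ennreal_leI) simp
    also have "\<dots> = ennreal ((a + b) powr (p - 1)) * (ennreal (a powr (1 - p)) * ennreal (u powr p) + ennreal (b powr (1 - p)) * ennreal (v powr p))"
      by (intro ennreal_lin_comb) auto
    finally show ?thesis using u v by (simp add: epow_ennreal ennreal_plus[symmetric] del: ennreal_plus)
  qed
qed

lemma nn_Minkowski:
  assumes p: "1 \<le> p" and [measurable]: "u \<in> borel_measurable M" "v \<in> borel_measurable M"
  shows "ennreal_powr (\<integral>\<^sup>+ x. ennreal_powr (u x + v x) p \<partial>M) (1 / p)
    \<le> ennreal_powr (\<integral>\<^sup>+ x. ennreal_powr (u x) p \<partial>M) (1 / p) + ennreal_powr (\<integral>\<^sup>+ x. ennreal_powr (v x) p \<partial>M) (1 / p)"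
    (is "?L \<le> ?a + ?b")
proof (cases "?a = top \<or> ?b = top")
  case False
  define A where "A = (\<integral>\<^sup>+ x. ennreal_powr (u x) p \<partial>M)"
  define B where "B = (\<integral>\<^sup>+ x. ennreal_powr (v x) p \<partial>M)"
  have "A \<noteq> top" "B \<noteq> top" using False by (auto simp: A_def B_def)
  obtain A' where A': "0 \<le> A'" "A = ennreal A'" using \<open>A \<noteq> top\<close> by (cases A) auto
  obtain B' where B': "0 \<le> B'" "B = ennreal B'" using \<open>B \<noteq> top\<close> by (cases B) auto
  show ?thesis
  proof (rule ennreal_le_epsilon)
    fix e :: real assume e: "0 < e"
    define a where "a = A' powr (1 / p) + e / 2"
    define b where "b = B' powr (1 / p) + e / 2"
    have ab: "0 < a" "0 < b" using e by (auto simp: a_def b_def intro: add_nonneg_pos)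
    have Aa: "A' \<le> a powr p"
    proof -
      have "(A' powr (1 / p)) powr p \<le> a powr p" using p e by (intro powr_mono2) (auto simp: a_def)
      then show ?thesis using p A' by (simp add: powr_powr)
    qed
    have Bb: "B' \<le> b powr p"
    proof -
      have "(B' powr (1 / p)) powr p \<le> b powr p" using p e by (intro powr_mono2) (auto simp: b_def)
      then show ?thesis using p B' by (simp add: powr_powr)
    qed
    have "(\<integral>\<^sup>+ x. ennreal_powr (u x + v x) p \<partial>M) \<le>
      (\<integral>\<^sup>+ x. ennreal ((a + b) powr (p - 1)) * (ennreal (a powr (1 - p)) * ennreal_powr (u x) p + ennreal (b powr (1 - p)) * ennreal_powr (v x) p) \<partial>M)"
      by (intro nn_integral_mono epow_convex p ab)
    also have "\<dots> = ennreal ((a + b) powr (p - 1)) * (ennreal (a powr (1 - p)) * A + ennreal (b powr (1 - p)) * B)"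
      by (simp add: nn_integral_cmult nn_integral_add A_def B_def)
    also have "\<dots> = ennreal ((a + b) powr (p - 1) * (a powr (1 - p) * A' + b powr (1 - p) * B'))"
      using A' B' by (simp add: ennreal_mult)
    also have "\<dots> \<le> ennreal ((a + b) powr p)"
    proof (rule ennreal_leI)
      have "a powr (1 - p) * A' \<le> a powr (1 - p) * a powr p" using Aa by (intro mult_left_mono) auto
      also have "\<dots> = a" using ab by (simp add: powr_add[symmetric])
      finally have 1: "a powr (1 - p) * A' \<le> a" .
      have "b powr (1 - p) * B' \<le> b powr (1 - p) * b powr p" using Bb by (intro mult_left_mono) auto
      also have "\<dots> = b" using ab by (simp add: powr_add[symmetric])
      finally have 2: "b powr (1 - p) * B' \<le> b" .
      have "(a + b) powr (p - 1) * (a powr (1 - p) * A' + b powr (1 - p) * B') \<le> (a + b) powr (p - 1) * (a + b)"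
        using 1 2 by (intro mult_left_mono) auto
      also have "\<dots> = (a + b) powr p" using ab by (simp add: powr_diff)
      finally show "(a + b) powr (p - 1) * (a powr (1 - p) * A' + b powr (1 - p) * B') \<le> (a + b) powr p" .
    qed
    finally have "?L \<le> ennreal_powr (ennreal ((a + b) powr p)) (1 / p)" using p by (intro epow_mono) auto
    also have "\<dots> = ennreal (a + b)" using ab p by (simp add: epow_ennreal powr_powr)
    also have "\<dots> = ennreal (A' powr (1 / p)) + ennreal (B' powr (1 / p)) + ennreal e"
      using e by (simp add: a_def b_def ennreal_plus[symmetric] del: ennreal_plus)
    also have "\<dots> = ?a + ?b + ennreal e" using A' B' by (simp add: epow_ennreal flip: A_def B_def)
    finally show "?L \<le> ?a + ?b + ennreal e" .
  qed
qed auto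

section \<open>Mixed norms of nonnegative measurable functions\<close>

lemma space_unit_measure [simp]: "space unit_measure = {0..1}"
  by (simp add: unit_measure_def space_restrict_space)

lemma emeasure_unit_measure [simp]: "emeasure unit_measure {0..1} = 1"
  by (simp add: unit_measure_def emeasure_restrict_space)

interpretation unitm: finite_measure unit_measure
  by (rule finite_measureI) simp

interpretation cubes: product_sigma_finite "\<lambda>_::nat. unit_measure"
  by (rule product_sigma_finite.intro) (rule unitm.sigma_finite_measure_axioms)

text \<open>The iterated norm for functions with values in \<open>[0,\<infinity>]\<close>, for which monotone limits are
  available.\<close>

primrec itn :: "(nat \<Rightarrow> real) \<Rightarrow> nat list \<Rightarrow> ((nat \<Rightarrow> real) \<Rightarrow> ennreal) \<Rightarrow> (nat \<Rightarrow> real) \<Rightarrow> ennreal" where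
  "itn p [] g t = g t"
| "itn p (j # js) g t =
    ennreal_powr (\<integral>\<^sup>+ s. ennreal_powr (itn p js g (t(j := s))) (p j) \<partial>unit_measure) (1 / p j)"

lemma iterated_norm_eq_itn: "iterated_norm p js f t = itn p js (\<lambda>x. ennreal \<bar>f x\<bar>) t"
  by (induction js arbitrary: t) auto

lemma measurable_itn:
  assumes "distinct js" "set js \<subseteq> K" "g \<in> borel_measurable (cube_measure K)"
  shows "itn p js g \<in> borel_measurable (cube_measure (K - set js))"
  using assms
proof (induction js)
  case (Cons j js)
  let ?K = "K - set (j # js)"
  have K: "K - set js = insert j ?K" using Cons.prems by auto
  have [measurable]: "itn p js g \<in> borel_measurable (Pi\<^sub>M (insert j ?K) (\<lambda>_. unit_measure))"
    using Cons K by (auto simp: cube_measure_def)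
  have "(\<lambda>t. ennreal_powr (\<integral>\<^sup>+ s. ennreal_powr (itn p js g (t(j := s))) (p j) \<partial>unit_measure) (1 / p j))
    \<in> borel_measurable (Pi\<^sub>M ?K (\<lambda>_. unit_measure))" by measurable
  moreover have "itn p (j # js) g = (\<lambda>t. ennreal_powr (\<integral>\<^sup>+ s. ennreal_powr (itn p js g (t(j := s))) (p j) \<partial>unit_measure) (1 / p j))"
    by (rule ext) simp
  ultimately show ?case unfolding cube_measure_def by simp
next
  case Nil
  have "itn p [] g = g" by (rule ext) simp
  then show ?case using Nil by simp
qed

lemma measurable_itn_slice:
  assumes "distinct (j # js)" "set (j # js) \<subseteq> K" "g \<in> borel_measurable (cube_measure K)"
    and t: "t \<in> space (cube_measure (K - set (j # js)))"
  shows "(\<lambda>s. itn p js g (t(j := s))) \<in> borel_measurable unit_measure"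
proof -
  let ?K = "K - set (j # js)"
  have K: "K - set js = insert j ?K" using assms(1,2) by auto
  have "itn p js g \<in> borel_measurable (Pi\<^sub>M (insert j ?K) (\<lambda>_. unit_measure))"
    using measurable_itn[of js K g p] assms K by (simp add: cube_measure_def)
  moreover have "(\<lambda>s. t(j := s)) \<in> measurable unit_measure (Pi\<^sub>M (insert j ?K) (\<lambda>_. unit_measure))"
    using t by (intro measurable_component_update) (auto simp: cube_measure_def)
  ultimately show ?thesis by (rule measurable_compose[rotated])
qed

lemma space_cube_upd:
  assumes "distinct (j # js)" "set (j # js) \<subseteq> K" "t \<in> space (cube_measure (K - set (j # js)))" "s \<in> {0..1}"
  shows "t(j := s) \<in> space (cube_measure (K - set js))"
proof -
  have K: "K - set js = insert j (K - set (j # js))" using assms(1,2) by auto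
  show ?thesis unfolding K using assms(3,4)
    by (auto simp: cube_measure_def space_PiM PiE_def extensional_def)
qed

lemma itn_mono: "(\<And>j. j \<in> set js \<Longrightarrow> 0 < p j) \<Longrightarrow> (\<And>x. g x \<le> h x) \<Longrightarrow> itn p js g t \<le> itn p js h t"
proof (induction js arbitrary: t)
  case (Cons j js)
  have "0 < p j" using Cons.prems by simp
  moreover have "itn p js g t \<le> itn p js h t" for t using Cons by simp
  ultimately show ?case by (auto intro!: epow_mono nn_integral_mono)
qed simp

lemma itn_add:
  assumes "distinct js" "set js \<subseteq> K" "g \<in> borel_measurable (cube_measure K)" "h \<in> borel_measurable (cube_measure K)"
    and "\<And>j. j \<in> set js \<Longrightarrow> 1 \<le> p j"
  shows "t \<in> space (cube_measure (K - set js)) \<Longrightarrow> itn p js (\<lambda>x. g x + h x) t \<le> itn p js g t + itn p js h t"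
  using assms
proof (induction js arbitrary: t)
  case (Cons j js)
  have pj: "1 \<le> p j" using Cons.prems by simp
  note [measurable] = measurable_itn_slice[OF Cons.prems(2,3,4,1)] measurable_itn_slice[OF Cons.prems(2,3,5,1)]
  have "itn p (j # js) (\<lambda>x. g x + h x) t \<le> ennreal_powr (\<integral>\<^sup>+ s. ennreal_powr (itn p js g (t(j := s)) + itn p js h (t(j := s))) (p j) \<partial>unit_measure) (1 / p j)"
    unfolding itn.simps
  proof (intro epow_mono nn_integral_mono)
    fix s assume "s \<in> space unit_measure"
    then have "t(j := s) \<in> space (cube_measure (K - set js))" using space_cube_upd[OF Cons.prems(2,3,1)] by simp
    then show "itn p js (\<lambda>x. g x + h x) (t(j := s)) \<le> itn p js g (t(j := s)) + itn p js h (t(j := s))"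
      using Cons.prems by (intro Cons.IH) (auto simp del: fun_upd_apply)
  qed (use pj in auto)
  also have "\<dots> \<le> itn p (j # js) g t + itn p (j # js) h t"
    unfolding itn.simps by (rule nn_Minkowski[OF pj]) measurable
  finally show ?case .
qed simp

lemma itn_cmult:
  assumes "distinct js" "set js \<subseteq> K" "g \<in> borel_measurable (cube_measure K)"
    and "\<And>j. j \<in> set js \<Longrightarrow> 0 < p j"
  shows "t \<in> space (cube_measure (K - set js)) \<Longrightarrow> itn p js (\<lambda>x. c * g x) t = c * itn p js g t"
  using assms
proof (induction js arbitrary: t)
  case (Cons j js)
  have pj: "0 < p j" using Cons.prems by simp
  note [measurable] = measurable_itn_slice[OF Cons.prems(2,3,4,1)]
  have "itn p (j # js) (\<lambda>x. c * g x) t = ennreal_powr (\<integral>\<^sup>+ s. ennreal_powr c (p j) * ennreal_powr (itn p js g (t(j := s))) (p j) \<partial>unit_measure) (1 / p j)"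
    unfolding itn.simps
  proof (intro arg_cong2[where f = ennreal_powr] nn_integral_cong refl)
    fix s assume "s \<in> space unit_measure"
    then have "t(j := s) \<in> space (cube_measure (K - set js))" using space_cube_upd[OF Cons.prems(2,3,1)] by simp
    then have "itn p js (\<lambda>x. c * g x) (t(j := s)) = c * itn p js g (t(j := s))"
      using Cons.prems by (intro Cons.IH) (auto simp del: fun_upd_apply)
    then show "ennreal_powr (itn p js (\<lambda>x. c * g x) (t(j := s))) (p j) = ennreal_powr c (p j) * ennreal_powr (itn p js g (t(j := s))) (p j)"
      by (simp add: epow_mult)
  qed
  also have "\<dots> = c * itn p (j # js) g t"
    using pj by (simp add: nn_integral_cmult epow_mult epow_epow)
  finally show ?case .
qed simp

lemma itn_SUP:
  assumes "distinct js" "set js \<subseteq> K" "\<And>n. g n \<in> borel_measurable (cube_measure K)"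
    and "\<And>j. j \<in> set js \<Longrightarrow> 0 < p j" and "\<And>x. incseq (\<lambda>n. g n x)"
  shows "t \<in> space (cube_measure (K - set js)) \<Longrightarrow> itn p js (\<lambda>x. SUP n. g n x) t = (SUP n. itn p js (g n) t)"
  using assms(1-4)
proof (induction js arbitrary: t)
  case (Cons j js)
  have pj: "0 < p j" using Cons.prems by simp
  have [measurable]: "\<And>n. (\<lambda>s. itn p js (g n) (t(j := s))) \<in> borel_measurable unit_measure"
    by (rule measurable_itn_slice[OF Cons.prems(2,3,4,1)])
  have inc: "incseq (\<lambda>n s. ennreal_powr (itn p js (g n) (t(j := s))) (p j))"
  proof (rule incseq_SucI, rule le_funI)
    fix n s
    have "itn p js (g n) (t(j := s)) \<le> itn p js (g (Suc n)) (t(j := s))"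
      by (rule itn_mono) (use Cons.prems(5) assms(5) in \<open>auto simp: incseq_Suc_iff\<close>)
    then show "ennreal_powr (itn p js (g n) (t(j := s))) (p j) \<le> ennreal_powr (itn p js (g (Suc n)) (t(j := s))) (p j)"
      using pj by (intro epow_mono) auto
  qed
  have "itn p (j # js) (\<lambda>x. SUP n. g n x) t = ennreal_powr (\<integral>\<^sup>+ s. (SUP n. ennreal_powr (itn p js (g n) (t(j := s))) (p j)) \<partial>unit_measure) (1 / p j)"
    unfolding itn.simps
  proof (intro arg_cong2[where f = ennreal_powr] nn_integral_cong refl)
    fix s assume "s \<in> space unit_measure"
    then have "t(j := s) \<in> space (cube_measure (K - set js))" using space_cube_upd[OF Cons.prems(2,3,1)] by simp
    then have "itn p js (\<lambda>x. SUP n. g n x) (t(j := s)) = (SUP n. itn p js (g n) (t(j := s)))"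
      using Cons.prems by (intro Cons.IH) (auto simp del: fun_upd_apply)
    then show "ennreal_powr (itn p js (\<lambda>x. SUP n. g n x) (t(j := s))) (p j) = (SUP n. ennreal_powr (itn p js (g n) (t(j := s))) (p j))"
      by (simp add: epow_SUP[OF pj])
  qed
  also have "(\<integral>\<^sup>+ s. (SUP n. ennreal_powr (itn p js (g n) (t(j := s))) (p j)) \<partial>unit_measure)
    = (SUP n. \<integral>\<^sup>+ s. ennreal_powr (itn p js (g n) (t(j := s))) (p j) \<partial>unit_measure)"
    by (rule nn_integral_monotone_convergence_SUP[OF inc]) measurable
  also have "ennreal_powr \<dots> (1 / p j) = (SUP n. itn p (j # js) (g n) t)"
    using pj by (simp add: epow_SUP)
  finally show ?case .
qed simp

lemma itn_INF_zero:
  assumes "distinct js" "set js \<subseteq> K" "\<And>n. g n \<in> borel_measurable (cube_measure K)"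
    and "\<And>j. j \<in> set js \<Longrightarrow> 0 < p j" and "\<And>x. decseq (\<lambda>n. g n x)" and "\<And>x. (INF n. g n x) = 0"
  shows "t \<in> space (cube_measure (K - set js)) \<Longrightarrow> itn p js (g 0) t < top \<Longrightarrow> (INF n. itn p js (g n) t) = 0"
  using assms(1-4)
proof (induction js arbitrary: t)
  case Nil
  then show ?case using assms(6) by simp
next
  case (Cons j js)
  have pj: "0 < p j" using Cons.prems by simp
  have m [measurable]: "\<And>n. (\<lambda>s. itn p js (g n) (t(j := s))) \<in> borel_measurable unit_measure"
    by (rule measurable_itn_slice[OF Cons.prems(3,4,5,1)])
  let ?u = "\<lambda>n s. ennreal_powr (itn p js (g n) (t(j := s))) (p j)"
  have dec: "decseq (\<lambda>n. ?u n s)" for s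
  proof (rule decseq_SucI)
    fix n
    have "itn p js (g (Suc n)) (t(j := s)) \<le> itn p js (g n) (t(j := s))"
      by (rule itn_mono) (use Cons.prems(6) assms(5) in \<open>auto simp: decseq_Suc_iff\<close>)
    then show "?u (Suc n) s \<le> ?u n s"
      using pj by (intro epow_mono) auto
  qed
  have fin: "(\<integral>\<^sup>+ s. ?u 0 s \<partial>unit_measure) < top" using Cons.prems(2) by simp
  have "AE s in unit_measure. ?u 0 s \<noteq> \<infinity>"
    by (rule nn_integral_noteq_infinite) (use fin in \<open>auto simp: less_top\<close>)
  then have z: "AE s in unit_measure. (INF n. ?u n s) = 0"
  proof (rule AE_mp, intro AE_I2 impI)
    fix s assume s: "s \<in> space unit_measure" "?u 0 s \<noteq> \<infinity>"
    have "t(j := s) \<in> space (cube_measure (K - set js))" using space_cube_upd[OF Cons.prems(3,4,1)] s by simp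
    then have "(INF n. itn p js (g n) (t(j := s))) = 0"
      using Cons.prems s by (intro Cons.IH) (auto simp: less_top simp del: fun_upd_apply)
    then show "(INF n. ?u n s) = 0" by (simp add: epow_INF[OF pj, symmetric])
  qed
  have dec2: "decseq ?u"
    by (rule decseq_SucI, rule le_funI) (rule dec[THEN decseq_SucD])
  have "(INF n. \<integral>\<^sup>+ s. ?u n s \<partial>unit_measure) = (\<integral>\<^sup>+ s. (INF n. ?u n s) \<partial>unit_measure)"
    by (rule nn_integral_monotone_convergence_INF_decseq[symmetric, where i = 0])
       (use fin dec2 in auto)
  also have "\<dots> = 0" using z by (subst nn_integral_0_iff_AE) auto
  finally have "(INF n. \<integral>\<^sup>+ s. ?u n s \<partial>unit_measure) = 0" .
  then show ?case using pj by (simp add: epow_INF[symmetric])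
qed

lemma itn_Holder:
  assumes "distinct js" "set js \<subseteq> K" "g \<in> borel_measurable (cube_measure K)" "h \<in> borel_measurable (cube_measure K)"
    and "\<And>j. j \<in> set js \<Longrightarrow> 1 < p j"
  shows "t \<in> space (cube_measure (K - set js)) \<Longrightarrow>
    itn (\<lambda>_. 1) js (\<lambda>x. g x * h x) t \<le> itn p js g t * itn (conj_exp p) js h t"
  using assms
proof (induction js arbitrary: t)
  case (Cons j js)
  have pj: "1 < p j" using Cons.prems by simp
  note [measurable] = measurable_itn_slice[OF Cons.prems(2,3,4,1)] measurable_itn_slice[OF Cons.prems(2,3,5,1)]
  have "itn (\<lambda>_. 1) (j # js) (\<lambda>x. g x * h x) t = (\<integral>\<^sup>+ s. itn (\<lambda>_. 1) js (\<lambda>x. g x * h x) (t(j := s)) \<partial>unit_measure)"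
    by simp
  also have "\<dots> \<le> (\<integral>\<^sup>+ s. itn p js g (t(j := s)) * itn (conj_exp p) js h (t(j := s)) \<partial>unit_measure)"
  proof (rule nn_integral_mono)
    fix s assume "s \<in> space unit_measure"
    then have "t(j := s) \<in> space (cube_measure (K - set js))" using space_cube_upd[OF Cons.prems(2,3,1)] by simp
    then show "itn (\<lambda>_. 1) js (\<lambda>x. g x * h x) (t(j := s)) \<le> itn p js g (t(j := s)) * itn (conj_exp p) js h (t(j := s))"
      using Cons.prems by (intro Cons.IH) (auto simp del: fun_upd_apply)
  qed
  also have "\<dots> \<le> itn p (j # js) g t * itn (conj_exp p) (j # js) h t"
    unfolding itn.simps using pj by (intro nn_Holder conj_exp) auto
  finally show ?case .
qed simp

lemma itn_mono_exponent:
  assumes "distinct js" "set js \<subseteq> K" "g \<in> borel_measurable (cube_measure K)"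
    and "\<And>j. j \<in> set js \<Longrightarrow> 0 < p j \<and> p j \<le> q j"
  shows "t \<in> space (cube_measure (K - set js)) \<Longrightarrow> itn p js g t \<le> itn q js g t"
  using assms
proof (induction js arbitrary: t)
  case (Cons j js)
  have pj: "0 < p j" "p j \<le> q j" using Cons.prems by auto
  note [measurable] = measurable_itn_slice[OF Cons.prems(2,3,4,1)]
  let ?v = "\<lambda>s. itn q js g (t(j := s))"
  have "itn p (j # js) g t \<le> ennreal_powr (\<integral>\<^sup>+ s. ennreal_powr (?v s) (p j) \<partial>unit_measure) (1 / p j)"
    unfolding itn.simps
  proof (intro epow_mono nn_integral_mono)
    fix s assume "s \<in> space unit_measure"
    then have "t(j := s) \<in> space (cube_measure (K - set js))" using space_cube_upd[OF Cons.prems(2,3,1)] by simp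
    then show "itn p js g (t(j := s)) \<le> ?v s" using Cons.prems by (intro Cons.IH) (auto simp del: fun_upd_apply)
  qed (use pj in auto)
  also have "\<dots> \<le> itn q (j # js) g t"
  proof (cases "p j = q j")
    case False
    define r where "r = q j / p j"
    have r: "1 < r" using pj False by (simp add: r_def)
    define s where "s = r / (r - 1)"
    have rs: "1 < s" "1 / r + 1 / s = 1" using r by (auto simp: s_def field_simps)
    have "(\<integral>\<^sup>+ x. ennreal_powr (?v x) (p j) * 1 \<partial>unit_measure) \<le>
      ennreal_powr (\<integral>\<^sup>+ x. ennreal_powr (ennreal_powr (?v x) (p j)) r \<partial>unit_measure) (1 / r) * ennreal_powr (\<integral>\<^sup>+ x. ennreal_powr 1 s \<partial>unit_measure) (1 / s)"
      by (rule nn_Holder[OF r rs]) measurable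
    also have "\<dots> = ennreal_powr (\<integral>\<^sup>+ x. ennreal_powr (?v x) (q j) \<partial>unit_measure) (1 / r)"
      using pj by (simp add: epow_epow r_def)
    finally have "ennreal_powr (\<integral>\<^sup>+ x. ennreal_powr (?v x) (p j) \<partial>unit_measure) (1 / p j) \<le>
      ennreal_powr (ennreal_powr (\<integral>\<^sup>+ x. ennreal_powr (?v x) (q j) \<partial>unit_measure) (1 / r)) (1 / p j)"
      using pj by (intro epow_mono) auto
    then show ?thesis using pj by (simp add: epow_epow r_def)
  qed simp
  finally show ?case .
qed simp

lemma itn_const_exponent:
  "0 < P \<Longrightarrow> itn (\<lambda>_. P) js g t = ennreal_powr (itn (\<lambda>_. 1) js (\<lambda>x. ennreal_powr (g x) P) t) (1 / P)"
  by (induction js arbitrary: t) (auto simp: epow_epow)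

lemma itn_shift: "j \<notin> set js \<Longrightarrow> itn p js (\<lambda>x. g (x(j := y))) t = itn p js g (t(j := y))"
proof (induction js arbitrary: t)
  case (Cons i js)
  then have "(t(j := y))(i := s) = (t(i := s))(j := y)" for s by (auto simp: fun_upd_twist)
  then show ?case using Cons by (simp del: fun_upd_apply)
qed simp

lemma itn_eq_integral:
  "distinct js \<Longrightarrow> g \<in> borel_measurable (cube_measure (set js)) \<Longrightarrow>
    itn (\<lambda>_. 1) js g (\<lambda>_. undefined) = (\<integral>\<^sup>+ x. g x \<partial>cube_measure (set js))"
proof (induction js arbitrary: g)
  case Nil
  then show ?case by (simp add: cube_measure_def PiM_empty nn_integral_count_space_finite)
next
  case (Cons j js)
  have j: "j \<notin> set js" "distinct js" using Cons.prems by auto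
  have [measurable]: "g \<in> borel_measurable (Pi\<^sub>M (insert j (set js)) (\<lambda>_. unit_measure))"
    using Cons.prems by (simp add: cube_measure_def)
  have "(\<integral>\<^sup>+ x. g x \<partial>cube_measure (set (j # js))) = (\<integral>\<^sup>+ y. (\<integral>\<^sup>+ x. g (x(j := y)) \<partial>cube_measure (set js)) \<partial>unit_measure)"
    using j by (simp add: cube_measure_def cubes.product_nn_integral_insert_rev)
  also have "\<dots> = (\<integral>\<^sup>+ y. itn (\<lambda>_. 1) js g ((\<lambda>_. undefined)(j := y)) \<partial>unit_measure)"
  proof (rule nn_integral_cong)
    fix y assume y: "y \<in> space unit_measure"
    have "(\<lambda>x. x(j := y)) \<in> measurable (Pi\<^sub>M (set js) (\<lambda>_. unit_measure)) (Pi\<^sub>M (insert j (set js)) (\<lambda>_. unit_measure))"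
      by (rule measurable_fun_upd[where J = "set js"]) (use y in auto)
    then have "(\<lambda>x. g (x(j := y))) \<in> borel_measurable (cube_measure (set js))"
      unfolding cube_measure_def by (rule measurable_compose) measurable
    from Cons.IH[OF j(2) this] show "(\<integral>\<^sup>+ x. g (x(j := y)) \<partial>cube_measure (set js)) = itn (\<lambda>_. 1) js g ((\<lambda>_. undefined)(j := y))"
      using itn_shift[OF j(1), of "\<lambda>_. 1" g y "\<lambda>_. undefined"] by (simp del: fun_upd_apply)
  qed
  finally show ?case by simp
qed

section \<open>Binary digits and step functions\<close>

text \<open>The left end point of the dyadic interval with digits \<open>u\<close>; \<open>True\<close> is the digit \<open>1\<close>.\<close>

primrec pt :: "bool list \<Rightarrow> real" where
  "pt [] = 0"
| "pt (b # u) = pt u + (if b then (1/2) ^ Suc (length u) else 0)"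

primrec bits :: "nat \<Rightarrow> real \<Rightarrow> bool list" where
  "bits 0 x = []"
| "bits (Suc N) x = (pt (bits N x) + (1/2) ^ Suc N \<le> x) # bits N x"

definition iv :: "bool list \<Rightarrow> real set" where
  "iv u = {pt u ..< pt u + (1/2) ^ length u}"

lemma length_bits [simp]: "length (bits N x) = N"
  by (induction N) auto

lemma iv_False: "iv (False # u) = {pt u ..< pt u + (1/2) ^ Suc (length u)}"
  and iv_True: "iv (True # u) = {pt u + (1/2) ^ Suc (length u) ..< pt u + (1/2) ^ length u}"
  by (auto simp: iv_def)

lemma iv_split: "iv u = iv (False # u) \<union> iv (True # u)" "iv (False # u) \<inter> iv (True # u) = {}"
proof -
  have "(0::real) < (1/2) ^ length u" by simp
  then show "iv u = iv (False # u) \<union> iv (True # u)" "iv (False # u) \<inter> iv (True # u) = {}"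
    unfolding iv_False iv_True iv_def[of u] by auto
qed

lemma in_iv_bits: "x \<in> {0..<1} \<Longrightarrow> x \<in> iv (bits N x)"
proof (induction N)
  case (Suc N)
  then have "x \<in> iv (bits N x)" by simp
  then show ?case by (auto simp: iv_def)
qed (simp add: iv_def)

lemma bits_unique: "x \<in> iv u \<Longrightarrow> bits (length u) x = u"
proof (induction u)
  case (Cons b u)
  have "x \<in> iv u" using Cons.prems iv_split(1)[of u] by (cases b) auto
  then have "bits (length u) x = u" by (rule Cons.IH)
  then show ?case using Cons.prems by (cases b) (auto simp: iv_False iv_True)
qed simp

lemma iv_subset: "iv u \<subseteq> {0..<1}"
proof (induction u)
  case (Cons b u)
  then show ?case using iv_split(1)[of u] by (cases b) auto
qed (simp add: iv_def)

lemma bits_drop: "N \<le> M \<Longrightarrow> drop (M - N) (bits M x) = bits N x"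
proof (induction M)
  case (Suc M)
  then show ?case by (cases "N = Suc M") (auto simp: Suc_diff_le)
qed simp

lemma sets_bits: "{x. bits N x = u} \<in> sets borel"
proof (induction N arbitrary: u)
  case (Suc N)
  show ?case
  proof (cases u)
    case (Cons b v)
    have "{x. bits (Suc N) x = u} = {x. bits N x = v} \<inter> (if b then {pt v + (1/2) ^ Suc N ..} else - {pt v + (1/2) ^ Suc N ..})"
      unfolding Cons by (cases b) auto
    then show ?thesis using Suc[of v] by (cases b) auto
  qed simp
qed simp

lemma sets_unit_measure: "sets unit_measure = sets (restrict_space borel {0..1})"
  unfolding unit_measure_def by (rule sets_restrict_space_cong) simp

lemma measurable_bits [measurable]: "bits N \<in> measurable unit_measure (count_space UNIV)"
proof (subst measurable_count_space_eq2_countable, intro conjI ballI)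
  fix u
  have "bits N -` {u} \<inter> space unit_measure = {x. bits N x = u} \<inter> {0..1}" by auto
  then show "bits N -` {u} \<inter> space unit_measure \<in> sets unit_measure"
    unfolding sets_unit_measure sets_restrict_space using sets_bits[of N u] by auto
qed auto

lemma emeasure_iv: "emeasure unit_measure (iv u) = ennreal ((1/2) ^ length u)"
proof -
  have "iv u \<subseteq> {0..1}" using iv_subset[of u] by auto
  then have "emeasure unit_measure (iv u) = emeasure lborel (iv u)"
    unfolding unit_measure_def by (intro emeasure_restrict_space) (auto simp: iv_def)
  then show ?thesis by (simp add: iv_def)
qed

lemma iv_in_sets: "iv u \<in> sets unit_measure"
proof -
  have "iv u = {0..1} \<inter> iv u" using iv_subset[of u] by auto
  then show ?thesis unfolding sets_unit_measure sets_restrict_space by (auto simp: iv_def)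
qed

lemma AE_unit_less_1: "AE s in unit_measure. s < 1"
proof (rule AE_I')
  have "emeasure unit_measure {1} = emeasure lborel {1::real}"
    unfolding unit_measure_def by (intro emeasure_restrict_space) auto
  moreover have "{1} \<in> sets unit_measure"
    unfolding sets_unit_measure sets_restrict_space by (rule image_eqI[of _ _ "{1}"]) auto
  ultimately show "{1} \<in> null_sets unit_measure" by (auto simp: null_sets_def)
qed auto

lemma nn_integral_bits:
  fixes \<phi> :: "bool list \<Rightarrow> real"
  assumes "\<And>w. 0 \<le> \<phi> w"
  shows "(\<integral>\<^sup>+ s. ennreal (\<phi> (bits N s)) \<partial>unit_measure) = ennreal (avg N \<phi>)"
proof -
  have m: "(\<lambda>s. ennreal (\<phi> (bits N s))) \<in> borel_measurable unit_measure"
    by (rule measurable_compose[OF measurable_bits]) simp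
  note [measurable] = m iv_in_sets
  have "length u + n = N \<Longrightarrow>
    (\<integral>\<^sup>+ s. ennreal (\<phi> (bits N s)) * indicator (iv u) s \<partial>unit_measure) = ennreal ((1/2) ^ length u * cexp n \<phi> u)" for n u
  proof (induction n arbitrary: u)
    case 0
    have "(\<integral>\<^sup>+ s. ennreal (\<phi> (bits N s)) * indicator (iv u) s \<partial>unit_measure)
      = (\<integral>\<^sup>+ s. ennreal (\<phi> u) * indicator (iv u) s \<partial>unit_measure)"
      using 0 by (intro nn_integral_cong) (auto simp: indicator_def dest: bits_unique)
    also have "\<dots> = ennreal (\<phi> u) * ennreal ((1/2) ^ length u)"
      by (simp add: nn_integral_cmult_indicator emeasure_iv iv_in_sets)
    finally show ?case using assms by (simp add: ennreal_mult[symmetric] mult.commute)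
  next
    case (Suc n)
    have "(\<integral>\<^sup>+ s. ennreal (\<phi> (bits N s)) * indicator (iv u) s \<partial>unit_measure)
      = (\<integral>\<^sup>+ s. ennreal (\<phi> (bits N s)) * indicator (iv (True # u)) s + ennreal (\<phi> (bits N s)) * indicator (iv (False # u)) s \<partial>unit_measure)"
      using iv_split[of u] by (intro nn_integral_cong) (auto simp: indicator_def)
    also have "\<dots> = ennreal ((1/2) ^ length (True # u) * cexp n \<phi> (True # u)) + ennreal ((1/2) ^ length (False # u) * cexp n \<phi> (False # u))"
      using Suc.IH[of "True # u"] Suc.IH[of "False # u"] Suc.prems by (subst nn_integral_add) auto
    also have "\<dots> = ennreal ((1/2) ^ length u * cexp (Suc n) \<phi> u)"
    proof -
      have "0 \<le> cexp n \<phi> v" for v using assms by (intro cexp_nonneg)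
      then show ?thesis by (subst ennreal_plus[symmetric]) (auto simp: algebra_simps)
    qed
    finally show ?case .
  qed
  from this[of "[]" N] have "(\<integral>\<^sup>+ s. ennreal (\<phi> (bits N s)) * indicator (iv []) s \<partial>unit_measure) = ennreal (avg N \<phi>)" by simp
  moreover have "(\<integral>\<^sup>+ s. ennreal (\<phi> (bits N s)) * indicator (iv []) s \<partial>unit_measure) = (\<integral>\<^sup>+ s. ennreal (\<phi> (bits N s)) \<partial>unit_measure)"
  proof (rule nn_integral_cong_AE, rule AE_mp[OF AE_unit_less_1], intro AE_I2 impI)
    fix s assume "s \<in> space unit_measure" "s < 1"
    then have "s \<in> iv []" by (simp add: iv_def)
    then show "ennreal (\<phi> (bits N s)) * indicator (iv []) s = ennreal (\<phi> (bits N s))" by simp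
  qed
  ultimately show ?thesis by simp
qed

text \<open>Digits are taken in every coordinate, also in those outside the index set of the cube, where
  points of a product space have the default value.\<close>

definition bitsv :: "nat \<Rightarrow> (nat \<Rightarrow> real) \<Rightarrow> nat \<Rightarrow> bool list" where
  "bitsv N x = (\<lambda>j. bits N (x j))"

definition stepf :: "nat \<Rightarrow> ((nat \<Rightarrow> bool list) \<Rightarrow> real) \<Rightarrow> (nat \<Rightarrow> real) \<Rightarrow> real" where
  "stepf N G x = G (bitsv N x)"

abbreviation base :: "nat \<Rightarrow> nat \<Rightarrow> bool list" where
  "base N \<equiv> bitsv N (\<lambda>_. undefined)"

definition nrm :: "(nat \<Rightarrow> real) \<Rightarrow> nat list \<Rightarrow> ((nat \<Rightarrow> real) \<Rightarrow> real) \<Rightarrow> ennreal" where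
  "nrm p js f = itn p js (\<lambda>x. ennreal \<bar>f x\<bar>) (\<lambda>_. undefined)"

lemma bitsv_upd: "bitsv N (x(j := s)) = (bitsv N x)(j := bits N s)"
  by (auto simp: bitsv_def)

lemma itn_step:
  assumes f: "\<And>x. (\<And>j. j \<in> J \<Longrightarrow> x j \<in> {0..<1}) \<Longrightarrow> f x = G (bitsv N x)"
  shows "(\<And>j. j \<in> J - set ns \<Longrightarrow> x j \<in> {0..<1}) \<Longrightarrow>
    itn p ns (\<lambda>x. ennreal \<bar>f x\<bar>) x = ennreal (dnorm N p ns G (bitsv N x))"
proof (induction ns arbitrary: x)
  case Nil
  then show ?case using f by simp
next
  case (Cons j ns)
  have "(\<integral>\<^sup>+ s. ennreal_powr (itn p ns (\<lambda>x. ennreal \<bar>f x\<bar>) (x(j := s))) (p j) \<partial>unit_measure)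
    = (\<integral>\<^sup>+ s. ennreal (dnorm N p ns G ((bitsv N x)(j := bits N s)) powr p j) \<partial>unit_measure)"
  proof (rule nn_integral_cong_AE, rule AE_mp[OF AE_unit_less_1], intro AE_I2 impI)
    fix s assume s: "s \<in> space unit_measure" "s < 1"
    have "itn p ns (\<lambda>x. ennreal \<bar>f x\<bar>) (x(j := s)) = ennreal (dnorm N p ns G (bitsv N (x(j := s))))"
      by (rule Cons.IH) (use Cons.prems s in auto)
    then show "ennreal_powr (itn p ns (\<lambda>x. ennreal \<bar>f x\<bar>) (x(j := s))) (p j) = ennreal (dnorm N p ns G ((bitsv N x)(j := bits N s)) powr p j)"
      by (simp add: bitsv_upd epow_ennreal dnorm_nonneg del: fun_upd_apply)
  qed
  also have "\<dots> = ennreal (avg N (\<lambda>w. dnorm N p ns G ((bitsv N x)(j := w)) powr p j))"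
    by (rule nn_integral_bits) simp
  finally show ?case by (simp add: epow_ennreal avg_nonneg del: fun_upd_apply)
qed

text \<open>The hypothesis omits the faces where a coordinate equals \<open>1\<close>: binary digits describe the
  half-open intervals, and the faces are null sets for every single integration.\<close>

lemma nrm_step:
  assumes "\<And>x. (\<And>j. j \<in> set js \<Longrightarrow> x j \<in> {0..<1}) \<Longrightarrow> f x = G (bitsv N x)"
  shows "nrm p js f = ennreal (dnorm N p js G (base N))"
  unfolding nrm_def using assms by (intro itn_step[where J = "set js"]) auto

lemma nrm_stepf: "nrm p js (stepf N G) = ennreal (dnorm N p js G (base N))"
  by (rule nrm_step) (simp add: stepf_def)

lemma stepf_refine: "N \<le> M \<Longrightarrow> stepf N G = stepf M (\<lambda>\<tau>. G (\<lambda>j. drop (M - N) (\<tau> j)))"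
  by (auto simp: stepf_def bitsv_def bits_drop)

lemma finite_pts: "finite (pts N js t)"
proof -
  have "pts N js t \<subseteq> (\<lambda>g i. if i \<in> set js then g i else t i) ` (\<Pi>\<^sub>E j\<in>set js. {u. length u = N})"
  proof
    fix \<tau> assume \<tau>: "\<tau> \<in> pts N js t"
    then have "\<tau> = (\<lambda>i. if i \<in> set js then restrict \<tau> (set js) i else t i)" by (auto simp: pts_def)
    moreover have "restrict \<tau> (set js) \<in> (\<Pi>\<^sub>E j\<in>set js. {u. length u = N})" using \<tau> by (auto simp: pts_def)
    ultimately show "\<tau> \<in> (\<lambda>g i. if i \<in> set js then g i else t i) ` (\<Pi>\<^sub>E j\<in>set js. {u. length u = N})" by (rule image_eqI)
  qed
  then show ?thesis by (rule finite_subset) (intro finite_imageI finite_PiE finite_set finite_length_lists)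
qed

abbreviation cubem :: "nat list \<Rightarrow> (nat \<Rightarrow> real) measure" where
  "cubem js \<equiv> cube_measure (set js)"

lemma bitsv_in_pts: "x \<in> space (cubem js) \<Longrightarrow> bitsv N x \<in> pts N js (base N)"
  by (auto simp: pts_def bitsv_def cube_measure_def space_PiM PiE_def extensional_def)

lemma measurable_component_cube [measurable]:
  "j \<in> set js \<Longrightarrow> (\<lambda>x. x j) \<in> measurable (cubem js) unit_measure"
  unfolding cube_measure_def by (rule measurable_component_singleton)

lemma sets_bitsv: "{x \<in> space (cubem js). bitsv N x = w} \<in> sets (cubem js)"
proof (cases "w \<in> pts N js (base N)")
  case True
  have "{x \<in> space (cubem js). bitsv N x = w} = {x \<in> space (cubem js). \<forall>j\<in>set js. bits N (x j) = w j}"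
  proof (intro Collect_cong conj_cong refl iffI)
    fix x assume x: "x \<in> space (cubem js)" "\<forall>j\<in>set js. bits N (x j) = w j"
    show "bitsv N x = w"
    proof
      fix i
      show "bitsv N x i = w i"
        using x True bitsv_in_pts[OF x(1), of N] by (cases "i \<in> set js") (auto simp: pts_def bitsv_def)
    qed
  qed (auto simp: bitsv_def)
  moreover have "{x \<in> space (cubem js). \<forall>j\<in>set js. bits N (x j) = w j} \<in> sets (cubem js)"
  proof (rule sets.sets_Collect_finite_All)
    fix j assume j: "j \<in> set js"
    have "{s \<in> space unit_measure. bits N s = w j} \<in> sets unit_measure" by measurable
    from measurable_sets[OF measurable_component_cube[OF j] this]
    have "(\<lambda>x. x j) -` {s \<in> space unit_measure. bits N s = w j} \<inter> space (cubem js) \<in> sets (cubem js)" .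
    also have "(\<lambda>x. x j) -` {s \<in> space unit_measure. bits N s = w j} \<inter> space (cubem js) = {x \<in> space (cubem js). bits N (x j) = w j}"
      using measurable_space[OF measurable_component_cube[OF j]] by auto
    finally show "{x \<in> space (cubem js). bits N (x j) = w j} \<in> sets (cubem js)" .
  next
    show "finite (set js)" by simp
  qed
  ultimately show ?thesis by simp
next
  case False
  then have e: "{x \<in> space (cubem js). bitsv N x = w} = {}" using bitsv_in_pts by blast
  show ?thesis unfolding e by (rule sets.empty_sets)
qed

lemma stepf_eq_sum:
  assumes "x \<in> space (cubem js)"
  shows "stepf N G x = (\<Sum>w\<in>pts N js (base N). G w * of_bool (bitsv N x = w))"
  using bitsv_in_pts[OF assms, of N] finite_pts[of N js "base N"]
  by (simp add: stepf_def of_bool_def if_distrib[of "\<lambda>y. _ * y"] cong: if_cong)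

lemma measurable_of_bool_bitsv [measurable]:
  "(\<lambda>x. of_bool (bitsv N x = w) :: real) \<in> borel_measurable (cubem js)"
proof -
  have "(\<lambda>x. if x \<in> {x \<in> space (cubem js). bitsv N x = w} then 1 else 0 :: real) \<in> borel_measurable (cubem js)"
    using sets_bitsv by measurable
  then show ?thesis by (rule measurable_cong[THEN iffD1, rotated]) auto
qed

lemma measurable_stepf [measurable]: "stepf N G \<in> borel_measurable (cubem js)"
proof -
  have "(\<lambda>x. \<Sum>w\<in>pts N js (base N). G w * of_bool (bitsv N x = w)) \<in> borel_measurable (cubem js)" by measurable
  then show ?thesis by (rule measurable_cong[THEN iffD1, rotated]) (simp add: stepf_eq_sum)
qed

section \<open>Density of step functions in the mean\<close>

lemma emeasure_cubem: "emeasure (cubem js) (space (cubem js)) = 1"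
proof -
  have "emeasure (Pi\<^sub>M (set js) (\<lambda>_. unit_measure)) (Pi\<^sub>E (set js) (\<lambda>_. space unit_measure)) = (\<Prod>i\<in>set js. emeasure unit_measure (space unit_measure))"
    by (rule cubes.emeasure_PiM) (use sets.top[of unit_measure] in auto)
  then show ?thesis by (simp add: cube_measure_def space_PiM)
qed

lemma finite_measure_cubem: "finite_measure (cubem js)"
  by (rule finite_measureI) (simp add: emeasure_cubem)

lemma nn_integral_component:
  assumes j: "j \<in> set js" and [measurable]: "\<phi> \<in> borel_measurable unit_measure"
  shows "(\<integral>\<^sup>+ x. \<phi> (x j) \<partial>cubem js) = (\<integral>\<^sup>+ s. \<phi> s \<partial>unit_measure)"
proof -
  let ?I = "set js - {j}"
  have I: "set js = insert j ?I" using j by auto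
  have m: "(\<lambda>x. \<phi> (x j)) \<in> borel_measurable (Pi\<^sub>M (insert j ?I) (\<lambda>_. unit_measure))"
    by measurable
  obtain ns where ns: "set ns = ?I" using finite_list[of ?I] by auto
  have "(\<integral>\<^sup>+ x. \<phi> (x j) \<partial>cubem js) = (\<integral>\<^sup>+ x. \<phi> (x j) \<partial>Pi\<^sub>M (insert j ?I) (\<lambda>_. unit_measure))"
    unfolding cube_measure_def using I by simp
  also have "\<dots> = (\<integral>\<^sup>+ y. (\<integral>\<^sup>+ x. \<phi> y \<partial>Pi\<^sub>M ?I (\<lambda>_. unit_measure)) \<partial>unit_measure)"
    by (subst cubes.product_nn_integral_insert_rev[OF _ _ m]) auto
  also have "\<dots> = (\<integral>\<^sup>+ s. \<phi> s \<partial>unit_measure)"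
    using emeasure_cubem[of ns] by (simp add: cube_measure_def ns)
  finally show ?thesis .
qed

definition appr :: "nat list \<Rightarrow> ((nat \<Rightarrow> real) \<Rightarrow> real) \<Rightarrow> bool" where
  "appr js f \<longleftrightarrow> f \<in> borel_measurable (cubem js) \<and>
    (\<forall>e>0. \<exists>N G. (\<integral>\<^sup>+ x. ennreal \<bar>f x - stepf N G x\<bar> \<partial>cubem js) < ennreal e)"

lemma stepf_binop: "\<exists>M H. \<forall>x. h (stepf N G x) (stepf N' G' x) = stepf M H x"
proof -
  let ?M = "max N N'"
  have "h (stepf N G x) (stepf N' G' x) = stepf ?M (\<lambda>\<tau>. h (G (\<lambda>j. drop (?M - N) (\<tau> j))) (G' (\<lambda>j. drop (?M - N') (\<tau> j)))) x" for x
    using stepf_refine[of N ?M G] stepf_refine[of N' ?M G'] by (simp add: stepf_def)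
  then show ?thesis by blast
qed

lemma appr_limit:
  assumes [measurable]: "f \<in> borel_measurable (cubem js)"
    and g: "\<And>e. 0 < e \<Longrightarrow> \<exists>g. appr js g \<and> (\<integral>\<^sup>+ x. ennreal \<bar>f x - g x\<bar> \<partial>cubem js) < ennreal e"
  shows "appr js f"
  unfolding appr_def
proof (intro conjI allI impI assms(1))
  fix e :: real assume e: "0 < e"
  obtain g where g: "appr js g" "(\<integral>\<^sup>+ x. ennreal \<bar>f x - g x\<bar> \<partial>cubem js) < ennreal (e / 2)" using g[of "e / 2"] e by auto
  have [measurable]: "g \<in> borel_measurable (cubem js)" using g by (simp add: appr_def)
  obtain N G where G: "(\<integral>\<^sup>+ x. ennreal \<bar>g x - stepf N G x\<bar> \<partial>cubem js) < ennreal (e / 2)"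
    using g(1) e unfolding appr_def by (meson half_gt_zero)
  have "(\<integral>\<^sup>+ x. ennreal \<bar>f x - stepf N G x\<bar> \<partial>cubem js) \<le> (\<integral>\<^sup>+ x. ennreal \<bar>f x - g x\<bar> + ennreal \<bar>g x - stepf N G x\<bar> \<partial>cubem js)"
    by (intro nn_integral_mono) (auto simp: ennreal_plus[symmetric] simp del: ennreal_plus intro!: ennreal_leI)
  also have "\<dots> = (\<integral>\<^sup>+ x. ennreal \<bar>f x - g x\<bar> \<partial>cubem js) + (\<integral>\<^sup>+ x. ennreal \<bar>g x - stepf N G x\<bar> \<partial>cubem js)"
    by (rule nn_integral_add) measurable
  also have "\<dots> < ennreal (e / 2) + ennreal (e / 2)" using g(2) G by (rule add_strict_mono)
  finally show "\<exists>N G. (\<integral>\<^sup>+ x. ennreal \<bar>f x - stepf N G x\<bar> \<partial>cubem js) < ennreal e"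
    using e by (auto simp: ennreal_plus[symmetric] simp del: ennreal_plus)
qed


lemma appr_stepf: "appr js (stepf N G)"
  unfolding appr_def by (auto intro!: exI[of _ N] exI[of _ G])

lemma appr_add:
  assumes f: "appr js f" and g: "appr js g"
  shows "appr js (\<lambda>x. f x + g x)"
proof -
  have [measurable]: "f \<in> borel_measurable (cubem js)" "g \<in> borel_measurable (cubem js)" using f g by (auto simp: appr_def)
  show ?thesis
  proof (rule appr_limit)
    fix e :: real assume e: "0 < e"
    obtain N G where G: "(\<integral>\<^sup>+ x. ennreal \<bar>f x - stepf N G x\<bar> \<partial>cubem js) < ennreal (e / 2)"
      using f e unfolding appr_def by (meson half_gt_zero)
    obtain N' G' where G': "(\<integral>\<^sup>+ x. ennreal \<bar>g x - stepf N' G' x\<bar> \<partial>cubem js) < ennreal (e / 2)"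
      using g e unfolding appr_def by (meson half_gt_zero)
    obtain M H where H: "\<And>x. stepf N G x + stepf N' G' x = stepf M H x" using stepf_binop[of "(+)" N G N' G'] by blast
    have "(\<integral>\<^sup>+ x. ennreal \<bar>f x + g x - stepf M H x\<bar> \<partial>cubem js) \<le> (\<integral>\<^sup>+ x. ennreal \<bar>f x - stepf N G x\<bar> + ennreal \<bar>g x - stepf N' G' x\<bar> \<partial>cubem js)"
      unfolding H[symmetric]
      by (intro nn_integral_mono) (auto simp: ennreal_plus[symmetric] simp del: ennreal_plus intro!: ennreal_leI)
    also have "\<dots> = (\<integral>\<^sup>+ x. ennreal \<bar>f x - stepf N G x\<bar> \<partial>cubem js) + (\<integral>\<^sup>+ x. ennreal \<bar>g x - stepf N' G' x\<bar> \<partial>cubem js)"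
      by (rule nn_integral_add) measurable
    also have "\<dots> < ennreal (e / 2) + ennreal (e / 2)" using G G' by (rule add_strict_mono)
    also have "\<dots> = ennreal e" using e by (auto simp: ennreal_plus[symmetric] simp del: ennreal_plus)
    finally show "\<exists>g'. appr js g' \<and> (\<integral>\<^sup>+ x. ennreal \<bar>f x + g x - g' x\<bar> \<partial>cubem js) < ennreal e"
      using appr_stepf by blast
  qed measurable
qed

lemma appr_cmult:
  assumes f: "appr js f" shows "appr js (\<lambda>x. c * f x)"
proof -
  have [measurable]: "f \<in> borel_measurable (cubem js)" using f by (auto simp: appr_def)
  show ?thesis
  proof (rule appr_limit)
    fix e :: real assume e: "0 < e"
    have e': "0 < e / (\<bar>c\<bar> + 1)" using e by simp
    obtain N G where G: "(\<integral>\<^sup>+ x. ennreal \<bar>f x - stepf N G x\<bar> \<partial>cubem js) < ennreal (e / (\<bar>c\<bar> + 1))"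
      using f e' unfolding appr_def by blast
    have st: "c * stepf N G x = stepf N (\<lambda>\<tau>. c * G \<tau>) x" for x by (simp add: stepf_def)
    have "(\<integral>\<^sup>+ x. ennreal \<bar>c * f x - stepf N (\<lambda>\<tau>. c * G \<tau>) x\<bar> \<partial>cubem js) = (\<integral>\<^sup>+ x. ennreal \<bar>c\<bar> * ennreal \<bar>f x - stepf N G x\<bar> \<partial>cubem js)"
      unfolding st[symmetric]
      by (intro nn_integral_cong) (simp add: ennreal_mult[symmetric] abs_mult[symmetric] right_diff_distrib)
    also have "\<dots> = ennreal \<bar>c\<bar> * (\<integral>\<^sup>+ x. ennreal \<bar>f x - stepf N G x\<bar> \<partial>cubem js)"
      by (rule nn_integral_cmult) measurable
    also have "\<dots> \<le> ennreal \<bar>c\<bar> * ennreal (e / (\<bar>c\<bar> + 1))" using G by (intro mult_left_mono) auto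
    also have "\<dots> = ennreal (\<bar>c\<bar> * (e / (\<bar>c\<bar> + 1)))" using e by (intro ennreal_mult[symmetric]) auto
    also have "\<dots> < ennreal e" using e by (intro ennreal_lessI) (auto simp: field_simps)
    finally show "\<exists>g'. appr js g' \<and> (\<integral>\<^sup>+ x. ennreal \<bar>c * f x - g' x\<bar> \<partial>cubem js) < ennreal e"
      using appr_stepf by blast
  qed measurable
qed

lemma appr_cong:
  assumes f: "appr js f" and eq: "\<And>x. x \<in> space (cubem js) \<Longrightarrow> f x = g x"
  shows "appr js g"
proof -
  have "f \<in> borel_measurable (cubem js)" using f by (simp add: appr_def)
  then have m: "g \<in> borel_measurable (cubem js)" using measurable_cong[of "cubem js" f g] eq by blast
  have "(\<integral>\<^sup>+ x. ennreal \<bar>g x - f x\<bar> \<partial>cubem js) = (\<integral>\<^sup>+ x. 0 \<partial>cubem js)"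
    by (intro nn_integral_cong) (simp add: eq)
  then show ?thesis using f by (intro appr_limit[OF m]) auto
qed

lemma appr_indicator_Int:
  assumes A: "appr js (indicator A)" and B: "appr js (indicator B)"
  shows "appr js (indicator (A \<inter> B))"
proof -
  have [measurable]: "(indicator A :: _ \<Rightarrow> real) \<in> borel_measurable (cubem js)" "(indicator B :: _ \<Rightarrow> real) \<in> borel_measurable (cubem js)"
    using A B by (auto simp: appr_def)
  have AB: "indicator (A \<inter> B) = (\<lambda>x. indicator A x * indicator B x :: real)" by (auto simp: indicator_def)
  show ?thesis unfolding AB
  proof (rule appr_limit)
    fix e :: real assume e: "0 < e"
    obtain N G where G: "(\<integral>\<^sup>+ x. ennreal \<bar>indicator A x - stepf N G x\<bar> \<partial>cubem js) < ennreal (e / 2)"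
      using A e unfolding appr_def by (meson half_gt_zero)
    obtain N' G' where G': "(\<integral>\<^sup>+ x. ennreal \<bar>indicator B x - stepf N' G' x\<bar> \<partial>cubem js) < ennreal (e / 2)"
      using B e unfolding appr_def by (meson half_gt_zero)
    define cl where "cl = (\<lambda>y::real. max 0 (min 1 y))"
    obtain M H where H: "\<And>x. cl (stepf N G x) * cl (stepf N' G' x) = stepf M H x"
      using stepf_binop[of "\<lambda>y z. cl y * cl z" N G N' G'] by blast
    have le: "\<bar>a * b - cl y * cl z\<bar> \<le> \<bar>a - y\<bar> + \<bar>b - z\<bar>" if "a \<in> {0, 1}" "b \<in> {0, 1}" for a b y z :: real
    proof -
      have c: "0 \<le> cl y" "cl y \<le> 1" by (auto simp: cl_def)
      have "a * b - cl y * cl z = (a - cl y) * b + cl y * (b - cl z)" by (simp add: algebra_simps)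
      then have "\<bar>a * b - cl y * cl z\<bar> \<le> \<bar>a - cl y\<bar> * \<bar>b\<bar> + \<bar>cl y\<bar> * \<bar>b - cl z\<bar>" by (metis abs_mult abs_triangle_ineq)
      also have "\<dots> \<le> \<bar>a - cl y\<bar> * 1 + 1 * \<bar>b - cl z\<bar>" using that c by (intro add_mono mult_mono) auto
      also have "\<dots> \<le> \<bar>a - y\<bar> + \<bar>b - z\<bar>" using that by (auto simp: cl_def)
      finally show ?thesis .
    qed
    have "(\<integral>\<^sup>+ x. ennreal \<bar>indicator A x * indicator B x - stepf M H x\<bar> \<partial>cubem js) \<le>
      (\<integral>\<^sup>+ x. ennreal \<bar>indicator A x - stepf N G x\<bar> + ennreal \<bar>indicator B x - stepf N' G' x\<bar> \<partial>cubem js)"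
      unfolding H[symmetric]
    proof (rule nn_integral_mono)
      fix x
      have "\<bar>indicator A x * indicator B x - cl (stepf N G x) * cl (stepf N' G' x)\<bar>
        \<le> \<bar>indicator A x - stepf N G x\<bar> + \<bar>indicator B x - stepf N' G' x\<bar>"
        by (rule le) (auto simp: indicator_def)
      then show "ennreal \<bar>indicator A x * indicator B x - cl (stepf N G x) * cl (stepf N' G' x)\<bar>
        \<le> ennreal \<bar>indicator A x - stepf N G x\<bar> + ennreal \<bar>indicator B x - stepf N' G' x\<bar>"
        by (simp add: ennreal_plus[symmetric] ennreal_leI del: ennreal_plus)
    qed
    also have "\<dots> = (\<integral>\<^sup>+ x. ennreal \<bar>indicator A x - stepf N G x\<bar> \<partial>cubem js) + (\<integral>\<^sup>+ x. ennreal \<bar>indicator B x - stepf N' G' x\<bar> \<partial>cubem js)"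
      by (rule nn_integral_add) measurable
    also have "\<dots> < ennreal (e / 2) + ennreal (e / 2)" using G G' by (rule add_strict_mono)
    also have "\<dots> = ennreal e" using e by (auto simp: ennreal_plus[symmetric] simp del: ennreal_plus)
    finally show "\<exists>g'. appr js g' \<and> (\<integral>\<^sup>+ x. ennreal \<bar>indicator A x * indicator B x - g' x\<bar> \<partial>cubem js) < ennreal e"
      using appr_stepf by blast
  qed measurable
qed

lemma appr_indicator_Diff:
  assumes A: "appr js (indicator A)"
  shows "appr js (indicator (space (cubem js) - A))"
proof -
  have "appr js (\<lambda>x. stepf 0 (\<lambda>_. 1) x + (-1) * indicator A x)"
    by (intro appr_add appr_cmult appr_stepf A)
  then show ?thesis by (rule appr_cong) (auto simp: stepf_def indicator_def)
qed

lemma appr_halfspace: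
  assumes j: "j \<in> set js"
  shows "appr js (indicator {x \<in> space (cubem js). x j < a})"
proof (rule appr_limit)
  have [measurable]: "(\<lambda>x. x j) \<in> borel_measurable (cubem js)"
    using measurable_compose[OF measurable_component_cube[OF j], of "\<lambda>x. x" borel]
    by (simp add: unit_measure_def measurable_restrict_space1)
  show "indicator {x \<in> space (cubem js). x j < a} \<in> borel_measurable (cubem js)" by measurable
  fix e :: real assume e: "0 < e"
  obtain N where N: "(1/2::real) ^ N < e" using real_arch_pow_inv[of e "1/2"] e by auto
  let ?g = "stepf N (\<lambda>\<tau>. of_bool (pt (\<tau> j) < a))"
  have [measurable]: "(indicator {a..<a + (1/2) ^ N} :: real \<Rightarrow> ennreal) \<in> borel_measurable unit_measure"
    "(indicator {1} :: real \<Rightarrow> ennreal) \<in> borel_measurable unit_measure"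
    by (auto simp: unit_measure_def intro!: measurable_restrict_space1)
  have "(\<integral>\<^sup>+ x. ennreal \<bar>indicator {x \<in> space (cubem js). x j < a} x - ?g x\<bar> \<partial>cubem js)
    \<le> (\<integral>\<^sup>+ x. (\<lambda>s. indicator {a..<a + (1/2) ^ N} s + indicator {1} s) (x j) \<partial>cubem js)"
  proof (rule nn_integral_mono)
    fix x assume x: "x \<in> space (cubem js)"
    have xj: "x j \<in> {0..1}" using measurable_space[OF measurable_component_cube[OF j] x] by simp
    show "ennreal \<bar>indicator {x \<in> space (cubem js). x j < a} x - ?g x\<bar> \<le> (\<lambda>s. indicator {a..<a + (1/2) ^ N} s + indicator {1} s) (x j)"
    proof (cases "x j = 1")
      case True
      have "\<bar>indicator {x \<in> space (cubem js). x j < a} x - ?g x\<bar> \<le> (1::real)" by (auto simp: stepf_def indicator_def)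
      then have "ennreal \<bar>indicator {x \<in> space (cubem js). x j < a} x - ?g x\<bar> \<le> 1" using ennreal_leI by fastforce
      also have "1 \<le> (indicator {a..<a + (1/2) ^ N} (x j) + indicator {1} (x j) :: ennreal)" using True by simp
      finally show ?thesis by simp
    next
      case False
      then have "x j \<in> iv (bits N (x j))" using xj by (intro in_iv_bits) auto
      then show ?thesis using x by (auto simp: stepf_def bitsv_def iv_def indicator_def)
    qed
  qed
  also have "\<dots> = (\<integral>\<^sup>+ s. indicator {a..<a + (1/2) ^ N} s + indicator {1} s \<partial>unit_measure)"
    by (rule nn_integral_component[OF j]) measurable
  also have "\<dots> = (\<integral>\<^sup>+ s. indicator {a..<a + (1/2) ^ N} s \<partial>unit_measure)"
  proof (rule nn_integral_cong_AE, rule AE_mp[OF AE_unit_less_1], intro AE_I2 impI)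
    fix s :: real assume "s < 1"
    then show "(indicator {a..<a + (1/2) ^ N} s + indicator {1} s :: ennreal) = indicator {a..<a + (1/2) ^ N} s" by (auto simp: indicator_def)
  qed
  also have "\<dots> \<le> ennreal ((1/2) ^ N)"
  proof -
    have "(\<integral>\<^sup>+ s. indicator {a..<a + (1/2) ^ N} s \<partial>unit_measure) = (\<integral>\<^sup>+ s. indicator {a..<a + (1/2) ^ N} s * indicator {0..1} s \<partial>lborel)"
      unfolding unit_measure_def by (subst nn_integral_restrict_space) auto
    also have "\<dots> \<le> (\<integral>\<^sup>+ s. indicator {a..<a + (1/2) ^ N} s \<partial>lborel)" by (intro nn_integral_mono) (auto simp: indicator_def)
    also have "\<dots> = ennreal ((1/2) ^ N)" by simp
    finally show ?thesis .
  qed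
  also have "\<dots> < ennreal e" using N e by (intro ennreal_lessI) auto
  finally show "\<exists>g. appr js g \<and> (\<integral>\<^sup>+ x. ennreal \<bar>indicator {x \<in> space (cubem js). x j < a} x - g x\<bar> \<partial>cubem js) < ennreal e"
    using appr_stepf by blast
qed

lemma appr_indicator:
  assumes "B \<in> sets (cubem js)" shows "appr js (indicator B)"
proof -
  interpret finite_measure "cubem js" by (rule finite_measure_cubem)
  define LL where "LL = {B \<in> sets (cubem js). appr js (indicator B)}"
  have LLD: "B \<in> sets (cubem js)" "appr js (indicator B)" if "B \<in> LL" for B using that by (auto simp: LL_def)
  have LL_compl: "space (cubem js) - B \<in> LL" if "B \<in> LL" for B
    using LLD[OF that] by (auto simp: LL_def intro: appr_indicator_Diff)
  have LL_Int: "A \<inter> B \<in> LL" if "A \<in> LL" "B \<in> LL" for A B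
    using LLD[OF that(1)] LLD[OF that(2)] by (auto simp: LL_def intro: appr_indicator_Int)
  have LL_empty: "{} \<in> LL"
    using appr_stepf[of js 0 "\<lambda>_. 0"] by (auto simp: LL_def elim: appr_cong simp: stepf_def)
  have LL_Un: "A \<union> B \<in> LL" if "A \<in> LL" "B \<in> LL" for A B
  proof -
    have "A \<union> B = space (cubem js) - ((space (cubem js) - A) \<inter> (space (cubem js) - B))"
      using LLD[OF that(1)] LLD[OF that(2)] sets.sets_into_space by blast
    then show ?thesis using that LL_compl LL_Int by metis
  qed
  have LL_fin: "(\<Union>i<n. A i) \<in> LL" if "range A \<subseteq> LL" for A :: "nat \<Rightarrow> _" and n
    by (induction n) (use that LL_empty LL_Un in \<open>auto simp: lessThan_Suc\<close>)
  have sa: "sigma_algebra (space (cubem js)) LL"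
    unfolding sigma_algebra_iff2
  proof (intro conjI ballI allI impI)
    show "LL \<subseteq> Pow (space (cubem js))" using LLD sets.sets_into_space by blast
    fix A :: "nat \<Rightarrow> (nat \<Rightarrow> real) set" assume A: "range A \<subseteq> LL"
    have Am [measurable]: "A i \<in> sets (cubem js)" for i using A LLD by blast
    let ?C = "\<lambda>n. \<Union>i<n. A i" and ?U = "\<Union>i. A i"
    have "appr js (indicator ?U)"
    proof (rule appr_limit)
      show "indicator ?U \<in> borel_measurable (cubem js)" by measurable
      fix e :: real assume e: "0 < e"
      have "(\<lambda>n. emeasure (cubem js) (?U - ?C n)) \<longlonglongrightarrow> emeasure (cubem js) (\<Inter>n. ?U - ?C n)"
        by (rule Lim_emeasure_decseq) (auto simp: decseq_def intro: less_le_trans)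
      moreover have e0: "(\<Inter>n. ?U - ?C n) = {}" by auto
      ultimately have "(\<lambda>n. emeasure (cubem js) (?U - ?C n)) \<longlonglongrightarrow> 0" by (simp only: e0 emeasure_empty)
      from order_tendstoD(2)[OF this, of "ennreal e"] e obtain n where n: "emeasure (cubem js) (?U - ?C n) < ennreal e"
        by (auto simp: eventually_sequentially)
      have "(\<integral>\<^sup>+ x. ennreal \<bar>indicator ?U x - indicator (?C n) x\<bar> \<partial>cubem js) = (\<integral>\<^sup>+ x. indicator (?U - ?C n) x \<partial>cubem js)"
        by (intro nn_integral_cong) (auto simp: indicator_def)
      also have "\<dots> = emeasure (cubem js) (?U - ?C n)" by (rule nn_integral_indicator) measurable
      finally show "\<exists>g. appr js g \<and> (\<integral>\<^sup>+ x. ennreal \<bar>indicator ?U x - g x\<bar> \<partial>cubem js) < ennreal e"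
        using n LLD(2)[OF LL_fin[OF A, of n]] by (intro exI[of _ "indicator (?C n)"]) simp
    qed
    then show "?U \<in> LL" by (simp add: LL_def)
  qed (use LL_empty LL_compl in auto)
  define M where "M = sigma (space (cubem js)) LL"
  have LLsub: "LL \<subseteq> Pow (space (cubem js))" using LLD sets.sets_into_space by blast
  have M: "sets M = LL" "space M = space (cubem js)"
    unfolding M_def using sa LLsub by (auto simp: sigma_algebra.sets_measure_of_eq space_measure_of_conv sets_measure_of sigma_algebra.sigma_sets_eq)
  have comp: "(\<lambda>x. x j) \<in> measurable M unit_measure" if j: "j \<in> set js" for j
  proof -
    have "(\<lambda>x. x j) \<in> borel_measurable M"
      unfolding borel_measurable_iff_less
    proof
      fix a
      have "{x \<in> space (cubem js). x j < a} \<in> sets (cubem js)"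
      proof -
        have [measurable]: "(\<lambda>x. x j) \<in> borel_measurable (cubem js)"
          using measurable_compose[OF measurable_component_cube[OF j], of "\<lambda>x. x" borel]
          by (simp add: unit_measure_def measurable_restrict_space1)
        show ?thesis by measurable
      qed
      then show "{w \<in> space M. w j < a} \<in> sets M" unfolding M LL_def using appr_halfspace[OF j] by simp
    qed
    moreover have "(\<lambda>x. x j) \<in> space M \<rightarrow> {0..1}"
      using measurable_space[OF measurable_component_cube[OF j]] unfolding M by auto
    ultimately show ?thesis unfolding unit_measure_def by (intro measurable_restrict_space2) auto
  qed
  have "(\<lambda>x. x) \<in> measurable M (Pi\<^sub>M (set js) (\<lambda>_. unit_measure))"
    by (rule measurable_PiM_single') (use comp M in \<open>auto simp: cube_measure_def space_PiM\<close>)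
  from measurable_sets[OF this, of B] assms have "B \<inter> space M \<in> sets M" by (simp add: cube_measure_def)
  moreover have "B \<inter> space M = B" using sets.sets_into_space[OF assms] M by auto
  ultimately show ?thesis using M LLD by simp
qed

lemma appr_integrable:
  fixes f :: "(nat \<Rightarrow> real) \<Rightarrow> real"
  assumes "integrable (cubem js) f" shows "appr js f"
  using assms
proof (induction rule: integrable_induct)
  case (base A c)
  have "appr js (\<lambda>x. c * indicator A x)" by (intro appr_cmult appr_indicator base)
  then show ?case by (rule appr_cong) simp
next
  case (add f g)
  then show ?case by (intro appr_add)
next
  case (lim f s)
  have [measurable]: "f \<in> borel_measurable (cubem js)" "\<And>i. s i \<in> borel_measurable (cubem js)" using lim by auto
  have "(\<lambda>i. \<integral>\<^sup>+ x. ennreal (norm (f x - s i x)) \<partial>cubem js) \<longlonglongrightarrow> 0"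
  proof (rule nn_integral_dominated_convergence_norm[where w = "\<lambda>x. 2 * norm (f x)"])
    have "(\<integral>\<^sup>+ x. ennreal (2 * norm (f x)) \<partial>cubem js) = (\<integral>\<^sup>+ x. 2 * ennreal (norm (f x)) \<partial>cubem js)"
      by (intro nn_integral_cong) (simp add: ennreal_mult)
    also have "\<dots> = 2 * (\<integral>\<^sup>+ x. ennreal (norm (f x)) \<partial>cubem js)" by (rule nn_integral_cmult) measurable
    also have "\<dots> < \<infinity>" using \<open>integrable (cubem js) f\<close> by (auto simp: integrable_iff_bounded ennreal_mult_less_top)
    finally show "(\<integral>\<^sup>+ x. ennreal (2 * norm (f x)) \<partial>cubem js) < \<infinity>" .
  qed (use lim in auto)
  then have small: "\<exists>i. (\<integral>\<^sup>+ x. ennreal (norm (f x - s i x)) \<partial>cubem js) < ennreal e" if "0 < e" for e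
    using order_tendstoD(2)[of _ 0 sequentially "ennreal e"] that by (fastforce simp: eventually_sequentially)
  show ?case
  proof (rule appr_limit)
    fix e :: real assume "0 < e"
    from small[OF this] show "\<exists>g. appr js g \<and> (\<integral>\<^sup>+ x. ennreal \<bar>f x - g x\<bar> \<partial>cubem js) < ennreal e"
      using lim.IH by auto
  qed measurable
qed

section \<open>The mixed norm on measurable functions\<close>

lemma base_point: "(\<lambda>_. undefined) \<in> space (cube_measure (set js - set js))"
  by (simp add: cube_measure_def space_PiM)

lemma measurable_abs_ennreal [measurable]:
  "f \<in> borel_measurable M \<Longrightarrow> (\<lambda>x. ennreal \<bar>f x\<bar>) \<in> borel_measurable M" for f :: "_ \<Rightarrow> real"
  by measurable

lemma nrm_add:
  assumes "distinct js" "\<And>j. j \<in> set js \<Longrightarrow> 1 \<le> p j"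
    and [measurable]: "f \<in> borel_measurable (cubem js)" "g \<in> borel_measurable (cubem js)"
  shows "nrm p js (\<lambda>x. f x + g x) \<le> nrm p js f + nrm p js g"
proof -
  have p0: "0 < p j" if "j \<in> set js" for j using assms(2)[OF that] by simp
  have "nrm p js (\<lambda>x. f x + g x) \<le> itn p js (\<lambda>x. ennreal \<bar>f x\<bar> + ennreal \<bar>g x\<bar>) (\<lambda>_. undefined)"
    unfolding nrm_def by (intro itn_mono p0) (auto simp: ennreal_plus[symmetric] intro!: ennreal_leI simp del: ennreal_plus)
  also have "\<dots> \<le> nrm p js f + nrm p js g"
    unfolding nrm_def using assms(1,2) by (intro itn_add[where K = "set js"] base_point) auto
  finally show ?thesis .
qed

lemma nrm_cmult:
  assumes "distinct js" "\<And>j. j \<in> set js \<Longrightarrow> 1 \<le> p j" and [measurable]: "f \<in> borel_measurable (cubem js)"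
  shows "nrm p js (\<lambda>x. c * f x) = ennreal \<bar>c\<bar> * nrm p js f"
proof -
  have p0: "0 < p j" if "j \<in> set js" for j using assms(2)[OF that] by simp
  have "nrm p js (\<lambda>x. c * f x) = itn p js (\<lambda>x. ennreal \<bar>c\<bar> * ennreal \<bar>f x\<bar>) (\<lambda>_. undefined)"
    unfolding nrm_def by (simp add: abs_mult ennreal_mult)
  also have "\<dots> = ennreal \<bar>c\<bar> * nrm p js f"
    unfolding nrm_def using assms(1) by (intro itn_cmult[where K = "set js"] base_point p0) auto
  finally show ?thesis .
qed

lemma nrm_diff_commute: "nrm p js (\<lambda>x. f x - g x) = nrm p js (\<lambda>x. g x - f x)"
  by (simp add: nrm_def abs_minus_commute)

lemma nrm_diff:
  assumes "distinct js" "\<And>j. j \<in> set js \<Longrightarrow> 1 \<le> p j"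
    and [measurable]: "f \<in> borel_measurable (cubem js)" "g \<in> borel_measurable (cubem js)" "h \<in> borel_measurable (cubem js)"
  shows "nrm p js (\<lambda>x. f x - h x) \<le> nrm p js (\<lambda>x. f x - g x) + nrm p js (\<lambda>x. g x - h x)"
  using nrm_add[of js p "\<lambda>x. f x - g x" "\<lambda>x. g x - h x"] assms by simp

lemma integral_le_nrm:
  assumes "distinct js" "\<And>j. j \<in> set js \<Longrightarrow> 1 \<le> p j" and [measurable]: "f \<in> borel_measurable (cubem js)"
  shows "(\<integral>\<^sup>+ x. ennreal \<bar>f x\<bar> \<partial>cubem js) \<le> nrm p js f"
proof -
  have "(\<integral>\<^sup>+ x. ennreal \<bar>f x\<bar> \<partial>cubem js) = itn (\<lambda>_. 1) js (\<lambda>x. ennreal \<bar>f x\<bar>) (\<lambda>_. undefined)"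
    using assms(1) by (intro itn_eq_integral[symmetric]) measurable
  also have "\<dots> \<le> nrm p js f"
    unfolding nrm_def using assms(1,2) by (intro itn_mono_exponent[where K = "set js"] base_point) auto
  finally show ?thesis .
qed

lemma integrable_nrm:
  assumes "distinct js" "\<And>j. j \<in> set js \<Longrightarrow> 1 \<le> p j" and [measurable]: "f \<in> borel_measurable (cubem js)"
    and "nrm p js f < top"
  shows "integrable (cubem js) f"
proof -
  have "(\<integral>\<^sup>+ x. ennreal (norm (f x)) \<partial>cubem js) \<le> nrm p js f"
    using integral_le_nrm[OF assms(1,2,3)] by simp
  also have "\<dots> < top" by fact
  finally show ?thesis by (intro integrableI_bounded) auto
qed

lemma step_dense_bounded:
  assumes js: "distinct js" and p: "\<And>j. j \<in> set js \<Longrightarrow> 1 \<le> p j" and [measurable]: "f \<in> borel_measurable (cubem js)"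
    and M: "\<And>x. \<bar>f x\<bar> \<le> M" and e: "0 < e"
  shows "\<exists>N G. nrm p js (\<lambda>x. f x - stepf N G x) < ennreal e"
proof -
  interpret finite_measure "cubem js" by (rule finite_measure_cubem)
  define P where "P = Max (insert 1 (p ` set js))"
  have P: "1 \<le> P" "\<And>j. j \<in> set js \<Longrightarrow> p j \<le> P" by (auto simp: P_def)
  define A where "A = 2 * (\<bar>M\<bar> + 1)"
  have A: "0 < A" by (simp add: A_def)
  define \<eta> where "\<eta> = (e / 2) powr P / A powr (P - 1)"
  have \<eta>: "0 < \<eta>" using e A by (simp add: \<eta>_def)
  have "integrable (cubem js) f" by (rule integrable_const_bound[where B = M]) (use M in auto)
  then have "appr js f" by (rule appr_integrable)
  then obtain N G where G: "(\<integral>\<^sup>+ x. ennreal \<bar>f x - stepf N G x\<bar> \<partial>cubem js) < ennreal \<eta>"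
    using \<eta> unfolding appr_def by blast
  define H where "H = (\<lambda>\<tau>. max (- (\<bar>M\<bar> + 1)) (min (\<bar>M\<bar> + 1) (G \<tau>)))"
  let ?u = "\<lambda>x. f x - stepf N H x"
  have u: "\<bar>?u x\<bar> \<le> \<bar>f x - stepf N G x\<bar>" "\<bar>?u x\<bar> \<le> A" for x
    using M[of x] by (auto simp: stepf_def H_def A_def)
  have pw: "ennreal_powr (ennreal \<bar>?u x\<bar>) P \<le> ennreal (A powr (P - 1)) * ennreal \<bar>f x - stepf N G x\<bar>" for x
  proof -
    have "\<bar>?u x\<bar> powr P = \<bar>?u x\<bar> powr (P - 1) * \<bar>?u x\<bar>"
      by (cases "?u x = 0") (auto simp: powr_diff)
    also have "\<dots> \<le> A powr (P - 1) * \<bar>f x - stepf N G x\<bar>"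
      using u[of x] P by (intro mult_mono powr_mono2) auto
    finally show ?thesis by (simp add: epow_ennreal ennreal_mult[symmetric] ennreal_leI)
  qed
  have "nrm p js ?u \<le> itn (\<lambda>_. P) js (\<lambda>x. ennreal \<bar>?u x\<bar>) (\<lambda>_. undefined)"
    unfolding nrm_def
  proof (rule itn_mono_exponent[OF js order_refl _ _ base_point])
    fix j assume "j \<in> set js"
    then show "0 < p j \<and> p j \<le> P" using p[of j] P(2)[of j] by simp
  qed measurable
  also have "\<dots> = ennreal_powr (itn (\<lambda>_. 1) js (\<lambda>x. ennreal_powr (ennreal \<bar>?u x\<bar>) P) (\<lambda>_. undefined)) (1 / P)"
    using P by (intro itn_const_exponent) simp
  also have "itn (\<lambda>_. 1) js (\<lambda>x. ennreal_powr (ennreal \<bar>?u x\<bar>) P) (\<lambda>_. undefined) = (\<integral>\<^sup>+ x. ennreal_powr (ennreal \<bar>?u x\<bar>) P \<partial>cubem js)"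
    by (rule itn_eq_integral[OF js]) measurable
  also have "ennreal_powr \<dots> (1 / P) \<le> ennreal_powr (ennreal ((e / 2) powr P)) (1 / P)"
  proof (rule epow_mono)
    have "(\<integral>\<^sup>+ x. ennreal_powr (ennreal \<bar>?u x\<bar>) P \<partial>cubem js) \<le> (\<integral>\<^sup>+ x. ennreal (A powr (P - 1)) * ennreal \<bar>f x - stepf N G x\<bar> \<partial>cubem js)"
      by (intro nn_integral_mono pw)
    also have "\<dots> = ennreal (A powr (P - 1)) * (\<integral>\<^sup>+ x. ennreal \<bar>f x - stepf N G x\<bar> \<partial>cubem js)"
      by (rule nn_integral_cmult) measurable
    also have "\<dots> \<le> ennreal (A powr (P - 1)) * ennreal \<eta>" using G by (intro mult_left_mono) auto
    also have "\<dots> = ennreal ((e / 2) powr P)" using A e by (simp add: \<eta>_def ennreal_mult[symmetric])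
    finally show "(\<integral>\<^sup>+ x. ennreal_powr (ennreal \<bar>?u x\<bar>) P \<partial>cubem js) \<le> ennreal ((e / 2) powr P)" .
  qed (use P in auto)
  also have "\<dots> = ennreal (e / 2)" using e P by (simp add: epow_ennreal powr_powr)
  also have "\<dots> < ennreal e" using e by (intro ennreal_lessI) auto
  finally show ?thesis by blast
qed

lemma step_dense:
  assumes js: "distinct js" and p: "\<And>j. j \<in> set js \<Longrightarrow> 1 \<le> p j" and [measurable]: "f \<in> borel_measurable (cubem js)"
    and fin: "nrm p js f < top" and e: "0 < e"
  shows "\<exists>N G. nrm p js (\<lambda>x. f x - stepf N G x) < ennreal e"
proof -
  have p0: "0 < p j" if "j \<in> set js" for j using p[OF that] by simp
  define T where "T = (\<lambda>(n::nat) x. max (- real n) (min (real n) (f x)))"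
  have Tm [measurable]: "T n \<in> borel_measurable (cubem js)" for n unfolding T_def by measurable
  define g where "g = (\<lambda>n x. ennreal \<bar>f x - T n x\<bar>)"
  have gm: "g n \<in> borel_measurable (cubem js)" for n unfolding g_def by measurable
  have dec: "decseq (\<lambda>n. g n x)" for x
    by (rule decseq_SucI) (auto simp: g_def T_def intro!: ennreal_leI)
  have inf: "(INF n. g n x) = 0" for x
  proof -
    obtain n :: nat where "\<bar>f x\<bar> \<le> real n" using real_arch_simple by blast
    then have "g n x = 0" by (auto simp: g_def T_def)
    then show ?thesis by (metis INF_lower UNIV_I le_zero_eq)
  qed
  have g0: "itn p js (g 0) (\<lambda>_. undefined) < top"
    using fin by (simp add: g_def T_def nrm_def)
  have "(INF n. itn p js (g n) (\<lambda>_. undefined)) = 0"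
    by (rule itn_INF_zero[OF js order_refl gm p0 dec inf base_point g0])
  then have "(INF n. itn p js (g n) (\<lambda>_. undefined)) < ennreal (e / 2)" using e by simp
  then obtain n where n: "nrm p js (\<lambda>x. f x - T n x) < ennreal (e / 2)"
    unfolding INF_less_iff by (auto simp: nrm_def g_def)
  have "\<exists>N G. nrm p js (\<lambda>x. T n x - stepf N G x) < ennreal (e / 2)"
    by (rule step_dense_bounded[OF js _ Tm, where M = "real n"]) (use p e in \<open>auto simp: T_def\<close>)
  then obtain N G where G: "nrm p js (\<lambda>x. T n x - stepf N G x) < ennreal (e / 2)" by blast
  have "nrm p js (\<lambda>x. f x - stepf N G x) \<le> nrm p js (\<lambda>x. f x - T n x) + nrm p js (\<lambda>x. T n x - stepf N G x)"
    by (rule nrm_diff[OF js p]) measurable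
  also have "\<dots> < ennreal (e / 2) + ennreal (e / 2)" using n G by (rule add_strict_mono)
  also have "\<dots> = ennreal e" using e by (auto simp: ennreal_plus[symmetric] simp del: ennreal_plus)
  finally show ?thesis by blast
qed

section \<open>Averaging over the dyadic cubes\<close>

definition ecoef :: "nat list \<Rightarrow> nat \<Rightarrow> ((nat \<Rightarrow> real) \<Rightarrow> real) \<Rightarrow> (nat \<Rightarrow> bool list) \<Rightarrow> real" where
  "ecoef js N f w = 2 ^ (N * length js) * (\<integral>x. f x * of_bool (bitsv N x = w) \<partial>cubem js)"

lemma mavg_point:
  assumes js: "distinct js" and w: "w \<in> pts N js t"
  shows "mavg N js (\<lambda>\<tau>. of_bool (\<tau> = w)) t = (1/2) ^ (N * length js)"
proof -
  have "mavg N js (\<lambda>\<tau>. of_bool (\<tau> = w)) t = mavg N js (\<lambda>\<tau>. \<Prod>j\<in>set js. of_bool (\<tau> j = w j)) t"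
  proof (rule mavg_cong)
    fix \<tau> assume \<tau>: "\<tau> \<in> pts N js t"
    have "\<tau> = w \<longleftrightarrow> (\<forall>j\<in>set js. \<tau> j = w j)" using \<tau> w by (force simp: pts_def)
    then show "of_bool (\<tau> = w) = (\<Prod>j\<in>set js. of_bool (\<tau> j = w j) :: real)"
      by (auto intro!: prod.neutral[symmetric] prod_zero[symmetric])
  qed
  also have "\<dots> = (\<Prod>j\<in>set js. avg N (\<lambda>s. of_bool (s = w j)))" by (rule mavg_prod[OF js])
  also have "\<dots> = (\<Prod>j\<in>set js. (1/2) ^ N)" using w by (intro prod.cong refl) (auto simp: avg_point pts_def)
  finally show ?thesis using js by (simp add: distinct_card power_mult)
qed

lemma integrable_mult_point:
  fixes f :: "(nat \<Rightarrow> real) \<Rightarrow> real"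
  assumes "integrable (cubem js) f" shows "integrable (cubem js) (\<lambda>x. f x * of_bool (bitsv N x = w))"
  by (rule Bochner_Integration.integrable_bound[OF assms]) (use assms in auto)

lemma ecoef_pairing:
  assumes js: "distinct js" and f: "integrable (cubem js) f"
  shows "mavg N js (\<lambda>\<tau>. ecoef js N f \<tau> * G \<tau>) (base N) = (\<integral>x. f x * stepf N G x \<partial>cubem js)"
proof -
  let ?W = "pts N js (base N)"
  have "mavg N js (\<lambda>\<tau>. ecoef js N f \<tau> * G \<tau>) (base N) = mavg N js (\<lambda>\<tau>. \<Sum>w\<in>?W. (ecoef js N f w * G w) * of_bool (\<tau> = w)) (base N)"
    by (rule mavg_cong) (simp add: finite_pts of_bool_def if_distrib[of "\<lambda>y. _ * y"] cong: if_cong)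
  also have "\<dots> = (\<Sum>w\<in>?W. (ecoef js N f w * G w) * (1/2) ^ (N * length js))"
    by (simp only: mavg_sum mavg_cmult) (intro sum.cong refl, simp add: mavg_point[OF js])
  also have "\<dots> = (\<Sum>w\<in>?W. \<integral>x. G w * (f x * of_bool (bitsv N x = w)) \<partial>cubem js)"
  proof (intro sum.cong refl)
    fix w
    have "(2::real) ^ k * (1/2) ^ k = 1" for k by (simp flip: power_mult_distrib)
    then show "(ecoef js N f w * G w) * (1/2) ^ (N * length js) = (\<integral>x. G w * (f x * of_bool (bitsv N x = w)) \<partial>cubem js)"
      unfolding ecoef_def by simp
  qed
  also have "\<dots> = (\<integral>x. (\<Sum>w\<in>?W. G w * (f x * of_bool (bitsv N x = w))) \<partial>cubem js)"
    by (rule Bochner_Integration.integral_sum[symmetric]) (intro integrable_mult_right integrable_mult_point f)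
  also have "\<dots> = (\<integral>x. f x * stepf N G x \<partial>cubem js)"
    by (intro Bochner_Integration.integral_cong refl)
       (simp add: stepf_eq_sum sum_distrib_left mult_ac)
  finally show ?thesis .
qed

lemma dnorm_ecoef:
  assumes js: "distinct js" and p: "\<And>j. j \<in> set js \<Longrightarrow> 1 < p j" and [measurable]: "f \<in> borel_measurable (cubem js)"
    and fin: "nrm p js f < top"
  shows "ennreal (dnorm N p js (ecoef js N f) (base N)) \<le> nrm p js f"
proof -
  have p1: "1 \<le> p j" if "j \<in> set js" for j using p[OF that] by simp
  have f: "integrable (cubem js) f" by (rule integrable_nrm[OF js p1 assms(3) fin])
  let ?G = "dualf N p js (ecoef js N f)"
  have G: "mavg N js (\<lambda>\<tau>. ecoef js N f \<tau> * ?G \<tau>) (base N) = dnorm N p js (ecoef js N f) (base N)"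
    "dnorm N (conj_exp p) js ?G (base N) \<le> 1"
    using dualf_norming[of js p N "ecoef js N f" "base N"] p by auto
  have "ennreal (dnorm N p js (ecoef js N f) (base N)) = ennreal (\<integral>x. f x * stepf N ?G x \<partial>cubem js)"
    using G(1) ecoef_pairing[OF js f, of N ?G] by simp
  also have "\<dots> \<le> (\<integral>\<^sup>+ x. ennreal \<bar>f x\<bar> * ennreal \<bar>stepf N ?G x\<bar> \<partial>cubem js)"
  proof (cases "integrable (cubem js) (\<lambda>x. f x * stepf N ?G x)")
    case True
    have "ennreal (\<integral>x. f x * stepf N ?G x \<partial>cubem js) \<le> ennreal (norm (\<integral>x. f x * stepf N ?G x \<partial>cubem js))"
      by (intro ennreal_leI) simp
    also have "\<dots> \<le> (\<integral>\<^sup>+ x. ennreal (norm (f x * stepf N ?G x)) \<partial>cubem js)"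
      by (rule integral_norm_bound_ennreal[OF True])
    finally show ?thesis by (simp add: abs_mult ennreal_mult)
  qed (simp add: not_integrable_integral_eq)
  also have "\<dots> = itn (\<lambda>_. 1) js (\<lambda>x. ennreal \<bar>f x\<bar> * ennreal \<bar>stepf N ?G x\<bar>) (\<lambda>_. undefined)"
    by (rule itn_eq_integral[OF js, symmetric]) measurable
  also have "\<dots> \<le> nrm p js f * nrm (conj_exp p) js (stepf N ?G)"
    unfolding nrm_def by (rule itn_Holder[OF js order_refl _ _ p base_point]) measurable
  also have "\<dots> \<le> nrm p js f * 1"
    unfolding nrm_stepf using G(2) by (intro mult_left_mono) (auto simp: ennreal_le_1)
  finally show ?thesis by simp
qed

lemma ecoef_stepf:
  assumes js: "distinct js" and w: "w \<in> pts N js (base N)"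
  shows "ecoef js N (stepf N G) w = G w"
proof -
  let ?S = "{x \<in> space (cubem js). bitsv N x = w}"
  have eq: "mavg N js (\<lambda>\<tau>. ecoef js N (\<lambda>x. 1) \<tau> * of_bool (\<tau> = w)) (base N) = (\<integral>x. 1 * stepf N (\<lambda>\<tau>. of_bool (\<tau> = w)) x \<partial>cubem js)"
  proof -
    interpret finite_measure "cubem js" by (rule finite_measure_cubem)
    show ?thesis by (rule ecoef_pairing[OF js]) simp
  qed
  have int: "(\<integral>x. (of_bool (bitsv N x = w) :: real) \<partial>cubem js) = (1/2) ^ (N * length js)"
  proof -
    have "ennreal (\<integral>x. (of_bool (bitsv N x = w) :: real) \<partial>cubem js) = (\<integral>\<^sup>+ x. ennreal (of_bool (bitsv N x = w)) \<partial>cubem js)"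
    proof (rule nn_integral_eq_integral[symmetric])
      interpret finite_measure "cubem js" by (rule finite_measure_cubem)
      show "integrable (cubem js) (\<lambda>x. of_bool (bitsv N x = w) :: real)"
        by (rule integrable_const_bound[where B = 1]) auto
    qed auto
    also have "\<dots> = (\<integral>\<^sup>+ x. ennreal \<bar>stepf N (\<lambda>\<tau>. of_bool (\<tau> = w)) x\<bar> \<partial>cubem js)"
      by (simp add: stepf_def)
    also have "\<dots> = nrm (\<lambda>_. 1) js (stepf N (\<lambda>\<tau>. of_bool (\<tau> = w)))"
      unfolding nrm_def by (rule itn_eq_integral[OF js, symmetric]) measurable
    also have "\<dots> = ennreal (dnorm N (\<lambda>_. 1) js (\<lambda>\<tau>. of_bool (\<tau> = w)) (base N))" by (rule nrm_stepf)
    also have "dnorm N (\<lambda>_. 1) js F t = mavg N js (\<lambda>\<tau>. \<bar>F \<tau>\<bar>) t" for F t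
    proof (induction js arbitrary: t)
      case (Cons j js)
      have "0 \<le> avg N (\<lambda>s. mavg N js (\<lambda>\<tau>. \<bar>F \<tau>\<bar>) (t(j := s)))"
        using dnorm_nonneg[of N "\<lambda>_. 1" js F] by (intro avg_nonneg) (simp add: Cons)
      moreover have "0 \<le> mavg N js (\<lambda>\<tau>. \<bar>F \<tau>\<bar>) t'" for t' using dnorm_nonneg[of N "\<lambda>_. 1" js F t'] by (simp add: Cons)
      ultimately show ?case by (simp add: Cons del: fun_upd_apply)
    qed simp
    also have "mavg N js (\<lambda>\<tau>. \<bar>of_bool (\<tau> = w)\<bar>) (base N) = (1/2) ^ (N * length js)"
      using mavg_point[OF js w] by simp
    finally show ?thesis by (subst (asm) ennreal_inj) auto
  qed
  have "(\<integral>x. stepf N G x * of_bool (bitsv N x = w) \<partial>cubem js) = (\<integral>x. G w * of_bool (bitsv N x = w) \<partial>cubem js)"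
    by (intro Bochner_Integration.integral_cong refl) (auto simp: stepf_def)
  also have "\<dots> = G w * (1/2) ^ (N * length js)" by (simp add: int)
  finally have "ecoef js N (stepf N G) w = 2 ^ (N * length js) * (G w * (1/2) ^ (N * length js))"
    by (simp only: ecoef_def)
  also have "\<dots> = G w * (2 ^ (N * length js) * (1/2) ^ (N * length js))" by (simp only: mult_ac)
  also have "\<dots> = G w" by (simp flip: power_mult_distrib)
  finally show ?thesis .
qed

definition zero_mean :: "nat list \<Rightarrow> ((nat \<Rightarrow> real) \<Rightarrow> real) \<Rightarrow> bool" where
  "zero_mean js f \<longleftrightarrow> (\<forall>j\<in>set js. AE t in cube_measure (set js - {j}). (\<integral>s. f (t(j := s)) \<partial>unit_measure) = 0)"

lemma integral_cexp:
  fixes \<phi> :: "bool list \<Rightarrow> 'x \<Rightarrow> real"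
  assumes "\<And>w. integrable M (\<phi> w)"
  shows "(\<integral>x. cexp n (\<lambda>w. \<phi> w x) u \<partial>M) = cexp n (\<lambda>w. \<integral>x. \<phi> w x \<partial>M) u \<and> integrable M (\<lambda>x. cexp n (\<lambda>w. \<phi> w x) u)"
  by (induction n arbitrary: u) (auto simp: assms)

lemma ecoef_zero_mean:
  assumes js: "distinct js" "j \<in> set js" and f: "integrable (cubem js) f" and z: "zero_mean js f"
    and \<tau>: "\<tau> \<in> pts N js (base N)"
  shows "avg N (\<lambda>s. ecoef js N f (\<tau>(j := s))) = 0"
proof -
  let ?I = "set js - {j}"
  have I: "set js = insert j ?I" using js by auto
  define \<kappa> where "\<kappa> = (\<lambda>x. of_bool (\<forall>i\<in>?I. bits N (x i) = \<tau> i) :: real)"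
  have chi: "avg N (\<lambda>s. of_bool (bitsv N x = \<tau>(j := s))) = (1/2) ^ N * \<kappa> x" if "x \<in> space (cubem js)" for x
  proof -
    have "bitsv N x = \<tau>(j := s) \<longleftrightarrow> (\<forall>i\<in>?I. bits N (x i) = \<tau> i) \<and> s = bits N (x j)" for s
    proof
      assume eq: "bitsv N x = \<tau>(j := s)"
      show "(\<forall>i\<in>?I. bits N (x i) = \<tau> i) \<and> s = bits N (x j)"
        using fun_cong[OF eq] by (auto simp: bitsv_def split: if_splits)
    next
      assume eq: "(\<forall>i\<in>?I. bits N (x i) = \<tau> i) \<and> s = bits N (x j)"
      show "bitsv N x = \<tau>(j := s)"
      proof
        fix i
        show "bitsv N x i = (\<tau>(j := s)) i"
          using eq \<tau> js(2) bitsv_in_pts[OF that, of N] by (cases "i \<in> set js") (auto simp: pts_def bitsv_def)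
      qed
    qed
    then have "avg N (\<lambda>s. of_bool (bitsv N x = \<tau>(j := s))) = avg N (\<lambda>s. \<kappa> x * of_bool (s = bits N (x j)))"
      by (simp add: \<kappa>_def of_bool_conj)
    also have "\<dots> = \<kappa> x * (1/2) ^ N" by (simp add: cexp_mult_left avg_point)
    finally show ?thesis by simp
  qed
  have chim [measurable]: "\<kappa> \<in> borel_measurable (cubem js)"
  proof -
    have "(\<lambda>x. 2 ^ N * avg N (\<lambda>s. of_bool (bitsv N x = \<tau>(j := s)) :: real)) \<in> borel_measurable (cubem js)"
    proof (intro borel_measurable_times borel_measurable_const)
      have "(\<lambda>x. cexp n (\<lambda>s. of_bool (bitsv N x = \<tau>(j := s)) :: real) u) \<in> borel_measurable (cubem js)" for n u
        by (induction n arbitrary: u) auto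
      then show "(\<lambda>x. avg N (\<lambda>s. of_bool (bitsv N x = \<tau>(j := s)) :: real)) \<in> borel_measurable (cubem js)" .
    qed
    then show ?thesis
      by (rule measurable_cong[THEN iffD1, rotated]) (simp add: chi power_mult_distrib[symmetric] del: fun_upd_apply flip: mult.assoc)
  qed
  have fchi: "integrable (cubem js) (\<lambda>x. f x * \<kappa> x)"
    by (rule Bochner_Integration.integrable_bound[OF f]) (use f in \<open>auto simp: \<kappa>_def\<close>)
  have "avg N (\<lambda>s. ecoef js N f (\<tau>(j := s))) = 2 ^ (N * length js) * avg N (\<lambda>s. \<integral>x. f x * of_bool (bitsv N x = \<tau>(j := s)) \<partial>cubem js)"
    unfolding ecoef_def by (rule cexp_mult_left)
  also have "avg N (\<lambda>s. \<integral>x. f x * of_bool (bitsv N x = \<tau>(j := s)) \<partial>cubem js)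
    = (\<integral>x. avg N (\<lambda>s. f x * of_bool (bitsv N x = \<tau>(j := s))) \<partial>cubem js)"
    using integral_cexp[of "cubem js" "\<lambda>s x. f x * of_bool (bitsv N x = \<tau>(j := s))" N "[]"] integrable_mult_point[OF f]
    by (simp del: fun_upd_apply)
  also have "\<dots> = (\<integral>x. (1/2) ^ N * (f x * \<kappa> x) \<partial>cubem js)"
    by (intro Bochner_Integration.integral_cong refl) (simp add: cexp_mult_left chi del: fun_upd_apply)
  also have "\<dots> = (1/2) ^ N * (\<integral>x. f x * \<kappa> x \<partial>cubem js)" by simp
  also have "(\<integral>x. f x * \<kappa> x \<partial>cubem js) = (\<integral>t. (\<integral>s. f (t(j := s)) * \<kappa> (t(j := s)) \<partial>unit_measure) \<partial>cube_measure ?I)"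
    using fchi unfolding cube_measure_def by (subst I, subst cubes.product_integral_insert) (auto simp: insert_absorb[OF js(2)])
  also have "\<dots> = 0"
  proof (rule integral_eq_zero_AE)
    have "AE t in cube_measure ?I. (\<integral>s. f (t(j := s)) \<partial>unit_measure) = 0" using z js(2) by (simp add: zero_mean_def)
    then show "AE t in cube_measure ?I. (\<integral>s. f (t(j := s)) * \<kappa> (t(j := s)) \<partial>unit_measure) = 0"
    proof (rule AE_mp, intro AE_I2 impI)
      fix t assume "(\<integral>s. f (t(j := s)) \<partial>unit_measure) = 0"
      moreover have "\<kappa> (t(j := s)) = \<kappa> t" for s by (auto simp: \<kappa>_def)
      ultimately show "(\<integral>s. f (t(j := s)) * \<kappa> (t(j := s)) \<partial>unit_measure) = 0" by (simp del: fun_upd_apply)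
    qed
  qed
  finally show ?thesis by (simp del: fun_upd_apply)
qed

text \<open>A step function close to \<open>f\<close> need not have vanishing means in each variable. The averages of \<open>f\<close> over
  dyadic cubes do, hence they are values of a Haar polynomial; since averaging fixes step functions and
  does not increase the norm, passing to them at most doubles the distance to step functions.\<close>

lemma haar_polynomials_dense:
  assumes js: "distinct js" and p: "\<And>j. j \<in> set js \<Longrightarrow> 1 < p j" and fm [measurable]: "f \<in> borel_measurable (cubem js)"
    and fin: "nrm p js f < top" and z: "zero_mean js f" and e: "0 < e"
  shows "\<exists>N b. nrm p js (\<lambda>x. f x - stepf N (hpoly js N b) x) < ennreal e"
proof -
  have p1: "1 \<le> p j" if "j \<in> set js" for j using p[OF that] by simp
  have f: "integrable (cubem js) f" by (rule integrable_nrm[OF js p1 fm fin])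
  obtain N G where G: "nrm p js (\<lambda>x. f x - stepf N G x) < ennreal (e / 2)"
    using step_dense[OF js p1 fm fin, of "e / 2"] e by auto
  have "\<forall>j\<in>set js. \<forall>\<tau>\<in>pts N js (base N). avg N (\<lambda>s. ecoef js N f (\<tau>(j := s))) = 0"
    using ecoef_zero_mean[OF js _ f z] by blast
  then have "\<exists>b. \<forall>\<tau>\<in>pts N js (base N). hpoly js N b \<tau> = ecoef js N f \<tau>"
    using projection_exists[of js p N "base N" "ecoef js N f"] js p by blast
  then obtain b where b: "\<And>\<tau>. \<tau> \<in> pts N js (base N) \<Longrightarrow> hpoly js N b \<tau> = ecoef js N f \<tau>" by blast
  define g where "g = (\<lambda>x. stepf N G x - f x)"
  have gm [measurable]: "g \<in> borel_measurable (cubem js)" unfolding g_def by measurable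
  have ng: "nrm p js g < ennreal (e / 2)" using G unfolding g_def by (subst nrm_diff_commute)
  have sG: "integrable (cubem js) (stepf N G)"
  proof -
    have "nrm p js (stepf N G) < top" by (simp add: nrm_stepf)
    then show ?thesis using integrable_nrm[OF js _ measurable_stepf, of p N G] p1 by blast
  qed
  have eg: "ecoef js N g w = G w - ecoef js N f w" if "w \<in> pts N js (base N)" for w
  proof -
    have "(\<integral>x. g x * of_bool (bitsv N x = w) \<partial>cubem js) = (\<integral>x. stepf N G x * of_bool (bitsv N x = w) \<partial>cubem js) - (\<integral>x. f x * of_bool (bitsv N x = w) \<partial>cubem js)"
      unfolding g_def left_diff_distrib
      by (intro Bochner_Integration.integral_diff integrable_mult_point f sG)
    then show ?thesis using ecoef_stepf[OF js that, of G] by (simp add: ecoef_def right_diff_distrib)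
  qed
  have "nrm p js (\<lambda>x. stepf N G x - stepf N (hpoly js N b) x) = nrm p js (stepf N (\<lambda>\<tau>. G \<tau> - hpoly js N b \<tau>))"
    by (simp add: nrm_def stepf_def)
  also have "\<dots> = ennreal (dnorm N p js (ecoef js N g) (base N))"
    unfolding nrm_stepf by (intro arg_cong[where f = ennreal] dnorm_cong) (simp add: eg b)
  also have "\<dots> \<le> nrm p js g" using ng by (intro dnorm_ecoef[OF js p gm]) (auto intro: less_trans)
  also have "\<dots> < ennreal (e / 2)" by (rule ng)
  finally have s1: "nrm p js (\<lambda>x. f x - stepf N G x) + nrm p js (\<lambda>x. stepf N G x - stepf N (hpoly js N b) x) < ennreal (e / 2) + ennreal (e / 2)"
    using G by (intro add_strict_mono)
  have s2: "nrm p js (\<lambda>x. f x - stepf N (hpoly js N b) x) \<le> nrm p js (\<lambda>x. f x - stepf N G x) + nrm p js (\<lambda>x. stepf N G x - stepf N (hpoly js N b) x)"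
    by (rule nrm_diff[OF js p1]) measurable
  have s3: "ennreal (e / 2) + ennreal (e / 2) = ennreal e" using e by (auto simp: ennreal_plus[symmetric] simp del: ennreal_plus)
  from order_le_less_trans[OF s2 s1] have "nrm p js (\<lambda>x. f x - stepf N (hpoly js N b) x) < ennreal e" unfolding s3 .
  then show ?thesis by (intro exI)
qed

section \<open>Completeness\<close>

lemma slices:
  fixes f :: "(nat \<Rightarrow> real) \<Rightarrow> real"
  assumes j: "j \<in> set js" and f: "f \<in> borel_measurable (cubem js)"
  shows "(\<lambda>t. \<integral>\<^sup>+ s. ennreal \<bar>f (t(j := s))\<bar> \<partial>unit_measure) \<in> borel_measurable (cube_measure (set js - {j}))"
    and "(\<lambda>t. \<integral>s. f (t(j := s)) \<partial>unit_measure) \<in> borel_measurable (cube_measure (set js - {j}))"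
    and "(\<integral>\<^sup>+ t. (\<integral>\<^sup>+ s. ennreal \<bar>f (t(j := s))\<bar> \<partial>unit_measure) \<partial>cube_measure (set js - {j})) = (\<integral>\<^sup>+ x. ennreal \<bar>f x\<bar> \<partial>cubem js)"
    and "\<And>t. t \<in> space (cube_measure (set js - {j})) \<Longrightarrow> (\<lambda>s. f (t(j := s))) \<in> borel_measurable unit_measure"
proof -
  let ?I = "set js - {j}"
  have I: "insert j ?I = set js" using j by auto
  have fm [measurable]: "f \<in> borel_measurable (Pi\<^sub>M (insert j ?I) (\<lambda>_. unit_measure))"
    using f unfolding I cube_measure_def .
  show "(\<lambda>t. \<integral>\<^sup>+ s. ennreal \<bar>f (t(j := s))\<bar> \<partial>unit_measure) \<in> borel_measurable (cube_measure ?I)"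
    "(\<lambda>t. \<integral>s. f (t(j := s)) \<partial>unit_measure) \<in> borel_measurable (cube_measure ?I)"
    unfolding cube_measure_def by measurable
  have "(\<integral>\<^sup>+ x. ennreal \<bar>f x\<bar> \<partial>Pi\<^sub>M (insert j ?I) (\<lambda>_. unit_measure)) = (\<integral>\<^sup>+ t. (\<integral>\<^sup>+ s. ennreal \<bar>f (t(j := s))\<bar> \<partial>unit_measure) \<partial>Pi\<^sub>M ?I (\<lambda>_. unit_measure))"
  proof (rule cubes.product_nn_integral_insert)
    show "finite ?I" "j \<notin> ?I" by simp_all
    show "(\<lambda>x. ennreal \<bar>f x\<bar>) \<in> borel_measurable (Pi\<^sub>M (insert j ?I) (\<lambda>_. unit_measure))" by measurable
  qed
  then show "(\<integral>\<^sup>+ t. (\<integral>\<^sup>+ s. ennreal \<bar>f (t(j := s))\<bar> \<partial>unit_measure) \<partial>cube_measure ?I) = (\<integral>\<^sup>+ x. ennreal \<bar>f x\<bar> \<partial>cubem js)"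
    unfolding I cube_measure_def by simp
  fix t assume "t \<in> space (cube_measure ?I)"
  then have "(\<lambda>s. t(j := s)) \<in> measurable unit_measure (Pi\<^sub>M (insert j ?I) (\<lambda>_. unit_measure))"
    by (intro measurable_component_update) (auto simp: cube_measure_def)
  then show "(\<lambda>s. f (t(j := s))) \<in> borel_measurable unit_measure" by (rule measurable_compose) (rule fm)
qed

lemma AE_integrable_slice:
  fixes f :: "(nat \<Rightarrow> real) \<Rightarrow> real"
  assumes j: "j \<in> set js" and f: "f \<in> borel_measurable (cubem js)" and fin: "(\<integral>\<^sup>+ x. ennreal \<bar>f x\<bar> \<partial>cubem js) < top"
  shows "AE t in cube_measure (set js - {j}). integrable unit_measure (\<lambda>s. f (t(j := s)))"
proof -
  have "AE t in cube_measure (set js - {j}). (\<integral>\<^sup>+ s. ennreal \<bar>f (t(j := s))\<bar> \<partial>unit_measure) \<noteq> \<infinity>"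
    by (rule nn_integral_PInf_AE[OF slices(1)[OF j f]]) (use fin in \<open>simp add: slices(3)[OF j f]\<close>)
  then show ?thesis
  proof (rule AE_mp, intro AE_I2 impI)
    fix t assume t: "t \<in> space (cube_measure (set js - {j}))" "(\<integral>\<^sup>+ s. ennreal \<bar>f (t(j := s))\<bar> \<partial>unit_measure) \<noteq> \<infinity>"
    then show "integrable unit_measure (\<lambda>s. f (t(j := s)))"
      using slices(4)[OF j f t(1)] by (intro integrableI_bounded) (auto simp: less_top simp del: fun_upd_apply)
  qed
qed

lemma zero_mean_add:
  assumes fm: "f \<in> borel_measurable (cubem js)" "(\<integral>\<^sup>+ x. ennreal \<bar>f x\<bar> \<partial>cubem js) < top" "zero_mean js f"
    and gm: "g \<in> borel_measurable (cubem js)" "(\<integral>\<^sup>+ x. ennreal \<bar>g x\<bar> \<partial>cubem js) < top" "zero_mean js g"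
  shows "zero_mean js (\<lambda>x. f x + g x)"
  unfolding zero_mean_def
proof
  fix j assume j: "j \<in> set js"
  show "AE t in cube_measure (set js - {j}). (\<integral>s. f (t(j := s)) + g (t(j := s)) \<partial>unit_measure) = 0"
    using AE_integrable_slice[OF j fm(1,2)] AE_integrable_slice[OF j gm(1,2)] bspec[OF fm(3)[unfolded zero_mean_def] j] bspec[OF gm(3)[unfolded zero_mean_def] j]
  proof eventually_elim
    case (elim t)
    then show ?case by (simp del: fun_upd_apply)
  qed
qed

lemma zero_mean_cmult:
  assumes "zero_mean js f" shows "zero_mean js (\<lambda>x. c * f x)"
  unfolding zero_mean_def
proof
  fix j assume "j \<in> set js"
  then have "AE t in cube_measure (set js - {j}). (\<integral>s. f (t(j := s)) \<partial>unit_measure) = 0"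
    using assms by (simp add: zero_mean_def del: fun_upd_apply)
  then show "AE t in cube_measure (set js - {j}). (\<integral>s. c * f (t(j := s)) \<partial>unit_measure) = 0"
    by eventually_elim (simp del: fun_upd_apply)
qed

lemma integral_finite:
  assumes "distinct js" and "\<forall>j\<in>set js. 1 \<le> p j" and "f \<in> borel_measurable (cubem js)" "nrm p js f < top"
  shows "(\<integral>\<^sup>+ x. ennreal \<bar>f x\<bar> \<partial>cubem js) < top"
proof -
  have "(\<integral>\<^sup>+ x. ennreal \<bar>f x\<bar> \<partial>cubem js) \<le> nrm p js f"
    using assms by (intro integral_le_nrm) auto
  then show ?thesis using assms(4) by (rule order_le_less_trans)
qed

text \<open>Integration over one variable is continuous for the norm of \<open>L\<^sup>1\<close>, which is dominated by every mixed
  norm with exponents at least \<open>1\<close>.\<close>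

lemma zero_mean_limit:
  assumes js: "distinct js" and p: "\<And>j. j \<in> set js \<Longrightarrow> 1 \<le> p j"
    and f: "f \<in> borel_measurable (cubem js)" "nrm p js f < top"
    and lim: "\<And>e. 0 < e \<Longrightarrow> \<exists>g. g \<in> borel_measurable (cubem js) \<and> nrm p js g < top \<and> zero_mean js g \<and> nrm p js (\<lambda>x. f x - g x) < ennreal e"
  shows "zero_mean js f"
  unfolding zero_mean_def
proof
  fix j assume j: "j \<in> set js"
  have pp: "\<forall>j\<in>set js. 1 \<le> p j" using p by blast
  let ?Q = "cube_measure (set js - {j})"
  let ?A = "\<lambda>t. \<integral>s. f (t(j := s)) \<partial>unit_measure"
  have eps: "(\<integral>\<^sup>+ t. ennreal \<bar>?A t\<bar> \<partial>?Q) \<le> 0 + ennreal e" if e: "0 < e" for e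
  proof -
    obtain g where g: "g \<in> borel_measurable (cubem js)" "nrm p js g < top" "zero_mean js g" "nrm p js (\<lambda>x. f x - g x) < ennreal e"
      using lim[OF e] by blast
    note [measurable] = f(1) g(1)
    have fg: "(\<lambda>x. f x - g x) \<in> borel_measurable (cubem js)" by measurable
    have "(\<integral>\<^sup>+ t. ennreal \<bar>?A t\<bar> \<partial>?Q) \<le> (\<integral>\<^sup>+ t. (\<integral>\<^sup>+ s. ennreal \<bar>f (t(j := s)) - g (t(j := s))\<bar> \<partial>unit_measure) \<partial>?Q)"
    proof (rule nn_integral_mono_AE)
      show "AE t in ?Q. ennreal \<bar>?A t\<bar> \<le> (\<integral>\<^sup>+ s. ennreal \<bar>f (t(j := s)) - g (t(j := s))\<bar> \<partial>unit_measure)"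
        using AE_integrable_slice[OF j f(1) integral_finite[OF js pp f]] AE_integrable_slice[OF j g(1) integral_finite[OF js pp g(1,2)]] bspec[OF g(3)[unfolded zero_mean_def] j]
      proof eventually_elim
        case (elim t)
        have "?A t = (\<integral>s. f (t(j := s)) - g (t(j := s)) \<partial>unit_measure)"
          using elim by (simp del: fun_upd_apply)
        then show ?case
          using integral_norm_bound_ennreal[of unit_measure "\<lambda>s. f (t(j := s)) - g (t(j := s))"] elim
          by (simp del: fun_upd_apply)
      qed
    qed
    also have "\<dots> = (\<integral>\<^sup>+ x. ennreal \<bar>f x - g x\<bar> \<partial>cubem js)" by (rule slices(3)[OF j fg])
    also have "\<dots> \<le> nrm p js (\<lambda>x. f x - g x)" by (rule integral_le_nrm[OF js p fg])
    also have "\<dots> \<le> ennreal e" using g(4) by simp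
    finally show ?thesis unfolding add_0 .
  qed
  have "(\<integral>\<^sup>+ t. ennreal \<bar>?A t\<bar> \<partial>?Q) \<le> 0" by (rule ennreal_le_epsilon) (rule eps)
  then have z: "(\<integral>\<^sup>+ t. ennreal \<bar>?A t\<bar> \<partial>?Q) = 0" by (rule antisym[OF _ zero_le])
  have "(\<lambda>t. ennreal \<bar>?A t\<bar>) \<in> borel_measurable ?Q"
    using slices(2)[OF j f(1)] by (rule measurable_abs_ennreal)
  from nn_integral_0_iff_AE[OF this] z have "AE t in ?Q. ennreal \<bar>?A t\<bar> = 0" by (rule iffD1)
  then show "AE t in ?Q. ?A t = 0" by eventually_elim (simp del: fun_upd_apply)
qed

lemma itn_suminf:
  assumes "distinct js" "\<And>j. j \<in> set js \<Longrightarrow> 1 \<le> p j" "\<And>n. g n \<in> borel_measurable (cubem js)"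
  shows "itn p js (\<lambda>x. \<Sum>n. g n x) (\<lambda>_. undefined) \<le> (\<Sum>n. itn p js (g n) (\<lambda>_. undefined))"
proof -
  note [measurable] = assms(3)
  have p0: "0 < p j" if "j \<in> set js" for j using assms(2)[OF that] by simp
  have part: "itn p js (\<lambda>x. \<Sum>n<m. g n x) (\<lambda>_. undefined) \<le> (\<Sum>n<m. itn p js (g n) (\<lambda>_. undefined))" for m
  proof (induction m)
    case 0
    have "itn p js (\<lambda>x. 0 * 0) (\<lambda>_. undefined) = 0 * itn p js (\<lambda>x. 0) (\<lambda>_. undefined)"
      by (rule itn_cmult[OF assms(1) order_refl _ p0 base_point]) auto
    then show ?case by simp
  next
    case (Suc m)
    have "itn p js (\<lambda>x. (\<Sum>n<m. g n x) + g m x) (\<lambda>_. undefined) \<le> itn p js (\<lambda>x. \<Sum>n<m. g n x) (\<lambda>_. undefined) + itn p js (g m) (\<lambda>_. undefined)"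
      by (rule itn_add[OF assms(1) order_refl _ _ assms(2) base_point]) measurable
    also have "\<dots> \<le> (\<Sum>n<m. itn p js (g n) (\<lambda>_. undefined)) + itn p js (g m) (\<lambda>_. undefined)"
      using Suc by (rule add_right_mono)
    finally show ?case by simp
  qed
  have "itn p js (\<lambda>x. \<Sum>n. g n x) (\<lambda>_. undefined) = itn p js (\<lambda>x. SUP m. \<Sum>n<m. g n x) (\<lambda>_. undefined)"
    by (simp add: suminf_eq_SUP)
  also have "\<dots> = (SUP m. itn p js (\<lambda>x. \<Sum>n<m. g n x) (\<lambda>_. undefined))"
    by (rule itn_SUP[OF assms(1) order_refl _ p0 _ base_point]) (auto simp: incseq_def intro!: sum_mono2)
  also have "\<dots> \<le> (\<Sum>n. itn p js (g n) (\<lambda>_. undefined))"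
    by (intro SUP_least order_trans[OF part] sum_le_suminf) auto
  finally show ?thesis .
qed

lemma ennreal_abs_limit_le:
  fixes h :: "nat \<Rightarrow> real"
  assumes fin: "(\<Sum>l. ennreal \<bar>h l\<bar>) < top"
  shows "summable h" and "ennreal \<bar>suminf h\<bar> \<le> (\<Sum>l. ennreal \<bar>h l\<bar>)"
proof -
  have s: "summable (\<lambda>l. \<bar>h l\<bar>)" using fin by (intro summable_suminf_not_top) auto
  then show "summable h" by (rule summable_rabs_cancel)
  have "\<bar>suminf h\<bar> \<le> (\<Sum>l. \<bar>h l\<bar>)" using s by (rule summable_rabs)
  then have "ennreal \<bar>suminf h\<bar> \<le> ennreal (\<Sum>l. \<bar>h l\<bar>)" by (rule ennreal_leI)
  also have "\<dots> = (\<Sum>l. ennreal \<bar>h l\<bar>)" using s by (intro suminf_ennreal2[symmetric]) auto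
  finally show "ennreal \<bar>suminf h\<bar> \<le> (\<Sum>l. ennreal \<bar>h l\<bar>)" .
qed

text \<open>Choose a subsequence with increments at most \<open>2\<^sup>-\<^sup>i\<close> in norm. The norm dominates the integral of the
  modulus, so the telescoping series converges almost everywhere, and the norm of its tails is
  controlled through monotone limits.\<close>

lemma nrm_complete:
  fixes X :: "nat \<Rightarrow> (nat \<Rightarrow> real) \<Rightarrow> real"
  assumes js: "distinct js" and p: "\<And>j. j \<in> set js \<Longrightarrow> 1 \<le> p j"
    and X: "\<And>n. X n \<in> borel_measurable (cubem js)"
    and cauchy: "\<And>e. 0 < e \<Longrightarrow> \<exists>M. \<forall>m\<ge>M. \<forall>n\<ge>M. nrm p js (\<lambda>x. X m x - X n x) < ennreal e"
  shows "\<exists>f. f \<in> borel_measurable (cubem js) \<and> (\<forall>e>0. \<exists>M. \<forall>n\<ge>M. nrm p js (\<lambda>x. f x - X n x) < ennreal e)"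
proof -
  note [measurable] = X
  have p0: "0 < p j" if "j \<in> set js" for j using p[OF that] by simp
  have "\<exists>M. \<forall>m\<ge>M. \<forall>n\<ge>M. nrm p js (\<lambda>x. X m x - X n x) < ennreal ((1/2)^i)" for i :: nat by (rule cauchy) simp
  from choice[OF allI, OF this] obtain M
    where M': "\<forall>i. \<forall>m\<ge>M i. \<forall>n\<ge>M i. nrm p js (\<lambda>x. X m x - X n x) < ennreal ((1/2)^i)" ..
  have M: "nrm p js (\<lambda>x. X m x - X n x) < ennreal ((1/2)^i)" if "m \<ge> M i" "n \<ge> M i" for i m n
    using M' that by blast
  define k where "k = (\<lambda>i. Max (M ` {..i}))"
  have kM: "M i \<le> k i" and kS: "k i \<le> k (Suc i)" for i
    unfolding k_def by (auto intro!: Max_ge Max_mono)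
  define h where "h = (\<lambda>i x. X (k (Suc i)) x - X (k i) x)"
  have hm [measurable]: "h i \<in> borel_measurable (cubem js)" for i unfolding h_def by measurable
  have nh: "nrm p js (h i) \<le> ennreal ((1/2)^i)" for i
    unfolding h_def using M[of i "k (Suc i)" "k i"] kM[of i] kS[of i] by (simp add: less_imp_le)
  define T where "T = (\<lambda>i x. \<Sum>l. ennreal \<bar>h (l + i) x\<bar>)"
  define f where "f = (\<lambda>x. if T 0 x < top then X (k 0) x + (\<Sum>l. h l x) else 0)"
  have [measurable]: "T i \<in> borel_measurable (cubem js)" for i unfolding T_def by measurable
  have fm [measurable]: "f \<in> borel_measurable (cubem js)" unfolding f_def by measurable
  have tele: "X (k 0) x + (\<Sum>l<i. h l x) = X (k i) x" for i x
    by (induction i) (auto simp: h_def)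
  have Tsplit: "T 0 x = (\<Sum>l<i. ennreal \<bar>h l x\<bar>) + T i x" for i x
    unfolding T_def add_0_right by (rule trans[OF suminf_offset[OF summableI] add.commute])
  have tail: "ennreal \<bar>f x - X (k i) x\<bar> \<le> T i x" for i x
  proof (cases "T 0 x < top")
    case True
    have "T i x \<le> (\<Sum>l<i. ennreal \<bar>h l x\<bar>) + T i x" by (rule add_increasing) simp_all
    then have "T i x < top" using True Tsplit[of x i] by (metis order_le_less_trans)
    from ennreal_abs_limit_le[of "\<lambda>l. h (l + i) x"] this
    have 1: "summable (\<lambda>l. h (l + i) x)" "ennreal \<bar>\<Sum>l. h (l + i) x\<bar> \<le> T i x" by (auto simp: T_def)
    have s: "summable (\<lambda>l. h l x)" using 1(1) by (rule iffD1[OF summable_iff_shift[of "\<lambda>l. h l x" i]])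
    have "f x - X (k i) x = (\<Sum>l. h (l + i) x)"
      using True suminf_split_initial_segment[OF s, of i] tele[of x i] by (simp add: f_def)
    then show ?thesis using 1(2) by simp
  next
    case False
    then have "T 0 x = top" by (simp add: less_top[symmetric] top_unique[symmetric] not_less)
    then have "(\<Sum>l<i. ennreal \<bar>h l x\<bar>) + T i x = top" using Tsplit[of x i] by metis
    moreover have "(\<Sum>l<i. ennreal \<bar>h l x\<bar>) \<noteq> top" by (simp add: sum_ennreal)
    ultimately have "T i x = top" by (simp only: ennreal_add_eq_top) blast
    then show ?thesis by simp
  qed
  have nf: "nrm p js (\<lambda>x. f x - X (k i) x) \<le> ennreal (2 * (1/2)^i)" for i
  proof -
    have "nrm p js (\<lambda>x. f x - X (k i) x) \<le> itn p js (T i) (\<lambda>_. undefined)"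
      unfolding nrm_def by (rule itn_mono[OF p0 tail])
    also have "\<dots> \<le> (\<Sum>l. itn p js (\<lambda>x. ennreal \<bar>h (l + i) x\<bar>) (\<lambda>_. undefined))"
      unfolding T_def by (rule itn_suminf[OF js p]) measurable
    also have "\<dots> \<le> (\<Sum>l. ennreal ((1/2)^(l + i)))"
      using nh unfolding nrm_def by (intro suminf_le) auto
    also have "\<dots> = ennreal (2 * (1/2)^i)"
    proof -
      have "(\<lambda>l. (1/2::real)^l) sums (1 / (1 - 1/2))" by (rule geometric_sums) simp
      then have "(\<lambda>l. (1/2::real)^l * (1/2)^i) sums (1 / (1 - 1/2) * (1/2)^i)" by (rule sums_mult2)
      then have "(\<lambda>l. (1/2::real)^(l + i)) sums (2 * (1/2)^i)" by (simp add: power_add)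
      then show ?thesis by (intro suminf_ennreal_eq) auto
    qed
    finally show ?thesis .
  qed
  show ?thesis
  proof (intro exI[of _ f] conjI fm allI impI)
    fix e :: real assume e: "0 < e"
    obtain i where i: "(1/2::real) ^ i < e / 4" using real_arch_pow_inv[of "e / 4" "1/2"] e by auto
    have "nrm p js (\<lambda>x. f x - X n x) < ennreal e" if n: "n \<ge> k i" for n
    proof -
      have "nrm p js (\<lambda>x. f x - X n x) \<le> nrm p js (\<lambda>x. f x - X (k i) x) + nrm p js (\<lambda>x. X (k i) x - X n x)"
        by (rule nrm_diff[OF js p]) measurable
      also have "\<dots> \<le> ennreal (2 * (1/2)^i) + ennreal ((1/2)^i)"
        using nf[of i] M[of i "k i" n] kM[of i] n by (intro add_mono) auto
      also have "\<dots> = ennreal (3 * (1/2)^i)" by (simp add: ennreal_plus[symmetric] del: ennreal_plus)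
      also have "\<dots> < ennreal e" using i e by (intro ennreal_lessI) auto
      finally show ?thesis .
    qed
    then show "\<exists>M. \<forall>n\<ge>M. nrm p js (\<lambda>x. f x - X n x) < ennreal e" by blast
  qed
qed

section \<open>The space \<open>L\<^sup>p\<^sub>0\<close>\<close>

definition dims :: "nat \<Rightarrow> nat list" where
  "dims d = [1..<Suc d]"

lemma set_dims: "set (dims d) = {1..d}"
  by (auto simp: dims_def)

lemma distinct_dims: "distinct (dims d)"
  by (simp add: dims_def)

lemma mixed_norm_eq: "mixed_norm d p f = enn2real (nrm p (dims d) f)"
  by (simp only: mixed_norm_def mixed_norm_ennreal_def nrm_def iterated_norm_eq_itn dims_def)

lemma mixed_Lp0_iff:
  "f \<in> mixed_Lp0 d p \<longleftrightarrow> f \<in> borel_measurable (cubem (dims d)) \<and> nrm p (dims d) f < top \<and> zero_mean (dims d) f"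
proof -
  have "mixed_norm_ennreal d p f = nrm p (dims d) f"
    by (simp only: mixed_norm_ennreal_def nrm_def iterated_norm_eq_itn dims_def)
  then show ?thesis
    by (simp only: mixed_Lp0_def mixed_Lp_def zero_mean_def set_dims mem_Collect_eq infinity_ennreal_def conj_assoc)
qed

lemma mixed_norm_less_iff:
  assumes "nrm p (dims d) f < top" "0 < e"
  shows "mixed_norm d p f < e \<longleftrightarrow> nrm p (dims d) f < ennreal e"
  using assms unfolding mixed_norm_eq by (cases "nrm p (dims d) f") (auto simp: ennreal_less_iff)

lemma banach_mixed_Lp0:
  assumes p: "\<And>j. j \<in> set (dims d) \<Longrightarrow> 1 \<le> p j"
  shows "banach_on (mixed_Lp0 d p) (mixed_norm d p)"
proof -
  let ?js = "dims d" and ?V = "mixed_Lp0 d p" and ?N = "mixed_norm d p"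
  have js: "distinct ?js" by (rule distinct_dims)
  have I1: "(\<integral>\<^sup>+ x. ennreal \<bar>h x\<bar> \<partial>cubem ?js) < top" if "h \<in> ?V" for h
    using integral_finite[OF js, of p h] p that unfolding mixed_Lp0_iff by blast
  have zero: "(0 :: (nat \<Rightarrow> real) \<Rightarrow> real) \<in> ?V"
  proof -
    have "nrm p ?js (\<lambda>x. 0 * 0) = ennreal \<bar>0\<bar> * nrm p ?js (\<lambda>x. 0)" by (rule nrm_cmult[OF js p]) auto
    then show ?thesis unfolding mixed_Lp0_iff by (auto simp: zero_fun_def zero_mean_def)
  qed
  have add: "f + g \<in> ?V" "nrm p ?js (f + g) \<le> nrm p ?js f + nrm p ?js g" if f: "f \<in> ?V" and g: "g \<in> ?V" for f g
  proof -
    have le: "nrm p ?js (\<lambda>x. f x + g x) \<le> nrm p ?js f + nrm p ?js g"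
      using f g unfolding mixed_Lp0_iff by (intro nrm_add[OF js p]) auto
    also have "\<dots> < top" using f g unfolding mixed_Lp0_iff by simp
    finally have fin: "nrm p ?js (\<lambda>x. f x + g x) < top" .
    have z: "zero_mean ?js (\<lambda>x. f x + g x)"
      using f g I1[OF f] I1[OF g] unfolding mixed_Lp0_iff by (intro zero_mean_add) auto
    show "f + g \<in> ?V" using f g fin z unfolding mixed_Lp0_iff plus_fun_def by auto
    show "nrm p ?js (f + g) \<le> nrm p ?js f + nrm p ?js g" using le by (simp add: plus_fun_def)
  qed
  have scale: "c *\<^sub>R f \<in> ?V" "nrm p ?js (c *\<^sub>R f) = ennreal \<bar>c\<bar> * nrm p ?js f" if f: "f \<in> ?V" for c f
  proof -
    have eq: "nrm p ?js (\<lambda>x. c * f x) = ennreal \<bar>c\<bar> * nrm p ?js f"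
      using f unfolding mixed_Lp0_iff by (intro nrm_cmult[OF js p]) auto
    then have "nrm p ?js (\<lambda>x. c * f x) < top" using f unfolding mixed_Lp0_iff by (simp add: ennreal_mult_less_top)
    then show "c *\<^sub>R f \<in> ?V" "nrm p ?js (c *\<^sub>R f) = ennreal \<bar>c\<bar> * nrm p ?js f"
      using f eq zero_mean_cmult[of ?js f c] unfolding mixed_Lp0_iff scaleR_fun_def by auto
  qed
  have diff: "f - g \<in> ?V" if "f \<in> ?V" "g \<in> ?V" for f g
    using add(1)[OF that(1) scale(1)[OF that(2), of "-1"]] by simp
  show ?thesis
    unfolding banach_on_def
  proof (intro conjI ballI allI impI)
    show "subspace ?V" using zero add scale by (auto simp: subspace_def)
  next
    fix f assume "f \<in> ?V" show "0 \<le> ?N f" by (simp add: mixed_norm_eq)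
  next
    fix f g assume f: "f \<in> ?V" "g \<in> ?V"
    have "enn2real (nrm p ?js (f + g)) \<le> enn2real (nrm p ?js f + nrm p ?js g)"
      using add(2)[OF f] f unfolding mixed_Lp0_iff by (intro enn2real_mono) auto
    also have "\<dots> = enn2real (nrm p ?js f) + enn2real (nrm p ?js g)"
      using f unfolding mixed_Lp0_iff by (intro enn2real_plus) auto
    finally show "?N (f + g) \<le> ?N f + ?N g" by (simp add: mixed_norm_eq)
  next
    fix c f assume f: "f \<in> ?V"
    show "?N (c *\<^sub>R f) = \<bar>c\<bar> * ?N f"
      unfolding mixed_norm_eq scale(2)[OF f] by (simp add: enn2real_mult)
  next
    fix X :: "nat \<Rightarrow> (nat \<Rightarrow> real) \<Rightarrow> real"
    assume A: "(\<forall>n. X n \<in> ?V) \<and> (\<forall>\<epsilon>>0. \<exists>M. \<forall>m\<ge>M. \<forall>n\<ge>M. ?N (X m - X n) < \<epsilon>)"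
    have XV: "X n \<in> ?V" for n using A by blast
    have fin: "nrm p ?js (X m - X n) < top" for m n using diff[OF XV XV] unfolding mixed_Lp0_iff by blast
    have "\<exists>M. \<forall>m\<ge>M. \<forall>n\<ge>M. nrm p ?js (\<lambda>x. X m x - X n x) < ennreal e" if e: "0 < e" for e
    proof -
      obtain M where M: "\<forall>m\<ge>M. \<forall>n\<ge>M. ?N (X m - X n) < e" using conjunct2[OF A, rule_format, OF e] ..
      have "nrm p ?js (\<lambda>x. X m x - X n x) < ennreal e" if "m \<ge> M" "n \<ge> M" for m n
      proof -
        have "nrm p ?js (X m - X n) < ennreal e" using M that by (intro iffD1[OF mixed_norm_less_iff[OF fin e]]) simp
        moreover have "X m - X n = (\<lambda>x. X m x - X n x)" by (rule ext) simp
        ultimately show ?thesis by simp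
      qed
      then show ?thesis by blast
    qed
    then have "\<exists>f. f \<in> borel_measurable (cubem ?js) \<and> (\<forall>e>0. \<exists>M. \<forall>n\<ge>M. nrm p ?js (\<lambda>x. f x - X n x) < ennreal e)"
      using XV unfolding mixed_Lp0_iff by (intro nrm_complete[OF js p]) auto
    then obtain f where fm: "f \<in> borel_measurable (cubem ?js)" and f: "\<And>e. 0 < e \<Longrightarrow> \<exists>M. \<forall>n\<ge>M. nrm p ?js (\<lambda>x. f x - X n x) < ennreal e"
      by blast
    have Xm: "X n \<in> borel_measurable (cubem ?js)" for n using XV unfolding mixed_Lp0_iff by blast
    have nf: "nrm p ?js f < top"
    proof -
      obtain n where n: "nrm p ?js (\<lambda>x. f x - X n x) < ennreal 1" using f[OF zero_less_one] by blast
      have "nrm p ?js (\<lambda>x. (f x - X n x) + X n x) \<le> nrm p ?js (\<lambda>x. f x - X n x) + nrm p ?js (X n)"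
        using fm Xm[of n] by (intro nrm_add[OF js p]) auto
      also have "\<dots> < top" using less_trans[OF n ennreal_less_top] conjunct1[OF conjunct2[OF XV[of n, unfolded mixed_Lp0_iff]]] by (simp only: ennreal_add_less_top)
      finally show ?thesis by (simp only: diff_add_cancel)
    qed
    have zf: "zero_mean ?js f"
    proof (rule zero_mean_limit[OF js p fm nf])
      fix e :: real assume "0 < e"
      from f[OF this] obtain n where "nrm p ?js (\<lambda>x. f x - X n x) < ennreal e" by blast
      then show "\<exists>g. g \<in> borel_measurable (cubem ?js) \<and> nrm p ?js g < top \<and> zero_mean ?js g \<and> nrm p ?js (\<lambda>x. f x - g x) < ennreal e"
        using XV[of n] unfolding mixed_Lp0_iff by blast
    qed
    have fV: "f \<in> ?V" using fm nf zf unfolding mixed_Lp0_iff by blast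
    have "(\<lambda>n. ?N (X n - f)) \<longlonglongrightarrow> 0"
    proof (rule LIMSEQ_I)
      fix e :: real assume e: "0 < e"
      from f[OF e] obtain M where M: "\<And>n. n \<ge> M \<Longrightarrow> nrm p ?js (\<lambda>x. f x - X n x) < ennreal e" by blast
      have "norm (?N (X n - f) - 0) < e" if "n \<ge> M" for n
      proof -
        have "X n - f = (\<lambda>x. X n x - f x)" by (rule ext) simp
        then have lt: "nrm p ?js (X n - f) < ennreal e" using M[OF that] nrm_diff_commute[of p ?js f "X n"] by (simp only:)
        have "?N (X n - f) < e" by (rule iffD2[OF mixed_norm_less_iff[OF less_trans[OF lt ennreal_less_top] e] lt])
        moreover have "0 \<le> ?N (X n - f)" by (simp add: mixed_norm_eq)
        ultimately show ?thesis by simp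
      qed
      then show "\<exists>no. \<forall>n\<ge>no. norm (?N (X n - f) - 0) < e" by blast
    qed
    then show "\<exists>f\<in>?V. (\<lambda>n. ?N (X n - f)) \<longlonglongrightarrow> 0" using fV by blast
  qed
qed

section \<open>Unconditional and shrinking bases of seminormed spaces\<close>

text \<open>The hypotheses under which everything in this section holds: \<open>h\<close> spans a dense subspace and
  coefficientwise domination of finite combinations implies domination of norms.\<close>

locale dominated_system =
  fixes V :: "'a::real_vector set" and N :: "'a \<Rightarrow> real" and h :: "nat \<Rightarrow> 'a" and C :: real
  assumes V: "subspace V"
    and N_nonneg: "x \<in> V \<Longrightarrow> 0 \<le> N x"
    and N_add: "x \<in> V \<Longrightarrow> y \<in> V \<Longrightarrow> N (x + y) \<le> N x + N y"
    and N_scale: "x \<in> V \<Longrightarrow> N (c *\<^sub>R x) = \<bar>c\<bar> * N x"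
    and hV: "h n \<in> V" and h_pos: "0 < N (h n)"
    and C1: "1 \<le> C"
    and dominated: "finite A \<Longrightarrow> (\<forall>n\<in>A. \<bar>a n\<bar> \<le> \<bar>b n\<bar>) \<Longrightarrow>
      N (\<Sum>n\<in>A. a n *\<^sub>R h n) \<le> C * N (\<Sum>n\<in>A. b n *\<^sub>R h n)"
    and dense: "x \<in> V \<Longrightarrow> 0 < e \<Longrightarrow> \<exists>A a. finite A \<and> N (x - (\<Sum>n\<in>A. a n *\<^sub>R h n)) < e"
begin

lemma comb_V: "(\<Sum>n\<in>A. a n *\<^sub>R h n) \<in> V"
  using V by (intro subspace_sum subspace_scale hV)

lemma N_minus: "x \<in> V \<Longrightarrow> N (- x) = N x"
  using N_scale[of x "-1"] by simp

lemma N_diff: "x \<in> V \<Longrightarrow> y \<in> V \<Longrightarrow> N (x - y) \<le> N x + N y"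
  using N_add[of x "- y"] N_minus[of y] subspace_neg[OF V, of y] by simp

lemma N_commute: "x \<in> V \<Longrightarrow> y \<in> V \<Longrightarrow> N (x - y) = N (y - x)"
  using N_minus[OF subspace_diff[OF V], of x y] by simp

lemma N_triangle3: "x \<in> V \<Longrightarrow> y \<in> V \<Longrightarrow> z \<in> V \<Longrightarrow> N (x - z) \<le> N (x - y) + N (y - z)"
  using N_add[of "x - y" "y - z"] subspace_diff[OF V] by simp

lemma N_zero: "N 0 = 0"
  using N_scale[of 0 0] subspace_0[OF V] by simp

lemma comb_extend: "finite B \<Longrightarrow> A \<subseteq> B \<Longrightarrow> (\<Sum>n\<in>A. a n *\<^sub>R h n) = (\<Sum>n\<in>B. (if n \<in> A then a n else 0) *\<^sub>R h n)"
  by (rule sum.mono_neutral_cong_left) auto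

lemma comb_subset:
  assumes "finite B" "A \<subseteq> B" shows "N (\<Sum>n\<in>A. a n *\<^sub>R h n) \<le> C * N (\<Sum>n\<in>B. a n *\<^sub>R h n)"
  unfolding comb_extend[OF assms, of a] by (rule dominated) (use assms in auto)

lemma single_bound:
  assumes "finite B" "k \<in> B" shows "\<bar>a k\<bar> * N (h k) \<le> C * N (\<Sum>n\<in>B. a n *\<^sub>R h n)"
  using comb_subset[of B "{k}" a] assms N_scale[OF hV, of "a k" k] by simp

lemma sums_in_unique:
  assumes "x \<in> V" "sums_in N (\<lambda>n. a n *\<^sub>R h n) x" "sums_in N (\<lambda>n. b n *\<^sub>R h n) x"
  shows "a = b"
proof
  fix k
  have "(\<lambda>m. N ((\<Sum>n<m. a n *\<^sub>R h n) - x) + N ((\<Sum>n<m. b n *\<^sub>R h n) - x)) \<longlonglongrightarrow> 0 + 0"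
    using assms(2,3) unfolding sums_in_def by (rule tendsto_add)
  then have lim: "(\<lambda>m. C * (N ((\<Sum>n<m. a n *\<^sub>R h n) - x) + N ((\<Sum>n<m. b n *\<^sub>R h n) - x))) \<longlonglongrightarrow> C * 0"
    by (intro tendsto_mult_left) simp
  have "\<forall>\<^sub>F m in sequentially. \<bar>a k - b k\<bar> * N (h k) \<le> C * (N ((\<Sum>n<m. a n *\<^sub>R h n) - x) + N ((\<Sum>n<m. b n *\<^sub>R h n) - x))"
    using eventually_gt_at_top[of k]
  proof eventually_elim
    case (elim m)
    have "\<bar>a k - b k\<bar> * N (h k) \<le> C * N (\<Sum>n<m. (a n - b n) *\<^sub>R h n)"
      using single_bound[of "{..<m}" k "\<lambda>n. a n - b n"] elim by simp
    also have "(\<Sum>n<m. (a n - b n) *\<^sub>R h n) = ((\<Sum>n<m. a n *\<^sub>R h n) - x) - ((\<Sum>n<m. b n *\<^sub>R h n) - x)"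
      by (simp add: scaleR_diff_left sum_subtractf)
    also have "C * N \<dots> \<le> C * (N ((\<Sum>n<m. a n *\<^sub>R h n) - x) + N ((\<Sum>n<m. b n *\<^sub>R h n) - x))"
      using C1 by (intro mult_left_mono N_diff subspace_diff[OF V] comb_V assms(1)) auto
    finally show ?case .
  qed
  from tendsto_lowerbound[OF lim this] have "\<bar>a k - b k\<bar> * N (h k) \<le> 0" by simp
  then show "a k = b k" using h_pos[of k] by (simp add: mult_le_0_iff)
qed

text \<open>Coefficients of approximating combinations converge, and the domination estimate passes to the limit.\<close>

lemma expansion:
  assumes x: "x \<in> V"
  shows "\<exists>a. \<forall>e>0. \<exists>A0. finite A0 \<and> (\<forall>A. finite A \<longrightarrow> A0 \<subseteq> A \<longrightarrow> N (x - (\<Sum>n\<in>A. a n *\<^sub>R h n)) < e)"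
proof -
  have "\<exists>A a. finite A \<and> (\<forall>n. n \<notin> A \<longrightarrow> a n = 0) \<and> N (x - (\<Sum>n\<in>A. a n *\<^sub>R h n)) < 1 / Suc i" for i
  proof -
    obtain A a where A: "finite A" "N (x - (\<Sum>n\<in>A. a n *\<^sub>R h n)) < 1 / Suc i" using dense[OF x, of "1 / Suc i"] by auto
    have "(\<Sum>n\<in>A. (if n \<in> A then a n else 0) *\<^sub>R h n) = (\<Sum>n\<in>A. a n *\<^sub>R h n)" by (rule sum.cong) auto
    then show ?thesis using A by (intro exI[of _ A] exI[of _ "\<lambda>n. if n \<in> A then a n else 0"]) simp
  qed
  then obtain A a where A: "\<And>i. finite (A i)" "\<And>i n. n \<notin> A i \<Longrightarrow> a i n = 0"
    and ax: "\<And>i. N (x - (\<Sum>n\<in>A i. a i n *\<^sub>R h n)) < 1 / Suc i" by metis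
  have big: "(\<Sum>n\<in>A i. a i n *\<^sub>R h n) = (\<Sum>n\<in>B. a i n *\<^sub>R h n)" if "finite B" "A i \<subseteq> B" for i B
    using that A(2) by (intro sum.mono_neutral_left) auto
  have close: "N (\<Sum>n\<in>B. (a i n - a k n) *\<^sub>R h n) \<le> 1 / Suc i + 1 / Suc k" if "finite B" "A i \<union> A k \<subseteq> B" for i k B
  proof -
    have "(\<Sum>n\<in>B. (a i n - a k n) *\<^sub>R h n) = (\<Sum>n\<in>A i. a i n *\<^sub>R h n) - (\<Sum>n\<in>A k. a k n *\<^sub>R h n)"
      using that big[of B i] big[of B k] by (simp add: scaleR_diff_left sum_subtractf)
    then show ?thesis
      using N_triangle3[of "\<Sum>n\<in>A i. a i n *\<^sub>R h n" x "\<Sum>n\<in>A k. a k n *\<^sub>R h n"] comb_V x ax[of i] ax[of k]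
        N_commute[of x "\<Sum>n\<in>A i. a i n *\<^sub>R h n"] by fastforce
  qed
  have part: "N (\<Sum>n\<in>B. (a i n - a k n) *\<^sub>R h n) \<le> C * (1 / Suc i + 1 / Suc k)" if "finite B" for i k B
  proof -
    have "N (\<Sum>n\<in>B. (a i n - a k n) *\<^sub>R h n) \<le> C * N (\<Sum>n\<in>B \<union> A i \<union> A k. (a i n - a k n) *\<^sub>R h n)"
      using that A(1) by (intro comb_subset) auto
    also have "\<dots> \<le> C * (1 / Suc i + 1 / Suc k)"
      using that A(1) C1 by (intro mult_left_mono close) auto
    finally show ?thesis .
  qed
  have small: "\<exists>M. \<forall>i\<ge>M. \<forall>k\<ge>M. C * (1 / Suc i + 1 / Suc k) < e" if "0 < e" for e :: real
  proof -
    have "0 < e / (2 * C)" using that C1 by simp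
    then obtain M where M: "1 / real (Suc M) < e / (2 * C)" by (rule nat_approx_posE)
    have "C * (1 / Suc i + 1 / Suc k) < e" if "i \<ge> M" "k \<ge> M" for i k
    proof -
      have "1 / real (Suc i) \<le> 1 / real (Suc M)" "1 / real (Suc k) \<le> 1 / real (Suc M)"
        using that by (auto intro!: divide_left_mono)
      then have "1 / real (Suc i) + 1 / real (Suc k) < e / C" using M by simp
      then show ?thesis using C1 by (simp add: field_simps)
    qed
    then show ?thesis by blast
  qed
  have "Cauchy (\<lambda>i. a i n)" for n
  proof (rule CauchyI)
    fix e :: real assume "0 < e"
    then obtain M where M: "\<forall>i\<ge>M. \<forall>k\<ge>M. C * (1 / Suc i + 1 / Suc k) < e * N (h n)"
      using small[of "e * N (h n)"] h_pos[of n] by auto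
    have "norm (a i n - a k n) < e" if "i \<ge> M" "k \<ge> M" for i k
    proof -
      have "\<bar>a i n - a k n\<bar> * N (h n) = N (\<Sum>n\<in>{n}. (a i n - a k n) *\<^sub>R h n)" by (simp add: N_scale[OF hV])
      also have "\<dots> \<le> C * (1 / Suc i + 1 / Suc k)" by (rule part) simp
      also have "\<dots> < e * N (h n)" using M that by blast
      finally show ?thesis using h_pos[of n] by simp
    qed
    then show "\<exists>M. \<forall>i\<ge>M. \<forall>k\<ge>M. norm (a i n - a k n) < e" by blast
  qed
  then have conv: "convergent (\<lambda>i. a i n)" for n by (rule Cauchy_convergent)
  define b where "b = (\<lambda>n. lim (\<lambda>i. a i n))"
  have lim: "(\<lambda>i. a i n) \<longlonglongrightarrow> b n" for n using conv unfolding b_def by (simp add: convergent_LIMSEQ_iff)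
  have bl: "N (\<Sum>n\<in>B. (a i n - b n) *\<^sub>R h n) \<le> C * (1 / Suc i)" if B: "finite B" for i B
  proof -
    have t1: "(\<lambda>k. N (\<Sum>n\<in>B. (a i n - a k n) *\<^sub>R h n) + (\<Sum>n\<in>B. \<bar>a k n - b n\<bar> * N (h n))) \<longlonglongrightarrow> L + (\<Sum>n\<in>B. \<bar>b n - b n\<bar> * N (h n))"
      if "(\<lambda>k. N (\<Sum>n\<in>B. (a i n - a k n) *\<^sub>R h n)) \<longlonglongrightarrow> L" for L
      by (intro tendsto_add that tendsto_sum tendsto_mult_right tendsto_rabs tendsto_diff lim tendsto_const)
    have upper: "(\<lambda>k. C * (1 / Suc i + 1 / Suc k) + (\<Sum>n\<in>B. \<bar>a k n - b n\<bar> * N (h n))) \<longlonglongrightarrow> C * (1 / Suc i + 0) + (\<Sum>n\<in>B. \<bar>b n - b n\<bar> * N (h n))"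
      by (intro tendsto_add tendsto_sum tendsto_mult_right tendsto_mult_left tendsto_rabs tendsto_diff lim tendsto_const LIMSEQ_Suc[OF lim_1_over_n])
    have "N (\<Sum>n\<in>B. (a i n - b n) *\<^sub>R h n) \<le> C * (1 / Suc i + 1 / Suc k) + (\<Sum>n\<in>B. \<bar>a k n - b n\<bar> * N (h n))" for k
    proof -
      have Nsum: "N (\<Sum>n\<in>B. c n *\<^sub>R h n) \<le> (\<Sum>n\<in>B. \<bar>c n\<bar> * N (h n))" for c
        using B
      proof (induction B)
        case (insert n B)
        then show ?case using N_add[of "c n *\<^sub>R h n" "\<Sum>n\<in>B. c n *\<^sub>R h n"] subspace_scale[OF V hV] comb_V N_scale[OF hV, of "c n" n]
          by fastforce
      qed (simp add: N_zero)
      have "(\<Sum>n\<in>B. (a i n - b n) *\<^sub>R h n) = (\<Sum>n\<in>B. (a i n - a k n) *\<^sub>R h n) + (\<Sum>n\<in>B. (a k n - b n) *\<^sub>R h n)"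
        by (simp add: sum.distrib[symmetric] scaleR_left_distrib[symmetric])
      then have "N (\<Sum>n\<in>B. (a i n - b n) *\<^sub>R h n) \<le> N (\<Sum>n\<in>B. (a i n - a k n) *\<^sub>R h n) + N (\<Sum>n\<in>B. (a k n - b n) *\<^sub>R h n)"
        using N_add[OF comb_V comb_V, of "\<lambda>n. a i n - a k n" B "\<lambda>n. a k n - b n" B] by (simp only:)
      also have "\<dots> \<le> C * (1 / Suc i + 1 / Suc k) + (\<Sum>n\<in>B. \<bar>a k n - b n\<bar> * N (h n))"
        by (intro add_mono part B Nsum)
      finally show ?thesis .
    qed
    then have "N (\<Sum>n\<in>B. (a i n - b n) *\<^sub>R h n) \<le> C * (1 / Suc i + 0) + (\<Sum>n\<in>B. \<bar>b n - b n\<bar> * N (h n))"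
      by (intro tendsto_lowerbound[OF upper]) auto
    then show ?thesis by simp
  qed
  have "\<exists>A0. finite A0 \<and> (\<forall>A. finite A \<longrightarrow> A0 \<subseteq> A \<longrightarrow> N (x - (\<Sum>n\<in>A. b n *\<^sub>R h n)) < e)" if e: "0 < e" for e
  proof -
    obtain M where M: "\<forall>i\<ge>M. \<forall>k\<ge>M. C * (1 / Suc i + 1 / Suc k) < e" using small[OF e] by blast
    have "N (x - (\<Sum>n\<in>B. b n *\<^sub>R h n)) < e" if B: "finite B" "A M \<subseteq> B" for B
    proof -
      have "N (x - (\<Sum>n\<in>B. b n *\<^sub>R h n)) \<le> N (x - (\<Sum>n\<in>B. a M n *\<^sub>R h n)) + N ((\<Sum>n\<in>B. a M n *\<^sub>R h n) - (\<Sum>n\<in>B. b n *\<^sub>R h n))"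
        by (intro N_triangle3 x comb_V)
      also have "\<dots> = N (x - (\<Sum>n\<in>A M. a M n *\<^sub>R h n)) + N (\<Sum>n\<in>B. (a M n - b n) *\<^sub>R h n)"
        using big[OF B] by (simp add: scaleR_diff_left sum_subtractf)
      also have "\<dots> \<le> 1 / Suc M + C * (1 / Suc M)" using ax[of M] bl[OF B(1), of M] by simp
      also have "\<dots> \<le> C * (1 / Suc M) + C * (1 / Suc M)" using C1 by (intro add_right_mono) (simp add: field_simps)
      also have "\<dots> = C * (1 / Suc M + 1 / Suc M)" by (rule distrib_left[symmetric])
      also have "\<dots> < e" using M by blast
      finally show ?thesis .
    qed
    then show ?thesis using A(1) by blast
  qed
  then show ?thesis by blast
qed

definition co :: "'a \<Rightarrow> nat \<Rightarrow> real" where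
  "co x = (SOME a. \<forall>e>0. \<exists>A0. finite A0 \<and> (\<forall>A. finite A \<longrightarrow> A0 \<subseteq> A \<longrightarrow> N (x - (\<Sum>n\<in>A. a n *\<^sub>R h n)) < e))"

lemma co: "x \<in> V \<Longrightarrow> 0 < e \<Longrightarrow> \<exists>A0. finite A0 \<and> (\<forall>A. finite A \<longrightarrow> A0 \<subseteq> A \<longrightarrow> N (x - (\<Sum>n\<in>A. co x n *\<^sub>R h n)) < e)"
  using someI_ex[OF expansion[of x]] unfolding co_def by blast

text \<open>Convergence along the directed set of finite index sets is insensitive to the order of
  summation.\<close>

lemma sums_in_rearranged:
  assumes x: "x \<in> V" and \<pi>: "bij (\<pi> :: nat \<Rightarrow> nat)"
  shows "sums_in N (\<lambda>n. co x (\<pi> n) *\<^sub>R h (\<pi> n)) x"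
  unfolding sums_in_def
proof (rule LIMSEQ_I)
  fix e :: real assume "0 < e"
  from co[OF x this] obtain A0 where A0: "finite A0" "\<And>A. finite A \<Longrightarrow> A0 \<subseteq> A \<Longrightarrow> N (x - (\<Sum>n\<in>A. co x n *\<^sub>R h n)) < e" by blast
  define M where "M = Suc (Max (insert 0 (inv \<pi> ` A0)))"
  have "norm (N ((\<Sum>n<m. co x (\<pi> n) *\<^sub>R h (\<pi> n)) - x) - 0) < e" if m: "m \<ge> M" for m
  proof -
    have "A0 \<subseteq> \<pi> ` {..<m}"
    proof
      fix k assume "k \<in> A0"
      then have "inv \<pi> k < m" using A0(1) m unfolding M_def by (auto simp: Suc_le_eq intro: le_less_trans[OF Max_ge])
      then show "k \<in> \<pi> ` {..<m}" using \<pi> by (metis bij_inv_eq_iff image_eqI lessThan_iff)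
    qed
    then have "N (x - (\<Sum>n\<in>\<pi> ` {..<m}. co x n *\<^sub>R h n)) < e" by (intro A0(2)) auto
    moreover have "(\<Sum>n\<in>\<pi> ` {..<m}. co x n *\<^sub>R h n) = (\<Sum>n<m. co x (\<pi> n) *\<^sub>R h (\<pi> n))"
      using \<pi> by (subst sum.reindex) (auto simp: bij_def intro: inj_on_subset)
    moreover have sV: "(\<Sum>n<m. co x (\<pi> n) *\<^sub>R h (\<pi> n)) \<in> V" by (intro subspace_sum subspace_scale V hV)
    ultimately show ?thesis using N_commute[OF x sV] N_nonneg[OF subspace_diff[OF V sV x]] by simp
  qed
  then show "\<exists>no. \<forall>m\<ge>no. norm (N ((\<Sum>n<m. co x (\<pi> n) *\<^sub>R h (\<pi> n)) - x) - 0) < e" by blast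
qed

lemma sums_in_co: "x \<in> V \<Longrightarrow> sums_in N (\<lambda>n. co x n *\<^sub>R h n) x"
  using sums_in_rearranged[of x id] by simp

lemma co_unique: "x \<in> V \<Longrightarrow> sums_in N (\<lambda>n. a n *\<^sub>R h n) x \<Longrightarrow> co x = a"
  using sums_in_unique[OF _ sums_in_co] by blast

lemma schauder: "schauder_basis V N h"
  unfolding schauder_basis_def using hV sums_in_co sums_in_unique by blast

lemma coord_eq: "coord V N h n = (\<lambda>x. if x \<in> V then co x n else 0)"
proof -
  have "(THE a. sums_in N (\<lambda>k. a k *\<^sub>R h k) x) = co x" if "x \<in> V" for x
    using that sums_in_co co_unique by (intro the_equality) auto
  then show ?thesis by (auto simp: coord_def)
qed

lemma unconditional: "unconditional_basis V N h"
  unfolding unconditional_basis_def using schauder sums_in_rearranged by (auto simp: coord_eq)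

lemma co_add: "x \<in> V \<Longrightarrow> y \<in> V \<Longrightarrow> co (x + y) n = co x n + co y n"
proof -
  assume xy: "x \<in> V" "y \<in> V"
  have "sums_in N (\<lambda>n. (co x n + co y n) *\<^sub>R h n) (x + y)"
    unfolding sums_in_def
  proof (rule tendsto_sandwich[OF _ _ tendsto_const])
    show "(\<lambda>m. N ((\<Sum>n<m. co x n *\<^sub>R h n) - x) + N ((\<Sum>n<m. co y n *\<^sub>R h n) - y)) \<longlonglongrightarrow> 0"
      using tendsto_add[OF sums_in_co[OF xy(1), unfolded sums_in_def] sums_in_co[OF xy(2), unfolded sums_in_def]] by simp
    show "\<forall>\<^sub>F m in sequentially. 0 \<le> N ((\<Sum>n<m. (co x n + co y n) *\<^sub>R h n) - (x + y))"
      using xy by (intro always_eventually allI N_nonneg subspace_diff V comb_V subspace_add)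
    have "N ((\<Sum>n<m. (co x n + co y n) *\<^sub>R h n) - (x + y)) \<le> N ((\<Sum>n<m. co x n *\<^sub>R h n) - x) + N ((\<Sum>n<m. co y n *\<^sub>R h n) - y)" for m
    proof -
      have "(\<Sum>n<m. (co x n + co y n) *\<^sub>R h n) - (x + y) = ((\<Sum>n<m. co x n *\<^sub>R h n) - x) + ((\<Sum>n<m. co y n *\<^sub>R h n) - y)"
        by (simp add: scaleR_left_distrib sum.distrib)
      then show ?thesis using N_add[OF subspace_diff[OF V comb_V xy(1)] subspace_diff[OF V comb_V xy(2)]] by (simp only:)
    qed
    then show "\<forall>\<^sub>F m in sequentially. N ((\<Sum>n<m. (co x n + co y n) *\<^sub>R h n) - (x + y)) \<le> N ((\<Sum>n<m. co x n *\<^sub>R h n) - x) + N ((\<Sum>n<m. co y n *\<^sub>R h n) - y)"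
      by (intro always_eventually allI)
  qed
  then show ?thesis using co_unique[OF subspace_add[OF V xy]] by simp
qed

lemma co_scale: "x \<in> V \<Longrightarrow> co (c *\<^sub>R x) n = c * co x n"
proof -
  assume x: "x \<in> V"
  have "sums_in N (\<lambda>n. (c * co x n) *\<^sub>R h n) (c *\<^sub>R x)"
  proof -
    have "N ((\<Sum>n<m. (c * co x n) *\<^sub>R h n) - c *\<^sub>R x) = \<bar>c\<bar> * N ((\<Sum>n<m. co x n *\<^sub>R h n) - x)" for m
      using N_scale[OF subspace_diff[OF V comb_V x], of c "co x" "{..<m}"]
      by (simp add: scaleR_right_diff_distrib scaleR_sum_right)
    then show ?thesis using tendsto_mult_left[OF sums_in_co[OF x, unfolded sums_in_def], of "\<bar>c\<bar>"]
      unfolding sums_in_def by simp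
  qed
  then show ?thesis using co_unique[OF subspace_scale[OF V x]] by simp
qed

lemma co_comb: "finite A \<Longrightarrow> co (\<Sum>n\<in>A. a n *\<^sub>R h n) k = (if k \<in> A then a k else 0)"
proof -
  assume A: "finite A"
  have "sums_in N (\<lambda>n. (if n \<in> A then a n else 0) *\<^sub>R h n) (\<Sum>n\<in>A. a n *\<^sub>R h n)"
    unfolding sums_in_def
  proof (rule tendsto_eventually)
    show "\<forall>\<^sub>F m in sequentially. N ((\<Sum>n<m. (if n \<in> A then a n else 0) *\<^sub>R h n) - (\<Sum>n\<in>A. a n *\<^sub>R h n)) = 0"
      using eventually_gt_at_top[of "Max (insert 0 A)"]
    proof eventually_elim
      case (elim m)
      then have "A \<subseteq> {..<m}" using A by (auto intro: le_less_trans[OF Max_ge])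
      then show ?case using comb_extend[of "{..<m}" A a] N_zero by simp
    qed
  qed
  then show ?thesis using co_unique[OF comb_V] by simp
qed

lemma projection_bound:
  assumes x: "x \<in> V" and A: "finite A" shows "N (\<Sum>n\<in>A. co x n *\<^sub>R h n) \<le> C * N x"
proof (rule field_le_epsilon)
  fix e :: real assume e: "0 < e"
  from co[OF x, of "e / C"] e C1 obtain A0 where A0: "finite A0" "\<And>B. finite B \<Longrightarrow> A0 \<subseteq> B \<Longrightarrow> N (x - (\<Sum>n\<in>B. co x n *\<^sub>R h n)) < e / C" by auto
  let ?y = "\<Sum>n\<in>A \<union> A0. co x n *\<^sub>R h n"
  have "N (\<Sum>n\<in>A. co x n *\<^sub>R h n) \<le> C * N ?y" using A A0 by (intro comb_subset) auto
  also have "N ?y \<le> N x + N (x - ?y)" using N_diff[OF x subspace_diff[OF V x comb_V], of "co x" "A \<union> A0"] by simp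
  also have "\<dots> \<le> N x + e / C" using A0(2)[of "A \<union> A0"] A A0(1) by simp
  finally show "N (\<Sum>n\<in>A. co x n *\<^sub>R h n) \<le> C * N x + e" using C1 by (simp add: algebra_simps mult_left_mono)
qed

section \<open>The dual space\<close>

abbreviation "D \<equiv> dual_space V N"
abbreviation "dn \<equiv> dual_norm V N"
abbreviation "cf \<equiv> coord V N h"

lemma DD:
  assumes "\<phi> \<in> D"
  shows "\<And>x y. x \<in> V \<Longrightarrow> y \<in> V \<Longrightarrow> \<phi> (x + y) = \<phi> x + \<phi> y" "\<And>c x. x \<in> V \<Longrightarrow> \<phi> (c *\<^sub>R x) = c * \<phi> x"
    "\<exists>K\<ge>0. \<forall>x\<in>V. \<bar>\<phi> x\<bar> \<le> K * N x" "\<And>x. x \<notin> V \<Longrightarrow> \<phi> x = 0"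
proof -
  obtain K where K: "\<forall>x\<in>V. \<bar>\<phi> x\<bar> \<le> K * N x" using assms unfolding dual_space_def by blast
  have "\<bar>\<phi> x\<bar> \<le> \<bar>K\<bar> * N x" if "x \<in> V" for x
    using K that mult_right_mono[OF abs_ge_self[of K] N_nonneg[OF that]] by fastforce
  then show "\<exists>K\<ge>0. \<forall>x\<in>V. \<bar>\<phi> x\<bar> \<le> K * N x" by (intro exI[of _ "\<bar>K\<bar>"]) auto
qed (use assms in \<open>auto simp: dual_space_def\<close>)

lemma D_diff: "\<phi> \<in> D \<Longrightarrow> x \<in> V \<Longrightarrow> y \<in> V \<Longrightarrow> \<phi> (x - y) = \<phi> x - \<phi> y"
  using DD(1)[of \<phi> "x - y" y] subspace_diff[OF V, of x y] by simp

lemma D_sum: "\<phi> \<in> D \<Longrightarrow> (\<And>i. x i \<in> V) \<Longrightarrow> \<phi> (\<Sum>i\<in>A. a i *\<^sub>R x i) = (\<Sum>i\<in>A. a i * \<phi> (x i))"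
proof (induction A rule: infinite_finite_induct)
  case (insert i A)
  have "\<phi> (a i *\<^sub>R x i + (\<Sum>i\<in>A. a i *\<^sub>R x i)) = \<phi> (a i *\<^sub>R x i) + \<phi> (\<Sum>i\<in>A. a i *\<^sub>R x i)"
    by (intro DD(1)[OF insert.prems(1)] subspace_scale subspace_sum V insert.prems(2))
  then show ?case using insert DD(2)[OF insert.prems(1,2), of "a i" i] by simp
qed (use DD(2)[of \<phi> 0 0] subspace_0[OF V] in auto)

lemma D_comb: "\<phi> \<in> D \<Longrightarrow> \<phi> (\<Sum>n\<in>A. a n *\<^sub>R h n) = (\<Sum>n\<in>A. a n * \<phi> (h n))"
  by (rule D_sum[OF _ hV])

lemma dn_bound:
  assumes "\<phi> \<in> D" "x \<in> V" shows "\<bar>\<phi> x\<bar> \<le> dn \<phi> * N x"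
proof -
  obtain K where K: "0 \<le> K" "\<forall>x\<in>V. \<bar>\<phi> x\<bar> \<le> K * N x" using DD(3)[OF assms(1)] by blast
  have bdd: "bdd_above ((\<lambda>x. \<bar>\<phi> x\<bar>) ` {x \<in> V. N x \<le> 1})"
  proof (rule bdd_aboveI2)
    fix x assume "x \<in> {x \<in> V. N x \<le> 1}"
    then show "\<bar>\<phi> x\<bar> \<le> K" using K mult_left_mono[of "N x" 1 K] by fastforce
  qed
  show ?thesis
  proof (cases "N x = 0")
    case True
    then show ?thesis using K(2) assms(2) by fastforce
  next
    case False
    then have pos: "0 < N x" using N_nonneg[OF assms(2)] by simp
    let ?y = "(1 / N x) *\<^sub>R x"
    have "?y \<in> {x \<in> V. N x \<le> 1}" using assms(2) pos N_scale[OF assms(2), of "1 / N x"] subspace_scale[OF V assms(2)] by simp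
    from cSUP_upper[OF this bdd] have "\<bar>\<phi> ?y\<bar> \<le> dn \<phi>" by (simp add: dual_norm_def)
    then show ?thesis using DD(2)[OF assms(1,2), of "1 / N x"] pos by (simp add: abs_mult field_simps)
  qed
qed

lemma dn_least: "(\<And>x. x \<in> V \<Longrightarrow> N x \<le> 1 \<Longrightarrow> \<bar>\<phi> x\<bar> \<le> K) \<Longrightarrow> dn \<phi> \<le> K"
  unfolding dual_norm_def using subspace_0[OF V] N_zero by (intro cSUP_least) auto

lemma dn_nonneg: "\<phi> \<in> D \<Longrightarrow> 0 \<le> dn \<phi>"
  using dn_bound[of \<phi> "h 0"] hV h_pos[of 0] abs_ge_zero[of "\<phi> (h 0)"]
  by (metis order_trans zero_le_mult_iff not_less less_le_not_le)

lemma D_subspace: "subspace D"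
  unfolding subspace_def
proof (intro conjI ballI allI)
  show "0 \<in> D" by (auto simp: dual_space_def zero_fun_def intro!: exI[of _ 0])
  fix \<phi> \<psi> assume a: "\<phi> \<in> D" "\<psi> \<in> D"
  obtain K where K: "\<forall>x\<in>V. \<bar>\<phi> x\<bar> \<le> K * N x" using DD(3)[OF a(1)] by blast
  obtain L where L: "\<forall>x\<in>V. \<bar>\<psi> x\<bar> \<le> L * N x" using DD(3)[OF a(2)] by blast
  have "\<bar>\<phi> x + \<psi> x\<bar> \<le> (K + L) * N x" if "x \<in> V" for x
    using K L that abs_triangle_ineq[of "\<phi> x" "\<psi> x"] by (fastforce simp: distrib_right)
  then have "\<exists>K. \<forall>x\<in>V. \<bar>\<phi> x + \<psi> x\<bar> \<le> K * N x" by blast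
  then show "\<phi> + \<psi> \<in> D" using DD(1,2,4)[OF a(1)] DD(1,2,4)[OF a(2)]
    by (auto simp: dual_space_def plus_fun_def algebra_simps)
next
  fix c :: real and \<phi> assume a: "\<phi> \<in> D"
  obtain K where K: "\<forall>x\<in>V. \<bar>\<phi> x\<bar> \<le> K * N x" using DD(3)[OF a(1)] by blast
  have "\<bar>c * \<phi> x\<bar> \<le> (\<bar>c\<bar> * K) * N x" if "x \<in> V" for x
    using mult_left_mono[OF bspec[OF K that], of "\<bar>c\<bar>"] by (simp add: abs_mult mult.assoc)
  then have "\<exists>K. \<forall>x\<in>V. \<bar>c * \<phi> x\<bar> \<le> K * N x" by blast
  then show "c *\<^sub>R \<phi> \<in> D" using DD(1,2,4)[OF a]
    by (auto simp: dual_space_def scaleR_fun_def algebra_simps)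
qed

lemma cf_D: "cf n \<in> D"
proof -
  have "\<bar>co x n\<bar> \<le> (C / N (h n)) * N x" if "x \<in> V" for x
    using projection_bound[OF that, of "{n}"] N_scale[OF hV, of "co x n" n] h_pos[of n] by (simp add: field_simps)
  then have "\<exists>K. \<forall>x\<in>V. \<bar>cf n x\<bar> \<le> K * N x" by (intro exI[of _ "C / N (h n)"]) (auto simp: coord_eq)
  then show ?thesis using co_add co_scale subspace_add[OF V] subspace_scale[OF V]
    by (auto simp: dual_space_def coord_eq)
qed

lemma cf_comb_D: "(\<Sum>n\<in>A. a n *\<^sub>R cf n) \<in> D"
  by (intro subspace_sum subspace_scale D_subspace cf_D)

lemma cf_comb_apply: "x \<in> V \<Longrightarrow> (\<Sum>n\<in>A. a n *\<^sub>R cf n) x = (\<Sum>n\<in>A. a n * co x n)"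
  by (simp add: sum_fun_apply coord_eq)

lemma co_h: "co (h k) n = (if n = k then 1 else 0)"
  using co_comb[of "{k}" "\<lambda>_. 1" n] by simp

text \<open>A strategy answers with blocks \<open>b k\<close> of the basis and weighted blocks \<open>b' k\<close> of the coordinate
  functionals. Equivalence of the \<open>b' k\<close> with the coordinate functionals is obtained by
  composing functionals with the two operators \<open>x \<mapsto> \<Sum>k. b' k x h k\<close> and \<open>x \<mapsto> \<Sum>k. co x k b k\<close>.\<close>

lemma block_system:
  fixes W :: "nat \<Rightarrow> nat set" and \<beta> :: "nat \<Rightarrow> nat \<Rightarrow> real"
  defines "b \<equiv> \<lambda>k. \<Sum>n\<in>W k. h n" and "b' \<equiv> \<lambda>k. \<Sum>n\<in>W k. \<beta> k n *\<^sub>R cf n"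
  assumes W: "\<And>k. finite (W k)" "\<And>k l. k \<noteq> l \<Longrightarrow> W k \<inter> W l = {}"
    and \<beta>: "\<And>k. (\<Sum>n\<in>W k. \<beta> k n) = 1"
    and E: "1 \<le> E"
    and lower: "\<And>F c. finite F \<Longrightarrow> N (\<Sum>k\<in>F. c k *\<^sub>R h k) \<le> E * N (\<Sum>k\<in>F. c k *\<^sub>R b k)"
    and upper: "\<And>F c. finite F \<Longrightarrow> N (\<Sum>k\<in>F. c k *\<^sub>R b k) \<le> E * N (\<Sum>k\<in>F. c k *\<^sub>R h k)"
    and av: "\<And>F x. finite F \<Longrightarrow> N (\<Sum>k\<in>F. (\<Sum>n\<in>W k. \<beta> k n * x n) *\<^sub>R h k) \<le> E * N (\<Sum>n\<in>(\<Union>k\<in>F. W k). x n *\<^sub>R h n)"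
  shows "b' k (b l) = (if k = l then 1 else 0)"
    and "impartially_equivalent ((E * C)\<^sup>2) N b N h"
    and "impartially_equivalent ((E * C)\<^sup>2) dn b' dn cf"
proof -
  have bV: "b k \<in> V" for k unfolding b_def by (intro subspace_sum V hV)
  have b'D: "b' k \<in> D" for k unfolding b'_def by (rule cf_comb_D)
  have b'x: "b' k x = (\<Sum>n\<in>W k. \<beta> k n * co x n)" if "x \<in> V" for k x
    unfolding b'_def by (rule cf_comb_apply[OF that])
  have bi: "b' k (b l) = (if k = l then 1 else 0)" for k l
  proof -
    have "co (b l) n = (if n \<in> W l then 1 else 0)" for n
      using co_comb[OF W(1)[of l], of "\<lambda>_. 1" n] by (simp add: b_def)
    then have "b' k (b l) = (\<Sum>n\<in>W k. \<beta> k n * (if n \<in> W l then 1 else 0))" by (simp add: b'x[OF bV])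
    also have "\<dots> = (if k = l then 1 else 0)"
    proof (cases "k = l")
      case True then show ?thesis using \<beta>[of k] by simp
    next
      case False
      then have "(\<Sum>n\<in>W k. \<beta> k n * (if n \<in> W l then 1 else 0)) = 0" using W(2)[OF False] by (intro sum.neutral) auto
      then show ?thesis using False by simp
    qed
    finally show ?thesis .
  qed
  show "b' k (b l) = (if k = l then 1 else 0)" by (rule bi)
  let ?G = "E * C"
  have EG: "E \<le> ?G" using mult_left_mono[OF C1, of E] E by simp
  then have G: "1 \<le> ?G" by (rule order_trans[OF E])
  have equivI: "1 / sqrt (?G\<^sup>2) * M \<le> L \<and> L \<le> sqrt (?G\<^sup>2) * M" if "M \<le> ?G * L" "L \<le> ?G * M" for L M
  proof -
    define g where "g = ?G"
    have "sqrt (?G\<^sup>2) = g" "0 < g" using G by (simp_all add: g_def)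
    then show ?thesis using that unfolding g_def[symmetric] by (simp add: field_simps)
  qed
  show "impartially_equivalent (?G\<^sup>2) N b N h"
    unfolding impartially_equivalent_def
  proof (intro allI impI)
    fix a :: "nat \<Rightarrow> real" assume fin: "finite {i. a i \<noteq> 0}"
    have sV: "(\<Sum>i | a i \<noteq> 0. a i *\<^sub>R b i) \<in> V" by (intro subspace_sum subspace_scale V bV)
    show "1 / sqrt (?G\<^sup>2) * N (\<Sum>i | a i \<noteq> 0. a i *\<^sub>R h i) \<le> N (\<Sum>i | a i \<noteq> 0. a i *\<^sub>R b i) \<and>
      N (\<Sum>i | a i \<noteq> 0. a i *\<^sub>R b i) \<le> sqrt (?G\<^sup>2) * N (\<Sum>i | a i \<noteq> 0. a i *\<^sub>R h i)"
      using lower[OF fin, of a] upper[OF fin, of a] mult_right_mono[OF EG N_nonneg[OF sV]]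
        mult_right_mono[OF EG N_nonneg[OF comb_V, of a "{i. a i \<noteq> 0}"]]
      by (intro equivI) auto
  qed
  show "impartially_equivalent (?G\<^sup>2) dn b' dn cf"
    unfolding impartially_equivalent_def
  proof (intro allI impI)
    fix a :: "nat \<Rightarrow> real" assume fin: "finite {i. a i \<noteq> 0}"
    let ?F = "{i. a i \<noteq> 0}"
    let ?p = "\<Sum>k\<in>?F. a k *\<^sub>R b' k" and ?c = "\<Sum>k\<in>?F. a k *\<^sub>R cf k"
    have pD: "?p \<in> D" by (intro subspace_sum subspace_scale D_subspace b'D)
    have cD: "?c \<in> D" by (rule cf_comb_D)
    have px: "?p x = (\<Sum>k\<in>?F. a k * b' k x)" for x by (simp add: sum_fun_apply)
    show "1 / sqrt (?G\<^sup>2) * dn ?c \<le> dn ?p \<and> dn ?p \<le> sqrt (?G\<^sup>2) * dn ?c"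
    proof (rule equivI)
      show "dn ?p \<le> ?G * dn ?c"
      proof (rule dn_least)
        fix x assume x: "x \<in> V" "N x \<le> 1"
        let ?y = "\<Sum>k\<in>?F. (\<Sum>n\<in>W k. \<beta> k n * co x n) *\<^sub>R h k"
        have "?c ?y = (\<Sum>k\<in>?F. a k * co ?y k)" by (rule cf_comb_apply[OF comb_V])
        also have "\<dots> = ?p x" unfolding px by (intro sum.cong refl) (simp add: co_comb[OF fin] b'x[OF x(1)])
        finally have le: "\<bar>?p x\<bar> \<le> dn ?c * N ?y" using dn_bound[OF cD comb_V, of "\<lambda>k. \<Sum>n\<in>W k. \<beta> k n * co x n" ?F] by simp
        have "N ?y \<le> E * N (\<Sum>n\<in>(\<Union>k\<in>?F. W k). co x n *\<^sub>R h n)" by (rule av[OF fin])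
        also have "\<dots> \<le> E * (C * N x)" using fin W(1) E by (intro mult_left_mono projection_bound[OF x(1)]) auto
        also have "\<dots> \<le> E * (C * 1)" using x C1 E by (intro mult_left_mono) auto
        finally have "dn ?c * N ?y \<le> dn ?c * ?G" using dn_nonneg[OF cD] by (intro mult_left_mono) auto
        from order_trans[OF le this] show "\<bar>?p x\<bar> \<le> ?G * dn ?c" by (simp only: mult.commute)
      qed
      show "dn ?c \<le> ?G * dn ?p"
      proof (rule dn_least)
        fix x assume x: "x \<in> V" "N x \<le> 1"
        let ?y = "\<Sum>k\<in>?F. co x k *\<^sub>R b k"
        have yV: "?y \<in> V" by (intro subspace_sum subspace_scale V bV)
        have "b' k ?y = co x k" if "k \<in> ?F" for k
        proof -
          have "b' k ?y = (\<Sum>l\<in>?F. co x l * b' k (b l))" by (rule D_sum[OF b'D bV])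
          also have "\<dots> = (\<Sum>l\<in>?F. if k = l then co x l else 0)" by (intro sum.cong refl) (simp add: bi)
          also have "\<dots> = co x k" using fin that by simp
          finally show ?thesis .
        qed
        then have "?p ?y = ?c x" unfolding px cf_comb_apply[OF x(1)] by (intro sum.cong refl) simp
        then have le: "\<bar>?c x\<bar> \<le> dn ?p * N ?y" using dn_bound[OF pD yV] by simp
        have "N ?y \<le> E * N (\<Sum>k\<in>?F. co x k *\<^sub>R h k)" by (rule upper[OF fin])
        also have "\<dots> \<le> E * (C * N x)" using E by (intro mult_left_mono projection_bound[OF x(1) fin]) auto
        also have "\<dots> \<le> E * (C * 1)" using x C1 E by (intro mult_left_mono) auto
        finally have "dn ?p * N ?y \<le> dn ?p * ?G" using dn_nonneg[OF pD] by (intro mult_left_mono) auto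
        from order_trans[OF le this] show "\<bar>?c x\<bar> \<le> ?G * dn ?p" by (simp only: mult.commute)
      qed
    qed
  qed
qed

end

section \<open>Upper estimates and shrinking bases\<close>

locale upper_dominated_system = dominated_system +
  fixes r T :: real
  assumes r1: "1 < r" and T0: "0 \<le> T"
    and upper: "\<And>(I :: nat set) A a. finite I \<Longrightarrow> (\<And>i. i \<in> I \<Longrightarrow> finite (A i)) \<Longrightarrow>
      (\<And>i k. i \<in> I \<Longrightarrow> k \<in> I \<Longrightarrow> i \<noteq> k \<Longrightarrow> A i \<inter> A k = {}) \<Longrightarrow>
      (\<And>i. i \<in> I \<Longrightarrow> N (\<Sum>n\<in>A i. a n *\<^sub>R h n) \<le> 1) \<Longrightarrow>
      N (\<Sum>i\<in>I. \<Sum>n\<in>A i. a n *\<^sub>R h n) \<le> T * real (card I) powr (1 / r)"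
begin

text \<open>If a functional were not small on tails, then disjoint blocks of norm at most \<open>1\<close> on
  which it is at least \<open>\<delta>\<close> would have sums of norm at least of the order of their number,
  against the upper estimate with \<open>r > 1\<close>.\<close>

lemma dual_tail:
  assumes \<phi>: "\<phi> \<in> D" and e: "0 < e"
  shows "\<exists>m0. \<forall>m\<ge>m0. dn ((\<Sum>n<m. \<phi> (h n) *\<^sub>R cf n) - \<phi>) \<le> e"
proof (rule ccontr)
  assume neg: "\<not> ?thesis"
  obtain K where K: "0 \<le> K" "\<And>x. x \<in> V \<Longrightarrow> \<bar>\<phi> x\<bar> \<le> K * N x" using DD(3)[OF \<phi>] by blast
  define \<delta> where "\<delta> = e / (2 * C)"
  have \<delta>: "0 < \<delta>" using e C1 by (simp add: \<delta>_def)
  have "\<exists>B a. finite B \<and> B \<subseteq> {m0..} \<and> N (\<Sum>n\<in>B. a n *\<^sub>R h n) \<le> 1 \<and> \<delta> \<le> \<phi> (\<Sum>n\<in>B. a n *\<^sub>R h n)" for m0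
  proof -
    obtain m where m: "m \<ge> m0" "\<not> dn ((\<Sum>n<m. \<phi> (h n) *\<^sub>R cf n) - \<phi>) \<le> e" using neg by blast
    then obtain x where x: "x \<in> V" "N x \<le> 1" and big: "e < \<bar>((\<Sum>n<m. \<phi> (h n) *\<^sub>R cf n) - \<phi>) x\<bar>"
      using dn_least[of "(\<Sum>n<m. \<phi> (h n) *\<^sub>R cf n) - \<phi>" e] by (meson not_le)
    have "0 < e / (2 * (K + 1))" using e K by simp
    from co[OF x(1) this] obtain A0 where A0: "finite A0" "\<And>A. finite A \<Longrightarrow> A0 \<subseteq> A \<Longrightarrow> N (x - (\<Sum>n\<in>A. co x n *\<^sub>R h n)) < e / (2 * (K + 1))" by blast
    let ?A = "A0 \<union> {..<m}" let ?B = "?A - {..<m}"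
    let ?s = "\<Sum>n\<in>?B. co x n *\<^sub>R h n"
    have "\<bar>\<phi> (x - (\<Sum>n\<in>?A. co x n *\<^sub>R h n))\<bar> \<le> K * N (x - (\<Sum>n\<in>?A. co x n *\<^sub>R h n))"
      by (intro K(2) subspace_diff V x comb_V)
    also have "\<dots> \<le> K * (e / (2 * (K + 1)))" using A0(1) K by (intro mult_left_mono less_imp_le[OF A0(2)]) auto
    also have "\<dots> \<le> e / 2" using K(1) e by (simp add: field_simps)
    finally have small: "\<bar>\<phi> x - \<phi> (\<Sum>n\<in>?A. co x n *\<^sub>R h n)\<bar> \<le> e / 2" using D_diff[OF \<phi> x(1) comb_V] by simp
    have split: "\<phi> (\<Sum>n\<in>?A. co x n *\<^sub>R h n) = \<phi> ?s + (\<Sum>n<m. co x n * \<phi> (h n))"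
      unfolding D_comb[OF \<phi>] using A0(1) by (intro sum.subset_diff) auto
    have "((\<Sum>n<m. \<phi> (h n) *\<^sub>R cf n) - \<phi>) x = (\<Sum>n<m. co x n * \<phi> (h n)) - \<phi> x"
      using cf_comb_apply[OF x(1), of "\<lambda>n. \<phi> (h n)" "{..<m}"] by (simp add: mult.commute)
    then have low: "e / 2 \<le> \<bar>\<phi> ?s\<bar>" using big small split by linarith
    have "N ?s \<le> C * N x" using A0(1) by (intro projection_bound x) auto
    also have "\<dots> \<le> C * 1" using x C1 by (intro mult_left_mono) auto
    finally have NS: "N ?s \<le> C" by simp
    let ?a = "\<lambda>n. (sgn (\<phi> ?s) / C) * co x n"
    have eq: "(\<Sum>n\<in>?B. ?a n *\<^sub>R h n) = (sgn (\<phi> ?s) / C) *\<^sub>R ?s" by (simp only: scaleR_sum_right scaleR_scaleR)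
    have "N (\<Sum>n\<in>?B. ?a n *\<^sub>R h n) = \<bar>sgn (\<phi> ?s) / C\<bar> * N ?s" unfolding eq by (rule N_scale[OF comb_V])
    also have "\<dots> \<le> (1 / C) * C" using C1 NS N_nonneg[OF comb_V] by (intro mult_mono) (auto simp: abs_sgn_eq)
    finally have n1: "N (\<Sum>n\<in>?B. ?a n *\<^sub>R h n) \<le> 1" using C1 by simp
    have "\<phi> (\<Sum>n\<in>?B. ?a n *\<^sub>R h n) = (sgn (\<phi> ?s) / C) * \<phi> ?s" unfolding eq by (rule DD(2)[OF \<phi> comb_V])
    also have "\<dots> = \<bar>\<phi> ?s\<bar> / C" by (simp add: abs_sgn mult.commute)
    finally have "\<delta> \<le> \<phi> (\<Sum>n\<in>?B. ?a n *\<^sub>R h n)" using low C1 by (simp add: \<delta>_def field_simps)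
    then show ?thesis using n1 A0(1) m(1) by (intro exI[of _ ?B] exI[of _ ?a]) auto
  qed
  then obtain B a where B: "\<And>m. finite (B m)" "\<And>m. B m \<subseteq> {m..}" "\<And>m. N (\<Sum>n\<in>B m. a m n *\<^sub>R h n) \<le> 1"
    "\<And>m. \<delta> \<le> \<phi> (\<Sum>n\<in>B m. a m n *\<^sub>R h n)" by metis
  define st where "st = rec_nat 0 (\<lambda>_ m. Suc (Max (insert m (B m))))"
  have st_Suc: "st (Suc i) = Suc (Max (insert (st i) (B (st i))))" for i by (simp add: st_def)
  have less: "n < st (Suc i)" if "n \<in> insert (st i) (B (st i))" for n i
    unfolding st_Suc using that B(1) by (intro le_imp_less_Suc Max_ge) auto
  have step: "st i \<le> st (Suc i)" for i using less[of "st i" i] by simp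
  have mono: "st i \<le> st k" if "i \<le> k" for i k by (rule lift_Suc_mono_le[of st, OF step that])
  have dis: "i = k" if "n \<in> B (st i)" "n \<in> B (st k)" for i k n
  proof (rule ccontr)
    assume "i \<noteq> k"
    then consider "Suc i \<le> k" | "Suc k \<le> i" by linarith
    then show False
    proof cases
      case 1 then show False using mono[OF 1] less[of n i] that B(2)[of "st k"] by fastforce
    next
      case 2 then show False using mono[OF 2] less[of n k] that B(2)[of "st i"] by fastforce
    qed
  qed
  define c where "c = (\<lambda>n. a (st (SOME i. n \<in> B (st i))) n)"
  have c: "c n = a (st i) n" if "n \<in> B (st i)" for n i
    using dis[OF that someI[of "\<lambda>i. n \<in> B (st i)", OF that]] by (simp add: c_def)
  have ci: "(\<Sum>n\<in>B (st i). c n *\<^sub>R h n) = (\<Sum>n\<in>B (st i). a (st i) n *\<^sub>R h n)" for i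
    by (intro sum.cong refl) (simp add: c)
  have bound: "real M * \<delta> \<le> K * T * real M powr (1 / r)" for M
  proof -
    have "N (\<Sum>i<M. \<Sum>n\<in>B (st i). c n *\<^sub>R h n) \<le> T * real (card {..<M}) powr (1 / r)"
      by (rule upper) (use B dis in \<open>auto simp: ci\<close>)
    then have up: "K * N (\<Sum>i<M. \<Sum>n\<in>B (st i). c n *\<^sub>R h n) \<le> K * (T * real M powr (1 / r))"
      using K(1) by (intro mult_left_mono) auto
    have "real M * \<delta> = (\<Sum>i<M. \<delta>)" by simp
    also have "\<dots> \<le> (\<Sum>i<M. 1 * \<phi> (\<Sum>n\<in>B (st i). c n *\<^sub>R h n))" unfolding ci using B(4) by (intro sum_mono) simp
    also have "\<dots> = \<phi> (\<Sum>i<M. 1 *\<^sub>R (\<Sum>n\<in>B (st i). c n *\<^sub>R h n))" by (rule D_sum[OF \<phi> comb_V, symmetric])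
    also have "\<dots> \<le> K * N (\<Sum>i<M. \<Sum>n\<in>B (st i). c n *\<^sub>R h n)"
    proof -
      have "(\<Sum>i<M. \<Sum>n\<in>B (st i). c n *\<^sub>R h n) \<in> V" by (intro subspace_sum V comb_V)
      from K(2)[OF this] show ?thesis by simp
    qed
    finally show ?thesis using up by (simp add: mult.assoc)
  qed
  define \<alpha> where "\<alpha> = 1 - 1 / r"
  have \<alpha>: "0 < \<alpha>" using r1 by (simp add: \<alpha>_def)
  define Q where "Q = K * T / \<delta> + 1"
  have Q: "0 < Q" using K T0 \<delta> by (simp add: Q_def add_nonneg_pos)
  obtain M where M: "Q powr (1 / \<alpha>) < real M" using reals_Archimedean2 by blast
  then have M0: "0 < real M" using powr_ge_zero[of Q "1 / \<alpha>"] by linarith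
  have "(Q powr (1 / \<alpha>)) powr \<alpha> \<le> real M powr \<alpha>" using M \<alpha> by (intro powr_mono2) auto
  then have "Q \<le> real M powr \<alpha>" using Q \<alpha> by (simp add: powr_powr)
  then have "\<delta> * Q * real M powr (1 / r) \<le> \<delta> * real M powr \<alpha> * real M powr (1 / r)"
    using \<delta> by (intro mult_right_mono mult_left_mono) auto
  also have "\<dots> = \<delta> * real M"
    using M0 by (simp add: \<alpha>_def mult.assoc powr_add[symmetric])
  also have "\<dots> \<le> K * T * real M powr (1 / r)" using bound[of M] by (simp add: mult.commute)
  finally have "\<delta> * Q \<le> K * T" using M0 by simp
  moreover have "\<delta> * Q = K * T + \<delta>" using \<delta> by (simp add: Q_def distrib_left)
  ultimately show False using \<delta> by simp
qed

lemma shrinking: "shrinking_basis V N h"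
proof -
  have ex: "sums_in dn (\<lambda>n. \<phi> (h n) *\<^sub>R cf n) \<phi>" if \<phi>: "\<phi> \<in> D" for \<phi>
    unfolding sums_in_def
  proof (rule LIMSEQ_I)
    fix e :: real assume e: "0 < e"
    from dual_tail[OF \<phi>, of "e / 2"] e obtain m0 where m0: "\<And>m. m \<ge> m0 \<Longrightarrow> dn ((\<Sum>n<m. \<phi> (h n) *\<^sub>R cf n) - \<phi>) \<le> e / 2" by auto
    have "norm (dn ((\<Sum>n<m. \<phi> (h n) *\<^sub>R cf n) - \<phi>) - 0) < e" if "m \<ge> m0" for m
      using m0[OF that] e dn_nonneg[OF subspace_diff[OF D_subspace cf_comb_D \<phi>], of "\<lambda>n. \<phi> (h n)" "{..<m}"] by simp
    then show "\<exists>no. \<forall>m\<ge>no. norm (dn ((\<Sum>n<m. \<phi> (h n) *\<^sub>R cf n) - \<phi>) - 0) < e" by blast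
  qed
  have uniq: "a = (\<lambda>n. \<phi> (h n))" if \<phi>: "\<phi> \<in> D" and s: "sums_in dn (\<lambda>n. a n *\<^sub>R cf n) \<phi>" for \<phi> a
  proof
    fix k
    have lim: "(\<lambda>m. dn ((\<Sum>n<m. a n *\<^sub>R cf n) - \<phi>) * N (h k)) \<longlonglongrightarrow> 0 * N (h k)"
      using s unfolding sums_in_def by (rule tendsto_mult_right)
    have "\<forall>\<^sub>F m in sequentially. \<bar>a k - \<phi> (h k)\<bar> \<le> dn ((\<Sum>n<m. a n *\<^sub>R cf n) - \<phi>) * N (h k)"
      using eventually_gt_at_top[of k]
    proof eventually_elim
      case (elim m)
      have "((\<Sum>n<m. a n *\<^sub>R cf n) - \<phi>) (h k) = (\<Sum>n<m. a n * co (h k) n) - \<phi> (h k)"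
        using cf_comb_apply[OF hV[of k], of a "{..<m}"] by (simp only: minus_apply)
      also have "(\<Sum>n<m. a n * co (h k) n) = (\<Sum>n<m. if n = k then a n else 0)" by (intro sum.cong refl) (simp add: co_h)
      also have "\<dots> = a k" using elim by simp
      finally show ?case using dn_bound[OF subspace_diff[OF D_subspace cf_comb_D \<phi>] hV, of a "{..<m}" k] by (simp only:)
    qed
    from tendsto_lowerbound[OF lim this] show "a k = \<phi> (h k)" by simp
  qed
  have "schauder_basis D dn cf"
    unfolding schauder_basis_def using cf_D ex uniq by metis
  then show ?thesis using schauder by (simp add: shrinking_basis_def)
qed

end

section \<open>Dyadic intervals as binary words\<close>

lemma pt_grid: "\<exists>i. i < 2 ^ length u \<and> pt u = real i / 2 ^ length u"
proof (induction u)
  case (Cons b u)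
  then obtain i where i: "i < 2 ^ length u" "pt u = real i / 2 ^ length u" by blast
  have "2 * i + of_bool b < 2 ^ length (b # u)" using i(1) by (cases b) auto
  moreover have "pt (b # u) = real (2 * i + of_bool b) / 2 ^ length (b # u)"
    using i(2) by (cases b) (auto simp: power_one_over field_simps)
  ultimately show ?case by blast
qed (simp add: exI[of _ 0])

text \<open>The words of length \<open>j\<close> enumerate the dyadic intervals of length \<open>2\<^sup>-\<^sup>j\<close>.\<close>

lemma iv_grid: "\<exists>i. i < 2 ^ length u \<and> iv u = {real i / 2 ^ length u ..< real (Suc i) / 2 ^ length u}"
proof -
  obtain i where i: "i < 2 ^ length u" "pt u = real i / 2 ^ length u" using pt_grid[of u] by blast
  then have "pt u + (1/2) ^ length u = real (Suc i) / 2 ^ length u" by (simp add: power_one_over add_divide_distrib)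
  then show ?thesis using i by (auto simp: iv_def)
qed

lemma range_iv: "range iv = dyadic_intervals"
proof (intro equalityI subsetI)
  fix I assume "I \<in> range iv"
  then obtain u where u: "I = iv u" by blast
  obtain i where i: "i < 2 ^ length u" "iv u = {real i / 2 ^ length u ..< real (Suc i) / 2 ^ length u}" using iv_grid[of u] by blast
  have "I = {(real (Suc i) - 1) / 2 ^ length u ..< real (Suc i) / 2 ^ length u}" unfolding u i(2) by simp
  moreover have "1 \<le> Suc i" "Suc i \<le> 2 ^ length u" using i(1) by (simp_all add: Suc_le_eq)
  ultimately show "I \<in> dyadic_intervals" unfolding dyadic_intervals_def by blast
next
  fix I assume "I \<in> dyadic_intervals"
  then obtain i j :: nat where ij: "1 \<le> i" "i \<le> 2 ^ j" and I: "I = {(real i - 1) / 2 ^ j ..< real i / 2 ^ j}"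
    unfolding dyadic_intervals_def by blast
  define x where "x = (real i - 1) / 2 ^ j"
  have "real i \<le> 2 ^ j" using ij(2) by (metis of_nat_le_iff of_nat_numeral of_nat_power)
  then have "real i - 1 < 2 ^ j" by linarith
  then have x: "x \<in> {0..<1}" using ij(1) by (simp add: x_def)
  obtain k where k: "iv (bits j x) = {real k / 2 ^ j ..< real (Suc k) / 2 ^ j}" using iv_grid[of "bits j x"] by auto
  have "x \<in> {real k / 2 ^ j ..< real (Suc k) / 2 ^ j}" using in_iv_bits[OF x, of j] unfolding k .
  then have "real k \<le> real i - 1" "real i - 1 < real (Suc k)" by (auto simp: x_def divide_le_cancel divide_less_cancel)
  then have "i = Suc k" using ij(1) by linarith
  then have "I = iv (bits j x)" unfolding k I by simp
  then show "I \<in> range iv" by blast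
qed

lemma inj_iv: "inj iv"
proof (rule injI)
  fix u v assume eq: "iv u = iv v"
  have pos: "(0::real) < (1/2) ^ length u" "(0::real) < (1/2) ^ length v" by simp_all
  have ab: "pt u = pt v \<and> pt u + (1/2) ^ length u = pt v + (1/2) ^ length v"
    using eq pos unfolding iv_def by (subst (asm) atLeastLessThan_eq_iff) auto
  then have e: "(1/2::real) ^ length u = (1/2) ^ length v" by linarith
  have lt: "(1/2::real) ^ b < (1/2) ^ a" if "a < b" for a b :: nat by (rule power_strict_decreasing[OF that]) simp_all
  have len: "length u = length v" using e lt[of "length u" "length v"] lt[of "length v" "length u"] by (metis less_irrefl nat_neq_iff)
  have "pt u \<in> iv u" using pos by (simp add: iv_def)
  then have u: "bits (length u) (pt u) = u" by (rule bits_unique)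
  have "pt u \<in> iv v" using \<open>pt u \<in> iv u\<close> by (simp only: eq)
  then have "bits (length v) (pt u) = v" by (rule bits_unique)
  with u[unfolded len] show "u = v" by (rule trans[OF sym])
qed

lemma haar_iv_indicator: "haar (iv u) x = indicator (iv (False # u)) x - indicator (iv (True # u)) x"
proof -
  have pos: "(0::real) < (1/2) ^ length u" by simp
  have mid: "(Inf (iv u) + Sup (iv u)) / 2 = pt u + (1/2) ^ Suc (length u)"
    using pos by (simp add: iv_def cInf_atLeastLessThan cSup_atLeastLessThan)
  have "left_half (iv u) = iv (False # u)" "right_half (iv u) = iv (True # u)"
    unfolding left_half_def right_half_def mid unfolding iv_False iv_True iv_def using pos by auto
  then show ?thesis by (simp add: haar_def)
qed

lemma iv_iff_bits: "x \<in> {0..<1} \<Longrightarrow> x \<in> iv u \<longleftrightarrow> bits (length u) x = u"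
  using in_iv_bits[of x "length u"] bits_unique[of x u] by auto

lemma haar_iv:
  assumes x: "x \<in> {0..<1}" and u: "length u < N" shows "haar (iv u) x = hw u (bits N x)"
proof -
  have "hw u (bits N x) = (if bits (length u) x = u then haar_sign (hd (bits (Suc (length u)) x)) else 0)"
    using u
  proof (induction N)
    case (Suc N)
    show ?case
    proof (cases "length u = N")
      case True
      then show ?thesis using hw_short[of "bits N x" u] by auto
    next
      case False
      then have "bits N x \<noteq> u" by auto
      then show ?thesis using Suc False by simp
    qed
  qed simp
  moreover have "haar (iv u) x = (if bits (length u) x = u then haar_sign (hd (bits (Suc (length u)) x)) else 0)"
    unfolding haar_iv_indicator indicator_def iv_iff_bits[OF x] by (auto simp: haar_sign_def)
  ultimately show ?thesis by simp
qed

lemma integral_haar_iv: "(\<integral>s. haar (iv u) s \<partial>unit_measure) = 0"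
proof -
  have m: "measure unit_measure (iv (b # u)) = (1/2) ^ Suc (length u)" for b
    unfolding measure_def emeasure_iv by simp
  have i: "integrable unit_measure (indicator (iv v) :: real \<Rightarrow> real)" for v
    by (intro integrable_real_indicator iv_in_sets) (simp add: emeasure_iv)
  have e: "(\<integral>s. indicator (iv v) s \<partial>unit_measure) = measure unit_measure (iv v)" for v
  proof -
    have "iv v \<subseteq> {0..1}" using iv_subset[of v] by auto
    then show ?thesis by (simp add: Int_absorb2)
  qed
  show ?thesis unfolding haar_iv_indicator by (subst Bochner_Integration.integral_diff[OF i i]) (simp only: e m diff_self)
qed

lemma measurable_haar_iv [measurable]: "haar (iv u) \<in> borel_measurable unit_measure"
proof -
  note [measurable] = iv_in_sets
  have "(\<lambda>x. indicator (iv (False # u)) x - indicator (iv (True # u)) x :: real) \<in> borel_measurable unit_measure" by measurable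
  then show ?thesis unfolding haar_iv_indicator[symmetric] .
qed

section \<open>The Haar system as a basis of \<open>L\<^sup>p\<^sub>0\<close>\<close>

lemma mixed_norm_step:
  assumes "\<And>x. (\<And>j. j \<in> set (dims d) \<Longrightarrow> x j \<in> {0..<1}) \<Longrightarrow> f x = G (bitsv N x)"
  shows "mixed_norm d p f = dnorm N p (dims d) G (base N)"
proof -
  have "nrm p (dims d) f = ennreal (dnorm N p (dims d) G (base N))" using assms by (rule nrm_step)
  then show ?thesis by (simp add: mixed_norm_eq dnorm_nonneg)
qed

locale haar_enumeration =
  fixes d :: nat and p :: "nat \<Rightarrow> real" and \<rho> :: "nat \<Rightarrow> nat \<Rightarrow> bool list"
  assumes d: "1 \<le> d" and p: "\<And>j. j \<in> set (dims d) \<Longrightarrow> 1 < p j"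
    and \<rho>: "bij_betw \<rho> UNIV ({1..d} \<rightarrow>\<^sub>E UNIV)"
begin

abbreviation "js \<equiv> dims d"
abbreviation "V \<equiv> mixed_Lp0 d p"
abbreviation "M \<equiv> mixed_norm d p"

definition h :: "nat \<Rightarrow> (nat \<Rightarrow> real) \<Rightarrow> real" where
  "h n = haar_tensor d (\<lambda>j\<in>{1..d}. iv (\<rho> n j))"

lemma js: "distinct js" "js \<noteq> []"
  using distinct_dims set_dims[of d] d by auto

lemma p1: "j \<in> set js \<Longrightarrow> 1 \<le> p j" and p0: "j \<in> set js \<Longrightarrow> 0 < p j"
  using p[of j] by auto

lemma inj_\<rho>: "inj \<rho>"
  using \<rho> by (simp add: bij_betw_def)

lemma range_\<rho>: "range \<rho> = {1..d} \<rightarrow>\<^sub>E UNIV"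
  using \<rho> by (simp add: bij_betw_def)

lemma ext_\<rho>: "\<rho> n \<in> extensional (set js)"
  using range_\<rho> by (auto simp: set_dims PiE_def)

lemma rects_range: "rects js N \<subseteq> range \<rho>" and desc_range: "desc js R m \<subseteq> range \<rho>"
  unfolding range_\<rho> rects_def desc_def set_dims by (auto simp: PiE_def)

lemma sum_index: "X \<subseteq> range \<rho> \<Longrightarrow> (\<Sum>n\<in>\<rho> -` X. g (\<rho> n)) = (\<Sum>R\<in>X. g R)"
proof -
  assume "X \<subseteq> range \<rho>"
  then have "\<rho> ` (\<rho> -` X) = X" by blast
  then show ?thesis using sum.reindex[of \<rho> "\<rho> -` X" g] inj_on_subset[OF inj_\<rho> subset_UNIV] by simp
qed

lemma finite_index: "finite X \<Longrightarrow> finite (\<rho> -` X)"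
  by (rule finite_vimageI[OF _ inj_\<rho>])

text \<open>Any number exceeding the lengths of all sides would do; the sum avoids a maximum.\<close>

definition len :: "nat \<Rightarrow> nat" where
  "len n = (\<Sum>j\<in>set js. Suc (length (\<rho> n j)))"

lemma length_less_len: "j \<in> set js \<Longrightarrow> length (\<rho> n j) < len n"
  using member_le_sum[of j "set js" "\<lambda>j. Suc (length (\<rho> n j))"] by (simp add: len_def)

lemma in_rects: "len n \<le> N \<Longrightarrow> \<rho> n \<in> rects js N"
  using ext_\<rho>[of n] length_less_len[of _ n] by (fastforce simp: rects_def PiE_def)

lemma rects_mono: "N \<le> N' \<Longrightarrow> rects js N \<subseteq> rects js N'"
  by (auto simp: rects_def PiE_def Pi_def)

lemma common_level: "finite A \<Longrightarrow> \<exists>N. \<forall>n\<in>A. \<rho> n \<in> rects js N"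
proof -
  assume A: "finite A"
  have "\<rho> n \<in> rects js (\<Sum>n\<in>A. len n)" if "n \<in> A" for n
    using A that by (intro in_rects member_le_sum) auto
  then show ?thesis by blast
qed

lemma h_step:
  assumes n: "\<rho> n \<in> rects js N" and x: "\<And>j. j \<in> set js \<Longrightarrow> x j \<in> {0..<1}"
  shows "h n x = ht js (\<rho> n) (bitsv N x)"
proof -
  have "haar ((\<lambda>j\<in>{1..d}. iv (\<rho> n j)) j) (x j) = hw (\<rho> n j) (bitsv N x j)" if "j \<in> set js" for j
  proof -
    have "length (\<rho> n j) < N" using n that by (auto simp: rects_def)
    then show ?thesis using haar_iv[OF x[OF that]] that by (simp add: set_dims bitsv_def)
  qed
  then show ?thesis unfolding h_def haar_tensor_def ht_def set_dims[symmetric] by (intro prod.cong refl)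
qed

lemma h_prod: "h n = (\<lambda>x. \<Prod>j\<in>set js. haar (iv (\<rho> n j)) (x j))"
  unfolding h_def haar_tensor_def set_dims by (intro ext prod.cong refl) simp

lemma measurable_h [measurable]: "h n \<in> borel_measurable (cubem js)"
  unfolding h_prod
  by (intro borel_measurable_prod measurable_compose[OF measurable_component_cube measurable_haar_iv])

lemma h_zero_mean: "zero_mean js (h n)"
  unfolding zero_mean_def
proof (intro ballI always_eventually allI)
  fix j t assume j: "j \<in> set js"
  have "h n (t(j := s)) = (\<Prod>i\<in>set js - {j}. haar (iv (\<rho> n i)) (t i)) * haar (iv (\<rho> n j)) s" for s
  proof -
    have "h n (t(j := s)) = haar (iv (\<rho> n j)) ((t(j := s)) j) * (\<Prod>i\<in>set js - {j}. haar (iv (\<rho> n i)) ((t(j := s)) i))"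
      unfolding h_prod by (rule prod.remove) (use j in auto)
    also have "(\<Prod>i\<in>set js - {j}. haar (iv (\<rho> n i)) ((t(j := s)) i)) = (\<Prod>i\<in>set js - {j}. haar (iv (\<rho> n i)) (t i))"
      by (rule prod.cong) auto
    finally show ?thesis by (simp only: fun_upd_same mult.commute)
  qed
  then show "(\<integral>s. h n (t(j := s)) \<partial>unit_measure) = 0" by (simp only: integral_mult_right_zero integral_haar_iv mult_zero_right)
qed

lemma h_in: "h n \<in> V"
proof -
  have "nrm p js (h n) = ennreal (dnorm (len n) p js (ht js (\<rho> n)) (base (len n)))"
    by (rule nrm_step) (rule h_step[OF in_rects[OF order_refl]])
  then show ?thesis unfolding mixed_Lp0_iff by (simp add: h_zero_mean)
qed

lemma norm_comb:
  assumes "\<And>n. n \<in> A \<Longrightarrow> \<rho> n \<in> rects js N"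
  shows "M (\<Sum>n\<in>A. a n *\<^sub>R h n) = dnorm N p js (\<lambda>\<tau>. \<Sum>n\<in>A. a n * ht js (\<rho> n) \<tau>) (base N)"
proof (rule mixed_norm_step)
  fix x assume x: "\<And>j. j \<in> set js \<Longrightarrow> x j \<in> {0..<1::real}"
  show "(\<Sum>n\<in>A. a n *\<^sub>R h n) x = (\<Sum>n\<in>A. a n * ht js (\<rho> n) (bitsv N x))"
    unfolding sum_fun_apply by (intro sum.cong refl) (simp add: h_step[OF assms x])
qed

lemma M_nonneg: "0 \<le> M f"
  by (simp add: mixed_norm_eq)

text \<open>The pairing of a Haar function with itself is the measure of its rectangle; Hoelder's
  inequality bounds it by the norm.\<close>

lemma h_positive: "0 < M (h n)"
proof -
  let ?N = "len n"
  have r: "\<rho> n \<in> rects js ?N" by (rule in_rects) simp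
  have "M (h n) = dnorm ?N p js (ht js (\<rho> n)) (base ?N)"
    by (rule mixed_norm_step) (rule h_step[OF r])
  moreover have "0 < rmeas js (\<rho> n)" by (rule rmeas_pos)
  moreover have "rmeas js (\<rho> n) \<le> dnorm ?N p js (ht js (\<rho> n)) (base ?N) * dnorm ?N (conj_exp p) js (ht js (\<rho> n)) (base ?N)"
    using dnorm_Holder[of js p ?N "ht js (\<rho> n)" "ht js (\<rho> n)" "base ?N"] p
      mavg_ht_orthogonal[OF js(1) r r, of "base ?N"] by simp
  ultimately have "M (h n) \<noteq> 0" by auto
  then show ?thesis using M_nonneg[of "h n"] by simp
qed

lemma dense:
  assumes f: "f \<in> V" and e: "0 < e"
  shows "\<exists>A a. finite A \<and> M (f - (\<Sum>n\<in>A. a n *\<^sub>R h n)) < e"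
proof -
  have fm [measurable]: "f \<in> borel_measurable (cubem js)" using f unfolding mixed_Lp0_iff by blast
  have "\<exists>N b. nrm p js (\<lambda>x. f x - stepf N (hpoly js N b) x) < ennreal e"
    using f by (intro haar_polynomials_dense[OF js(1) p _ _ _ e]) (auto simp: mixed_Lp0_iff)
  then obtain N b where Nb: "nrm p js (\<lambda>x. f x - stepf N (hpoly js N b) x) < ennreal e" by blast
  let ?A = "\<rho> -` rects js N"
  let ?y = "\<Sum>n\<in>?A. b (\<rho> n) *\<^sub>R h n"
  have ym: "?y \<in> borel_measurable (cubem js)"
  proof -
    have "(\<lambda>x. \<Sum>n\<in>?A. b (\<rho> n) * h n x) \<in> borel_measurable (cubem js)" by measurable
    moreover have "?y = (\<lambda>x. \<Sum>n\<in>?A. b (\<rho> n) * h n x)" by (rule ext) (simp add: sum_fun_apply)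
    ultimately show ?thesis by simp
  qed
  \<comment> \<open>both functions agree off the faces \<open>x j = 1\<close>\<close>
  have "stepf N (hpoly js N b) x - ?y x = 0" if x: "\<And>j. j \<in> set js \<Longrightarrow> x j \<in> {0..<1}" for x
  proof -
    have "?y x = (\<Sum>n\<in>?A. b (\<rho> n) * ht js (\<rho> n) (bitsv N x))"
      unfolding sum_fun_apply by (intro sum.cong refl) (simp add: h_step[OF _ x])
    also have "\<dots> = stepf N (hpoly js N b) x"
      unfolding stepf_def hpoly_def by (rule sum_index[OF rects_range, of "\<lambda>R. b R * ht js R (bitsv N x)"])
    finally show ?thesis by simp
  qed
  then have "nrm p js (\<lambda>x. stepf N (hpoly js N b) x - ?y x) = ennreal (dnorm N p js (\<lambda>_. 0) (base N))"
    by (intro nrm_step) auto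
  also have "dnorm N p js (\<lambda>_. 0) (base N) = 0" using dnorm_scale[of js p N 0 "\<lambda>_. 0" "base N"] p0 by simp
  finally have z: "nrm p js (\<lambda>x. stepf N (hpoly js N b) x - ?y x) = 0" by (simp only: ennreal_0)
  have "nrm p js (\<lambda>x. f x - ?y x) \<le> nrm p js (\<lambda>x. f x - stepf N (hpoly js N b) x) + nrm p js (\<lambda>x. stepf N (hpoly js N b) x - ?y x)"
    by (intro nrm_diff[OF js(1) p1 fm measurable_stepf ym])
  also have "\<dots> < ennreal e" using Nb z by simp
  finally have lt: "nrm p js (\<lambda>x. f x - ?y x) < ennreal e" .
  have "f - ?y = (\<lambda>x. f x - ?y x)" by (rule ext) simp
  with lt have lt: "nrm p js (f - ?y) < ennreal e" by (simp only:)
  have "M (f - ?y) < e" by (rule iffD2[OF mixed_norm_less_iff[OF less_trans[OF lt ennreal_less_top] e] lt])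
  then show ?thesis using finite_index[OF finite_rects] by (intro exI[of _ ?A] exI[of _ "\<lambda>n. b (\<rho> n)"]) simp
qed

lemma domination:
  "\<exists>C\<ge>1. \<forall>A a b. finite A \<longrightarrow> (\<forall>n\<in>A. \<bar>a n\<bar> \<le> \<bar>b n\<bar>) \<longrightarrow> M (\<Sum>n\<in>A. a n *\<^sub>R h n) \<le> C * M (\<Sum>n\<in>A. b n *\<^sub>R h n)"
proof -
  have "\<exists>C\<ge>1. \<forall>N a b t. (\<forall>\<tau>\<in>pts N js t. sqf js N b \<tau> \<le> sqf js N a \<tau>) \<longrightarrow>
    dnorm N p js (hpoly js N b) t \<le> C * dnorm N p js (hpoly js N a) t"
    using js(1) p by (rule hpoly_dominated)
  then obtain C where C: "1 \<le> C" "\<And>N a b t. (\<forall>\<tau>\<in>pts N js t. sqf js N b \<tau> \<le> sqf js N a \<tau>) \<Longrightarrow>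
    dnorm N p js (hpoly js N b) t \<le> C * dnorm N p js (hpoly js N a) t" by blast
  have "M (\<Sum>n\<in>A. a n *\<^sub>R h n) \<le> C * M (\<Sum>n\<in>A. b n *\<^sub>R h n)" if A: "finite A" "\<forall>n\<in>A. \<bar>a n\<bar> \<le> \<bar>b n\<bar>" for A a b
  proof -
    obtain N where N: "\<And>n. n \<in> A \<Longrightarrow> \<rho> n \<in> rects js N" using common_level[OF A(1)] by blast
    let ?f = "fam A (\<lambda>n. {\<rho> n})"
    have sub: "\<And>n. n \<in> A \<Longrightarrow> {\<rho> n} \<subseteq> rects js N" using N by simp
    have dis: "\<And>k l. k \<in> A \<Longrightarrow> l \<in> A \<Longrightarrow> k \<noteq> l \<Longrightarrow> {\<rho> k} \<inter> {\<rho> l} = {}" using inj_\<rho> by (auto simp: inj_def)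
    have eq: "M (\<Sum>n\<in>A. c n *\<^sub>R h n) = dnorm N p js (hpoly js N (?f c)) (base N)" for c
    proof -
      have "hpoly js N (?f c) = (\<lambda>\<tau>. \<Sum>n\<in>A. c n * ht js (\<rho> n) \<tau>)"
        by (rule ext) (simp add: hpoly_fam[OF A(1) sub])
      then show ?thesis using norm_comb[of A N c, OF N] by simp
    qed
    have "sqf js N (?f a) \<tau> \<le> sqf js N (?f b) \<tau>" for \<tau>
    proof -
      have sq: "sqf js N (?f c) \<tau> = sqrt (\<Sum>n\<in>A. (c n)\<^sup>2 * (ht js (\<rho> n) \<tau>)\<^sup>2)" for c
        using sqf_fam[where c = c and \<tau> = \<tau>, OF A(1) sub dis] by simp
      have "(\<Sum>n\<in>A. (a n)\<^sup>2 * (ht js (\<rho> n) \<tau>)\<^sup>2) \<le> (\<Sum>n\<in>A. (b n)\<^sup>2 * (ht js (\<rho> n) \<tau>)\<^sup>2)"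
        using A(2) by (intro sum_mono mult_right_mono) (auto simp: abs_le_square_iff)
      then show ?thesis unfolding sq by (rule real_sqrt_le_mono)
    qed
    then show ?thesis unfolding eq by (intro C(2)) blast
  qed
  then show ?thesis using C(1) by blast
qed

text \<open>An exponent above \<open>1\<close> for which both the \<open>\<ell>\<^sup>2\<close>-sum in the square function and all the exponents of
  the mixed norm allow an upper estimate.\<close>

definition exponent :: real where
  "exponent = Min (insert 2 (p ` set js))"

lemma exponent: "1 < exponent" "exponent \<le> 2" "j \<in> set js \<Longrightarrow> exponent \<le> p j"
  unfolding exponent_def using p by (auto simp: Min_gr_iff)

lemma upper_estimate:
  "\<exists>T\<ge>0. \<forall>(I :: nat set) A a. finite I \<and> (\<forall>i\<in>I. finite (A i)) \<and> (\<forall>i\<in>I. \<forall>k\<in>I. i \<noteq> k \<longrightarrow> A i \<inter> A k = {}) \<and>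
      (\<forall>i\<in>I. M (\<Sum>n\<in>A i. a n *\<^sub>R h n) \<le> 1) \<longrightarrow>
    M (\<Sum>i\<in>I. \<Sum>n\<in>A i. a n *\<^sub>R h n) \<le> T * real (card I) powr (1 / exponent)"
proof -
  have "\<exists>C\<ge>0. \<forall>N (I :: nat set) S x t. finite I \<and> (\<forall>i\<in>I. S i \<subseteq> rects js N) \<and>
      (\<forall>i\<in>I. \<forall>k\<in>I. i \<noteq> k \<longrightarrow> S i \<inter> S k = {}) \<and>
      (\<forall>i\<in>I. dnorm N p js (\<lambda>\<tau>. \<Sum>R\<in>S i. x R * ht js R \<tau>) t \<le> 1) \<longrightarrow>
    dnorm N p js (\<lambda>\<tau>. \<Sum>i\<in>I. \<Sum>R\<in>S i. x R * ht js R \<tau>) t \<le> C * real (card I) powr (1 / exponent)"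
    using js(1) p less_imp_le[OF exponent(1)] exponent(2) exponent(3) by (rule disjoint_sum_bound)
  then obtain T where T: "0 \<le> T" "\<And>N (I :: nat set) S x t. finite I \<and> (\<forall>i\<in>I. S i \<subseteq> rects js N) \<and>
      (\<forall>i\<in>I. \<forall>k\<in>I. i \<noteq> k \<longrightarrow> S i \<inter> S k = {}) \<and>
      (\<forall>i\<in>I. dnorm N p js (\<lambda>\<tau>. \<Sum>R\<in>S i. x R * ht js R \<tau>) t \<le> 1) \<Longrightarrow>
    dnorm N p js (\<lambda>\<tau>. \<Sum>i\<in>I. \<Sum>R\<in>S i. x R * ht js R \<tau>) t \<le> T * real (card I) powr (1 / exponent)" by blast
  have *: "M (\<Sum>i\<in>I. \<Sum>n\<in>A i. a n *\<^sub>R h n) \<le> T * real (card I) powr (1 / exponent)"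
    if I: "finite I" "\<forall>i\<in>I. finite (A i)" "\<forall>i\<in>I. \<forall>k\<in>I. i \<noteq> k \<longrightarrow> A i \<inter> A k = {}"
      "\<forall>i\<in>I. M (\<Sum>n\<in>A i. a n *\<^sub>R h n) \<le> 1" for I :: "nat set" and A a
  proof -
    obtain N where N: "\<And>i n. i \<in> I \<Longrightarrow> n \<in> A i \<Longrightarrow> \<rho> n \<in> rects js N"
      using common_level[of "\<Union>i\<in>I. A i"] I(1,2) by blast
    define x where "x = (\<lambda>R. a (inv \<rho> R))"
    have re: "(\<Sum>R\<in>\<rho> ` A i. x R * ht js R \<tau>) = (\<Sum>n\<in>A i. a n * ht js (\<rho> n) \<tau>)" for i \<tau>
      using sum.reindex[of \<rho> "A i" "\<lambda>R. x R * ht js R \<tau>"] inj_on_subset[OF inj_\<rho> subset_UNIV] by (simp add: x_def inv_f_f[OF inj_\<rho>])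
    have "M (\<Sum>i\<in>I. \<Sum>n\<in>A i. a n *\<^sub>R h n) = dnorm N p js (\<lambda>\<tau>. \<Sum>i\<in>I. \<Sum>R\<in>\<rho> ` A i. x R * ht js R \<tau>) (base N)"
    proof (rule mixed_norm_step)
      fix y assume y: "\<And>j. j \<in> set js \<Longrightarrow> y j \<in> {0..<1::real}"
      show "(\<Sum>i\<in>I. \<Sum>n\<in>A i. a n *\<^sub>R h n) y = (\<Sum>i\<in>I. \<Sum>R\<in>\<rho> ` A i. x R * ht js R (bitsv N y))"
        unfolding sum_fun_apply re by (intro sum.cong refl) (simp add: h_step[OF N y])
    qed
    also have "\<dots> \<le> T * real (card I) powr (1 / exponent)"
    proof (rule T(2), intro conjI ballI impI I(1))
      fix i assume i: "i \<in> I"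
      then show "\<rho> ` A i \<subseteq> rects js N" using N by blast
      show "dnorm N p js (\<lambda>\<tau>. \<Sum>R\<in>\<rho> ` A i. x R * ht js R \<tau>) (base N) \<le> 1"
        using I(4)[rule_format, OF i] norm_comb[of "A i" N a, OF N[OF i]] unfolding re by simp
      fix k assume "k \<in> I" "i \<noteq> k"
      then have "A i \<inter> A k = {}" using I(3) i by blast
      then show "\<rho> ` A i \<inter> \<rho> ` A k = {}" using image_Int[OF inj_\<rho>, of "A i" "A k"] by (metis image_empty)
    qed
    finally show ?thesis .
  qed
  show ?thesis by (intro exI[of _ T] conjI allI impI T(1); elim conjE; rule *; assumption)
qed

lemma haar_upper_dominated_system: "\<exists>C T. upper_dominated_system V M h C exponent T"
proof -
  obtain C where C: "1 \<le> C" "\<And>A a b. finite A \<Longrightarrow> (\<forall>n\<in>A. \<bar>a n\<bar> \<le> \<bar>b n\<bar>) \<Longrightarrow> M (\<Sum>n\<in>A. a n *\<^sub>R h n) \<le> C * M (\<Sum>n\<in>A. b n *\<^sub>R h n)"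
    using domination by blast
  obtain T where T: "0 \<le> T" "\<And>(I :: nat set) A a. finite I \<and> (\<forall>i\<in>I. finite (A i)) \<and> (\<forall>i\<in>I. \<forall>k\<in>I. i \<noteq> k \<longrightarrow> A i \<inter> A k = {}) \<and>
      (\<forall>i\<in>I. M (\<Sum>n\<in>A i. a n *\<^sub>R h n) \<le> 1) \<Longrightarrow>
    M (\<Sum>i\<in>I. \<Sum>n\<in>A i. a n *\<^sub>R h n) \<le> T * real (card I) powr (1 / exponent)"
    using upper_estimate by blast
  have B: "banach_on V M" by (rule banach_mixed_Lp0) (rule p1)
  have "dominated_system V M h C"
  proof (rule dominated_system.intro)
    show "subspace V" using B by (simp add: banach_on_def)
    show "M (f + g) \<le> M f + M g" if "f \<in> V" "g \<in> V" for f g using B that by (simp add: banach_on_def)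
    show "M (c *\<^sub>R f) = \<bar>c\<bar> * M f" if "f \<in> V" for c f using B that by (simp add: banach_on_def)
    show "0 \<le> M f" for f by (rule M_nonneg)
  qed (fact h_in h_positive C dense)+
  moreover have "upper_dominated_system_axioms M h exponent T"
  proof (rule upper_dominated_system_axioms.intro)
    fix I :: "nat set" and A and a :: "nat \<Rightarrow> real"
    assume "finite I" "\<And>i. i \<in> I \<Longrightarrow> finite (A i)" "\<And>i k. i \<in> I \<Longrightarrow> k \<in> I \<Longrightarrow> i \<noteq> k \<Longrightarrow> A i \<inter> A k = {}"
      "\<And>i. i \<in> I \<Longrightarrow> M (\<Sum>n\<in>A i. a n *\<^sub>R h n) \<le> 1"
    then show "M (\<Sum>i\<in>I. \<Sum>n\<in>A i. a n *\<^sub>R h n) \<le> T * real (card I) powr (1 / exponent)" by (intro T(2)) blast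
  qed (fact exponent(1) T(1))+
  ultimately show ?thesis using upper_dominated_system.intro by blast
qed

section \<open>The strategy\<close>

definition bound :: "nat \<Rightarrow> nat" where
  "bound n = (\<Sum>i\<le>n. len i)"

lemma len_le_bound: "i \<le> n \<Longrightarrow> len i \<le> bound n"
  unfolding bound_def by (rule member_le_sum) auto

text \<open>The scale used after the moves \<open>ns\<close>. The first sum makes it finer than all rectangles with index at most
  the last move, the second makes it at least as fine as the rectangle to be reproduced, and
  both grow with \<open>ns\<close>, so that no scale is used twice.\<close>

definition level :: "nat list \<Rightarrow> nat" where
  "level ns = (\<Sum>n\<leftarrow>ns. Suc (bound n)) + (\<Sum>i<length ns. bound i)"

definition block :: "nat list \<Rightarrow> nat set" where
  "block ns = \<rho> -` desc js (\<rho> (length ns - 1)) (level ns)"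

definition strategy :: "nat list \<Rightarrow> ((nat \<Rightarrow> real) \<Rightarrow> real) \<times> (((nat \<Rightarrow> real) \<Rightarrow> real) \<Rightarrow> real)" where
  "strategy ns = (\<Sum>n\<in>block ns. h n,
     \<Sum>n\<in>block ns. (rmeas js (\<rho> n) / rmeas js (\<rho> (length ns - 1))) *\<^sub>R coord V M h n)"

lemma level_map: "level (map n [0..<Suc k]) = (\<Sum>i<Suc k. Suc (bound (n i)) + bound i)"
proof -
  have "(\<Sum>n\<leftarrow>map n [0..<Suc k]. Suc (bound n)) = (\<Sum>i<Suc k. Suc (bound (n i)))"
    by (simp only: map_map comp_def interv_sum_list_conv_sum_set_nat atLeast0LessThan set_upt)
  then show ?thesis unfolding level_def by (simp only: length_map length_upt sum.distrib diff_zero)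
qed

lemma level_bounds: "bound (n k) < level (map n [0..<Suc k])" "bound k \<le> level (map n [0..<Suc k])"
  unfolding level_map by auto

lemma level_strict_mono: "k < l \<Longrightarrow> level (map n [0..<Suc k]) < level (map n [0..<Suc l])"
proof -
  have "strict_mono (\<lambda>k. level (map n [0..<Suc k]))" unfolding strict_mono_Suc_iff level_map by simp
  then show "k < l \<Longrightarrow> level (map n [0..<Suc k]) < level (map n [0..<Suc l])" by (rule strict_monoD)
qed

text \<open>The sides of a rectangle in the block are words of length equal to the level, and rectangles with small
  indices have shorter words.\<close>

lemma block_late: "i \<in> block (map n [0..<Suc k]) \<Longrightarrow> n k \<le> i"
proof (rule ccontr)
  assume i: "i \<in> block (map n [0..<Suc k])" and "\<not> n k \<le> i"
  then have "len i \<le> bound (n k)" by (intro len_le_bound) simp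
  moreover have hd: "hd js \<in> set js" using js(2) by simp
  then have "length (\<rho> i (hd js)) = level (map n [0..<Suc k])"
    using i unfolding block_def desc_def by (auto simp: PiE_def Pi_def simp del: upt_Suc)
  ultimately show False using length_less_len[OF hd, of i] level_bounds(1)[of n k] by linarith
qed

lemma winning:
  assumes "dominated_system V M h C"
  shows "\<exists>G\<ge>1. winning_strategy V M h G strategy"
proof -
  interpret dominated_system V M h C by fact
  have "\<exists>C\<ge>1. \<forall>N (F :: nat set) \<rho> m c t.
    finite F \<and> inj_on \<rho> F \<and> inj_on m F \<and> (\<forall>k\<in>F. m k < N \<and> \<rho> k \<in> rects js (Suc (m k))) \<longrightarrow>
    dnorm N p js (\<lambda>\<tau>. \<Sum>k\<in>F. c k * (\<Sum>K\<in>desc js (\<rho> k) (m k). ht js K \<tau>)) t \<le>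
      C * dnorm N p js (\<lambda>\<tau>. \<Sum>k\<in>F. c k * ht js (\<rho> k) \<tau>) t \<and>
    dnorm N p js (\<lambda>\<tau>. \<Sum>k\<in>F. c k * ht js (\<rho> k) \<tau>) t \<le>
      C * dnorm N p js (\<lambda>\<tau>. \<Sum>k\<in>F. c k * (\<Sum>K\<in>desc js (\<rho> k) (m k). ht js K \<tau>)) t"
    using js p by (rule blocks_equivalent)
  then obtain E1 where E1: "1 \<le> E1" "\<And>N (F :: nat set) \<rho> m c t.
    finite F \<and> inj_on \<rho> F \<and> inj_on m F \<and> (\<forall>k\<in>F. m k < N \<and> \<rho> k \<in> rects js (Suc (m k))) \<Longrightarrow>
    dnorm N p js (\<lambda>\<tau>. \<Sum>k\<in>F. c k * (\<Sum>K\<in>desc js (\<rho> k) (m k). ht js K \<tau>)) t \<le>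
      E1 * dnorm N p js (\<lambda>\<tau>. \<Sum>k\<in>F. c k * ht js (\<rho> k) \<tau>) t \<and>
    dnorm N p js (\<lambda>\<tau>. \<Sum>k\<in>F. c k * ht js (\<rho> k) \<tau>) t \<le>
      E1 * dnorm N p js (\<lambda>\<tau>. \<Sum>k\<in>F. c k * (\<Sum>K\<in>desc js (\<rho> k) (m k). ht js K \<tau>)) t" by blast
  have "\<exists>C\<ge>1. \<forall>N (F :: nat set) \<rho> m x t.
    finite F \<and> inj_on \<rho> F \<and> inj_on m F \<and> (\<forall>k\<in>F. m k < N \<and> \<rho> k \<in> rects js (Suc (m k))) \<longrightarrow>
    dnorm N p js (\<lambda>\<tau>. \<Sum>k\<in>F. (\<Sum>K\<in>desc js (\<rho> k) (m k). rmeas js K / rmeas js (\<rho> k) * x K) * ht js (\<rho> k) \<tau>) t \<le>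
      C * dnorm N p js (\<lambda>\<tau>. \<Sum>k\<in>F. \<Sum>K\<in>desc js (\<rho> k) (m k). x K * ht js K \<tau>) t"
    using js p by (rule block_averages_bounded)
  then obtain E2 where E2: "1 \<le> E2" "\<And>N (F :: nat set) \<rho> m x t.
    finite F \<and> inj_on \<rho> F \<and> inj_on m F \<and> (\<forall>k\<in>F. m k < N \<and> \<rho> k \<in> rects js (Suc (m k))) \<Longrightarrow>
    dnorm N p js (\<lambda>\<tau>. \<Sum>k\<in>F. (\<Sum>K\<in>desc js (\<rho> k) (m k). rmeas js K / rmeas js (\<rho> k) * x K) * ht js (\<rho> k) \<tau>) t \<le>
      E2 * dnorm N p js (\<lambda>\<tau>. \<Sum>k\<in>F. \<Sum>K\<in>desc js (\<rho> k) (m k). x K * ht js K \<tau>) t" by blast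
  define E where "E = max E1 E2"
  have E: "1 \<le> E" "\<And>f. E1 * M f \<le> E * M f" "\<And>f. E2 * M f \<le> E * M f"
    using E1(1) by (auto simp: E_def intro!: mult_right_mono M_nonneg)
  have "winning_strategy V M h ((E * C)\<^sup>2) strategy"
    unfolding winning_strategy_def Let_def
  proof
    fix n :: "nat \<Rightarrow> nat"
    define m where "m = (\<lambda>k. level (map n [0..<Suc k]))"
    define W where "W = (\<lambda>k. \<rho> -` desc js (\<rho> k) (m k))"
    define \<beta> where "\<beta> = (\<lambda>k i. rmeas js (\<rho> i) / rmeas js (\<rho> k))"
    have block: "block (map n [0..<Suc k]) = W k" for k
      unfolding block_def W_def m_def by (simp only: length_map length_upt diff_zero diff_Suc_1)
    have fst: "fst (strategy (map n [0..<Suc k])) = (\<Sum>i\<in>W k. h i)" for k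
      unfolding strategy_def fst_conv block ..
    have snd: "snd (strategy (map n [0..<Suc k])) = (\<Sum>i\<in>W k. \<beta> k i *\<^sub>R cf i)" for k
      unfolding strategy_def snd_conv block \<beta>_def by (simp only: length_map length_upt diff_zero diff_Suc_1)
    have late: "n k \<le> i" if "i \<in> W k" for i k using block_late[of i n k] that unfolding block .
    have finW: "finite (W k)" for k unfolding W_def by (rule finite_index[OF finite_desc])
    have mne: "m k \<noteq> m l" if "k \<noteq> l" for k l
      using level_strict_mono[of k l n] level_strict_mono[of l k n] that unfolding m_def by linarith
    have disW: "W k \<inter> W l = {}" if "k \<noteq> l" for k l
      using desc_disjoint[OF js(2) mne[OF that], of "\<rho> k" "\<rho> l"] unfolding W_def by blast
    have len_m: "len k \<le> m k" for k
      using len_le_bound[of k k] level_bounds(2)[of k n] unfolding m_def by linarith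
    have rk: "\<rho> k \<in> rects js (Suc (m k))" for k using len_m[of k] by (intro in_rects) simp
    have \<beta>1: "(\<Sum>i\<in>W k. \<beta> k i) = 1" for k
    proof -
      have "(\<Sum>i\<in>W k. \<beta> k i) = (\<Sum>i\<in>W k. rmeas js (\<rho> i)) / rmeas js (\<rho> k)" by (simp add: \<beta>_def sum_divide_distrib)
      also have "(\<Sum>i\<in>W k. rmeas js (\<rho> i)) = (\<Sum>K\<in>desc js (\<rho> k) (m k). rmeas js K)"
        unfolding W_def by (rule sum_index[OF desc_range])
      also have "\<dots> = rmeas js (\<rho> k)"
        using length_less_len[of _ k] len_m[of k] by (intro sum_rmeas_desc js ext_\<rho>) (meson less_imp_le order_trans)
      finally show ?thesis using rmeas_pos[of js "\<rho> k"] by simp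
    qed
    have cond: "\<exists>N. (\<forall>k\<in>F. m k < N)" if "finite F" for F
      using finite_nat_set_iff_bounded[of "m ` F"] that by auto
    have inj: "inj_on \<rho> F" "inj_on m F" for F
      using inj_\<rho> mne by (auto simp: inj_on_def inj_def)
    have in_F: "\<rho> k \<in> rects js N" if "m k < N" for k N using rk[of k] rects_mono[of "Suc (m k)" N] that by auto
    have in_W: "\<rho> i \<in> rects js N" if "i \<in> W k" "m k < N" for i k N
      using desc_subset_rects[OF that(2)] that(1) unfolding W_def by blast
    have Mb: "M (\<Sum>k\<in>F. c k *\<^sub>R (\<Sum>i\<in>W k. h i)) = dnorm N p js (\<lambda>\<tau>. \<Sum>k\<in>F. c k * (\<Sum>K\<in>desc js (\<rho> k) (m k). ht js K \<tau>)) (base N)"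
      if N: "\<forall>k\<in>F. m k < N" for F c N
    proof (rule mixed_norm_step)
      fix y assume y: "\<And>j. j \<in> set js \<Longrightarrow> y j \<in> {0..<1::real}"
      have "(\<Sum>i\<in>W k. h i y) = (\<Sum>K\<in>desc js (\<rho> k) (m k). ht js K (bitsv N y))" if "k \<in> F" for k
      proof -
        have "(\<Sum>i\<in>W k. h i y) = (\<Sum>i\<in>W k. ht js (\<rho> i) (bitsv N y))"
          using N that in_W by (intro sum.cong refl h_step y) blast
        also have "\<dots> = (\<Sum>K\<in>desc js (\<rho> k) (m k). ht js K (bitsv N y))"
          unfolding W_def by (rule sum_index[OF desc_range])
        finally show ?thesis .
      qed
      then show "(\<Sum>k\<in>F. c k *\<^sub>R (\<Sum>i\<in>W k. h i)) y = (\<Sum>k\<in>F. c k * (\<Sum>K\<in>desc js (\<rho> k) (m k). ht js K (bitsv N y)))"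
        by (simp add: sum_fun_apply)
    qed
    have Mh: "M (\<Sum>k\<in>F. c k *\<^sub>R h k) = dnorm N p js (\<lambda>\<tau>. \<Sum>k\<in>F. c k * ht js (\<rho> k) \<tau>) (base N)"
      if N: "\<forall>k\<in>F. m k < N" for F c N
      by (rule norm_comb) (use N in_F in blast)
    have equiv: "M (\<Sum>k\<in>F. c k *\<^sub>R (\<Sum>i\<in>W k. h i)) \<le> E1 * M (\<Sum>k\<in>F. c k *\<^sub>R h k) \<and>
        M (\<Sum>k\<in>F. c k *\<^sub>R h k) \<le> E1 * M (\<Sum>k\<in>F. c k *\<^sub>R (\<Sum>i\<in>W k. h i))" if F: "finite F" for F c
    proof -
      obtain N where N: "\<forall>k\<in>F. m k < N" using cond[OF F] by blast
      have pre: "finite F \<and> inj_on \<rho> F \<and> inj_on m F \<and> (\<forall>k\<in>F. m k < N \<and> \<rho> k \<in> rects js (Suc (m k)))"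
        using F inj N rk by simp
      show ?thesis unfolding Mb[OF N] Mh[OF N] by (rule E1(2)[OF pre])
    qed
    have av: "M (\<Sum>k\<in>F. (\<Sum>i\<in>W k. \<beta> k i * x i) *\<^sub>R h k) \<le> E * M (\<Sum>i\<in>(\<Union>k\<in>F. W k). x i *\<^sub>R h i)" if F: "finite F" for F x
    proof -
      obtain N where N: "\<forall>k\<in>F. m k < N" using cond[OF F] by blast
      have pre: "finite F \<and> inj_on \<rho> F \<and> inj_on m F \<and> (\<forall>k\<in>F. m k < N \<and> \<rho> k \<in> rects js (Suc (m k)))"
        using F inj N rk by simp
      have re: "(\<Sum>K\<in>desc js (\<rho> k) (m k). g K (inv \<rho> K)) = (\<Sum>i\<in>W k. g (\<rho> i) i)" for k and g :: "_ \<Rightarrow> _ \<Rightarrow> real"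
        using sum_index[OF desc_range, of "\<lambda>K. g K (inv \<rho> K)" "\<rho> k" "m k"] by (simp add: W_def inv_f_f[OF inj_\<rho>])
      have un: "(\<Sum>i\<in>(\<Union>k\<in>F. W k). g i) = (\<Sum>k\<in>F. \<Sum>i\<in>W k. g i)" for g :: "nat \<Rightarrow> real"
        using F finW disW by (intro sum.UNION_disjoint) auto
      have "M (\<Sum>k\<in>F. (\<Sum>i\<in>W k. \<beta> k i * x i) *\<^sub>R h k) =
          dnorm N p js (\<lambda>\<tau>. \<Sum>k\<in>F. (\<Sum>i\<in>W k. \<beta> k i * x i) * ht js (\<rho> k) \<tau>) (base N)" by (rule Mh[OF N])
      also have "\<dots> = dnorm N p js (\<lambda>\<tau>. \<Sum>k\<in>F. (\<Sum>K\<in>desc js (\<rho> k) (m k). rmeas js K / rmeas js (\<rho> k) * x (inv \<rho> K)) * ht js (\<rho> k) \<tau>) (base N)"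
        using re[of "\<lambda>K i. rmeas js K / rmeas js (\<rho> _) * x i"] by (simp add: \<beta>_def re[of "\<lambda>K i. rmeas js K / rmeas js (\<rho> k) * x i" k for k])
      also have "\<dots> \<le> E2 * dnorm N p js (\<lambda>\<tau>. \<Sum>k\<in>F. \<Sum>K\<in>desc js (\<rho> k) (m k). x (inv \<rho> K) * ht js K \<tau>) (base N)"
        by (rule E2(2)[OF pre])
      also have "dnorm N p js (\<lambda>\<tau>. \<Sum>k\<in>F. \<Sum>K\<in>desc js (\<rho> k) (m k). x (inv \<rho> K) * ht js K \<tau>) (base N) =
          dnorm N p js (\<lambda>\<tau>. \<Sum>i\<in>(\<Union>k\<in>F. W k). x i * ht js (\<rho> i) \<tau>) (base N)"
        unfolding un by (simp add: re[of "\<lambda>K i. x i * ht js K \<tau>" for \<tau>])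
      also have "\<dots> = M (\<Sum>i\<in>(\<Union>k\<in>F. W k). x i *\<^sub>R h i)"
        by (rule norm_comb[symmetric]) (use N in_W in blast)
      finally show ?thesis using E(3) by (rule order_trans)
    qed
    have up: "M (\<Sum>k\<in>F. c k *\<^sub>R (\<Sum>i\<in>W k. h i)) \<le> E * M (\<Sum>k\<in>F. c k *\<^sub>R h k)"
      and lo: "M (\<Sum>k\<in>F. c k *\<^sub>R h k) \<le> E * M (\<Sum>k\<in>F. c k *\<^sub>R (\<Sum>i\<in>W k. h i))" if "finite F" for F c
      using equiv[OF that, of c] E(2) by (meson order_trans)+
    note prems = finW disW \<beta>1 E(1) lo up av
    show "(\<forall>k. fst (strategy (map n [0..<Suc k])) \<in> span (h ` {n k..}) \<and>
          snd (strategy (map n [0..<Suc k])) \<in> span (coord V M h ` {n k..})) \<and>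
        impartially_equivalent ((E * C)\<^sup>2) M (\<lambda>k. fst (strategy (map n [0..<Suc k]))) M h \<and>
        impartially_equivalent ((E * C)\<^sup>2) (dual_norm V M) (\<lambda>k. snd (strategy (map n [0..<Suc k]))) (dual_norm V M) (coord V M h) \<and>
        (\<forall>k l. snd (strategy (map n [0..<Suc k])) (fst (strategy (map n [0..<Suc l]))) = (if k = l then 1 else 0))"
      unfolding fst snd
    proof (intro conjI allI)
      fix k l
      show "(\<Sum>i\<in>W k. h i) \<in> span (h ` {n k..})" using late by (intro span_sum span_base) auto
      show "(\<Sum>i\<in>W k. \<beta> k i *\<^sub>R cf i) \<in> span (cf ` {n k..})" using late by (intro span_sum span_scale span_base) auto
      show "(\<Sum>i\<in>W k. \<beta> k i *\<^sub>R cf i) (\<Sum>i\<in>W l. h i) = (if k = l then 1 else 0)"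
        by (rule block_system(1)[of W \<beta> E]) (fact prems)+
      show "impartially_equivalent ((E * C)\<^sup>2) M (\<lambda>k. \<Sum>i\<in>W k. h i) M h"
        by (rule block_system(2)[of W \<beta> E]) (fact prems)+
      show "impartially_equivalent ((E * C)\<^sup>2) dn (\<lambda>k. \<Sum>i\<in>W k. \<beta> k i *\<^sub>R cf i) dn cf"
        by (rule block_system(3)[of W \<beta> E]) (fact prems)+
    qed
  qed
  moreover have "1 \<le> (E * C)\<^sup>2"
  proof -
    have "1 * 1 \<le> E * C" using E(1) C1 by (intro mult_mono) auto
    then show ?thesis by (simp add: one_le_power)
  qed
  ultimately show ?thesis by blast
qed

lemma reproducible: "strategically_reproducible V M h"
proof -
  obtain C T where u: "upper_dominated_system V M h C exponent T" using haar_upper_dominated_system by blast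
  then interpret upper_dominated_system V M h C exponent T .
  have "dominated_system V M h C" by (rule dominated_system_axioms)
  from winning[OF this] show ?thesis
    unfolding strategically_reproducible_def
    using banach_mixed_Lp0[of d p, OF p1] unconditional shrinking by blast
qed

end

theorem theorem5p1:
  fixes d :: nat and p :: "nat \<Rightarrow> real"
  assumes "1 \<le> d"
    and "\<And>j. 1 \<le> j \<Longrightarrow> j \<le> d \<Longrightarrow> 1 < p j"
  shows "\<exists>\<sigma>. bij_betw \<sigma> (UNIV :: nat set) (dyadic_rectangles d) \<and>
    strategically_reproducible (mixed_Lp0 d p) (mixed_norm d p) (\<lambda>n. haar_tensor d (\<sigma> n))"
proof -
  let ?P = "{1..d} \<rightarrow>\<^sub>E (UNIV :: bool list set)"
  have "countable ?P" by (intro countable_PiE) auto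
  moreover have "infinite ?P"
  proof
    assume "finite ?P"
    then have "finite ((\<lambda>R. R 1) ` ?P)" by (rule finite_imageI)
    moreover have "u \<in> (\<lambda>R. R 1) ` ?P" for u
      using assms(1) by (intro image_eqI[of _ _ "\<lambda>j\<in>{1..d}. u"]) auto
    then have "(\<lambda>R. R 1) ` ?P = UNIV" by blast
    ultimately show False using infinite_UNIV_listI[where 'a = bool] by simp
  qed
  ultimately have \<rho>: "bij_betw (from_nat_into ?P) UNIV ?P" by (rule bij_betw_from_nat_into)
  define \<rho> where "\<rho> = from_nat_into ?P"
  interpret haar_enumeration d p \<rho>
    by unfold_locales (use assms \<rho> in \<open>auto simp: set_dims \<rho>_def\<close>)
  have "bij_betw (\<lambda>R. \<lambda>j\<in>{1..d}. iv (R j)) ?P (dyadic_rectangles d)"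
    unfolding bij_betw_def
  proof
    show "inj_on (\<lambda>R. \<lambda>j\<in>{1..d}. iv (R j)) ?P"
    proof (rule inj_onI)
      fix R R' assume R: "R \<in> ?P" "R' \<in> ?P" and eq: "(\<lambda>j\<in>{1..d}. iv (R j)) = (\<lambda>j\<in>{1..d}. iv (R' j))"
      show "R = R'"
      proof (rule PiE_ext[OF R])
        fix j assume "j \<in> {1..d}"
        then have "iv (R j) = iv (R' j)" using fun_cong[OF eq, of j] by simp
        then show "R j = R' j" by (rule injD[OF inj_iv])
      qed
    qed
    show "(\<lambda>R. \<lambda>j\<in>{1..d}. iv (R j)) ` ?P = dyadic_rectangles d"
    proof (intro equalityI subsetI)
      fix S assume "S \<in> (\<lambda>R. \<lambda>j\<in>{1..d}. iv (R j)) ` ?P"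
      then show "S \<in> dyadic_rectangles d" unfolding dyadic_rectangles_def range_iv[symmetric] by auto
    next
      fix S assume S: "S \<in> dyadic_rectangles d"
      have "S = (\<lambda>j\<in>{1..d}. iv ((\<lambda>j\<in>{1..d}. inv iv (S j)) j))"
      proof
        fix j
        show "S j = (\<lambda>j\<in>{1..d}. iv ((\<lambda>j\<in>{1..d}. inv iv (S j)) j)) j"
          using S unfolding dyadic_rectangles_def range_iv[symmetric]
          by (cases "j \<in> {1..d}") (auto simp: f_inv_into_f PiE_def Pi_def extensional_def)
      qed
      moreover have "(\<lambda>j\<in>{1..d}. inv iv (S j)) \<in> ?P" by auto
      ultimately show "S \<in> (\<lambda>R. \<lambda>j\<in>{1..d}. iv (R j)) ` ?P" by (rule image_eqI)
    qed
  qed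
  then have "bij_betw ((\<lambda>R. \<lambda>j\<in>{1..d}. iv (R j)) \<circ> \<rho>) UNIV (dyadic_rectangles d)"
    using \<rho> unfolding \<rho>_def by (intro bij_betw_trans)
  moreover have "(\<lambda>n. haar_tensor d (((\<lambda>R. \<lambda>j\<in>{1..d}. iv (R j)) \<circ> \<rho>) n)) = h"
    by (rule ext) (simp add: h_def)
  ultimately show ?thesis using reproducible by metis
qed

end
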